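(* Let $(S_n)_{n\ge 0}$ be the elephant random walk with memory parameter $p$ and first-step parameter $q\in[0,1]$, let $a_n=\frac{\Gamma(n)\Gamma(2p)}{\Gamma(n+2p-1)}$, $v_n=\sum_{i=1}^n a_i^2$, and let $\Phi$ be the standard normal distribution function. Assume $p\in(0,3/4]$ and $p\neq 1/2$. We have the following equalities. [i] If $p\in(0,1/2)$, then there is an absolute constant $\alpha_0>0$ such that for all $0\le x\le \alpha_0\sqrt n$, $$\frac{\mathbf{P}(a_nS_n/\sqrt{v_n}\ge x)}{1-\Phi(x)}=\exp\Big\{\theta\, C_{\alpha_0}\Big(\frac{x^3}{\sqrt n}+(1+x)\frac{\log n}{\sqrt n}\Big)\Big\}.$$ [ii] If $p\in(1/2,3/4)$, then there is an absolute constant $\alpha_0>0$ such that for all $0\le x\le \alpha_0\, n^{(3-4p)/2}$, $$\frac{\mathbf{P}(a_nS_n/\sqrt{v_n}\ge x)}{1-\Phi(x)}=\exp\Big\{\theta\, C_{\alpha_0,p}\Big(\frac{x^3}{n^{(3-4p)/2}}+(1+x)\frac{\log n}{n^{(3-4p)/2}}\Big)\Big\}.$$ [iii] If $p=3/4$, then there is an absolute constant $\alpha_0>0$ such that for all $0\le x\le\alpha_0\sqrt{\log n}$, $$\frac{\mathbf{P}(a_nS_n/\sqrt{v_n}\ge x)}{1-\Phi(x)}=\exp\Big\{\theta\, C_{\alpha_0}\Big(\frac{x^3}{\sqrt{\log n}}+(1+x)\frac{\log\log n}{\sqrt{\log n}}\Big)\Big\}.$$ Moreover, the same equalities hold when $\frac{\mathbf{P}(a_nS_n/\sqrt{v_n}\ge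 x)}{1-\Phi(x)}$ is replaced by $\frac{\mathbf{P}(a_nS_n/\sqrt{v_n}\le -x)}{\Phi(-x)}$.
   Context: Elephant random walk with memory parameter $p\in[0,1]$ and first-step parameter $q\in[0,1]$: $S_0=0$; $X_1=1$ with probability $q$ and $X_1=-1$ with probability $1-q$; $S_1=X_1$. At time $n+1$, for $n\ge 1$, an integer $\beta_n$ is chosen uniformly at random from $\{1,\dots,n\}$, and then: if $X_{\beta_n}=1$, $X_{n+1}$ equals $1$ with probability $p$ and $-1$ with probability $1-p$; if $X_{\beta_n}=-1$, $X_{n+1}$ equals $1$ with probability $1-p$ and $-1$ with probability $p$. Equivalently, $X_{n+1}=\alpha_nX_{\beta_n}$, where $\alpha_n$ equals $1$ with probability $p$ and $-1$ with probability $1-p$, and $\alpha_n$ is independent of $X_1,\dots,X_n$. The position is $S_{n}=\sum_{i=1}^{n}X_i$. Conventions: $\theta$ stands for values (possibly different at each occurrence) satisfying $|\theta|\le 1$; $C_{\alpha_0}$ denotes a positive constant depending only on the absolute constant $\alpha_0$, and $C_{\alpha_0,p}$ a positive constant depending only on $\alpha_0$ and $p$.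
   Formalization: The equalities are stated for all n ≥ 3: for n = 1 (x = 0, q ≠ 1/2, cases [i], [ii]) and for n = 2 (q = 0, small x > 0, where the upper-tail probability is 0) they fail as written. *)

theory Defs
  imports "HOL-Probability.Probability"
begin

definition sign_pmf :: "real \<Rightarrow> int pmf" where
  "sign_pmf r = map_pmf (\<lambda>b. if b then 1 else - 1) (bernoulli_pmf r)"

text \<open>
  Joint law of the steps \<open>X 1, \<dots>, X n\<close> of the elephant random walk with memory parameter \<open>p\<close> and
  first-step parameter \<open>q\<close>. A path is a function \<open>X\<close> of the time index; index \<open>0\<close> and the
  indices beyond \<open>n\<close> carry the dummy value \<open>0\<close>. The binds are sequential, so \<open>\<alpha>\<close> and \<open>\<beta>\<close> are
  independent of each other and of the past.
\<close>

fun erw_pmf :: "real \<Rightarrow> real \<Rightarrow> nat \<Rightarrow> (nat \<Rightarrow> int) pmf" where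
  "erw_pmf p q 0 = return_pmf (\<lambda>_. 0)"
| "erw_pmf p q (Suc 0) = map_pmf (\<lambda>x. (\<lambda>_. 0)(1 := x)) (sign_pmf q)"
| "erw_pmf p q (Suc (Suc n)) =
     bind_pmf (erw_pmf p q (Suc n)) (\<lambda>X.
     bind_pmf (pmf_of_set {1..Suc n}) (\<lambda>\<beta>.
     bind_pmf (sign_pmf p) (\<lambda>\<alpha>.
     return_pmf (X(Suc (Suc n) := \<alpha> * X \<beta>)))))"

definition erw_pos :: "(nat \<Rightarrow> int) \<Rightarrow> nat \<Rightarrow> int" where
  "erw_pos X n = (\<Sum>i=1..n. X i)"

text \<open>
  The laws for different horizons are consistent, i.e. they are the finite-dimensional
  distributions of a single process.
\<close>

lemma erw_pmf_zero:
  assumes "X \<in> set_pmf (erw_pmf p q n)" "i = 0 \<or> i > n"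
  shows "X i = 0"
  using assms
  by (induction p q n arbitrary: X rule: erw_pmf.induct) (auto split: if_splits)

lemma erw_pmf_consistent:
  "map_pmf (\<lambda>X i. if i \<le> n then X i else 0) (erw_pmf p q (Suc n)) = erw_pmf p q n"
proof (cases n)
  case 0
  have "(\<lambda>i. if i = 0 then ((\<lambda>_. 0)(Suc 0 := x)) i else 0) = (\<lambda>_::nat. 0::int)" for x
    by (auto simp: fun_eq_iff)
  then show ?thesis
    using 0 by (simp add: map_pmf_comp map_pmf_const del: fun_upd_apply)
next
  case (Suc m)
  have trunc: "(\<lambda>i. if i \<le> Suc m then (X(Suc (Suc m) := y)) i else 0) = X"
    if "X \<in> set_pmf (erw_pmf p q (Suc m))" for X and y :: int
    using erw_pmf_zero[OF that] by (auto simp: fun_eq_iff)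
  have "map_pmf (\<lambda>X i. if i \<le> Suc m then X i else 0) (erw_pmf p q (Suc (Suc m))) =
      bind_pmf (erw_pmf p q (Suc m)) return_pmf"
    by (simp only: erw_pmf.simps map_bind_pmf map_return_pmf)
       (intro bind_pmf_cong refl, simp only: trunc bind_pmf_const)
  then show ?thesis
    using Suc by (simp add: bind_return_pmf')
qed

definition erw_a :: "real \<Rightarrow> nat \<Rightarrow> real" where
  "erw_a p n = Gamma (real n) * Gamma (2 * p) / Gamma (real n + 2 * p - 1)"

definition erw_v :: "real \<Rightarrow> nat \<Rightarrow> real" where
  "erw_v p n = (\<Sum>i=1..n. (erw_a p i)\<^sup>2)"

definition erw_norm :: "real \<Rightarrow> nat \<Rightarrow> (nat \<Rightarrow> int) \<Rightarrow> real" where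
  "erw_norm p n X = erw_a p n * real_of_int (erw_pos X n) / sqrt (erw_v p n)"

abbreviation std_normal_cdf :: "real \<Rightarrow> real" where
  "std_normal_cdf \<equiv> cdf std_normal_distribution"

definition upper_tail_ratio :: "real \<Rightarrow> real \<Rightarrow> nat \<Rightarrow> real \<Rightarrow> real" where
  "upper_tail_ratio p q n x =
     measure_pmf.prob (erw_pmf p q n) {X. erw_norm p n X \<ge> x} / (1 - std_normal_cdf x)"

definition lower_tail_ratio :: "real \<Rightarrow> real \<Rightarrow> nat \<Rightarrow> real \<Rightarrow> real" where
  "lower_tail_ratio p q n x =
     measure_pmf.prob (erw_pmf p q n) {X. erw_norm p n X \<le> - x} / std_normal_cdf (- x)"

end

theory Submission
  imports Defs "HOL-Real_Asymp.Real_Asymp"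
begin

text \<open>
  Put \<open>e k = a k / sqrt (v n)\<close> and \<open>tau k = (e 1)^2 + ... + (e k)^2\<close>. Then \<open>M k = e k * S k\<close> is a
  martingale with \<open>tau n = 1\<close>, and all weights \<open>e k\<close> are bounded by some small \<open>\<epsilon>\<close>. Tilting every step
  from time 2 on exponentially with parameter \<open>lam * e k\<close> produces a chain whose mean at time \<open>n\<close> is
  about \<open>lam\<close>; up to an error of order \<open>lam^3 * \<epsilon> + lam * \<epsilon>\<close> in the exponent and a term governed by the
  squared memory drifts, the density is \<open>exp (lam^2 / 2 - lam * M n)\<close>.

  Under the tilted law \<open>M n - lam\<close> is normal up to \<open>lam^2 * \<epsilon> + \<epsilon> * ln (1 / \<epsilon>)\<close> in Kolmogorov distance.
  This is a Lindeberg replacement along the heat flow \<open>Phi ((y - b) / sqrt t)\<close>: the errors near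
  the terminal time, where the flow is nearly discontinuous, are paid for by a second function, a
  logarithmic multiple of a Gaussian bump, which decreases in mean along the chain. Taking \<open>lam = x\<close>
  and integrating the density against this approximation yields the ratio of the tails. When \<open>x^2 * \<epsilon>\<close>
  is not small, a crude upper bound suffices, and the lower bound comes from tilting slightly beyond
  \<open>x\<close> and Chebyshev's inequality.

  The three regimes differ only in the size of \<open>\<epsilon>\<close>, which is \<open>2 / sqrt n\<close>, \<open>2 / n powr ((3 - 4 * p) / 2)\<close>
  or \<open>2 / sqrt (ln n)\<close>. For bounded \<open>n\<close> it is enough that the walk reaches \<open>n - 2\<close> with positive
  probability. The lower tail for \<open>q\<close> is the upper tail for \<open>1 - q\<close>.
\<close>

subsection \<open>Exponential tilting of a random sign\<close>

text \<open>The obstacle is the last stretch of the replacement. The third derivative of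
  \<open>Phi (y / sqrt t)\<close> is of order \<open>t powr (-3/2)\<close>; its supremum, summed
  over the steps down to times of order \<open>\<epsilon>^2\<close>, gives a constant and not a
  small error. It is large only for \<open>y\<close> of order \<open>sqrt t\<close>, though, and a
  nearly normal chain is there with probability of order \<open>sqrt t\<close>; with this gain the
  sum is of order \<open>\<epsilon> * ln (1 / \<epsilon>)\<close>. No such concentration is known
  beforehand, and the barrier supplies it: a Gaussian kernel of variance \<open>t\<close> is nearly
  a martingale along the chain, while its logarithmic prefactor falls by about
  \<open>e^2 / t\<close> per step. The fall pays for exactly these local errors, and the total
  payment is at most the initial value of the barrier, of order \<open>ln (1 / \<epsilon>)\<close>.

  The steps are dependent: given the past, a step has a mean \<open>r\<close> proportional to
  position over time. After centring only \<open>r^2\<close> enters the errors, and its accumulated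
  expectation is controlled by second moments and Hardy's inequality.\<close>

lemma exp_cubic_bound:
  fixes x :: real
  assumes "\<bar>x\<bar> \<le> 1"
  shows "\<bar>exp x - (1 + x + x\<^sup>2 / 2)\<bar> \<le> \<bar>x\<bar> ^ 3"
proof -
  obtain t where t: "\<bar>t\<bar> \<le> \<bar>x\<bar>" "exp x = (\<Sum>m<3. x ^ m / fact m) + exp t / fact 3 * x ^ 3"
    using Maclaurin_exp_le by blast
  have "exp t \<le> exp 1" using t(1) assms by simp
  also have "\<dots> \<le> 3" using exp_le by simp
  finally have "exp t / fact 3 \<le> 1" by (simp add: fact_numeral)
  then have "exp t / fact 3 * \<bar>x\<bar> ^ 3 \<le> 1 * \<bar>x\<bar> ^ 3"
    by (intro mult_right_mono) auto
  moreover have "exp x - (1 + x + x\<^sup>2 / 2) = exp t / fact 3 * x ^ 3"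
    using t(2) by (simp add: eval_nat_numeral)
  ultimately show ?thesis by (simp add: abs_mult power_abs)
qed

lemma exp_quadratic_bound:
  fixes x :: real
  shows "exp x \<le> 1 + x + x\<^sup>2 * exp \<bar>x\<bar>"
proof -
  obtain t where t: "\<bar>t\<bar> \<le> \<bar>x\<bar>" "exp x = (\<Sum>m<2. x ^ m / fact m) + exp t / fact 2 * x ^ 2"
    using Maclaurin_exp_le by blast
  have "exp t / fact 2 \<le> exp \<bar>x\<bar>"
  proof -
    have "exp t \<le> exp \<bar>x\<bar>" using t(1) by simp
    moreover have "0 \<le> exp t" by simp
    ultimately have "exp t / 2 \<le> exp \<bar>x\<bar>" by linarith
    then show ?thesis by (simp add: fact_numeral)
  qed
  then have "exp t / fact 2 * x ^ 2 \<le> exp \<bar>x\<bar> * x ^ 2"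
    by (intro mult_right_mono) auto
  then show ?thesis using t(2) by (simp add: eval_nat_numeral mult.commute)
qed

lemma tanh_le_self:
  fixes h :: real
  assumes "0 \<le> h"
  shows "tanh h \<le> h"
proof -
  have "(\<lambda>h. h - tanh h) 0 \<le> (\<lambda>h. h - tanh h) h"
  proof (rule DERIV_nonneg_imp_nondecreasing[OF assms])
    fix x :: real
    have "((\<lambda>h. h - tanh h) has_real_derivative (1 - (1 - tanh x ^ 2))) (at x)"
      by (auto intro!: derivative_eq_intros)
    then show "\<exists>y. ((\<lambda>h. h - tanh h) has_real_derivative y) (at x) \<and> 0 \<le> y"
      by (intro exI conjI) auto
  qed
  then show ?thesis by simp
qed

lemma tanh_small_bounds:
  fixes h :: real
  assumes "0 \<le> h"
  shows "0 \<le> tanh h" "tanh h \<le> h" "h - h\<^sup>2 \<le> tanh h"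
proof -
  show 0: "0 \<le> tanh h" using assms by simp
  show "tanh h \<le> h" using assms by (rule tanh_le_self)
  have "(\<lambda>h. tanh h - (h - h\<^sup>2)) 0 \<le> (\<lambda>h. tanh h - (h - h\<^sup>2)) h"
  proof (rule DERIV_nonneg_imp_nondecreasing[OF assms])
    fix x :: real assume x: "0 \<le> x" "x \<le> h"
    have "(tanh x)\<^sup>2 \<le> tanh x" using tanh_real_bounds[of x] x
      by (simp add: power2_eq_square mult_left_le)
    also have "tanh x \<le> x" using x by (intro tanh_le_self)
    finally have "0 \<le> (1 - tanh x ^ 2) - (1 - 2 * x)" using x by simp
    moreover have "((\<lambda>h. tanh h - (h - h\<^sup>2)) has_real_derivative ((1 - tanh x ^ 2) - (1 - 2 * x))) (at x)"
      by (auto intro!: derivative_eq_intros)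
    ultimately show "\<exists>y. ((\<lambda>h. tanh h - (h - h\<^sup>2)) has_real_derivative y) (at x) \<and> 0 \<le> y"
      by blast
  qed
  then show "h - h\<^sup>2 \<le> tanh h" by simp
qed

text \<open>The mean of a random sign with mean \<open>r\<close> after reweighting by \<open>exp (h * \<sigma>)\<close>.\<close>

definition tilt :: "real \<Rightarrow> real \<Rightarrow> real" where
  "tilt r h = (r + tanh h) / (1 + r * tanh h)"

text \<open>The excess \<open>tilt r h - r\<close> equals \<open>(1 - r^2) * \<theta> / c\<close>
  with \<open>\<theta> = tanh h\<close> and \<open>c \<ge> 7/8\<close>. So the tilt adds the drift
  \<open>h\<close> up to terms in \<open>h * r^2\<close> and \<open>h^2\<close>: the memory drift
  enters the error only through its square, which is what second moments can control.\<close>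

lemma tilt_bounds:
  fixes r h :: real
  assumes r: "\<bar>r\<bar> \<le> 1" and h: "0 \<le> h" "h \<le> 1/8"
  shows "\<bar>tilt r h\<bar> \<le> 1" "\<bar>tilt r h - r - h\<bar> \<le> 2 * h * r\<^sup>2 + 3 * h\<^sup>2"
    "(tilt r h)\<^sup>2 \<le> 3 * (r\<^sup>2 + h\<^sup>2)" "0 \<le> tilt r h - r" "tilt r h - r \<le> 2 * h"
proof -
  define \<theta> where "\<theta> = tanh h"
  note th = tanh_small_bounds[OF h(1), folded \<theta>_def]
  have rt: "\<bar>r * \<theta>\<bar> \<le> 1/8"
    using mult_mono[OF r, of "\<bar>\<theta>\<bar>" "1/8"] th h by (simp add: abs_mult)
  define c where "c = 1 + r * \<theta>"
  have c: "7/8 \<le> c" "c > 0" using rt by (auto simp: c_def abs_le_iff)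
  have ic: "inverse c \<le> 8/7" using c by (simp add: field_simps)
  have t: "tilt r h = (r + \<theta>) / c" by (simp add: tilt_def \<theta>_def c_def)
  have r1: "-1 \<le> r" "r \<le> 1" using r by auto
  have t1: "0 \<le> 1 - \<theta>" using th h by simp
  have "(1 - r) * (1 - \<theta>) \<ge> 0" "(1 + r) * (1 + \<theta>) \<ge> 0"
    using r1 t1 th by simp_all
  then have "r + \<theta> \<le> c" "- c \<le> r + \<theta>" by (auto simp: c_def algebra_simps)
  then show "\<bar>tilt r h\<bar> \<le> 1" using c by (simp add: t abs_le_iff field_simps)
  have r2: "r\<^sup>2 \<le> 1" using r by (simp add: abs_square_le_1)
  have tr: "tilt r h - r = (1 - r\<^sup>2) * \<theta> / c"
    using c by (simp add: t field_simps c_def power2_eq_square)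
  show "0 \<le> tilt r h - r" unfolding tr using c th r2 by simp
  have "(1 - r\<^sup>2) * \<theta> \<le> 1 * h" using th r2 h by (intro mult_mono) auto
  also have "\<dots> \<le> 2 * h * c" using mult_left_mono[OF c(1) h(1)] h by simp
  finally show "tilt r h - r \<le> 2 * h" unfolding tr using c by (simp add: field_simps)
  have "tilt r h - r - h = ((\<theta> - h) - r\<^sup>2 * \<theta> - h * r * \<theta>) / c"
    unfolding tr using c by (simp add: field_simps c_def)
  also have "\<bar>\<dots>\<bar> \<le> (h\<^sup>2 + r\<^sup>2 * h + h\<^sup>2) * (8/7)"
  proof -
    have "\<bar>r\<^sup>2 * \<theta>\<bar> \<le> r\<^sup>2 * h" using th by (simp add: abs_mult mult_left_mono)
    moreover have "\<bar>h * r * \<theta>\<bar> \<le> h * h"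
      using mult_mono[OF mult_left_mono[OF r h(1)], of "\<bar>\<theta>\<bar>" h] th h by (simp add: abs_mult)
    moreover have "\<bar>\<theta> - h\<bar> \<le> h\<^sup>2" using th by (simp add: abs_le_iff)
    ultimately have "\<bar>(\<theta> - h) - r\<^sup>2 * \<theta> - h * r * \<theta>\<bar> \<le> h\<^sup>2 + r\<^sup>2 * h + h\<^sup>2"
      by (simp add: power2_eq_square abs_le_iff)
    then have "\<bar>(\<theta> - h) - r\<^sup>2 * \<theta> - h * r * \<theta>\<bar> * inverse c \<le> (h\<^sup>2 + r\<^sup>2 * h + h\<^sup>2) * (8/7)"
      using c ic h by (intro mult_mono) auto
    then show ?thesis unfolding abs_divide abs_of_pos[OF c(2)] by (simp only: divide_inverse)
  qed
  also have "\<dots> \<le> 2 * h * r\<^sup>2 + 3 * h\<^sup>2" using h by (simp add: field_simps)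
  finally show "\<bar>tilt r h - r - h\<bar> \<le> 2 * h * r\<^sup>2 + 3 * h\<^sup>2" .
  have "\<bar>r + \<theta>\<bar> \<le> \<bar>r\<bar> + h" using th by linarith
  then have "(r + \<theta>)\<^sup>2 \<le> (\<bar>r\<bar> + h)\<^sup>2"
    using abs_le_square_iff[of "r + \<theta>" "\<bar>r\<bar> + h"] h by simp
  also have "\<dots> \<le> 2 * (r\<^sup>2 + h\<^sup>2)"
    using zero_le_power2[of "\<bar>r\<bar> - h"] by (simp add: power2_eq_square algebra_simps)
  finally have a: "(r + \<theta>)\<^sup>2 \<le> 2 * (r\<^sup>2 + h\<^sup>2)" .
  have "(inverse c)\<^sup>2 \<le> (8/7)\<^sup>2" using ic c by (intro power_mono) auto
  then have "(inverse c)\<^sup>2 \<le> 3/2" by (simp add: power2_eq_square)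
  then have "(r + \<theta>)\<^sup>2 * (inverse c)\<^sup>2 \<le> 2 * (r\<^sup>2 + h\<^sup>2) * (3/2)"
    using a by (intro mult_mono) auto
  then show "(tilt r h)\<^sup>2 \<le> 3 * (r\<^sup>2 + h\<^sup>2)"
    by (simp only: t divide_inverse power_mult_distrib) simp
qed

text \<open>The expectation of \<open>F (e * (\<sigma> - r - h))\<close> for a random sign \<open>\<sigma>\<close> with mean \<open>tilt r h\<close>.\<close>

definition twopt :: "real \<Rightarrow> real \<Rightarrow> real \<Rightarrow> (real \<Rightarrow> real) \<Rightarrow> real" where
  "twopt e r h F = (1 + tilt r h) / 2 * F (e * (1 - r - h)) + (1 - tilt r h) / 2 * F (e * (- 1 - r - h))"

lemma twopt_linear:
  "twopt e r h (\<lambda>d. F d + G d) = twopt e r h F + twopt e r h G"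
  "twopt e r h (\<lambda>d. F d - G d) = twopt e r h F - twopt e r h G"
  "twopt e r h (\<lambda>d. c * F d) = c * twopt e r h F"
  "twopt e r h (\<lambda>d. c) = c"
  by (simp_all add: twopt_def algebra_simps add_divide_distrib diff_divide_distrib)

context
  fixes e r h :: real
  assumes r: "\<bar>r\<bar> \<le> 1" and h: "0 \<le> h" "h \<le> 1/8" and e: "0 < e"
begin

lemma step_abs:
  assumes "d \<in> {e * (1 - r - h), e * (- 1 - r - h)}"
  shows "\<bar>d\<bar> \<le> 3 * e"
proof -
  have "\<bar>1 - r - h\<bar> \<le> 3" "\<bar>- 1 - r - h\<bar> \<le> 3" using r h by auto
  then show ?thesis using assms e by (auto simp: abs_mult)
qed

lemma twopt_mono:
  assumes "\<And>d. \<bar>d\<bar> \<le> 3 * e \<Longrightarrow> F d \<le> G d"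
  shows "twopt e r h F \<le> twopt e r h G"
proof -
  have "0 \<le> (1 + tilt r h) / 2" "0 \<le> (1 - tilt r h) / 2"
    using tilt_bounds(1)[OF r h] by auto
  then show ?thesis
    unfolding twopt_def by (intro add_mono mult_left_mono assms step_abs) auto
qed

lemma twopt_abs_le:
  assumes "\<And>d. \<bar>d\<bar> \<le> 3 * e \<Longrightarrow> \<bar>F d\<bar> \<le> c"
  shows "\<bar>twopt e r h F\<bar> \<le> c"
proof -
  have "F d \<le> c \<and> - c \<le> F d" if "\<bar>d\<bar> \<le> 3 * e" for d
    using assms[OF that] by linarith
  then have "twopt e r h F \<le> twopt e r h (\<lambda>d. c)" "twopt e r h (\<lambda>d. - c) \<le> twopt e r h F"
    by (intro twopt_mono; simp)+
  then show ?thesis by (simp add: twopt_linear abs_le_iff)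
qed

lemma twopt_mean: "twopt e r h (\<lambda>d. d) = e * (tilt r h - r - h)"
  by (simp add: twopt_def field_simps)

lemma twopt_mean_abs: "\<bar>twopt e r h (\<lambda>d. d)\<bar> \<le> e * (2 * h * r\<^sup>2 + 3 * h\<^sup>2)"
  unfolding twopt_mean using tilt_bounds(2)[OF r h] e by (simp add: abs_mult)

lemma twopt_var: "\<bar>twopt e r h (\<lambda>d. d\<^sup>2) - e\<^sup>2\<bar> \<le> 4 * e\<^sup>2 * (r\<^sup>2 + h\<^sup>2)"
proof -
  define \<rho> where "\<rho> = tilt r h"
  define w where "w = \<rho> - r - h"
  \<comment> \<open>Bias and variance: a sign with mean \<open>\<rho>\<close> has variance
    \<open>1 - \<rho>^2\<close>, and after centring at \<open>r + h\<close> its mean is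
    \<open>w\<close>.\<close>
  have "twopt e r h (\<lambda>d. d\<^sup>2) - e\<^sup>2 = e\<^sup>2 * (w\<^sup>2 - \<rho>\<^sup>2)"
    by (simp add: twopt_def \<rho>_def w_def power2_eq_square field_simps)
  moreover have *: "\<bar>w\<^sup>2 - \<rho>\<^sup>2\<bar> \<le> 4 * (r\<^sup>2 + h\<^sup>2)"
  proof -
    have r2: "r\<^sup>2 \<le> 1" using r by (simp add: abs_square_le_1)
    have "\<bar>w\<bar> \<le> 2 * h * r\<^sup>2 + 3 * h\<^sup>2" using tilt_bounds(2)[OF r h] by (simp add: w_def \<rho>_def)
    also have "\<dots> = h * (2 * r\<^sup>2 + 3 * h)" by (simp add: power2_eq_square algebra_simps)
    also have "\<dots> \<le> h * 3" using r2 h by (intro mult_left_mono) auto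
    finally have a: "\<bar>w\<bar> \<le> 3 * h" by simp
    have "\<bar>w\<bar> \<le> 2 * h * r\<^sup>2 + 3 * h\<^sup>2" using tilt_bounds(2)[OF r h] by (simp add: w_def \<rho>_def)
    also have "\<dots> \<le> 1/4 * r\<^sup>2 + 3 * (h * h)" using h
      by (intro add_mono mult_right_mono) (auto simp: power2_eq_square)
    finally have b: "\<bar>w\<bar> \<le> 1/4 * r\<^sup>2 + 3 * h\<^sup>2" by (simp add: power2_eq_square)
    have "w\<^sup>2 = \<bar>w\<bar> * \<bar>w\<bar>" by (simp add: power2_eq_square)
    also have "\<dots> \<le> \<bar>w\<bar> * (3/8)" using a h by (intro mult_left_mono) auto
    also have "\<dots> \<le> (1/4 * r\<^sup>2 + 3 * h\<^sup>2) * (3/8)" using b by (intro mult_right_mono) auto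
    also have "\<dots> = 3/32 * r\<^sup>2 + 9/8 * h\<^sup>2" by (simp add: algebra_simps)
    finally have "w\<^sup>2 \<le> 4 * (r\<^sup>2 + h\<^sup>2)" using zero_le_power2[of r] zero_le_power2[of h] unfolding distrib_left by linarith
    moreover have "\<rho>\<^sup>2 \<le> 3 * (r\<^sup>2 + h\<^sup>2)" using tilt_bounds(3)[OF r h] by (simp add: \<rho>_def)
    moreover have "0 \<le> w\<^sup>2" "0 \<le> \<rho>\<^sup>2" "0 \<le> r\<^sup>2" "0 \<le> h\<^sup>2" by auto
    ultimately show ?thesis unfolding distrib_left by linarith
  qed
  moreover have "e\<^sup>2 * \<bar>w\<^sup>2 - \<rho>\<^sup>2\<bar> \<le> e\<^sup>2 * (4 * (r\<^sup>2 + h\<^sup>2))"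
    by (intro mult_left_mono *) auto
  ultimately show ?thesis by (simp only: abs_mult abs_power2 mult.assoc mult.left_commute)
qed

text \<open>A Lindeberg step: a centred normal increment of variance \<open>e^2\<close> would give
  \<open>f y + e^2 / 2 * f2 y\<close> to this order. The first two error terms are the defects of
  mean and variance; \<open>9/2\<close> is \<open>3^3 / 3!\<close>, because the increments are at
  most \<open>3 * e\<close>.\<close>

lemma twopt_taylor:
  assumes f: "\<And>x. (f has_real_derivative f1 x) (at x)" "\<And>x. (f1 has_real_derivative f2 x) (at x)"
    "\<And>x. (f2 has_real_derivative f3 x) (at x)"
  assumes B: "\<And>x. \<bar>x - y\<bar> \<le> 3 * e \<Longrightarrow> \<bar>f3 x\<bar> \<le> B"
  shows "\<bar>twopt e r h (\<lambda>d. f (y + d)) - (f y + e\<^sup>2 / 2 * f2 y)\<bar>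
    \<le> e * (2 * h * r\<^sup>2 + 3 * h\<^sup>2) * \<bar>f1 y\<bar> + 2 * e\<^sup>2 * (r\<^sup>2 + h\<^sup>2) * \<bar>f2 y\<bar> + 9/2 * e ^ 3 * B"
proof -
  define R where "R d = f (y + d) - (f y + f1 y * d + f2 y / 2 * d\<^sup>2)" for d
  have R: "\<bar>R d\<bar> \<le> 9/2 * e ^ 3 * B" if d: "\<bar>d\<bar> \<le> 3 * e" for d
  proof (cases "d = 0")
    case True
    have "0 \<le> B" using B[of y] e by simp
    then show ?thesis using True e by (simp add: R_def)
  next
    case False
    define diff where "diff m = (if m = 0 then f else if m = 1 then f1 else if m = 2 then f2 else f3)" for m :: nat
    have "\<exists>t. (if y + d < y then y + d < t \<and> t < y else y < t \<and> t < y + d) \<and>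
      f (y + d) = (\<Sum>m<3. diff m y / fact m * (y + d - y) ^ m) + diff 3 t / fact 3 * (y + d - y) ^ 3"
      by (rule Taylor[of 3 diff f "min y (y + d)" "max y (y + d)"])
         (use False f in \<open>auto simp: diff_def less_Suc_eq eval_nat_numeral\<close>)
    then obtain t where t: "\<bar>t - y\<bar> \<le> \<bar>d\<bar>"
      and eq: "f (y + d) = (\<Sum>m<3. diff m y / fact m * d ^ m) + diff 3 t / fact 3 * d ^ 3"
      by (smt (verit) add_diff_cancel_left' sum.cong)
    have "R d = f3 t / 6 * d ^ 3"
      using eq by (simp add: R_def diff_def eval_nat_numeral)
    also have "\<bar>\<dots>\<bar> = \<bar>f3 t\<bar> / 6 * \<bar>d\<bar> ^ 3" by (simp add: abs_mult power_abs)
    also have "\<dots> \<le> B / 6 * (3 * e) ^ 3"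
      using B[of t] t d by (intro mult_mono power_mono) auto
    finally show ?thesis by (simp add: power_mult_distrib mult_ac)
  qed
  have "twopt e r h (\<lambda>d. f (y + d)) =
    twopt e r h R + f1 y * twopt e r h (\<lambda>d. d) + f2 y / 2 * twopt e r h (\<lambda>d. d\<^sup>2) + f y"
  proof -
    have "(\<lambda>d. f (y + d)) = (\<lambda>d. ((R d + f1 y * d) + f2 y / 2 * d\<^sup>2) + f y)"
      by (auto simp: R_def)
    then show ?thesis by (simp only: twopt_linear)
  qed
  then have "twopt e r h (\<lambda>d. f (y + d)) - (f y + e\<^sup>2 / 2 * f2 y) =
    f1 y * twopt e r h (\<lambda>d. d) + f2 y / 2 * (twopt e r h (\<lambda>d. d\<^sup>2) - e\<^sup>2) + twopt e r h R"
    by (simp add: algebra_simps)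
  also have "\<bar>\<dots>\<bar> \<le> \<bar>f1 y\<bar> * (e * (2 * h * r\<^sup>2 + 3 * h\<^sup>2)) + \<bar>f2 y\<bar> / 2 * (4 * e\<^sup>2 * (r\<^sup>2 + h\<^sup>2)) + 9/2 * e ^ 3 * B"
  proof -
    have "\<bar>f1 y * twopt e r h (\<lambda>d. d)\<bar> \<le> \<bar>f1 y\<bar> * (e * (2 * h * r\<^sup>2 + 3 * h\<^sup>2))"
      unfolding abs_mult by (intro mult_left_mono twopt_mean_abs) auto
    moreover have "\<bar>f2 y / 2 * (twopt e r h (\<lambda>d. d\<^sup>2) - e\<^sup>2)\<bar> \<le> \<bar>f2 y\<bar> / 2 * (4 * e\<^sup>2 * (r\<^sup>2 + h\<^sup>2))"
      unfolding abs_mult abs_divide abs_numeral by (intro mult_left_mono twopt_var) auto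
    moreover have "\<bar>twopt e r h R\<bar> \<le> 9/2 * e ^ 3 * B"
      by (intro twopt_abs_le R)
    ultimately show ?thesis by linarith
  qed
  finally show ?thesis by (simp add: algebra_simps)
qed

end

subsection \<open>The normal distribution function\<close>

abbreviation Phi :: "real \<Rightarrow> real" where "Phi \<equiv> cdf std_normal_distribution"

lemma std_normal_density_le: "std_normal_density x \<le> exp (- x\<^sup>2 / 2) / 2"
proof -
  have "2 \<le> sqrt (2 * pi)" using pi_gt3 by (intro real_le_rsqrt) auto
  then have "1 / sqrt (2 * pi) \<le> 1 / 2" by (intro divide_left_mono) auto
  then have "1 / sqrt (2 * pi) * exp (- x\<^sup>2 / 2) \<le> 1 / 2 * exp (- x\<^sup>2 / 2)"
    by (intro mult_right_mono) auto
  then show ?thesis by (simp add: std_normal_density_def)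
qed

lemma std_normal_density_ge: "exp (- x\<^sup>2 / 2) / 3 \<le> std_normal_density x"
proof -
  have "sqrt (2 * pi) \<le> 3" using pi_less_4 by (intro real_le_lsqrt) auto
  then have "1 / 3 \<le> 1 / sqrt (2 * pi)" using pi_gt3 by (intro divide_left_mono) auto
  then have "1 / 3 * exp (- x\<^sup>2 / 2) \<le> 1 / sqrt (2 * pi) * exp (- x\<^sup>2 / 2)"
    by (intro mult_right_mono) auto
  then show ?thesis by (simp add: std_normal_density_def)
qed

lemma std_normal_density_deriv:
  "(std_normal_density has_real_derivative (- x * std_normal_density x)) (at x)"
proof -
  have "((\<lambda>x. 1 / sqrt (2 * pi) * exp (- x\<^sup>2 / 2)) has_real_derivative
      (1 / sqrt (2 * pi) * (exp (- x\<^sup>2 / 2) * (- x)))) (at x)"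
    by (intro DERIV_cmult) (auto intro!: derivative_eq_intros)
  moreover have "1 / sqrt (2 * pi) * (exp (- x\<^sup>2 / 2) * (- x)) = - x * std_normal_density x"
    by (simp only: std_normal_density_def) simp
  ultimately show ?thesis by (simp only: std_normal_density_def[abs_def])
qed

lemma continuous_on_std_normal_density: "continuous_on A std_normal_density"
  using std_normal_density_deriv DERIV_isCont by (blast intro: continuous_at_imp_continuous_on)

lemma real_distribution_std_normal: "real_distribution std_normal_distribution"
  by (rule real_dist_normal_dist)

lemma Phi_diff:
  assumes "a \<le> b"
  shows "Phi b - Phi a = integral {a..b} std_normal_density"
proof -
  interpret real_distribution std_normal_distribution by (rule real_distribution_std_normal)
  have i: "set_integrable lborel {a..b} std_normal_density"
    by (rule borel_integrable_atLeastAtMost') (rule continuous_on_std_normal_density)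
  then have i': "set_integrable lborel {a<..b} std_normal_density"
    by (rule set_integrable_subset) auto
  have "Phi b - Phi a = measure std_normal_distribution {a<..b}"
    using assms by (cases "a = b") (auto simp: cdf_diff_eq)
  also have "\<dots> = enn2real (\<integral>\<^sup>+x. ennreal (indicator {a<..b} x * std_normal_density x) \<partial>lborel)"
    unfolding measure_def by (subst emeasure_density) (auto simp: mult.commute ennreal_mult ennreal_indicator intro!: arg_cong[where f=enn2real] nn_integral_cong split: split_indicator)
  also have "\<dots> = (LBINT x:{a<..b}. std_normal_density x)"
    using i' unfolding set_integrable_def set_lebesgue_integral_def
    by (subst nn_integral_eq_integral) (auto intro!: integral_nonneg_AE)
  also have "\<dots> = (LBINT x:{a..b}. std_normal_density x)"
    unfolding set_lebesgue_integral_def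
    by (rule integral_cong_AE) (use AE_lborel_singleton[of a] in \<open>auto simp: indicator_def elim!: eventually_mono\<close>)
  also have "\<dots> = integral {a..b} std_normal_density"
    using set_borel_integral_eq_integral(2)[OF i] .
  finally show ?thesis .
qed

lemma Phi_deriv: "(Phi has_real_derivative std_normal_density x) (at x)"
proof -
  have "((\<lambda>y. integral {x - 1..y} std_normal_density) has_real_derivative std_normal_density x)
      (at x within {x - 1..x + 1})"
    by (rule integral_has_real_derivative) (auto intro: continuous_on_std_normal_density)
  then have "((\<lambda>y. Phi (x - 1) + integral {x - 1..y} std_normal_density) has_real_derivative std_normal_density x)
      (at x within {x - 1..x + 1})"
    by (auto intro!: derivative_eq_intros)
  then have "((\<lambda>y. Phi (x - 1) + integral {x - 1..y} std_normal_density) has_real_derivative std_normal_density x) (at x)"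
    using at_within_interior[of x "{x - 1..x + 1}"] by simp
  then show ?thesis
  proof (rule DERIV_cong_ev[THEN iffD1, rotated -1])
    show "\<forall>\<^sub>F y in nhds x. Phi (x - 1) + integral {x - 1..y} std_normal_density = Phi y"
      using eventually_nhds_in_open[of "{x - 1<..}" x]
      by (auto elim!: eventually_mono simp: Phi_diff[symmetric])
  qed auto
qed

lemma Phi_mono: "x \<le> y \<Longrightarrow> Phi x \<le> Phi y"
proof -
  interpret real_distribution std_normal_distribution by (rule real_distribution_std_normal)
  show "x \<le> y \<Longrightarrow> Phi x \<le> Phi y" by (rule cdf_nondecreasing)
qed

lemma Phi_le_1: "Phi x \<le> 1" and Phi_nonneg: "0 \<le> Phi x" and Phi_at_top: "(Phi \<longlongrightarrow> 1) at_top"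
proof -
  interpret real_distribution std_normal_distribution by (rule real_distribution_std_normal)
  show "Phi x \<le> 1" "0 \<le> Phi x" "(Phi \<longlongrightarrow> 1) at_top"
    using cdf_bounded_prob cdf_nonneg cdf_lim_at_top_prob by auto
qed

text \<open>\<open>Phi x + Phi (- x)\<close> has derivative 0 and tends to 1 at infinity.\<close>

lemma Phi_minus: "Phi (- x) = 1 - Phi x"
proof -
  have "\<forall>x. ((\<lambda>x. Phi x + Phi (- x)) has_real_derivative 0) (at x)"
  proof
    fix x :: real
    have "((\<lambda>x. Phi (- x)) has_real_derivative std_normal_density (- x) * - 1) (at x)"
      by (rule DERIV_chain2[OF Phi_deriv]) (auto intro!: derivative_eq_intros)
    from DERIV_add[OF Phi_deriv this]
    show "((\<lambda>x. Phi x + Phi (- x)) has_real_derivative 0) (at x)"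
      by (simp add: std_normal_density_def)
  qed
  then have c: "Phi y + Phi (- y) = Phi x + Phi (- x)" for y
    by (rule DERIV_isconst_all)
  interpret real_distribution std_normal_distribution by (rule real_distribution_std_normal)
  have "((\<lambda>y. Phi (- y)) \<longlongrightarrow> 0) at_top"
    using cdf_lim_at_bot filterlim_compose[OF _ filterlim_uminus_at_bot_at_top] by blast
  from tendsto_add[OF Phi_at_top this]
  have l: "((\<lambda>y. Phi y + Phi (- y)) \<longlongrightarrow> 1) at_top" by simp
  have eq: "(\<lambda>y. Phi y + Phi (- y)) = (\<lambda>y. Phi x + Phi (- x))"
    by (rule ext) (rule c)
  have "((\<lambda>y::real. Phi x + Phi (- x)) \<longlongrightarrow> 1) at_top" using l unfolding eq .
  then have "Phi x + Phi (- x) = 1" by (simp add: tendsto_const_iff)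
  then show ?thesis by simp
qed

lemma Phi_0: "Phi 0 = 1/2"
  using Phi_minus[of 0] by simp

lemma nonneg_if_decreasing_to_0:
  fixes f :: "real \<Rightarrow> real"
  assumes d: "\<And>y. x \<le> y \<Longrightarrow> (f has_real_derivative f' y) (at y)" "\<And>y. x \<le> y \<Longrightarrow> f' y \<le> 0"
    and l: "(f \<longlongrightarrow> 0) at_top"
  shows "0 \<le> f x"
proof (rule tendsto_upperbound[OF l])
  show "\<forall>\<^sub>F y in at_top. f y \<le> f x"
    using eventually_ge_at_top[of x]
  proof eventually_elim
    case (elim y)
    show ?case by (rule DERIV_nonpos_imp_nonincreasing[OF elim]) (use d in blast)
  qed
qed simp

lemma gauss_over_tendsto_0: "((\<lambda>x::real. exp (- x\<^sup>2 / 2) / (1 + x)) \<longlongrightarrow> 0) at_top"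
proof (rule tendsto_sandwich[OF _ _ tendsto_const])
  show "\<forall>\<^sub>F x in at_top. 0 \<le> exp (- x\<^sup>2 / 2) / (1 + x :: real)"
    using eventually_ge_at_top[of 0] by eventually_elim auto
  show "\<forall>\<^sub>F x in at_top. exp (- x\<^sup>2 / 2) / (1 + x) \<le> inverse (x :: real)"
    using eventually_gt_at_top[of 0]
  proof eventually_elim
    case (elim x)
    then have "exp (- x\<^sup>2 / 2) / (1 + x) \<le> 1 / x" by (intro frac_le) auto
    then show ?case by (simp add: inverse_eq_divide)
  qed
  show "(inverse \<longlongrightarrow> (0::real)) at_top" by (rule tendsto_inverse_0_at_top[OF filterlim_ident])
qed

lemma gauss_over_deriv:
  assumes "0 \<le> (x :: real)"
  shows "((\<lambda>x. exp (- x\<^sup>2 / 2) / (1 + x)) has_real_derivative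
    (- exp (- x\<^sup>2 / 2) * ((x\<^sup>2 + x + 1) / (1 + x)\<^sup>2))) (at x)"
proof -
  have "((\<lambda>x. exp (- x\<^sup>2 / 2)) has_real_derivative exp (- x\<^sup>2 / 2) * (- x)) (at x)"
    by (auto intro!: derivative_eq_intros)
  moreover have "((\<lambda>x. 1 + x) has_real_derivative 1) (at x)"
    by (auto intro!: derivative_eq_intros)
  ultimately have "((\<lambda>x. exp (- x\<^sup>2 / 2) / (1 + x)) has_real_derivative
      (exp (- x\<^sup>2 / 2) * (- x) * (1 + x) - exp (- x\<^sup>2 / 2) * 1) / ((1 + x) * (1 + x))) (at x)"
    using assms by (intro DERIV_divide) auto
  also have "(exp (- x\<^sup>2 / 2) * (- x) * (1 + x) - exp (- x\<^sup>2 / 2) * 1) = - exp (- x\<^sup>2 / 2) * (x\<^sup>2 + x + 1)"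
    by (simp add: algebra_simps power2_eq_square)
  finally show ?thesis by (simp add: power2_eq_square)
qed

text \<open>All terms vanish at infinity, so it suffices to compare derivatives. The quotient
  \<open>(y^2 + y + 1) / (1 + y)^2\<close> lies between 1/2 and 1, and the density between 1/3 and
  1/2 of \<open>exp (- y^2 / 2)\<close>; this is where the factor 3 comes from.\<close>

lemma normal_tail_bounds:
  assumes "0 \<le> x"
  shows "1 - Phi x \<le> exp (- x\<^sup>2 / 2) / (1 + x)" "exp (- x\<^sup>2 / 2) / (3 * (1 + x)) \<le> 1 - Phi x"
proof -
  have l: "((\<lambda>x. 1 - Phi x) \<longlongrightarrow> 0) at_top"
    using tendsto_diff[OF tendsto_const[of 1] Phi_at_top] by simp
  have "0 \<le> exp (- x\<^sup>2 / 2) / (1 + x) - (1 - Phi x)"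
  proof (rule nonneg_if_decreasing_to_0[where f = "\<lambda>x. exp (- x\<^sup>2 / 2) / (1 + x) - (1 - Phi x)"])
    fix y assume "x \<le> y"
    then have y: "0 \<le> y" using assms by simp
    show "((\<lambda>x. exp (- x\<^sup>2 / 2) / (1 + x) - (1 - Phi x)) has_real_derivative
      ((- exp (- y\<^sup>2 / 2) * ((y\<^sup>2 + y + 1) / (1 + y)\<^sup>2)) - (0 - std_normal_density y))) (at y)"
      by (intro DERIV_diff gauss_over_deriv y DERIV_const Phi_deriv)
    have "0 < (1 + y)\<^sup>2" using y by (intro zero_less_power) simp
    moreover have "1/2 * (1 + y)\<^sup>2 \<le> y\<^sup>2 + y + 1"
      using y by (simp add: power2_sum)
    ultimately have "1/2 \<le> (y\<^sup>2 + y + 1) / (1 + y)\<^sup>2"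
      by (simp only: pos_le_divide_eq)
    then have "exp (- y\<^sup>2 / 2) * (1/2) \<le> exp (- y\<^sup>2 / 2) * ((y\<^sup>2 + y + 1) / (1 + y)\<^sup>2)"
      by (intro mult_left_mono) auto
    then show "((- exp (- y\<^sup>2 / 2) * ((y\<^sup>2 + y + 1) / (1 + y)\<^sup>2)) - (0 - std_normal_density y)) \<le> 0"
      using std_normal_density_le[of y] by linarith
  next
    show "((\<lambda>x. exp (- x\<^sup>2 / 2) / (1 + x) - (1 - Phi x)) \<longlongrightarrow> 0) at_top"
      using tendsto_diff[OF gauss_over_tendsto_0 l] by simp
  qed
  then show "1 - Phi x \<le> exp (- x\<^sup>2 / 2) / (1 + x)" by simp
  have "0 \<le> (1 - Phi x) - 1/3 * (exp (- x\<^sup>2 / 2) / (1 + x))"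
  proof (rule nonneg_if_decreasing_to_0[where f = "\<lambda>x. (1 - Phi x) - 1/3 * (exp (- x\<^sup>2 / 2) / (1 + x))"])
    fix y assume "x \<le> y"
    then have y: "0 \<le> y" using assms by simp
    show "((\<lambda>x. (1 - Phi x) - 1/3 * (exp (- x\<^sup>2 / 2) / (1 + x))) has_real_derivative
      ((0 - std_normal_density y) - 1/3 * (- exp (- y\<^sup>2 / 2) * ((y\<^sup>2 + y + 1) / (1 + y)\<^sup>2)))) (at y)"
      by (intro DERIV_diff DERIV_cmult gauss_over_deriv y DERIV_const Phi_deriv)
    have "0 < (1 + y)\<^sup>2" using y by (intro zero_less_power) simp
    moreover have "y\<^sup>2 + y + 1 \<le> (1 + y)\<^sup>2"
      using y by (simp add: power2_sum)
    ultimately have "(y\<^sup>2 + y + 1) / (1 + y)\<^sup>2 \<le> 1"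
      by simp
    then have "exp (- y\<^sup>2 / 2) * ((y\<^sup>2 + y + 1) / (1 + y)\<^sup>2) \<le> exp (- y\<^sup>2 / 2) * 1"
      by (intro mult_left_mono) auto
    then show "((0 - std_normal_density y) - 1/3 * (- exp (- y\<^sup>2 / 2) * ((y\<^sup>2 + y + 1) / (1 + y)\<^sup>2))) \<le> 0"
      using std_normal_density_ge[of y] by simp
  next
    show "((\<lambda>x. (1 - Phi x) - 1/3 * (exp (- x\<^sup>2 / 2) / (1 + x))) \<longlongrightarrow> 0) at_top"
      using tendsto_diff[OF l tendsto_mult_left[OF gauss_over_tendsto_0, of "1/3"]] by simp
  qed
  then show "exp (- x\<^sup>2 / 2) / (3 * (1 + x)) \<le> 1 - Phi x" by simp
qed

section \<open>Exponential moments on the half-line from distribution functions\<close>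

lemma nn_integral_exp_tail:
  fixes l y :: real
  assumes "0 < l"
  shows "(\<integral>\<^sup>+s. ennreal (l * exp (- (l * s))) * indicator {y..} s \<partial>lborel) = ennreal (exp (- (l * y)))"
proof -
  have "((\<lambda>s. exp (- (l * s))) \<longlongrightarrow> 0) at_top"
    using assms by real_asymp
  then have "((\<lambda>s. - exp (- (l * s))) \<longlongrightarrow> 0) at_top"
    using tendsto_minus by fastforce
  then have "(\<integral>\<^sup>+s. ennreal (l * exp (- (l * s))) * indicator {y..} s \<partial>lborel) = ennreal (0 - (- exp (- (l * y))))"
    using assms by (intro nn_integral_FTC_atLeast) (auto intro!: derivative_eq_intros)
  then show ?thesis by simp
qed

text \<open>Integration by parts with the square completed:
  \<open>exp (- (l * s)) * std_normal_density s\<close> is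
  \<open>exp (l^2 / 2) * std_normal_density (s + l)\<close>. The value is the normal tail at
  \<open>l\<close> with its Gaussian factor removed.\<close>

lemma nn_integral_exp_Phi:
  fixes l :: real
  assumes "0 < l"
  shows "(\<integral>\<^sup>+s. ennreal (l * exp (- (l * s)) * (Phi s - Phi 0)) * indicator {0..} s \<partial>lborel)
    = ennreal (exp (l\<^sup>2 / 2) * (1 - Phi l))"
proof -
  define F where "F s = exp (l\<^sup>2 / 2) * Phi (s + l) - exp (- (l * s)) * (Phi s - Phi 0)" for s
  have D: "(F has_real_derivative l * exp (- (l * s)) * (Phi s - Phi 0)) (at s)" for s
  proof -
    have "((\<lambda>s. Phi (s + l)) has_real_derivative std_normal_density (s + l) * 1) (at s)"
      by (rule DERIV_chain2[OF Phi_deriv]) (auto intro!: derivative_eq_intros)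
    moreover have "((\<lambda>s. exp (- (l * s))) has_real_derivative exp (- (l * s)) * (- l)) (at s)"
      by (auto intro!: derivative_eq_intros)
    moreover have "((\<lambda>s. Phi s - Phi 0) has_real_derivative std_normal_density s - 0) (at s)"
      by (intro DERIV_diff Phi_deriv DERIV_const)
    ultimately have "(F has_real_derivative exp (l\<^sup>2 / 2) * (std_normal_density (s + l) * 1)
      - (exp (- (l * s)) * (- l) * (Phi s - Phi 0) + (std_normal_density s - 0) * exp (- (l * s)))) (at s)"
      unfolding F_def by (intro DERIV_diff[OF DERIV_cmult DERIV_mult])
    moreover have "exp (l\<^sup>2 / 2) * std_normal_density (s + l) = std_normal_density s * exp (- (l * s))"
      by (simp add: std_normal_density_def exp_add[symmetric] power2_eq_square field_simps)
    ultimately show ?thesis by (simp add: algebra_simps)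
  qed
  have "((\<lambda>s. exp (- (l * s))) \<longlongrightarrow> 0) at_top"
    using assms by real_asymp
  moreover have "((\<lambda>s. Phi (s + l)) \<longlongrightarrow> 1) at_top"
    by (rule filterlim_compose[OF Phi_at_top]) real_asymp
  ultimately have "(F \<longlongrightarrow> exp (l\<^sup>2 / 2) * 1 - 0 * (1 - Phi 0)) at_top"
    unfolding F_def by (intro tendsto_intros Phi_at_top)
  then have "(F \<longlongrightarrow> exp (l\<^sup>2 / 2)) at_top" by simp
  then have "(\<integral>\<^sup>+s. ennreal (l * exp (- (l * s)) * (Phi s - Phi 0)) * indicator {0..} s \<partial>lborel)
      = ennreal (exp (l\<^sup>2 / 2) - F 0)"
  proof (intro nn_integral_FTC_atLeast)
    have "isCont Phi x" for x using Phi_deriv DERIV_isCont by blast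
    then have "continuous_on UNIV Phi" by (simp add: continuous_on_eq_continuous_at)
    then have "Phi \<in> borel_measurable borel" by (rule borel_measurable_continuous_onI)
    then show "(\<lambda>s. l * exp (- (l * s)) * (Phi s - Phi 0)) \<in> borel_measurable borel"
      by measurable
  qed (use assms D Phi_mono in auto)
  moreover have "exp (l\<^sup>2 / 2) - F 0 = exp (l\<^sup>2 / 2) * (1 - Phi l)"
    by (simp add: F_def algebra_simps)
  ultimately show ?thesis by simp
qed

text \<open>Fubini, after writing \<open>exp (- (l * y))\<close> as the integral of
  \<open>l * exp (- (l * s))\<close> over \<open>s \<ge> y\<close>.\<close>

lemma layer_cake_pmf:
  fixes Q :: "'a pmf" and Y :: "'a \<Rightarrow> real"
  assumes fin: "finite (set_pmf Q)" and l: "0 < l"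
  shows "ennreal (measure_pmf.expectation Q (\<lambda>X. if 0 \<le> Y X then exp (- (l * Y X)) else 0)) =
    (\<integral>\<^sup>+s. ennreal (l * exp (- (l * s)) * measure_pmf.prob Q {X. 0 \<le> Y X \<and> Y X \<le> s}) * indicator {0..} s \<partial>lborel)"
proof -
  have "(\<integral>\<^sup>+s. ennreal (l * exp (- (l * s)) * measure_pmf.prob Q {X. 0 \<le> Y X \<and> Y X \<le> s}) * indicator {0..} s \<partial>lborel)
    = (\<integral>\<^sup>+s. (\<Sum>X\<in>{X\<in>set_pmf Q. 0 \<le> Y X}. ennreal (pmf Q X) * (ennreal (l * exp (- (l * s))) * indicator {Y X..} s)) \<partial>lborel)"
  proof (intro nn_integral_cong)
    fix s :: real
    show "ennreal (l * exp (- (l * s)) * measure_pmf.prob Q {X. 0 \<le> Y X \<and> Y X \<le> s}) * indicator {0..} s =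
      (\<Sum>X\<in>{X\<in>set_pmf Q. 0 \<le> Y X}. ennreal (pmf Q X) * (ennreal (l * exp (- (l * s))) * indicator {Y X..} s))"
    proof (cases "0 \<le> s")
      case True
      have "measure_pmf.prob Q {X. 0 \<le> Y X \<and> Y X \<le> s} = measure_pmf.prob Q ({X. 0 \<le> Y X \<and> Y X \<le> s} \<inter> set_pmf Q)"
        by (simp add: measure_Int_set_pmf)
      also have "\<dots> = (\<Sum>X\<in>{X. 0 \<le> Y X \<and> Y X \<le> s} \<inter> set_pmf Q. pmf Q X)"
        using fin by (intro measure_measure_pmf_finite) auto
      also have "\<dots> = (\<Sum>X\<in>{X\<in>set_pmf Q. 0 \<le> Y X}. pmf Q X * indicator {Y X..} s)"
        using fin by (intro sum.mono_neutral_cong_left) (auto simp: indicator_def)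
      finally have "ennreal (l * exp (- (l * s)) * measure_pmf.prob Q {X. 0 \<le> Y X \<and> Y X \<le> s})
        = ennreal (\<Sum>X\<in>{X\<in>set_pmf Q. 0 \<le> Y X}. pmf Q X * (l * exp (- (l * s)) * indicator {Y X..} s))"
        by (simp add: sum_distrib_left mult_ac)
      also have "\<dots> = (\<Sum>X\<in>{X\<in>set_pmf Q. 0 \<le> Y X}. ennreal (pmf Q X * (l * exp (- (l * s)) * indicator {Y X..} s)))"
        using l by (intro sum_ennreal[symmetric]) (auto simp: indicator_def)
      finally show ?thesis using True l
        by (simp add: ennreal_mult ennreal_indicator[symmetric] del: ennreal_indicator)
    next
      case False
      then show ?thesis by (auto intro!: sum.neutral simp: indicator_def)
    qed
  qed
  also have "\<dots> = (\<Sum>X\<in>{X\<in>set_pmf Q. 0 \<le> Y X}. ennreal (pmf Q X) * ennreal (exp (- (l * Y X))))"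
    by (subst nn_integral_sum) (auto simp: nn_integral_cmult nn_integral_exp_tail[OF l])
  also have "\<dots> = ennreal (\<Sum>X\<in>{X\<in>set_pmf Q. 0 \<le> Y X}. pmf Q X * exp (- (l * Y X)))"
    by (subst sum_ennreal[symmetric]) (auto simp: ennreal_mult)
  also have "(\<Sum>X\<in>{X\<in>set_pmf Q. 0 \<le> Y X}. pmf Q X * exp (- (l * Y X))) =
    (\<Sum>X\<in>set_pmf Q. (if 0 \<le> Y X then exp (- (l * Y X)) else 0) * pmf Q X)"
    using fin by (intro sum.mono_neutral_cong_left) auto
  also have "\<dots> = measure_pmf.expectation Q (\<lambda>X. if 0 \<le> Y X then exp (- (l * Y X)) else 0)"
    using fin by (subst integral_measure_pmf_real[of "set_pmf Q"]) auto
  finally show ?thesis by simp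
qed

text \<open>Since \<open>l * exp (- (l * s))\<close> is a probability density on the half-line, a
  uniform error \<open>\<eta>\<close> of the distribution function passes through without any factor
  depending on \<open>l\<close>.\<close>

lemma exp_moment_via_cdf:
  fixes Q :: "'a pmf" and Y :: "'a \<Rightarrow> real"
  assumes fin: "finite (set_pmf Q)" and l: "0 < l" and \<eta>: "0 \<le> \<eta>"
    and cdf: "\<And>s. 0 \<le> s \<Longrightarrow> \<bar>measure_pmf.prob Q {X. 0 \<le> Y X \<and> Y X \<le> s} - (Phi s - Phi 0)\<bar> \<le> \<eta>"
  shows "\<bar>measure_pmf.expectation Q (\<lambda>X. if 0 \<le> Y X then exp (- (l * Y X)) else 0)
    - exp (l\<^sup>2 / 2) * (1 - Phi l)\<bar> \<le> \<eta>"
proof -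
  let ?E = "measure_pmf.expectation Q (\<lambda>X. if 0 \<le> Y X then exp (- (l * Y X)) else 0)"
  let ?G = "exp (l\<^sup>2 / 2) * (1 - Phi l)"
  let ?p = "\<lambda>s. measure_pmf.prob Q {X. 0 \<le> Y X \<and> Y X \<le> s}"
  have E0: "0 \<le> ?E" by (intro integral_nonneg_AE) auto
  have G0: "0 \<le> ?G" using Phi_le_1[of l] by simp
  have meas: "(\<lambda>s. ennreal (l * exp (- (l * s)) * ?p s) * indicator {0..} s) \<in> borel_measurable lborel"
    "(\<lambda>s. ennreal (l * exp (- (l * s)) * (Phi s - Phi 0)) * indicator {0..} s) \<in> borel_measurable lborel"
  proof -
    have "mono ?p"
      by (intro monoI measure_pmf.finite_measure_mono) auto
    then have [measurable]: "?p \<in> borel_measurable borel" by (rule borel_measurable_mono)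
    have [measurable]: "Phi \<in> borel_measurable borel"
      by (rule borel_measurable_mono) (auto intro: monoI Phi_mono)
    show "(\<lambda>s. ennreal (l * exp (- (l * s)) * ?p s) * indicator {0..} s) \<in> borel_measurable lborel"
      "(\<lambda>s. ennreal (l * exp (- (l * s)) * (Phi s - Phi 0)) * indicator {0..} s) \<in> borel_measurable lborel"
      by measurable
  qed
  have eta: "(\<integral>\<^sup>+s. ennreal \<eta> * (ennreal (l * exp (- (l * s))) * indicator {0..} s) \<partial>lborel) = ennreal \<eta>"
    using nn_integral_exp_tail[OF l, of 0] by (subst nn_integral_cmult) auto
  have "ennreal ?E \<le> (\<integral>\<^sup>+s. ennreal (l * exp (- (l * s)) * (Phi s - Phi 0)) * indicator {0..} s
      + ennreal \<eta> * (ennreal (l * exp (- (l * s))) * indicator {0..} s) \<partial>lborel)"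
    unfolding layer_cake_pmf[OF fin l]
  proof (intro nn_integral_mono)
    fix s :: real
    show "ennreal (l * exp (- (l * s)) * ?p s) * indicator {0..} s \<le>
      ennreal (l * exp (- (l * s)) * (Phi s - Phi 0)) * indicator {0..} s
      + ennreal \<eta> * (ennreal (l * exp (- (l * s))) * indicator {0..} s)"
    proof (cases "0 \<le> s")
      case True
      have "?p s \<le> (Phi s - Phi 0) + \<eta>" using cdf[OF True] by linarith
      then have "l * exp (- (l * s)) * ?p s \<le> l * exp (- (l * s)) * ((Phi s - Phi 0) + \<eta>)"
        using l by (intro mult_left_mono) auto
      then have "ennreal (l * exp (- (l * s)) * ?p s) \<le> ennreal (l * exp (- (l * s)) * (Phi s - Phi 0) + \<eta> * (l * exp (- (l * s))))"
        by (intro ennreal_leI) (simp add: algebra_simps)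
      then show ?thesis using True l \<eta> Phi_mono[OF True]
        by (simp add: ennreal_mult[symmetric] ennreal_plus[symmetric] del: ennreal_plus)
    qed auto
  qed
  also have "\<dots> = ennreal ?G + ennreal \<eta>"
    using meas by (subst nn_integral_add) (auto simp: eta nn_integral_exp_Phi[OF l])
  finally have 1: "?E \<le> ?G + \<eta>" using G0 \<eta> E0 by (simp add: ennreal_plus[symmetric] del: ennreal_plus)
  have "ennreal ?G \<le> (\<integral>\<^sup>+s. ennreal (l * exp (- (l * s)) * ?p s) * indicator {0..} s
      + ennreal \<eta> * (ennreal (l * exp (- (l * s))) * indicator {0..} s) \<partial>lborel)"
    unfolding nn_integral_exp_Phi[OF l, symmetric]
  proof (intro nn_integral_mono)
    fix s :: real
    show "ennreal (l * exp (- (l * s)) * (Phi s - Phi 0)) * indicator {0..} s \<le>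
      ennreal (l * exp (- (l * s)) * ?p s) * indicator {0..} s
      + ennreal \<eta> * (ennreal (l * exp (- (l * s))) * indicator {0..} s)"
    proof (cases "0 \<le> s")
      case True
      have "Phi s - Phi 0 \<le> ?p s + \<eta>" using cdf[OF True] by linarith
      then have "l * exp (- (l * s)) * (Phi s - Phi 0) \<le> l * exp (- (l * s)) * (?p s + \<eta>)"
        using l by (intro mult_left_mono) auto
      then have "ennreal (l * exp (- (l * s)) * (Phi s - Phi 0)) \<le> ennreal (l * exp (- (l * s)) * ?p s + \<eta> * (l * exp (- (l * s))))"
        by (intro ennreal_leI) (simp add: algebra_simps)
      then show ?thesis using True l \<eta>
        by (simp add: ennreal_mult[symmetric] ennreal_plus[symmetric] del: ennreal_plus)
    qed auto
  qed
  also have "\<dots> = ennreal ?E + ennreal \<eta>"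
    using meas by (subst nn_integral_add) (auto simp: eta layer_cake_pmf[OF fin l])
  finally have 2: "?G \<le> ?E + \<eta>" using G0 \<eta> E0 by (simp add: ennreal_plus[symmetric] del: ennreal_plus)
  show ?thesis using 1 2 by linarith
qed

lemma Phi_lipschitz: "\<bar>Phi x - Phi y\<bar> \<le> \<bar>x - y\<bar>"
proof -
  have *: "\<bar>Phi b - Phi a\<bar> \<le> b - a" if "a \<le> b" for a b
  proof (cases "a = b")
    case False
    then have ab: "a < b" using that by simp
    obtain z where "Phi b - Phi a = (b - a) * std_normal_density z"
      using MVT2[OF ab, of Phi std_normal_density] Phi_deriv by blast
    moreover have "std_normal_density z \<le> 1"
      using std_normal_density_le[of z] exp_le_one_iff[of "- z\<^sup>2 / 2"] by (smt (verit) divide_nonpos_pos field_sum_of_halves not_exp_le_zero zero_le_power2)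
    ultimately show ?thesis using that by (simp add: abs_mult mult_left_le)
  qed auto
  show ?thesis using *[of x y] *[of y x] by (cases "x \<le> y") auto
qed

lemma Phi_window:
  assumes "0 \<le> \<delta>" "\<delta> \<le> 1"
  shows "\<delta> / 6 \<le> Phi \<delta> - Phi 0"
proof (cases "\<delta> = 0")
  case False
  then obtain z where z: "0 < z" "z < \<delta>" "Phi \<delta> - Phi 0 = (\<delta> - 0) * std_normal_density z"
    using MVT2[of 0 \<delta> Phi std_normal_density] assms Phi_deriv by auto
  have "z\<^sup>2 \<le> 1" using z assms by (simp add: power_le_one)
  then have "1/2 \<le> exp (- z\<^sup>2 / 2)" using exp_ge_add_one_self[of "- z\<^sup>2 / 2"] by linarith
  then have "1/6 \<le> std_normal_density z" using std_normal_density_ge[of z] by linarith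
  then show ?thesis using z assms mult_left_mono[of "1/6" "std_normal_density z" \<delta>] by simp
qed auto

lemma gauss_poly1: "0 \<le> x \<Longrightarrow> (1 + x) * exp (- (x / 8)) \<le> (8::real)"
proof -
  assume x: "0 \<le> x"
  have "1 + x \<le> 8 * exp (x / 8)" using exp_ge_add_one_self[of "x / 8"] by linarith
  then have "(1 + x) * exp (- (x / 8)) \<le> 8 * exp (x / 8) * exp (- (x / 8))"
    by (intro mult_right_mono) auto
  then show ?thesis by (simp add: exp_minus field_simps)
qed

lemma gauss_poly2: "(1 + Z\<^sup>2) * exp (- Z\<^sup>2 / 2) \<le> (2::real)"
proof -
  have "1 + Z\<^sup>2 \<le> 2 * exp (Z\<^sup>2 / 2)" using exp_ge_add_one_self[of "Z\<^sup>2 / 2"] by linarith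
  then have "(1 + Z\<^sup>2) * exp (- Z\<^sup>2 / 2) \<le> 2 * exp (Z\<^sup>2 / 2) * exp (- Z\<^sup>2 / 2)"
    by (intro mult_right_mono) auto
  then show ?thesis by (simp add: exp_minus field_simps)
qed

lemma gauss_poly3: "Z * exp (- Z\<^sup>2 / 2) \<le> (1::real)"
proof -
  have "2 * Z \<le> 1 + Z\<^sup>2" using zero_le_power2[of "Z - 1"] by (simp add: power2_diff)
  then have "2 * Z * exp (- Z\<^sup>2 / 2) \<le> (1 + Z\<^sup>2) * exp (- Z\<^sup>2 / 2)"
    by (intro mult_right_mono) auto
  with gauss_poly2[of Z] show ?thesis by linarith
qed

lemma div_square:
  fixes t a x :: real
  assumes "t = a * a"
  shows "x / t = x / a / a" "x / t\<^sup>2 = x / a / a ^ 3"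
  by (simp_all add: assms power2_eq_square power3_eq_cube)

subsection \<open>One step of the chain along the heat flow\<close>

text \<open>
  The barrier at remaining time \<open>t\<close> is \<open>ell * psi wid\<close>. As \<open>t\<close> decreases by \<open>e^2\<close>, the logarithm \<open>ell\<close>,
  counted from the smallest admissible time \<open>smin\<close>, loses about \<open>e^2 / t\<close>; the inflation of the
  variance from \<open>t\<close> to \<open>wid\<close>, by a factor of at most \<open>9/8\<close>, turns this into a gain that also
  covers the quadratic growth of the error in \<open>y / sqrt t\<close>. The quantity \<open>rterm\<close> collects the errors
  due to the memory drift \<open>r\<close> and to the tilt.
\<close>

definition psi :: "real \<Rightarrow> real \<Rightarrow> real" where
  "psi T y = exp (- y\<^sup>2 / (2 * T)) / sqrt T"

definition smin :: "real \<Rightarrow> real" where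
  "smin \<epsilon> = (160000 * \<epsilon>)\<^sup>2 * (- ln \<epsilon>)"

definition ell :: "real \<Rightarrow> real \<Rightarrow> real" where
  "ell \<epsilon> t = 2 + ln (t / smin \<epsilon>)"

definition wid :: "real \<Rightarrow> real \<Rightarrow> real" where
  "wid \<epsilon> t = t + t / (4 * ell \<epsilon> t)"

definition rterm :: "real \<Rightarrow> real \<Rightarrow> real \<Rightarrow> real \<Rightarrow> real" where
  "rterm \<epsilon> lam r t = (2 * lam * r\<^sup>2 + 3 * lam\<^sup>2 * \<epsilon>) / sqrt t + 4 * (r\<^sup>2 + lam\<^sup>2 * \<epsilon>\<^sup>2) / t"

lemma smin_pos: "0 < \<epsilon> \<Longrightarrow> \<epsilon> < 1 \<Longrightarrow> 0 < smin \<epsilon>"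
  unfolding smin_def by (intro mult_pos_pos) auto

lemma ln_small: "0 < \<epsilon> \<Longrightarrow> \<epsilon> \<le> 1/100 \<Longrightarrow> 1 \<le> - ln (\<epsilon>::real)"
proof -
  assume e: "0 < \<epsilon>" "\<epsilon> \<le> 1/100"
  have "ln \<epsilon> \<le> ln (exp (-1))"
  proof (subst ln_le_cancel_iff)
    have "1/100 \<le> exp (-1 :: real)"
      using exp_le by (simp add: exp_minus field_simps)
    then show "\<epsilon> \<le> exp (-1)" using e by linarith
  qed (use e in auto)
  then show ?thesis by simp
qed

text \<open>Time runs backwards: \<open>t\<close> is the time remaining after the step,
  \<open>t + e^2\<close> the time remaining before it, and \<open>y\<close> is the position relative
  to the threshold before the step. \<open>Z\<close> and \<open>s\<close> below are position and
  step size in units of the bump width \<open>sqrt T\<close>.\<close>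

locale heat_step =
  fixes e r lam \<epsilon> t y :: real
  assumes r: "\<bar>r\<bar> \<le> 1" and e: "0 < e" "e \<le> \<epsilon>" and lam: "0 \<le> lam" "lam * \<epsilon> \<le> 1/8"
    and eps: "\<epsilon> \<le> 1/100" and t: "smin \<epsilon> \<le> t"
begin

definition "L = - ln \<epsilon>"
definition "l = ell \<epsilon> t"
definition "T = wid \<epsilon> t"
definition "h = lam * e"
definition "R = sqrt T"
definition "q = sqrt t"
definition "Z = \<bar>y\<bar> / R"
definition "s = e / R"
abbreviation "tw \<equiv> twopt e r h"
abbreviation "rt \<equiv> rterm \<epsilon> lam r t"

lemma eps0: "0 < \<epsilon>" using e by linarith
lemma L1: "1 \<le> L" using ln_small eps0 eps by (simp add: L_def)
lemma smin0: "0 < smin \<epsilon>" using smin_pos eps0 eps by simp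
lemma t0: "0 < t" using smin0 t by linarith

lemma h: "0 \<le> h" "h \<le> 1/8" "h \<le> lam * \<epsilon>"
proof -
  show "0 \<le> h" using lam e by (simp add: h_def)
  show "h \<le> lam * \<epsilon>" unfolding h_def using lam e by (intro mult_left_mono) auto
  with lam show "h \<le> 1/8" by linarith
qed

lemma l2: "2 \<le> l"
  using t smin0 by (simp add: l_def ell_def)

lemma T_eq: "T = t + t / (4 * l)" by (simp add: T_def wid_def l_def)

lemma T_bounds: "t \<le> T" "T \<le> 9/8 * t" "0 < T"
proof -
  have "t / (4 * l) \<le> t / 8" using l2 t0 by (intro divide_left_mono) auto
  then show "t \<le> T" "T \<le> 9/8 * t" "0 < T" using t0 l2 by (simp_all add: T_eq add_pos_nonneg)
qed

lemma q0: "0 < q" and R0: "0 < R" and qR: "q \<le> R" and qq: "q\<^sup>2 = t" and RR: "R\<^sup>2 = T"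
  using t0 T_bounds by (auto simp: q_def R_def)

lemma div_t: "x / t = x / q / q" "x / t\<^sup>2 = x / q / q ^ 3"
  using div_square[of t q x] qq by (simp_all add: power2_eq_square)

lemma sqrtL: "1 \<le> sqrt L" using L1 by simp

text \<open>By \<open>ln w \<le> 2 * (sqrt w - 1)\<close> the factor \<open>sqrt t\<close> absorbs
  the logarithm \<open>l\<close>. What is left is \<open>2 / 160000\<close>, from the constant in
  \<open>smin\<close>, and \<open>1 / sqrt L\<close>, from its logarithmic factor. The later
  smallness thresholds all rest on this bound.\<close>

lemma lq: "l * \<epsilon> / q \<le> 1 / (80000 * sqrt L)"
proof -
  define w where "w = t / smin \<epsilon>"
  have w: "1 \<le> w" using t smin0 by (simp add: w_def)
  have "ln w = 2 * ln (sqrt w)" using w by (simp add: ln_sqrt)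
  also have "\<dots> \<le> 2 * (sqrt w - 1)" using ln_le_minus_one[of "sqrt w"] w by simp
  finally have l: "l \<le> 2 * sqrt w" by (simp add: l_def ell_def w_def)
  have "q = sqrt w * sqrt (smin \<epsilon>)"
    using smin0 by (simp add: q_def w_def real_sqrt_mult[symmetric])
  also have "sqrt (smin \<epsilon>) = 160000 * \<epsilon> * sqrt L"
    unfolding smin_def L_def real_sqrt_mult real_sqrt_abs using eps0 by simp
  finally have q: "q = sqrt w * (160000 * \<epsilon> * sqrt L)" .
  have "l * \<epsilon> / q \<le> 2 * sqrt w * \<epsilon> / q"
    using l eps0 q0 by (intro divide_right_mono mult_right_mono) auto
  also have "\<dots> = 1 / (80000 * sqrt L)"
    unfolding q using w eps0 sqrtL by (simp add: field_simps)
  finally show ?thesis .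
qed

lemma lR: "l * \<epsilon> / R \<le> 1 / (80000 * sqrt L)"
proof -
  have "l * \<epsilon> / R \<le> l * \<epsilon> / q" using qR q0 l2 eps0 by (intro divide_left_mono mult_pos_pos) auto
  with lq show ?thesis by linarith
qed

lemma sqrtL_inv: "1 / (80000 * sqrt L) \<le> 1 / 80000"
  using sqrtL by (intro divide_left_mono) auto

lemma eq_small: "\<epsilon> / q \<le> 1/160000"
proof -
  have "2 * (\<epsilon> / q) \<le> l * (\<epsilon> / q)" using l2 eps0 q0 by (intro mult_right_mono) auto
  moreover have "l * (\<epsilon> / q) = l * \<epsilon> / q" by simp
  ultimately show ?thesis using lq sqrtL_inv by linarith
qed

lemma s_bounds: "0 < s" "s \<le> \<epsilon> / R" "\<epsilon> / R \<le> 1/160000" "s \<le> 1/160000" "l * s \<le> 1/80000" "\<epsilon> / R \<le> \<epsilon> / q"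
proof -
  show "0 < s" using e R0 by (simp add: s_def)
  show a: "s \<le> \<epsilon> / R" using e R0 by (simp add: s_def divide_right_mono)
  show b: "\<epsilon> / R \<le> \<epsilon> / q" using qR q0 eps0 by (intro divide_left_mono mult_pos_pos) auto
  show c: "\<epsilon> / R \<le> 1/160000" using b eq_small by linarith
  show "s \<le> 1/160000" using a c by linarith
  have "l * s \<le> l * (\<epsilon> / R)" using a l2 by (intro mult_left_mono) auto
  then show "l * s \<le> 1/80000" using lR sqrtL_inv by simp
qed

lemma eps_le: "\<epsilon> \<le> q" "\<epsilon> \<le> R"
  using eq_small q0 qR eps0 by (auto simp: field_simps)

lemma Z0: "0 \<le> Z" using R0 by (simp add: Z_def)
lemma ZZ: "Z\<^sup>2 = y\<^sup>2 / T" by (simp add: Z_def power_divide RR)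

text \<open>Expansions around \<open>y\<close> need \<open>Z * (l * s)\<close> to be small. Where it
  is not, the factor \<open>sqrt L\<close> gained from the logarithm in \<open>smin\<close> forces
  \<open>Z \<ge> 8 * sqrt L\<close>, so Gaussian factors are high powers of
  \<open>\<epsilon>\<close> and beat every negative power of \<open>\<epsilon>\<close> coming from a
  small \<open>t\<close>. This is the reason for the logarithm in \<open>smin\<close>.\<close>

lemma bad:
  assumes "\<not> Z * (l * s) \<le> 1/10000"
  shows "8 \<le> Z" "exp (- Z\<^sup>2 / 8) \<le> \<epsilon> ^ 8"
proof -
  have "Z * (l * s) \<le> Z * (1 / (80000 * sqrt L))"
  proof (intro mult_left_mono Z0)
    have "l * s \<le> l * (\<epsilon> / R)" using s_bounds l2 by (intro mult_left_mono) auto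
    then show "l * s \<le> 1 / (80000 * sqrt L)" using lR by simp
  qed
  then have "1/10000 \<le> Z * (1 / (80000 * sqrt L))" using assms by linarith
  then have Z: "8 * sqrt L \<le> Z" using sqrtL by (simp add: field_simps)
  then show "8 \<le> Z" using sqrtL by linarith
  have "(8 * sqrt L)\<^sup>2 \<le> Z\<^sup>2" using Z sqrtL by (intro power_mono) auto
  then have "64 * L \<le> Z\<^sup>2" using L1 by (simp add: power_mult_distrib)
  then have "exp (- Z\<^sup>2 / 8) \<le> exp (8 * ln \<epsilon>)" by (simp add: L_def)
  also have "\<dots> = \<epsilon> ^ 8" using eps0 by (simp add: exp_of_nat_mult[of 8, simplified])
  finally show "exp (- Z\<^sup>2 / 8) \<le> \<epsilon> ^ 8" .
qed

lemma bad_gauss: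
  assumes "\<not> Z * (l * s) \<le> 1/10000"
  shows "(1 + Z\<^sup>2) * exp (- (3/8 * Z\<^sup>2)) \<le> 8 * \<epsilon> ^ 16" "(1 + Z\<^sup>2)\<^sup>2 * exp (- Z\<^sup>2 / 2) \<le> 64 * \<epsilon> ^ 16"
proof -
  have p: "(1 + Z\<^sup>2) * exp (- (Z\<^sup>2 / 8)) \<le> 8" by (rule gauss_poly1) simp
  have e2: "exp (- Z\<^sup>2 / 4) \<le> \<epsilon> ^ 16"
  proof -
    have "exp (- Z\<^sup>2 / 4) = exp (- Z\<^sup>2 / 8) ^ 2" by (simp add: exp_of_nat_mult[of 2, simplified, symmetric])
    also have "\<dots> \<le> (\<epsilon> ^ 8) ^ 2" using bad(2)[OF assms] by (intro power_mono) auto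
    finally show ?thesis by (simp add: power_mult[symmetric])
  qed
  have "(1 + Z\<^sup>2) * exp (- (3/8 * Z\<^sup>2)) = ((1 + Z\<^sup>2) * exp (- (Z\<^sup>2 / 8))) * exp (- Z\<^sup>2 / 4)"
    by (simp add: exp_add[symmetric] mult.assoc)
  also have "\<dots> \<le> 8 * \<epsilon> ^ 16" using p e2 by (intro mult_mono) auto
  finally show "(1 + Z\<^sup>2) * exp (- (3/8 * Z\<^sup>2)) \<le> 8 * \<epsilon> ^ 16" .
  have "(1 + Z\<^sup>2)\<^sup>2 * exp (- Z\<^sup>2 / 2) = ((1 + Z\<^sup>2) * exp (- (Z\<^sup>2 / 8)))\<^sup>2 * exp (- Z\<^sup>2 / 4)"
    by (simp add: power_mult_distrib exp_of_nat_mult[of 2, simplified, symmetric] exp_add[symmetric] mult.assoc)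
  also have "\<dots> \<le> 8\<^sup>2 * \<epsilon> ^ 16" using p e2 by (intro mult_mono power_mono) auto
  finally show "(1 + Z\<^sup>2)\<^sup>2 * exp (- Z\<^sup>2 / 2) \<le> 64 * \<epsilon> ^ 16" by simp
qed

lemma eps_pow: "k \<ge> 1 \<Longrightarrow> \<epsilon> ^ (k + 1) \<le> \<epsilon> / 100 ^ k"
proof -
  have "\<epsilon> ^ k \<le> (1/100) ^ k" using eps eps0 by (intro power_mono) auto
  then have "\<epsilon> * \<epsilon> ^ k \<le> \<epsilon> * (1/100) ^ k" using eps0 by (intro mult_left_mono) auto
  then show ?thesis by (simp add: power_divide)
qed

lemma RR_cube: "R ^ 3 \<le> 6/5 * q ^ 3"
proof -
  have "(R / q)\<^sup>2 \<le> 9/8" using T_bounds t0 qq RR by (simp add: power_divide field_simps)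
  then have a: "(R / q)\<^sup>2 \<le> 9/8" "0 \<le> R / q" using R0 q0 by auto
  have "R / q \<le> 16/15"
  proof (rule power2_le_imp_le)
    show "(R / q)\<^sup>2 \<le> (16/15)\<^sup>2" using a by (simp add: power2_eq_square)
  qed simp
  then have "(R / q)\<^sup>2 * (R / q) \<le> 9/8 * (16/15)" using a by (intro mult_mono) auto
  then show ?thesis using q0 by (simp add: power3_eq_cube power2_eq_square field_simps)
qed

lemma psi_eq: "psi T y = exp (- Z\<^sup>2 / 2) / R"
  by (simp add: psi_def ZZ R_def divide_divide_eq_left mult.commute)

lemma psi_over: "psi T y / T = exp (- Z\<^sup>2 / 2) / R ^ 3"
proof -
  have "psi T y / T = exp (- Z\<^sup>2 / 2) / R / R\<^sup>2" by (simp only: psi_eq RR)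
  then show ?thesis by (simp add: power3_eq_cube power2_eq_square)
qed

text \<open>The third derivative keeps its Gaussian decay in the estimate, so the cubic error
  appears as a multiple of the bump and not as a uniform bound. The defects of mean and variance, in
  contrast, are bounded uniformly in \<open>y\<close> and go into \<open>rterm\<close>.\<close>

lemma step_cdf_space:
  "\<bar>tw (\<lambda>d. Phi ((y + d) / q)) - (Phi (y / q) - e\<^sup>2 / 2 * (y / q * std_normal_density (y / q) / t))\<bar>
    \<le> e\<^sup>2 * (19 * \<epsilon> * (1 + Z\<^sup>2) * psi T y / T + \<epsilon> / 2 + rt)"
proof -
  define a where "a = \<bar>y\<bar> / q"
  define \<delta> where "\<delta> = 3 * e / q"
  have a0: "0 \<le> a" using q0 by (simp add: a_def)
  have aa: "a\<^sup>2 = y\<^sup>2 / t" by (simp add: a_def power_divide qq)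
  have Za: "Z\<^sup>2 \<le> a\<^sup>2" unfolding ZZ aa using T_bounds t0 by (intro divide_left_mono) auto
  have aZ: "a\<^sup>2 \<le> 9/8 * Z\<^sup>2" unfolding ZZ aa using T_bounds t0 mult_right_mono[OF T_bounds(2), of "y\<^sup>2"]
    by (simp add: field_simps)
  have d1: "0 \<le> \<delta>" using e q0 by (simp add: \<delta>_def)
  have d2: "\<delta> \<le> 1/50000"
  proof -
    have "e / q \<le> \<epsilon> / q" using e q0 by (intro divide_right_mono) auto
    then show ?thesis using eq_small by (simp add: \<delta>_def)
  qed
  \<comment> \<open>Bound for the third derivative over the whole reach of the step: moving
    \<open>y\<close> by at most \<open>3 * e\<close> changes the exponent \<open>- a^2 / 2\<close>
    by at most \<open>a * \<delta>\<close>.\<close>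
  define B where "B = 3/2 * (1 + a\<^sup>2) * exp (- a\<^sup>2 / 2 + a * \<delta>) / q ^ 3"
  define f1 where "f1 x = std_normal_density (x / q) / q" for x
  define f2 where "f2 x = - (x / q * std_normal_density (x / q)) / q\<^sup>2" for x
  define f3 where "f3 x = ((x / q)\<^sup>2 - 1) * std_normal_density (x / q) / q ^ 3" for x
  have D: "((\<lambda>x. F (x / q)) has_real_derivative F' * (1 / q)) (at x)"
    if "(F has_real_derivative F') (at (x / q))" for F F' x
    by (rule DERIV_chain2[where g = "\<lambda>x. x / q", OF that]) (use q0 in \<open>auto intro!: derivative_eq_intros\<close>)
  have D1: "((\<lambda>x. Phi (x / q)) has_real_derivative f1 x) (at x)" for x
    using D[OF Phi_deriv[of "x / q"]] by (simp add: f1_def)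
  have D2: "(f1 has_real_derivative f2 x) (at x)" for x
    using DERIV_cdivide[OF D[OF std_normal_density_deriv[of "x / q"]], of q] q0
    unfolding f1_def[abs_def] f2_def by (simp add: power2_eq_square mult.assoc)
  have D3: "(f2 has_real_derivative f3 x) (at x)" for x
  proof -
    have "((\<lambda>z. - (z * std_normal_density z)) has_real_derivative
        - (1 * std_normal_density z + (- z * std_normal_density z) * z)) (at z)" for z
      by (intro DERIV_minus DERIV_mult std_normal_density_deriv DERIV_ident)
    from DERIV_cdivide[OF D[OF this[of "x / q"]], of "q\<^sup>2"]
    have "(f2 has_real_derivative (- (1 * std_normal_density (x / q) + (- (x / q) * std_normal_density (x / q)) * (x / q))) * (1 / q) / q\<^sup>2) (at x)"
      unfolding f2_def[abs_def] by simp
    moreover have "(- (1 * std_normal_density (x / q) + (- (x / q) * std_normal_density (x / q)) * (x / q))) * (1 / q) / q\<^sup>2 = f3 x"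
      using q0 by (simp add: f3_def power2_eq_square power3_eq_cube field_simps)
    ultimately show ?thesis by simp
  qed
  have f3B: "\<bar>f3 x\<bar> \<le> B" if x: "\<bar>x - y\<bar> \<le> 3 * e" for x
  proof -
    define c where "c = \<bar>x\<bar> / q"
    have c0: "0 \<le> c" using q0 by (simp add: c_def)
    have xc: "(x / q)\<^sup>2 = c\<^sup>2" by (simp add: c_def power_divide)
    have "c \<le> (\<bar>y\<bar> + 3 * e) / q" unfolding c_def using x q0 by (intro divide_right_mono) auto
    then have ca: "c \<le> a + \<delta>" by (simp add: a_def \<delta>_def add_divide_distrib)
    have "(\<bar>y\<bar> - 3 * e) / q \<le> c" unfolding c_def using x q0 by (intro divide_right_mono) auto
    then have ac: "a - \<delta> \<le> c" by (simp add: a_def \<delta>_def diff_divide_distrib)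
    have c2: "a\<^sup>2 - 2 * a * \<delta> \<le> c\<^sup>2"
    proof (cases "\<delta> \<le> a")
      case True
      then have "(a - \<delta>)\<^sup>2 \<le> c\<^sup>2" using ac by (intro power_mono) auto
      then show ?thesis unfolding power2_diff using zero_le_power2[of \<delta>] by linarith
    next
      case False
      then have "a * a \<le> a * \<delta>" using a0 by (intro mult_left_mono) auto
      moreover have "0 \<le> a * \<delta>" using a0 d1 by simp
      moreover have "0 \<le> c\<^sup>2" by simp
      ultimately show ?thesis unfolding power2_eq_square by linarith
    qed
    have "c \<le> a + 1" using ca d2 by linarith
    then have "c\<^sup>2 \<le> (a + 1)\<^sup>2" using c0 by (intro power_mono) auto
    moreover have "0 \<le> (a - 1)\<^sup>2" by simp
    moreover have "0 \<le> a\<^sup>2" by simp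
    ultimately have p: "1 + c\<^sup>2 \<le> 3 * (1 + a\<^sup>2)" unfolding power2_sum power2_diff distrib_left power_one mult_1_right by linarith
    have "\<bar>f3 x\<bar> = \<bar>c\<^sup>2 - 1\<bar> * std_normal_density (x / q) / q ^ 3"
      using q0 by (simp add: f3_def xc abs_mult)
    also have "\<dots> \<le> (1 + c\<^sup>2) * (exp (- a\<^sup>2 / 2 + a * \<delta>) / 2) / q ^ 3"
    proof (intro divide_right_mono mult_mono)
      have "std_normal_density (x / q) \<le> exp (- c\<^sup>2 / 2) / 2" using std_normal_density_le[of "x / q"] xc by simp
      also have "\<dots> \<le> exp (- a\<^sup>2 / 2 + a * \<delta>) / 2" using c2 by simp
      finally show "std_normal_density (x / q) \<le> exp (- a\<^sup>2 / 2 + a * \<delta>) / 2" .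
    qed (use q0 in \<open>auto simp: abs_le_iff\<close>)
    also have "\<dots> \<le> (3 * (1 + a\<^sup>2)) * (exp (- a\<^sup>2 / 2 + a * \<delta>) / 2) / q ^ 3"
      using p q0 by (intro divide_right_mono mult_right_mono) auto
    finally show ?thesis by (simp add: B_def)
  qed
  have main: "\<bar>tw (\<lambda>d. Phi ((y + d) / q)) - (Phi (y / q) + e\<^sup>2 / 2 * f2 y)\<bar>
      \<le> e * (2 * h * r\<^sup>2 + 3 * h\<^sup>2) * \<bar>f1 y\<bar> + 2 * e\<^sup>2 * (r\<^sup>2 + h\<^sup>2) * \<bar>f2 y\<bar> + 9/2 * e ^ 3 * B"
    by (rule twopt_taylor[OF r h(1,2) e(1) D1 D2 D3 f3B])
  have n1: "std_normal_density (y / q) \<le> 1"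
    using std_normal_density_le[of "y / q"] exp_le_one_iff[of "- (y / q)\<^sup>2 / 2"] by (smt (verit) divide_nonpos_pos field_sum_of_halves not_exp_le_zero zero_le_power2)
  have F1: "e * (2 * h * r\<^sup>2 + 3 * h\<^sup>2) * \<bar>f1 y\<bar> \<le> e\<^sup>2 * ((2 * lam * r\<^sup>2 + 3 * lam\<^sup>2 * \<epsilon>) / q)"
  proof -
    have "\<bar>f1 y\<bar> \<le> 1 / q" unfolding f1_def using n1 q0 by (simp add: divide_right_mono)
    moreover have "e * (2 * h * r\<^sup>2 + 3 * h\<^sup>2) = e\<^sup>2 * (2 * lam * r\<^sup>2 + 3 * lam\<^sup>2 * e)"
      by (simp add: h_def power2_eq_square algebra_simps)
    moreover have "\<dots> \<le> e\<^sup>2 * (2 * lam * r\<^sup>2 + 3 * lam\<^sup>2 * \<epsilon>)"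
      using e lam by (intro mult_left_mono add_left_mono) auto
    moreover have "0 \<le> e\<^sup>2 * (2 * lam * r\<^sup>2 + 3 * lam\<^sup>2 * \<epsilon>)"
      using eps0 lam by simp
    ultimately have "e * (2 * h * r\<^sup>2 + 3 * h\<^sup>2) * \<bar>f1 y\<bar> \<le> e\<^sup>2 * (2 * lam * r\<^sup>2 + 3 * lam\<^sup>2 * \<epsilon>) * (1 / q)"
      by (intro mult_mono[of "e * (2 * h * r\<^sup>2 + 3 * h\<^sup>2)"]) simp_all
    then show ?thesis by simp
  qed
  have F2: "2 * e\<^sup>2 * (r\<^sup>2 + h\<^sup>2) * \<bar>f2 y\<bar> \<le> e\<^sup>2 * (4 * (r\<^sup>2 + lam\<^sup>2 * \<epsilon>\<^sup>2) / t)"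
  proof -
    have "\<bar>y / q\<bar> * std_normal_density (y / q) \<le> \<bar>y / q\<bar> * exp (- (y / q)\<^sup>2 / 2)"
      using std_normal_density_le[of "y / q"] exp_ge_zero[of "- (y / q)\<^sup>2 / 2"]
      by (intro mult_left_mono) (linarith, simp)
    also have "\<dots> \<le> 1" using gauss_poly3[of "\<bar>y / q\<bar>"] by (simp only: power2_abs)
    finally have "\<bar>y / q\<bar> * std_normal_density (y / q) / t \<le> 1 / t"
      using t0 by (intro divide_right_mono) auto
    moreover have "\<bar>f2 y\<bar> = \<bar>y / q\<bar> * std_normal_density (y / q) / t"
      using t0 by (simp add: f2_def qq abs_mult)
    ultimately have "\<bar>f2 y\<bar> \<le> 1 / t" by simp
    moreover have "h\<^sup>2 \<le> (lam * \<epsilon>)\<^sup>2" using h by (intro power_mono) auto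
    then have "2 * e\<^sup>2 * (r\<^sup>2 + h\<^sup>2) \<le> 4 * e\<^sup>2 * (r\<^sup>2 + lam\<^sup>2 * \<epsilon>\<^sup>2)"
      by (intro mult_mono) (auto simp: power_mult_distrib)
    ultimately have "2 * e\<^sup>2 * (r\<^sup>2 + h\<^sup>2) * \<bar>f2 y\<bar> \<le> 4 * e\<^sup>2 * (r\<^sup>2 + lam\<^sup>2 * \<epsilon>\<^sup>2) * (1 / t)"
      by (intro mult_mono[of "2 * e\<^sup>2 * (r\<^sup>2 + h\<^sup>2)"]) auto
    then show ?thesis by (simp add: algebra_simps add_divide_distrib)
  qed
  have F3: "9/2 * e ^ 3 * B \<le> e\<^sup>2 * (19 * \<epsilon> * (1 + Z\<^sup>2) * psi T y / T + \<epsilon> / 2)"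
  proof -
    have pp: "0 \<le> psi T y / T" unfolding psi_over using R0 by simp
    have e3: "9/2 * e ^ 3 * B \<le> e\<^sup>2 * (9/2 * \<epsilon> * B)"
    proof -
      have "0 \<le> B" using q0 by (simp add: B_def)
      then have "e * (e\<^sup>2 * (9/2 * B)) \<le> \<epsilon> * (e\<^sup>2 * (9/2 * B))" using e by (intro mult_right_mono) auto
      then show ?thesis by (simp add: power3_eq_cube power2_eq_square mult_ac)
    qed
    have "9/2 * \<epsilon> * B \<le> 19 * \<epsilon> * (1 + Z\<^sup>2) * psi T y / T + \<epsilon> / 2"
    \<comment> \<open>In the central region \<open>exp (a * \<delta>) \<le> 2\<close>, and the
      constants multiply to \<open>9/2 * 81/20 < 19\<close>. Outside it the error is below
      \<open>\<epsilon> / 2\<close> with no help from the bump.\<close>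
    proof (cases "Z * (l * s) \<le> 1/10000")
      case True
      have "Z * (2 * s) \<le> Z * (l * s)" using l2 s_bounds Z0 by (intro mult_left_mono mult_right_mono) auto
      then have Zs: "Z * s \<le> 1/20000" using True by simp
      have "a * \<delta> \<le> 1/2"
      proof -
        have "a * \<delta> = 3 * \<bar>y\<bar> * e / t" by (simp add: a_def \<delta>_def div_t)
        also have "\<dots> \<le> 3 * \<bar>y\<bar> * e * (9/8) / T"
          using T_bounds t0 e mult_left_mono[OF T_bounds(2), of "3 * \<bar>y\<bar> * e"] by (simp add: field_simps)
        also have "\<dots> = 27/8 * (Z * s)" by (simp add: Z_def s_def RR[symmetric] power2_eq_square)
        finally show ?thesis using Zs by linarith
      qed
      then have "exp (a * \<delta>) \<le> exp (1/2)" by simp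
      also have "exp (1/2) \<le> (2::real)" using exp_bound_half[of "1/2::real"] by simp
      finally have ex: "exp (a * \<delta>) \<le> 2" .
      have "exp (- a\<^sup>2 / 2 + a * \<delta>) = exp (- a\<^sup>2 / 2) * exp (a * \<delta>)" by (simp add: exp_add[symmetric])
      also have "\<dots> \<le> exp (- Z\<^sup>2 / 2) * 2" using ex Za by (intro mult_mono) auto
      finally have E: "exp (- a\<^sup>2 / 2 + a * \<delta>) \<le> 2 * exp (- Z\<^sup>2 / 2)" by simp
      have iq: "1 / q ^ 3 \<le> 6/5 * (1 / R ^ 3)" using RR_cube q0 R0 by (simp add: field_simps)
      have A1: "3/2 * (1 + a\<^sup>2) \<le> 3/2 * (9/8 * (1 + Z\<^sup>2))" using aZ by simp
      have "3/2 * (1 + a\<^sup>2) * exp (- a\<^sup>2 / 2 + a * \<delta>) \<le> 3/2 * (9/8 * (1 + Z\<^sup>2)) * (2 * exp (- Z\<^sup>2 / 2))"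
        by (rule mult_mono[OF A1 E]) auto
      from mult_mono[OF this iq] have "B \<le> 3/2 * (9/8 * (1 + Z\<^sup>2)) * (2 * exp (- Z\<^sup>2 / 2)) * (6/5 * (1 / R ^ 3))"
        using q0 by (simp add: B_def)
      also have "\<dots> = 81/20 * ((1 + Z\<^sup>2) * (exp (- Z\<^sup>2 / 2) / R ^ 3))" by simp
      also have "\<dots> = 81/20 * ((1 + Z\<^sup>2) * (psi T y / T))" by (simp only: psi_over)
      finally have "9/2 * \<epsilon> * B \<le> 9/2 * \<epsilon> * (81/20 * ((1 + Z\<^sup>2) * (psi T y / T)))"
        using eps0 by (intro mult_left_mono) auto
      also have "\<dots> \<le> 19 * (\<epsilon> * ((1 + Z\<^sup>2) * (psi T y / T)))"
      proof -
        have "0 \<le> \<epsilon> * ((1 + Z\<^sup>2) * (psi T y / T))"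
          using eps0 by (intro mult_nonneg_nonneg pp) auto
        then show ?thesis by linarith
      qed
      finally show ?thesis using eps0 by (simp add: mult.assoc)
    next
      case False
      note b = bad[OF False] bad_gauss[OF False]
      have "8\<^sup>2 \<le> Z\<^sup>2" using b(1) by (intro power_mono) auto
      then have "8\<^sup>2 \<le> a\<^sup>2" using Za by linarith
      then have a8: "8 \<le> a" using a0 by (rule power2_le_imp_le)
      have "a * \<delta> \<le> a * (a / 72)" using a8 d2 by (intro mult_left_mono) auto
      then have ad: "a * \<delta> \<le> a\<^sup>2 / 72" by (simp add: power2_eq_square)
      have "(1 + a\<^sup>2) * exp (- a\<^sup>2 / 2 + a * \<delta>) \<le> (9/8 * (1 + Z\<^sup>2)) * exp (- (3/8 * Z\<^sup>2))"
        using aZ Za ad by (intro mult_mono) auto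
      also have "\<dots> = 9/8 * ((1 + Z\<^sup>2) * exp (- (3/8 * Z\<^sup>2)))" by (simp only: mult.assoc)
      finally have "3/2 * ((1 + a\<^sup>2) * exp (- a\<^sup>2 / 2 + a * \<delta>)) \<le> 27/2 * \<epsilon> ^ 16" using b(3) by linarith
      moreover have "1 / q ^ 3 \<le> 1 / \<epsilon> ^ 3" using eps_le eps0 by (intro divide_left_mono power_mono) auto
      ultimately have "3/2 * ((1 + a\<^sup>2) * exp (- a\<^sup>2 / 2 + a * \<delta>)) * (1 / q ^ 3) \<le> 27/2 * \<epsilon> ^ 16 * (1 / \<epsilon> ^ 3)"
        using q0 eps0 by (intro mult_mono[of "3/2 * ((1 + a\<^sup>2) * exp (- a\<^sup>2 / 2 + a * \<delta>))"]) auto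
      moreover have "B = 3/2 * ((1 + a\<^sup>2) * exp (- a\<^sup>2 / 2 + a * \<delta>)) * (1 / q ^ 3)" by (simp add: B_def)
      moreover have "27/2 * \<epsilon> ^ 16 * (1 / \<epsilon> ^ 3) = 27/2 * \<epsilon> ^ 13" using eps0 by (simp add: field_simps power_add[symmetric])
      ultimately have "B \<le> 27/2 * \<epsilon> ^ 13" by simp
      also have "\<epsilon> ^ 13 \<le> \<epsilon> / 100 ^ 12" using eps_pow[of 12] by simp
      finally have "B \<le> 1/9" using eps by simp
      then have "9/2 * \<epsilon> * B \<le> 9/2 * \<epsilon> * (1/9)" using eps0 by (intro mult_left_mono) auto
      moreover have "0 \<le> 19 * \<epsilon> * (1 + Z\<^sup>2) * psi T y / T"
        unfolding times_divide_eq_right[symmetric] using eps0 by (intro mult_nonneg_nonneg pp) auto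
      ultimately show ?thesis by linarith
    qed
    then have "e\<^sup>2 * (9/2 * \<epsilon> * B) \<le> e\<^sup>2 * (19 * \<epsilon> * (1 + Z\<^sup>2) * psi T y / T + \<epsilon> / 2)"
      by (intro mult_left_mono) auto
    with e3 show ?thesis by linarith
  qed
  have "Phi (y / q) + e\<^sup>2 / 2 * f2 y = Phi (y / q) - e\<^sup>2 / 2 * (y / q * std_normal_density (y / q) / t)"
    by (simp add: f2_def qq)
  note main' = main[unfolded this]
  have "e\<^sup>2 * rt = e\<^sup>2 * ((2 * lam * r\<^sup>2 + 3 * lam\<^sup>2 * \<epsilon>) / q) + e\<^sup>2 * (4 * (r\<^sup>2 + lam\<^sup>2 * \<epsilon>\<^sup>2) / t)"
    unfolding rterm_def q_def by (rule distrib_left)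
  moreover have "e\<^sup>2 * (19 * \<epsilon> * (1 + Z\<^sup>2) * psi T y / T + \<epsilon> / 2 + rt) =
      e\<^sup>2 * (19 * \<epsilon> * (1 + Z\<^sup>2) * psi T y / T + \<epsilon> / 2) + e\<^sup>2 * rt"
    by (rule distrib_left)
  ultimately show ?thesis using main' F1 F2 F3 by linarith
qed

end

text \<open>The derivative of \<open>psi\<close> in \<open>T\<close> is
  \<open>psi T y / (2 * T) * (y^2 / T - 1)\<close>. The second bound is this first-order expansion
  with an explicit remainder; the first keeps only the loss in the normalisation and serves where
  the Gaussian factor is negligible.\<close>

lemma psi_widen:
  assumes T: "0 < T" and D: "0 \<le> D" "D \<le> T"
  shows "psi T y * (1 - D / T / 2) \<le> psi (T + D) y"
    "psi T y * (1 + D / T / 2 * (y\<^sup>2 / T - 1) - y\<^sup>2 / T * (D / T)\<^sup>2) \<le> psi (T + D) y"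
proof -
  define x where "x = D / T"
  define z where "z = y\<^sup>2 / T"
  have x: "0 \<le> x" "x \<le> 1" using assms by (auto simp: x_def)
  have z: "0 \<le> z" using T by (simp add: z_def)
  have TD: "T + D = T * (1 + x)" using T by (simp add: x_def field_simps)
  have s0: "0 < sqrt (1 + x)" using x by simp
  have "sqrt (1 + x) \<le> 1 + x / 2" using x by (intro real_le_lsqrt) (auto simp: power2_eq_square algebra_simps)
  then have "(1 - x / 2) * sqrt (1 + x) \<le> (1 - x / 2) * (1 + x / 2)" using x by (intro mult_left_mono) auto
  also have "\<dots> \<le> 1" using x by (simp add: algebra_simps)
  finally have i: "1 - x / 2 \<le> 1 / sqrt (1 + x)" using s0 by (simp add: field_simps)
  have ex: "y\<^sup>2 / (2 * (T + D)) = z / 2 - z * x / (2 * (1 + x))"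
  proof -
    have "y\<^sup>2 = z * T" using T by (simp add: z_def)
    then have "y\<^sup>2 / (2 * (T + D)) = z / (2 * (1 + x))" using T by (simp add: TD)
    moreover have "z / 2 - z * x / (2 * (1 + x)) = z / (2 * (1 + x))"
      using x by (simp add: field_simps)
    ultimately show ?thesis by simp
  qed
  have p: "psi (T + D) y = psi T y * (1 / sqrt (1 + x)) * exp (z * x / (2 * (1 + x)))"
  proof -
    have "exp (- y\<^sup>2 / (2 * (T + D))) = exp (- (z / 2)) * exp (z * x / (2 * (1 + x)))"
      using ex by (simp add: exp_add[symmetric])
    moreover have "- y\<^sup>2 / (2 * T) = - (z / 2)" by (simp add: z_def)
    ultimately show ?thesis by (simp add: psi_def TD real_sqrt_mult)
  qed
  have p0: "0 \<le> psi T y" using T by (simp add: psi_def)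
  have e1: "1 + z * x / (2 * (1 + x)) \<le> exp (z * x / (2 * (1 + x)))" by (rule exp_ge_add_one_self)
  have e0: "0 \<le> z * x / (2 * (1 + x))" using x z by simp
  have k: "(1 - x / 2) * (1 + z * x / (2 * (1 + x))) \<le> (1 / sqrt (1 + x)) * exp (z * x / (2 * (1 + x)))"
    using i e1 e0 x s0 by (intro mult_mono) auto
  have "(1 - x / 2) * 1 \<le> (1 - x / 2) * (1 + z * x / (2 * (1 + x)))"
    using e0 x by (intro mult_left_mono) auto
  with k have "1 - x / 2 \<le> (1 / sqrt (1 + x)) * exp (z * x / (2 * (1 + x)))" by simp
  then have "psi T y * (1 - x / 2) \<le> psi T y * ((1 / sqrt (1 + x)) * exp (z * x / (2 * (1 + x))))"
    using p0 by (intro mult_left_mono) auto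
  then show "psi T y * (1 - D / T / 2) \<le> psi (T + D) y" by (simp add: p x_def mult.assoc)
  have "(1 - 3/2 * x) * (1 + x) = 1 - x / 2 - 3/2 * x\<^sup>2" by (simp add: power2_eq_square algebra_simps)
  moreover have "0 \<le> x\<^sup>2" by simp
  ultimately have "(1 - 3/2 * x) * (1 + x) \<le> 1 - x / 2" by linarith
  moreover have "0 < 1 + x" using x by simp
  ultimately have "1 - 3/2 * x \<le> (1 - x / 2) / (1 + x)" by (simp only: pos_le_divide_eq)
  then have "z * x / 2 * (1 - 3/2 * x) \<le> z * x / 2 * ((1 - x / 2) / (1 + x))"
    using x z by (intro mult_left_mono) auto
  moreover have "(1 - x / 2) * (1 + z * x / (2 * (1 + x))) = (1 - x / 2) + z * x / 2 * ((1 - x / 2) / (1 + x))"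
    using x by (simp add: field_simps)
  moreover have "z * x / 2 * (1 - 3/2 * x) = z * x / 2 - 3/4 * (z * x\<^sup>2)" by (simp add: power2_eq_square algebra_simps)
  moreover have "x / 2 * (z - 1) = z * x / 2 - x / 2" by (simp add: right_diff_distrib mult.commute)
  moreover have "0 \<le> z * x\<^sup>2" using z by simp
  ultimately have "1 + x / 2 * (z - 1) - z * x\<^sup>2 \<le> (1 / sqrt (1 + x)) * exp (z * x / (2 * (1 + x)))"
    using k by linarith
  then have "psi T y * (1 + x / 2 * (z - 1) - z * x\<^sup>2) \<le> psi T y * ((1 / sqrt (1 + x)) * exp (z * x / (2 * (1 + x))))"
    using p0 by (intro mult_left_mono) auto
  then show "psi T y * (1 + D / T / 2 * (y\<^sup>2 / T - 1) - y\<^sup>2 / T * (D / T)\<^sup>2) \<le> psi (T + D) y"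
    by (simp add: p x_def z_def mult.assoc)
qed

context heat_step
begin

lemma e_over: "e / q \<le> 1/160000" "e\<^sup>2 / t \<le> 1/100" "l * (e\<^sup>2 / t) \<le> 1/100"
proof -
  have a: "e / q \<le> \<epsilon> / q" using e q0 by (intro divide_right_mono) auto
  then show b: "e / q \<le> 1/160000" using eq_small by linarith
  have e2: "e\<^sup>2 / t = (e / q)\<^sup>2" by (simp add: power_divide qq)
  have b0: "0 \<le> e / q" using e q0 by simp
  have c: "(e / q)\<^sup>2 \<le> 1/160000 * (e / q)" unfolding power2_eq_square using b b0 by (intro mult_right_mono) auto
  then show "e\<^sup>2 / t \<le> 1/100" unfolding e2 using b by linarith
  have "l * (e\<^sup>2 / t) \<le> l * (1/160000 * (e / q))" unfolding e2 using c l2 by (intro mult_left_mono) auto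
  also have "\<dots> \<le> l * (1/160000 * (\<epsilon> / q))" using a l2 by (intro mult_left_mono) auto
  also have "\<dots> = 1/160000 * (l * \<epsilon> / q)" by simp
  also have "\<dots> \<le> 1/160000 * (1/80000)" using lq sqrtL_inv by (intro mult_left_mono) linarith+
  finally show "l * (e\<^sup>2 / t) \<le> 1/100" by linarith
qed

lemma tT: "t + e\<^sup>2 \<le> T"
proof -
  have "e\<^sup>2 \<le> t / (4 * l)" using e_over(3) t0 l2 by (simp add: field_simps)
  then show ?thesis by (simp add: T_eq)
qed

text \<open>\<open>Phi (y / sqrt t)\<close> solves the heat equation, so the second-order term left
  by the spatial expansion cancels the first-order change from \<open>t\<close> to
  \<open>t + e^2\<close>. The remainder is the second time derivative \<open>w2\<close>, comparable
  to a fourth derivative in space, hence smaller than the cubic error by a factor of order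
  \<open>e / sqrt t\<close>.\<close>

lemma step_cdf_time:
  "\<bar>Phi (y / q) - e\<^sup>2 / 2 * (y / q * std_normal_density (y / q) / t) - Phi (y / sqrt (t + e\<^sup>2))\<bar>
    \<le> e\<^sup>2 * (\<epsilon> * (1 + Z\<^sup>2) * psi T y / T + \<epsilon> / 2)"
proof -
  define a where "a = \<bar>y\<bar> / q"
  have a0: "0 \<le> a" using q0 by (simp add: a_def)
  have aa: "a\<^sup>2 = y\<^sup>2 / t" by (simp add: a_def power_divide qq)
  have aZ: "a\<^sup>2 \<le> 9/8 * Z\<^sup>2" unfolding ZZ aa using T_bounds t0 mult_right_mono[OF T_bounds(2), of "y\<^sup>2"]
    by (simp add: field_simps)
  define z where "z x = y / sqrt x" for x
  define w1 where "w1 x = std_normal_density (z x) * (- z x / (2 * x))" for x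
  define w2 where "w2 x = std_normal_density (z x) * (3 * z x - z x ^ 3) / (4 * x\<^sup>2)" for x
  have Dz: "(z has_real_derivative (- z x / (2 * x))) (at x)" if "0 < x" for x
  proof -
    have "(z has_real_derivative (0 * sqrt x - y * (inverse (sqrt x) / 2)) / (sqrt x * sqrt x)) (at x)"
      unfolding z_def[abs_def] using that by (intro DERIV_divide DERIV_const DERIV_real_sqrt) auto
    moreover have "(0 * sqrt x - y * (inverse (sqrt x) / 2)) / (sqrt x * sqrt x) = - z x / (2 * x)"
    proof -
      have "sqrt x * sqrt x = x" using that by simp
      then show ?thesis unfolding z_def inverse_eq_divide by simp
    qed
    ultimately show ?thesis by simp
  qed
  have D1: "((\<lambda>x. Phi (z x)) has_real_derivative w1 x) (at x)" if "0 < x" for x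
    unfolding w1_def by (rule DERIV_chain2[OF Phi_deriv Dz[OF that]])
  have D2: "(w1 has_real_derivative w2 x) (at x)" if x: "0 < x" for x
  proof -
    have "((\<lambda>x. std_normal_density (z x)) has_real_derivative (- z x * std_normal_density (z x)) * (- z x / (2 * x))) (at x)"
      by (rule DERIV_chain2[OF std_normal_density_deriv Dz[OF that]])
    moreover have "((\<lambda>x. - z x / (2 * x)) has_real_derivative
        (- (- z x / (2 * x)) * (2 * x) - (- z x) * (2 * 1)) / (2 * x * (2 * x))) (at x)"
      by (intro DERIV_divide DERIV_minus Dz x DERIV_cmult DERIV_ident) (use x in auto)
    ultimately have "(w1 has_real_derivative
        ((- z x * std_normal_density (z x)) * (- z x / (2 * x)) * (- z x / (2 * x)) +
        (- (- z x / (2 * x)) * (2 * x) - (- z x) * (2 * 1)) / (2 * x * (2 * x)) * std_normal_density (z x))) (at x)"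
      unfolding w1_def[abs_def] by (rule DERIV_mult)
    moreover have "((- z x * std_normal_density (z x)) * (- z x / (2 * x)) * (- z x / (2 * x)) +
        (- (- z x / (2 * x)) * (2 * x) - (- z x) * (2 * 1)) / (2 * x * (2 * x)) * std_normal_density (z x)) = w2 x"
      using x by (simp add: w2_def power2_eq_square power3_eq_cube divide_simps) (simp add: algebra_simps)
    ultimately show ?thesis by simp
  qed
  define diff where "diff m = (if m = 0 then (\<lambda>x. Phi (z x)) else if m = 1 then w1 else w2)" for m :: nat
  have ee: "0 < e\<^sup>2" using e by simp
  have "\<exists>\<xi>. (if t + e\<^sup>2 < t then t + e\<^sup>2 < \<xi> \<and> \<xi> < t else t < \<xi> \<and> \<xi> < t + e\<^sup>2) \<and>
      Phi (z (t + e\<^sup>2)) = (\<Sum>m<2. diff m t / fact m * (t + e\<^sup>2 - t) ^ m) + diff 2 \<xi> / fact 2 * (t + e\<^sup>2 - t) ^ 2"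
    by (rule Taylor[of 2 diff "\<lambda>x. Phi (z x)" t "t + e\<^sup>2"])
       (use D1 D2 t0 ee in \<open>auto simp: diff_def less_Suc_eq eval_nat_numeral\<close>)
  then obtain \<xi> where \<xi>: "t < \<xi>" "\<xi> < t + e\<^sup>2"
    and eq: "Phi (z (t + e\<^sup>2)) = (\<Sum>m<2. diff m t / fact m * (e\<^sup>2) ^ m) + diff 2 \<xi> / fact 2 * (e\<^sup>2) ^ 2"
    using ee by auto
  have eq': "Phi (z (t + e\<^sup>2)) = Phi (z t) + w1 t * e\<^sup>2 + w2 \<xi> / 2 * (e\<^sup>2)\<^sup>2"
    using eq by (simp add: diff_def eval_nat_numeral)
  have w1t: "w1 t * e\<^sup>2 = - (e\<^sup>2 / 2 * (y / q * std_normal_density (y / q) / t))"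
    by (simp add: w1_def z_def q_def mult_ac)
  have zq: "z t = y / q" by (simp add: z_def q_def)
  have main: "\<bar>Phi (y / q) - e\<^sup>2 / 2 * (y / q * std_normal_density (y / q) / t) - Phi (y / sqrt (t + e\<^sup>2))\<bar> = \<bar>w2 \<xi>\<bar> / 2 * (e\<^sup>2)\<^sup>2"
  proof -
    have "Phi (y / q) - e\<^sup>2 / 2 * (y / q * std_normal_density (y / q) / t) - Phi (y / sqrt (t + e\<^sup>2)) = - (w2 \<xi> / 2 * (e\<^sup>2)\<^sup>2)"
      using eq'[unfolded zq] w1t unfolding z_def by linarith
    then show ?thesis by (simp add: abs_mult)
  qed
  have \<xi>0: "0 < \<xi>" using \<xi> t0 by linarith
  have za: "\<bar>z \<xi>\<bar> \<le> a"
    unfolding z_def a_def q_def abs_divide using \<xi> t0 by (intro frac_le) auto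
  have zZ: "Z\<^sup>2 \<le> (z \<xi>)\<^sup>2"
  proof -
    have "(z \<xi>)\<^sup>2 = y\<^sup>2 / \<xi>" using \<xi>0 by (simp add: z_def power_divide)
    then show ?thesis unfolding ZZ using \<xi>0 \<xi> tT T_bounds by (simp add: frac_le)
  qed
  have nd: "std_normal_density (z \<xi>) \<le> exp (- Z\<^sup>2 / 2) / 2"
    using std_normal_density_le[of "z \<xi>"] zZ by (smt (verit) exp_le_cancel_iff divide_right_mono)
  have poly: "\<bar>3 * z \<xi> - z \<xi> ^ 3\<bar> \<le> 3 * (a * (1 + a\<^sup>2))"
  proof -
    have "\<bar>3 * z \<xi> - z \<xi> ^ 3\<bar> \<le> 3 * \<bar>z \<xi>\<bar> + \<bar>z \<xi>\<bar> ^ 3"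
      using abs_triangle_ineq4[of "3 * z \<xi>" "z \<xi> ^ 3"] by (simp add: abs_mult power_abs)
    also have "\<dots> \<le> 3 * a + a ^ 3" using za by (intro add_mono mult_left_mono power_mono) auto
    also have "\<dots> \<le> 3 * a + 3 * a ^ 3" using a0 by simp
    finally show ?thesis by (simp add: power3_eq_cube power2_eq_square algebra_simps)
  qed
  have "\<bar>w2 \<xi>\<bar> = std_normal_density (z \<xi>) * \<bar>3 * z \<xi> - z \<xi> ^ 3\<bar> / (4 * \<xi>\<^sup>2)"
    by (simp add: w2_def abs_mult)
  also have "\<dots> \<le> (exp (- Z\<^sup>2 / 2) / 2) * (3 * (a * (1 + a\<^sup>2))) / (4 * t\<^sup>2)"
    using nd poly \<xi> t0 a0 by (intro frac_le mult_mono power_mono) auto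
  finally have "\<bar>w2 \<xi>\<bar> / 2 * (e\<^sup>2)\<^sup>2 \<le> (exp (- Z\<^sup>2 / 2) / 2) * (3 * (a * (1 + a\<^sup>2))) / (4 * t\<^sup>2) / 2 * (e\<^sup>2)\<^sup>2"
    by (intro mult_right_mono divide_right_mono) simp_all
  also have "\<dots> = 3/16 * (exp (- Z\<^sup>2 / 2) * (a * (1 + a\<^sup>2))) / t\<^sup>2 * (e\<^sup>2)\<^sup>2" by simp
  finally have w2: "\<bar>w2 \<xi>\<bar> / 2 * (e\<^sup>2)\<^sup>2 \<le> 3/16 * (exp (- Z\<^sup>2 / 2) * (a * (1 + a\<^sup>2))) / t\<^sup>2 * (e\<^sup>2)\<^sup>2" .
  have pp: "0 \<le> psi T y / T" unfolding psi_over using R0 by simp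
  have "3/16 * (exp (- Z\<^sup>2 / 2) * (a * (1 + a\<^sup>2))) / t\<^sup>2 * e\<^sup>2 \<le> \<epsilon> * (1 + Z\<^sup>2) * psi T y / T + \<epsilon> / 2"
  \<comment> \<open>Centrally one factor \<open>a * e / q\<close> is at most 1 and a bump times
    \<open>\<epsilon>\<close> remains; outside, \<open>\<epsilon>^16\<close> from the Gaussian
    outweighs \<open>e^2 / t^2 \<le> 1 / \<epsilon>^2\<close>.\<close>
  proof (cases "Z * (l * s) \<le> 1/10000")
    case True
    have "Z * (2 * s) \<le> Z * (l * s)" using l2 s_bounds Z0 by (intro mult_left_mono mult_right_mono) auto
    then have Zs: "Z * s \<le> 1/20000" using True by simp
    have ae: "a * e / q \<le> 1"
    proof -
      have "a * e / q = \<bar>y\<bar> * e / t" by (simp add: a_def div_t)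
      also have "\<dots> \<le> \<bar>y\<bar> * e * (9/8) / T"
        using T_bounds t0 e mult_left_mono[OF T_bounds(2), of "\<bar>y\<bar> * e"] by (simp add: field_simps)
      also have "\<dots> = 9/8 * (Z * s)" by (simp add: Z_def s_def RR[symmetric] power2_eq_square)
      finally show ?thesis using Zs by linarith
    qed
    have iq: "1 / q ^ 3 \<le> 6/5 * (1 / R ^ 3)" using RR_cube q0 R0 by (simp add: field_simps)
    have "3/16 * (exp (- Z\<^sup>2 / 2) * (a * (1 + a\<^sup>2))) / t\<^sup>2 * e\<^sup>2 =
        3/16 * e * (a * e / q) * ((1 + a\<^sup>2) * exp (- Z\<^sup>2 / 2) * (1 / q ^ 3))"
      unfolding div_t(2) by (simp add: power2_eq_square mult_ac)
    also have "\<dots> \<le> 3/16 * \<epsilon> * 1 * (9/8 * (1 + Z\<^sup>2) * exp (- Z\<^sup>2 / 2) * (6/5 * (1 / R ^ 3)))"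
      using e eps0 ae aZ iq a0 q0 by (intro mult_mono) auto
    also have "\<dots> = 81/320 * (\<epsilon> * (1 + Z\<^sup>2) * (exp (- Z\<^sup>2 / 2) / R ^ 3))" by simp
    also have "\<dots> = 81/320 * (\<epsilon> * (1 + Z\<^sup>2) * (psi T y / T))" by (simp only: psi_over)
    finally have f: "3/16 * (exp (- Z\<^sup>2 / 2) * (a * (1 + a\<^sup>2))) / t\<^sup>2 * e\<^sup>2 \<le> 81/320 * (\<epsilon> * (1 + Z\<^sup>2) * (psi T y / T))" .
    have "0 \<le> \<epsilon> * (1 + Z\<^sup>2) * (psi T y / T)"
      using eps0 by (intro mult_nonneg_nonneg pp) auto
    with f eps0 show ?thesis unfolding times_divide_eq_right[of _ "psi T y" T, symmetric] by linarith
  next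
    case False
    have "0 \<le> (a - 1)\<^sup>2" by simp
    then have "a \<le> 1 + a\<^sup>2" unfolding power2_diff power_one mult_1_right using zero_le_power2[of a] by linarith
    then have "a * (1 + a\<^sup>2) \<le> (1 + a\<^sup>2)\<^sup>2" unfolding power2_eq_square[of "1 + a\<^sup>2"] by (intro mult_right_mono) auto
    also have "\<dots> \<le> (9/8 * (1 + Z\<^sup>2))\<^sup>2" using aZ by (intro power_mono) auto
    finally have "exp (- Z\<^sup>2 / 2) * (a * (1 + a\<^sup>2)) \<le> exp (- Z\<^sup>2 / 2) * (9/8 * (1 + Z\<^sup>2))\<^sup>2"
      by (intro mult_left_mono) auto
    also have "\<dots> = 81/64 * ((1 + Z\<^sup>2)\<^sup>2 * exp (- Z\<^sup>2 / 2))"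
      unfolding power_mult_distrib[of "9/8"] by (simp add: power_divide)
    also have "\<dots> \<le> 81/64 * (64 * \<epsilon> ^ 16)" using bad_gauss(2)[OF False] by (intro mult_left_mono) auto
    finally have A: "exp (- Z\<^sup>2 / 2) * (a * (1 + a\<^sup>2)) \<le> 81 * \<epsilon> ^ 16" by simp
    have "e\<^sup>2 \<le> \<epsilon>\<^sup>2" using e by (intro power_mono) auto
    moreover have "\<epsilon>\<^sup>2 \<le> q\<^sup>2" using eps_le eps0 by (intro power_mono) auto
    then have "\<epsilon>\<^sup>2 \<le> t" by (simp only: qq)
    moreover note this
    ultimately have "e\<^sup>2 / t\<^sup>2 \<le> \<epsilon>\<^sup>2 / (\<epsilon>\<^sup>2)\<^sup>2" using eps0 by (intro frac_le power_mono[of "\<epsilon>\<^sup>2" t 2]) auto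
    then have B: "e\<^sup>2 / t\<^sup>2 \<le> 1 / \<epsilon>\<^sup>2" using eps0 by (simp add: power2_eq_square field_simps)
    have "3/16 * (exp (- Z\<^sup>2 / 2) * (a * (1 + a\<^sup>2))) / t\<^sup>2 * e\<^sup>2 = 3/16 * ((exp (- Z\<^sup>2 / 2) * (a * (1 + a\<^sup>2))) * (e\<^sup>2 / t\<^sup>2))"
      by simp
    also have "\<dots> \<le> 3/16 * ((81 * \<epsilon> ^ 16) * (1 / \<epsilon>\<^sup>2))"
      using eps0 by (intro mult_left_mono mult_mono[OF A B]) auto
    also have "\<dots> = 243/16 * \<epsilon> ^ 14" using eps0 by (simp add: field_simps power_add[symmetric])
    also have "\<dots> \<le> 243/16 * (\<epsilon> / 100 ^ 13)" using eps_pow[of 13] by simp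
    also have "\<dots> \<le> \<epsilon> / 2" using eps0 by simp
    finally have f: "3/16 * (exp (- Z\<^sup>2 / 2) * (a * (1 + a\<^sup>2))) / t\<^sup>2 * e\<^sup>2 \<le> \<epsilon> / 2" .
    have "0 \<le> \<epsilon> * (1 + Z\<^sup>2) * (psi T y / T)"
      using eps0 by (intro mult_nonneg_nonneg pp) auto
    with f eps0 show ?thesis unfolding times_divide_eq_right[of _ "psi T y" T, symmetric] by linarith
  qed
  then have "e\<^sup>2 * (3/16 * (exp (- Z\<^sup>2 / 2) * (a * (1 + a\<^sup>2))) / t\<^sup>2 * e\<^sup>2) \<le> e\<^sup>2 * (\<epsilon> * (1 + Z\<^sup>2) * psi T y / T + \<epsilon> / 2)"
    by (intro mult_left_mono) auto
  then show ?thesis unfolding main using w2 by (simp add: power2_eq_square[of "e\<^sup>2"] mult_ac)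
qed

lemma step_cdf:
  "\<bar>tw (\<lambda>d. Phi ((y + d) / sqrt t)) - Phi (y / sqrt (t + e\<^sup>2))\<bar>
    \<le> e\<^sup>2 * (20 * \<epsilon> * (1 + Z\<^sup>2) * psi T y / T + \<epsilon> + rt)"
proof -
  define P where "P = (1 + Z\<^sup>2) * psi T y / T"
  have P: "19 * \<epsilon> * (1 + Z\<^sup>2) * psi T y / T = 19 * (\<epsilon> * P)" "\<epsilon> * (1 + Z\<^sup>2) * psi T y / T = \<epsilon> * P"
    "20 * \<epsilon> * (1 + Z\<^sup>2) * psi T y / T = 20 * (\<epsilon> * P)"
    by (simp_all add: P_def)
  have "(19 * (\<epsilon> * P) + \<epsilon> / 2 + rt) + (\<epsilon> * P + \<epsilon> / 2) = 20 * (\<epsilon> * P) + \<epsilon> + rt" by simp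
  then have "e\<^sup>2 * (19 * (\<epsilon> * P) + \<epsilon> / 2 + rt) + e\<^sup>2 * (\<epsilon> * P + \<epsilon> / 2) = e\<^sup>2 * (20 * (\<epsilon> * P) + \<epsilon> + rt)"
    by (simp only: distrib_left[symmetric])
  then show ?thesis
    using step_cdf_space step_cdf_time unfolding P q_def[symmetric] by linarith
qed

end

section \<open>One step of the barrier\<close>

context heat_step
begin

definition "l' = ell \<epsilon> (t + e\<^sup>2)"
definition "T' = wid \<epsilon> (t + e\<^sup>2)"
definition "m = e * (2 * h * r\<^sup>2 + 3 * h\<^sup>2)"

lemma ring_swaps:
  fixes a b c d f p k :: real
  shows "k * (p * (a + b)) = p * (k * a) + k * p * b" "p * (a + c * b) = p * a + c * (b * p)"
    "k * p * (a + b + c + d * f) = k * p * (a + b) + k * p * c + k * (d * (f * p))"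
  by (simp_all add: algebra_simps)

lemma ss: "s\<^sup>2 = e\<^sup>2 / T" by (simp add: s_def power_divide RR)

lemma ell_increment:
  "l' - l \<le> e\<^sup>2 / t" "99/100 * (e\<^sup>2 / t) \<le> l' - l"
proof -
  have u: "0 \<le> e\<^sup>2 / t" "e\<^sup>2 / t \<le> 1/100" using e_over(2) t0 by auto
  have eq: "(t + e\<^sup>2) / smin \<epsilon> = t / smin \<epsilon> * (1 + e\<^sup>2 / t)" using t0 smin0 by (simp add: field_simps)
  have p: "0 < t / smin \<epsilon>" "0 < 1 + e\<^sup>2 / t" using t0 smin0 u by (auto intro: add_pos_nonneg)
  have "ln ((t + e\<^sup>2) / smin \<epsilon>) = ln (t / smin \<epsilon>) + ln (1 + e\<^sup>2 / t)"
    unfolding eq by (rule ln_mult_pos[OF p])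
  then have v: "l' - l = ln (1 + e\<^sup>2 / t)" unfolding l'_def l_def ell_def by linarith
  show "l' - l \<le> e\<^sup>2 / t" unfolding v using u by (intro ln_add_one_self_le_self)
  have "e\<^sup>2 / t - (e\<^sup>2 / t)\<^sup>2 \<le> ln (1 + e\<^sup>2 / t)" using u by (intro ln_one_plus_pos_lower_bound) linarith+
  moreover have "(e\<^sup>2 / t)\<^sup>2 \<le> 1/100 * (e\<^sup>2 / t)" unfolding power2_eq_square[of "e\<^sup>2 / t"] using u by (intro mult_right_mono) auto
  ultimately show "99/100 * (e\<^sup>2 / t) \<le> l' - l" unfolding v by linarith
qed

lemma l'_ge: "l \<le> l'" "l' \<le> l + 1/100" "l' \<le> 2 * l"
proof -
  have "0 \<le> e\<^sup>2 / t" using t0 by simp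
  then show "l \<le> l'" "l' \<le> l + 1/100" "l' \<le> 2 * l" using ell_increment e_over(2) l2 by linarith+
qed

text \<open>If the width grew by exactly \<open>e^2\<close>, the terms in \<open>Z^2\<close> would
  only balance. The correction \<open>t / (4 * ell)\<close> in \<open>wid\<close> makes the weighted
  growth exceed \<open>l * e^2\<close>: the excess is \<open>v * e^2 + l' * G / 4\<close>, and
  \<open>l' * G\<close> lies between \<open>e^2 / 2\<close> and \<open>e^2\<close>. The lower bound
  pays the \<open>Z^2\<close> part of the error; the upper bound keeps the price at
  \<open>y = 0\<close> below the fall of the logarithm.\<close>

lemma wid_increment:
  "e\<^sup>2 \<le> T' - T" "T' - T \<le> 9/8 * e\<^sup>2"
  "e\<^sup>2 / 8 \<le> l' * (T' - T) - l * e\<^sup>2" "l' * (T' - T) - l * e\<^sup>2 \<le> 26/100 * e\<^sup>2"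
proof -
  define G where "G = (t + e\<^sup>2) / l' - t / l"
  define v where "v = l' - l"
  have l'0: "0 < l'" "2 \<le> l'" using l2 l'_ge by auto
  have v0: "0 \<le> v" "v \<le> 1/100" using l'_ge by (auto simp: v_def)
  have tv: "t * v \<le> e\<^sup>2" using ell_increment(1) t0 by (simp add: v_def field_simps)
  have D: "T' - T = e\<^sup>2 + G / 4"
    unfolding T'_def wid_def l'_def[symmetric] T_eq G_def by (simp add: add_divide_distrib diff_divide_distrib)
  have lG: "l' * G = e\<^sup>2 - t * v / l"
    using l'0 l2 by (simp add: G_def v_def field_simps)
  have "t * v / l \<le> e\<^sup>2 / 2" using tv l2 v0 t0 by (intro frac_le) auto
  moreover have "0 \<le> t * v / l" using t0 v0 l2 by simp
  ultimately have lGb: "e\<^sup>2 / 2 \<le> l' * G" "l' * G \<le> e\<^sup>2" unfolding lG by linarith+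
  have ee: "0 \<le> e\<^sup>2" by simp
  have "0 \<le> l' * G" using lGb ee by linarith
  then have G0: "0 \<le> G" using l'0 by (simp add: zero_le_mult_iff)
  then have "2 * G \<le> l' * G" using l'0 by (intro mult_right_mono) auto
  then have G1: "G \<le> e\<^sup>2 / 2" using lGb by linarith
  show "e\<^sup>2 \<le> T' - T" "T' - T \<le> 9/8 * e\<^sup>2" unfolding D using G0 G1 by linarith+
  have W: "l' * (T' - T) - l * e\<^sup>2 = v * e\<^sup>2 + l' * G / 4" by (simp add: D v_def algebra_simps)
  have "v * e\<^sup>2 \<le> 1/100 * e\<^sup>2" by (intro mult_right_mono v0) auto
  moreover have "0 \<le> v * e\<^sup>2" using v0 by simp
  ultimately show "e\<^sup>2 / 8 \<le> l' * (T' - T) - l * e\<^sup>2" "l' * (T' - T) - l * e\<^sup>2 \<le> 26/100 * e\<^sup>2"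
    unfolding W using lGb by linarith+
qed

lemma psi0: "0 \<le> psi T y" unfolding psi_eq using R0 by simp

lemma psi_shift: "psi T (y + d) = psi T y * exp (- ((2 * y * d + d\<^sup>2) / (2 * T)))"
proof -
  have "- (y + d)\<^sup>2 / (2 * T) = - y\<^sup>2 / (2 * T) + - ((2 * y * d + d\<^sup>2) / (2 * T))"
    by (simp add: power2_sum add_divide_distrib diff_divide_distrib)
  then show ?thesis by (simp only: psi_def exp_add) simp
qed

lemma shift_abs:
  assumes "\<bar>d\<bar> \<le> 3 * e"
  shows "\<bar>(2 * y * d + d\<^sup>2) / (2 * T)\<bar> \<le> 3 * s * (1 + Z)"
proof -
  have "\<bar>2 * y * d + d\<^sup>2\<bar> \<le> 2 * \<bar>y\<bar> * \<bar>d\<bar> + \<bar>d\<bar>\<^sup>2"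
    by (simp add: abs_mult) (metis abs_mult abs_numeral abs_power2 abs_triangle_ineq)
  also have "\<dots> \<le> 2 * \<bar>y\<bar> * (3 * e) + (3 * e)\<^sup>2" using assms by (intro add_mono mult_left_mono power_mono) auto
  finally have "\<bar>2 * y * d + d\<^sup>2\<bar> / (2 * T) \<le> (2 * \<bar>y\<bar> * (3 * e) + (3 * e)\<^sup>2) / (2 * T)"
    using T_bounds by (intro divide_right_mono) auto
  also have "\<dots> = 3 * (Z * s) + 9/2 * s\<^sup>2"
  proof -
    have "Z * s = \<bar>y\<bar> * e / T" by (simp add: Z_def s_def RR[symmetric] power2_eq_square)
    then show ?thesis using T_bounds by (simp add: ss power_mult_distrib add_divide_distrib)
  qed
  also have "s\<^sup>2 \<le> 1/160000 * s" unfolding power2_eq_square using s_bounds by (intro mult_right_mono) auto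
  finally have "\<bar>2 * y * d + d\<^sup>2\<bar> / (2 * T) \<le> 3 * (Z * s) + 3 * s" using s_bounds(1) by linarith
  then show ?thesis using T_bounds by (simp add: abs_divide abs_mult algebra_simps)
qed

text \<open>The barrier is as large as \<open>l / R \<le> 1 / \<epsilon>\<close>, so its drift
  errors are those of the distribution function divided by \<open>\<epsilon>\<close>. The loss is
  harmless because the barrier is later multiplied by a constant times
  \<open>\<epsilon>\<close>.\<close>

lemma drift_part: "l * psi T y * (Z * m / R + 2 * (Z\<^sup>2 + 1) * s\<^sup>2 * (r\<^sup>2 + h\<^sup>2)) \<le> e\<^sup>2 * rt / \<epsilon>"
proof -
  define E where "E = exp (- Z\<^sup>2 / 2)"
  have E0: "0 \<le> E" by (simp add: E_def)
  have m0: "0 \<le> m" using h e by (simp add: m_def)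
  have lR1: "l / R \<le> 1 / \<epsilon>"
  proof -
    have "l * \<epsilon> / R \<le> 1" using lR sqrtL_inv by linarith
    then show ?thesis using R0 eps0 by (simp add: field_simps)
  qed
  have m1: "m / R \<le> e\<^sup>2 * ((2 * lam * r\<^sup>2 + 3 * lam\<^sup>2 * \<epsilon>) / q)"
  proof -
    have "m = e\<^sup>2 * (2 * lam * r\<^sup>2 + 3 * lam\<^sup>2 * e)" by (simp add: m_def h_def power2_eq_square algebra_simps)
    also have "\<dots> \<le> e\<^sup>2 * (2 * lam * r\<^sup>2 + 3 * lam\<^sup>2 * \<epsilon>)" using e lam by (intro mult_left_mono add_left_mono) auto
    finally have "m / R \<le> e\<^sup>2 * (2 * lam * r\<^sup>2 + 3 * lam\<^sup>2 * \<epsilon>) / q"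
      using m0 q0 qR by (intro frac_le) auto
    then show ?thesis by simp
  qed
  have s1: "s\<^sup>2 * (r\<^sup>2 + h\<^sup>2) \<le> e\<^sup>2 * ((r\<^sup>2 + lam\<^sup>2 * \<epsilon>\<^sup>2) / t)"
  proof -
    have "h\<^sup>2 \<le> (lam * \<epsilon>)\<^sup>2" using h by (intro power_mono) auto
    then have "r\<^sup>2 + h\<^sup>2 \<le> r\<^sup>2 + lam\<^sup>2 * \<epsilon>\<^sup>2" by (simp add: power_mult_distrib)
    moreover have "s\<^sup>2 \<le> e\<^sup>2 / t" unfolding ss using T_bounds t0 by (intro divide_left_mono) auto
    ultimately have "s\<^sup>2 * (r\<^sup>2 + h\<^sup>2) \<le> e\<^sup>2 / t * (r\<^sup>2 + lam\<^sup>2 * \<epsilon>\<^sup>2)"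
      using t0 by (intro mult_mono) auto
    then show ?thesis by simp
  qed
  have "E * (Z * m / R + 2 * (Z\<^sup>2 + 1) * s\<^sup>2 * (r\<^sup>2 + h\<^sup>2)) = (Z * E) * (m / R) + 2 * ((1 + Z\<^sup>2) * E) * (s\<^sup>2 * (r\<^sup>2 + h\<^sup>2))"
    by (simp add: algebra_simps)
  also have "\<dots> \<le> 1 * (m / R) + 2 * 2 * (s\<^sup>2 * (r\<^sup>2 + h\<^sup>2))"
    using gauss_poly2[of Z] gauss_poly3[of Z] m0 R0 unfolding E_def[symmetric]
    by (intro add_mono mult_right_mono mult_left_mono) auto
  also have "\<dots> \<le> e\<^sup>2 * ((2 * lam * r\<^sup>2 + 3 * lam\<^sup>2 * \<epsilon>) / q) + 4 * (e\<^sup>2 * ((r\<^sup>2 + lam\<^sup>2 * \<epsilon>\<^sup>2) / t))"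
    using m1 s1 by linarith
  also have "\<dots> = e\<^sup>2 * rt" unfolding rterm_def q_def[symmetric] by (simp add: distrib_left)
  finally have A: "E * (Z * m / R + 2 * (Z\<^sup>2 + 1) * s\<^sup>2 * (r\<^sup>2 + h\<^sup>2)) \<le> e\<^sup>2 * rt" .
  have B: "0 \<le> E * (Z * m / R + 2 * (Z\<^sup>2 + 1) * s\<^sup>2 * (r\<^sup>2 + h\<^sup>2))"
    using E0 Z0 m0 R0 by simp
  have "l * psi T y * (Z * m / R + 2 * (Z\<^sup>2 + 1) * s\<^sup>2 * (r\<^sup>2 + h\<^sup>2)) = l / R * (E * (Z * m / R + 2 * (Z\<^sup>2 + 1) * s\<^sup>2 * (r\<^sup>2 + h\<^sup>2)))"
    unfolding psi_eq E_def by simp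
  also have "\<dots> \<le> 1 / \<epsilon> * (e\<^sup>2 * rt)" using B eps0 by (intro mult_mono[OF lR1 A]) auto
  finally show ?thesis by simp
qed

lemma rt0: "0 \<le> rt"
  unfolding rterm_def using lam eps0 t0
  by (intro add_nonneg_nonneg divide_nonneg_nonneg mult_nonneg_nonneg) auto

lemma mean_var: "\<bar>tw (\<lambda>d. d)\<bar> \<le> m" "\<bar>tw (\<lambda>d. d\<^sup>2) - e\<^sup>2\<bar> \<le> 4 * e\<^sup>2 * (r\<^sup>2 + h\<^sup>2)"
  unfolding m_def by (rule twopt_mean_abs[OF r h(1,2) e(1)], rule twopt_var[OF r h(1,2) e(1)])

text \<open>Averaging over a step spreads \<open>psi T\<close> by variance \<open>e^2\<close>, and
  the wider kernel \<open>psi T'\<close> dominates the result. Two sources leave a surplus: the fall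
  of the logarithm for bounded \<open>Z\<close>, and the excess widening for large
  \<open>Z\<close>.\<close>

lemma bump_good:
  assumes good: "Z * (l * s) \<le> 1/10000"
  shows "l * tw (\<lambda>d. psi T (y + d)) \<le> l' * psi T' y - s\<^sup>2 / 32 * ((1 + Z\<^sup>2) * psi T y) + e\<^sup>2 * rt / \<epsilon>"
proof -
  \<comment> \<open>27 comes from the cube of \<open>3 * s * (1 + Z)\<close> in the exponential
    series, 27/2 from the cross term of its square; the quartic term fits into the rounding to
    42.\<close>
  define E3 where "E3 = 42 * s ^ 3 * (1 + Z) ^ 3"
  define c where "c = y\<^sup>2 / (2 * T\<^sup>2) - 1 / (2 * T)"
  have "Z * (2 * s) \<le> Z * (l * s)" using l2 s_bounds Z0 by (intro mult_left_mono mult_right_mono) auto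
  then have Zs: "Z * s \<le> 1/20000" using good by simp
  have sZ: "3 * s * (1 + Z) \<le> 1" using Zs s_bounds by (simp add: algebra_simps)
  have c_eq: "c = (Z\<^sup>2 - 1) / (2 * T)" unfolding c_def ZZ by (simp add: diff_divide_distrib power2_eq_square mult_ac)
  have expand: "exp (- ((2 * y * d + d\<^sup>2) / (2 * T))) \<le> (1 + E3) + ((- (y / T)) * d + c * d\<^sup>2)"
    if d: "\<bar>d\<bar> \<le> 3 * e" for d
  proof -
    define X where "X = (2 * y * d + d\<^sup>2) / (2 * T)"
    have X: "\<bar>X\<bar> \<le> 3 * s * (1 + Z)" unfolding X_def by (rule shift_abs[OF d])
    then have "\<bar>- X\<bar> \<le> 1" using sZ by simp
    from exp_cubic_bound[OF this] have 1: "exp (- X) \<le> 1 - X + X\<^sup>2 / 2 + \<bar>X\<bar> ^ 3" by (simp add: abs_le_iff)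
    have 2: "\<bar>X\<bar> ^ 3 \<le> 27 * (s ^ 3 * (1 + Z) ^ 3)"
      using power_mono[OF X, of 3] by (simp add: power_mult_distrib)
    have XX: "1 - X + X\<^sup>2 / 2 = 1 + (- (y / T)) * d + c * d\<^sup>2 + (y * d ^ 3 / (2 * T\<^sup>2) + d ^ 4 / (8 * T\<^sup>2))"
      using T_bounds by (simp add: X_def c_def field_simps power2_eq_square power3_eq_cube power4_eq_xxxx)
    have Zs3: "Z * s ^ 3 = \<bar>y\<bar> * e ^ 3 / T\<^sup>2"
      by (simp add: Z_def s_def RR[symmetric] power2_eq_square power3_eq_cube)
    have ss4: "s ^ 4 = e ^ 4 / T\<^sup>2"
      by (simp add: s_def RR[symmetric] power_divide power_mult[symmetric])
    have "y * d ^ 3 / (2 * T\<^sup>2) \<le> \<bar>y\<bar> * (3 * e) ^ 3 / (2 * T\<^sup>2)"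
    proof (intro divide_right_mono)
      have "y * d ^ 3 \<le> \<bar>y\<bar> * \<bar>d\<bar> ^ 3" by (metis abs_ge_self abs_mult power_abs)
      also have "\<dots> \<le> \<bar>y\<bar> * (3 * e) ^ 3" using d by (intro mult_left_mono power_mono) auto
      finally show "y * d ^ 3 \<le> \<bar>y\<bar> * (3 * e) ^ 3" .
    qed simp
    also have "\<dots> = 27/2 * (Z * s ^ 3)" unfolding Zs3 by (simp add: power_mult_distrib)
    finally have 3: "y * d ^ 3 / (2 * T\<^sup>2) \<le> 27/2 * (Z * s ^ 3)" .
    have "d ^ 4 \<le> (3 * e) ^ 4" using power_mono[OF d, of 4] by simp
    then have "d ^ 4 / (8 * T\<^sup>2) \<le> (3 * e) ^ 4 / (8 * T\<^sup>2)" by (intro divide_right_mono) auto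
    also have "\<dots> = 81/8 * s ^ 4" unfolding ss4 by (simp add: power_mult_distrib)
    also have "s ^ 4 \<le> 1/160000 * s ^ 3"
    proof -
      have "s * s ^ 3 \<le> 1/160000 * s ^ 3" using s_bounds by (intro mult_right_mono) auto
      then show ?thesis by (simp add: power3_eq_cube power4_eq_xxxx)
    qed
    finally have "d ^ 4 / (8 * T\<^sup>2) \<le> 81/8 * (1/160000 * s ^ 3)" by simp
    moreover have "0 \<le> s ^ 3" using s_bounds by simp
    ultimately have 4: "d ^ 4 / (8 * T\<^sup>2) \<le> s ^ 3 / 1000" by linarith
    have Z3: "1 + Z \<le> (1 + Z) ^ 3" using Z0 power_increasing[of 1 3 "1 + Z"] by simp
    have "s ^ 3 * (1 + Z) \<le> s ^ 3 * (1 + Z) ^ 3" using Z3 s_bounds by (intro mult_left_mono) auto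
    then have 5: "s ^ 3 + Z * s ^ 3 \<le> s ^ 3 * (1 + Z) ^ 3" by (simp add: algebra_simps)
    have "0 \<le> s ^ 3" "0 \<le> Z * s ^ 3" using s_bounds Z0 by auto
    then show ?thesis unfolding X_def[symmetric] E3_def using 1 2 3 4 5 XX by linarith
  qed
  have "tw (\<lambda>d. psi T (y + d)) \<le> tw (\<lambda>d. psi T y * ((1 + E3) + ((- (y / T)) * d + c * d\<^sup>2)))"
    unfolding psi_shift by (intro twopt_mono[OF r h(1,2) e(1)] mult_left_mono expand psi0)
  also have "\<dots> = psi T y * ((1 + E3) + ((- (y / T)) * tw (\<lambda>d. d) + c * tw (\<lambda>d. d\<^sup>2)))"
    by (simp only: twopt_linear)
  also have "\<dots> \<le> psi T y * ((1 + E3 + (Z\<^sup>2 - 1) / 2 * s\<^sup>2) + (Z * m / R + 2 * (Z\<^sup>2 + 1) * s\<^sup>2 * (r\<^sup>2 + h\<^sup>2)))"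
  proof (intro mult_left_mono psi0)
    have "(- (y / T)) * tw (\<lambda>d. d) \<le> \<bar>y / T\<bar> * \<bar>tw (\<lambda>d. d)\<bar>"
      by (metis abs_ge_self abs_minus_cancel abs_mult)
    also have "\<dots> \<le> \<bar>y / T\<bar> * m" using mean_var by (intro mult_left_mono) auto
    also have "\<bar>y / T\<bar> = Z / R" using T_bounds by (simp add: Z_def RR[symmetric] power2_eq_square)
    finally have a: "(- (y / T)) * tw (\<lambda>d. d) \<le> Z * m / R" by simp
    have "c * (tw (\<lambda>d. d\<^sup>2) - e\<^sup>2) \<le> \<bar>c\<bar> * \<bar>tw (\<lambda>d. d\<^sup>2) - e\<^sup>2\<bar>" by (metis abs_ge_self abs_mult)
    also have "\<dots> \<le> (Z\<^sup>2 + 1) / (2 * T) * (4 * e\<^sup>2 * (r\<^sup>2 + h\<^sup>2))"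
      using mean_var T_bounds unfolding c_eq abs_divide by (intro mult_mono divide_mono) (auto simp: abs_le_iff)
    also have "\<dots> = 2 * (Z\<^sup>2 + 1) * s\<^sup>2 * (r\<^sup>2 + h\<^sup>2)" unfolding ss by simp
    finally have b: "c * (tw (\<lambda>d. d\<^sup>2) - e\<^sup>2) \<le> 2 * (Z\<^sup>2 + 1) * s\<^sup>2 * (r\<^sup>2 + h\<^sup>2)" .
    have "c * e\<^sup>2 = (Z\<^sup>2 - 1) / 2 * s\<^sup>2" unfolding c_eq ss by simp
    then have "c * tw (\<lambda>d. d\<^sup>2) = (Z\<^sup>2 - 1) / 2 * s\<^sup>2 + c * (tw (\<lambda>d. d\<^sup>2) - e\<^sup>2)" by (simp add: algebra_simps)
    with a b show "(1 + E3) + ((- (y / T)) * tw (\<lambda>d. d) + c * tw (\<lambda>d. d\<^sup>2))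
      \<le> (1 + E3 + (Z\<^sup>2 - 1) / 2 * s\<^sup>2) + (Z * m / R + 2 * (Z\<^sup>2 + 1) * s\<^sup>2 * (r\<^sup>2 + h\<^sup>2))" by linarith
  qed
  finally have "l * tw (\<lambda>d. psi T (y + d)) \<le> l * (psi T y * ((1 + E3 + (Z\<^sup>2 - 1) / 2 * s\<^sup>2) + (Z * m / R + 2 * (Z\<^sup>2 + 1) * s\<^sup>2 * (r\<^sup>2 + h\<^sup>2))))"
    using l2 by (intro mult_left_mono) auto
  also have "\<dots> = psi T y * (l * (1 + E3 + (Z\<^sup>2 - 1) / 2 * s\<^sup>2)) + l * psi T y * (Z * m / R + 2 * (Z\<^sup>2 + 1) * s\<^sup>2 * (r\<^sup>2 + h\<^sup>2))"
    by (rule ring_swaps(1))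
  finally have up: "l * tw (\<lambda>d. psi T (y + d)) \<le> psi T y * (l * (1 + E3 + (Z\<^sup>2 - 1) / 2 * s\<^sup>2)) + e\<^sup>2 * rt / \<epsilon>"
    using drift_part by linarith
  define D where "D = T' - T"
  define x where "x = D / T"
  have D: "e\<^sup>2 \<le> D" "D \<le> 9/8 * e\<^sup>2" "0 \<le> D" "D \<le> T"
  proof -
    show a: "e\<^sup>2 \<le> D" "D \<le> 9/8 * e\<^sup>2" using wid_increment by (auto simp: D_def)
    then show "0 \<le> D" using zero_le_power2[of e] by linarith
    have "e\<^sup>2 \<le> 1/100 * t" using e_over(2) t0 by (simp add: field_simps)
    then show "D \<le> T" using a T_bounds t0 by linarith
  qed
  have low: "psi T y * (1 + x / 2 * (Z\<^sup>2 - 1) - Z\<^sup>2 * x\<^sup>2) \<le> psi T' y"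
    using psi_widen(2)[of T D y] T_bounds D by (simp add: x_def ZZ D_def)
  have x: "0 \<le> x" "x \<le> 9/8 * s\<^sup>2"
    using D T_bounds unfolding x_def ss by (auto simp: field_simps)
  have W: "s\<^sup>2 / 8 \<le> l' * x - l * s\<^sup>2" "l' * x - l * s\<^sup>2 \<le> 26/100 * s\<^sup>2"
  proof -
    have "l' * x - l * s\<^sup>2 = (l' * D - l * e\<^sup>2) / T" unfolding x_def ss by (simp add: diff_divide_distrib)
    moreover have "(e\<^sup>2 / 8) / T \<le> (l' * D - l * e\<^sup>2) / T" "(l' * D - l * e\<^sup>2) / T \<le> (26/100 * e\<^sup>2) / T"
      using wid_increment(3,4) T_bounds unfolding D_def by (intro divide_right_mono; simp)+
    ultimately show "s\<^sup>2 / 8 \<le> l' * x - l * s\<^sup>2" "l' * x - l * s\<^sup>2 \<le> 26/100 * s\<^sup>2" unfolding ss by simp_all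
  qed
  \<comment> \<open>The balance in units of \<open>s^2\<close>: without \<open>Z\<close>, at least
    \<open>99/100 - 13/100 - 1/100\<close>; in front of \<open>Z^2\<close>, at least
    \<open>1/16 - 1/1000 - 1/100\<close>. Both exceed \<open>1/32\<close>.\<close>
  have fin: "l * (1 + E3 + (Z\<^sup>2 - 1) / 2 * s\<^sup>2) + s\<^sup>2 / 32 * (1 + Z\<^sup>2) \<le> l' * (1 + x / 2 * (Z\<^sup>2 - 1) - Z\<^sup>2 * x\<^sup>2)"
  proof -
    define w where "w = l' * x - l * s\<^sup>2"
    have eq: "l' * (1 + x / 2 * (Z\<^sup>2 - 1) - Z\<^sup>2 * x\<^sup>2) - l * (1 + E3 + (Z\<^sup>2 - 1) / 2 * s\<^sup>2)
       = (l' - l) + (Z\<^sup>2 * w / 2 - w / 2) - Z\<^sup>2 * (l' * x\<^sup>2) - l * E3"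
      by (simp add: w_def algebra_simps add_divide_distrib diff_divide_distrib)
    have v: "99/100 * s\<^sup>2 \<le> l' - l"
    proof -
      have "s\<^sup>2 \<le> e\<^sup>2 / t" unfolding ss using T_bounds t0 by (intro divide_left_mono) auto
      then show ?thesis using ell_increment(2) by linarith
    qed
    have w1: "Z\<^sup>2 * (s\<^sup>2 / 8) \<le> Z\<^sup>2 * w" using W unfolding w_def by (intro mult_left_mono) auto
    have "x\<^sup>2 \<le> (9/8 * s\<^sup>2)\<^sup>2" using x by (intro power_mono) auto
    then have "l' * x\<^sup>2 \<le> (2 * l) * (81/64 * (s\<^sup>2 * s\<^sup>2))" using l'_ge l2 by (intro mult_mono) (auto simp: power2_eq_square)
    also have "\<dots> = 81/32 * (l * s) * s * s\<^sup>2" by (simp add: power2_eq_square)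
    also have "\<dots> \<le> 81/32 * (1/80000) * (1/160000) * s\<^sup>2"
      using s_bounds l2 by (intro mult_right_mono mult_mono) auto
    finally have x2: "l' * x\<^sup>2 \<le> 1/1000 * s\<^sup>2" using zero_le_power2[of s] by linarith
    then have x3: "Z\<^sup>2 * (l' * x\<^sup>2) \<le> Z\<^sup>2 * (1/1000 * s\<^sup>2)" by (intro mult_left_mono) auto
    have "(1 + Z)\<^sup>2 \<le> 2 * (1 + Z\<^sup>2)" using zero_le_power2[of "Z - 1"] by (simp add: power2_eq_square algebra_simps)
    then have "(1 + Z) * (1 + Z)\<^sup>2 \<le> (1 + Z) * (2 * (1 + Z\<^sup>2))" using Z0 by (intro mult_left_mono) auto
    then have "42 * (l * s) * s\<^sup>2 * ((1 + Z) * (1 + Z)\<^sup>2) \<le> 42 * (l * s) * s\<^sup>2 * ((1 + Z) * (2 * (1 + Z\<^sup>2)))"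
      by (rule mult_left_mono) (use l2 s_bounds in simp)
    also have "\<dots> = 84 * (l * s + Z * (l * s)) * (s\<^sup>2 * (1 + Z\<^sup>2))" by (simp add: algebra_simps)
    also have "\<dots> \<le> 84 * (1/80000 + 1/10000) * (s\<^sup>2 * (1 + Z\<^sup>2))"
      using good s_bounds by (intro mult_right_mono mult_left_mono add_mono) auto
    also have "\<dots> \<le> 1/100 * (s\<^sup>2 * (1 + Z\<^sup>2))" by (intro mult_right_mono) auto
    finally have E: "l * E3 \<le> 1/100 * (s\<^sup>2 * (1 + Z\<^sup>2))"
      by (simp add: E3_def power2_eq_square power3_eq_cube mult_ac)
    have "0 \<le> s\<^sup>2" "0 \<le> Z\<^sup>2 * s\<^sup>2" by auto
    moreover have "s\<^sup>2 * (1 + Z\<^sup>2) = s\<^sup>2 + Z\<^sup>2 * s\<^sup>2" "s\<^sup>2 / 32 * (1 + Z\<^sup>2) = s\<^sup>2 / 32 + Z\<^sup>2 * s\<^sup>2 / 32"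
      by (simp_all add: algebra_simps)
    moreover have "w \<le> 26/100 * s\<^sup>2" using W by (simp add: w_def)
    ultimately show ?thesis using eq v w1 x3 E by linarith
  qed
  have "psi T y * (l * (1 + E3 + (Z\<^sup>2 - 1) / 2 * s\<^sup>2) + s\<^sup>2 / 32 * (1 + Z\<^sup>2)) \<le> psi T y * (l' * (1 + x / 2 * (Z\<^sup>2 - 1) - Z\<^sup>2 * x\<^sup>2))"
    by (intro mult_left_mono fin psi0)
  also have "\<dots> = l' * (psi T y * (1 + x / 2 * (Z\<^sup>2 - 1) - Z\<^sup>2 * x\<^sup>2))" by simp
  also have "\<dots> \<le> l' * psi T' y" using low l2 l'_ge by (intro mult_left_mono) auto
  finally have "psi T y * (l * (1 + E3 + (Z\<^sup>2 - 1) / 2 * s\<^sup>2)) + s\<^sup>2 / 32 * ((1 + Z\<^sup>2) * psi T y) \<le> l' * psi T' y"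
    unfolding ring_swaps(2) .
  with up show ?thesis by linarith
qed

text \<open>Far out no gain has to be produced: the Gaussian factor makes the expansion error, the
  loss from widening and even the claimed gain together smaller than \<open>e^2\<close>. The drift
  may therefore be bounded crudely by \<open>e^2 / \<epsilon>\<close>.\<close>

lemma bump_bad:
  assumes bad': "\<not> Z * (l * s) \<le> 1/10000"
  shows "l * tw (\<lambda>d. psi T (y + d)) \<le> l' * psi T' y - s\<^sup>2 / 32 * ((1 + Z\<^sup>2) * psi T y) + e\<^sup>2"
proof -
  define E where "E = exp (3 * s * (1 + Z))"
  define D where "D = T' - T"
  have Z8: "8 \<le> Z" by (rule bad[OF bad'])
  have s2: "s\<^sup>2 \<le> e\<^sup>2 / \<epsilon>\<^sup>2"
    unfolding s_def power_divide using eps_le eps0 by (intro divide_left_mono power_mono) auto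
  have expand: "exp (- ((2 * y * d + d\<^sup>2) / (2 * T))) \<le> (1 + (3 * s * (1 + Z))\<^sup>2 * E) + (- (y / T)) * d"
    if d: "\<bar>d\<bar> \<le> 3 * e" for d
  proof -
    define X where "X = (2 * y * d + d\<^sup>2) / (2 * T)"
    have X: "\<bar>X\<bar> \<le> 3 * s * (1 + Z)" unfolding X_def by (rule shift_abs[OF d])
    have "exp (- X) \<le> 1 + - X + (- X)\<^sup>2 * exp \<bar>- X\<bar>" by (rule exp_quadratic_bound)
    moreover have "X\<^sup>2 \<le> (3 * s * (1 + Z))\<^sup>2" using power_mono[OF X, of 2] by simp
    then have "X\<^sup>2 * exp \<bar>X\<bar> \<le> (3 * s * (1 + Z))\<^sup>2 * E" unfolding E_def using X by (intro mult_mono) auto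
    moreover have "(- (y / T)) * d = - X + d\<^sup>2 / (2 * T)" using T_bounds by (simp add: X_def field_simps)
    moreover have "0 \<le> d\<^sup>2 / (2 * T)" using T_bounds by simp
    ultimately show ?thesis unfolding X_def[symmetric] by simp
  qed
  have "tw (\<lambda>d. psi T (y + d)) \<le> tw (\<lambda>d. psi T y * ((1 + (3 * s * (1 + Z))\<^sup>2 * E) + (- (y / T)) * d))"
    unfolding psi_shift by (intro twopt_mono[OF r h(1,2) e(1)] mult_left_mono expand psi0)
  also have "\<dots> = psi T y * ((1 + (3 * s * (1 + Z))\<^sup>2 * E) + (- (y / T)) * tw (\<lambda>d. d))"
    by (simp only: twopt_linear)
  also have "\<dots> \<le> psi T y * ((1 + (3 * s * (1 + Z))\<^sup>2 * E) + Z * (e\<^sup>2 / \<epsilon>\<^sup>2))"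
  proof (intro mult_left_mono psi0 add_left_mono)
    have "\<bar>tw (\<lambda>d. d)\<bar> \<le> e * h"
    proof -
      have "\<bar>tilt r h - r - h\<bar> \<le> h" using tilt_bounds(4,5)[OF r h(1,2)] by linarith
      then show ?thesis unfolding twopt_mean[OF r h(1,2) e(1)] using e by (simp add: abs_mult)
    qed
    also have "e * h \<le> e\<^sup>2 / \<epsilon>"
    proof -
      have "lam \<le> 1 / \<epsilon>" using lam eps0 by (simp add: field_simps)
      then have "lam * e\<^sup>2 \<le> 1 / \<epsilon> * e\<^sup>2" by (intro mult_right_mono) auto
      then show ?thesis by (simp add: h_def power2_eq_square mult_ac)
    qed
    finally have m1: "\<bar>tw (\<lambda>d. d)\<bar> \<le> e\<^sup>2 / \<epsilon>" .
    have "(- (y / T)) * tw (\<lambda>d. d) \<le> \<bar>y / T\<bar> * \<bar>tw (\<lambda>d. d)\<bar>"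
      by (metis abs_ge_self abs_minus_cancel abs_mult)
    also have "\<bar>y / T\<bar> = Z / R" using T_bounds by (simp add: Z_def RR[symmetric] power2_eq_square)
    also have "Z / R * \<bar>tw (\<lambda>d. d)\<bar> \<le> Z / \<epsilon> * (e\<^sup>2 / \<epsilon>)"
      using m1 Z0 eps_le eps0 by (intro mult_mono divide_left_mono) auto
    finally show "(- (y / T)) * tw (\<lambda>d. d) \<le> Z * (e\<^sup>2 / \<epsilon>\<^sup>2)" by (simp add: power2_eq_square)
  qed
  finally have "l * tw (\<lambda>d. psi T (y + d)) \<le> l * (psi T y * ((1 + (3 * s * (1 + Z))\<^sup>2 * E) + Z * (e\<^sup>2 / \<epsilon>\<^sup>2)))"
    using l2 by (intro mult_left_mono) auto
  then have up: "l * tw (\<lambda>d. psi T (y + d)) \<le> l * psi T y + l * psi T y * ((3 * s * (1 + Z))\<^sup>2 * E + Z * (e\<^sup>2 / \<epsilon>\<^sup>2))"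
    by (simp add: algebra_simps)
  have D: "D \<le> 9/8 * e\<^sup>2" "0 \<le> D" "D \<le> T"
  proof -
    show a: "D \<le> 9/8 * e\<^sup>2" using wid_increment by (auto simp: D_def)
    have "e\<^sup>2 \<le> D" using wid_increment by (auto simp: D_def)
    then show "0 \<le> D" using zero_le_power2[of e] by linarith
    have "e\<^sup>2 \<le> 1/100 * t" using e_over(2) t0 by (simp add: field_simps)
    then show "D \<le> T" using a T_bounds t0 by linarith
  qed
  have low: "l * psi T y - l * psi T y * s\<^sup>2 \<le> l' * psi T' y"
  proof -
    have "D / T / 2 \<le> s\<^sup>2" using D T_bounds unfolding ss by (simp add: field_simps)
    then have "psi T y * (1 - s\<^sup>2) \<le> psi T y * (1 - D / T / 2)" by (intro mult_left_mono psi0) auto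
    also have "\<dots> \<le> psi T' y" using psi_widen(1)[of T D y] T_bounds D by (simp add: D_def)
    finally have a: "psi T y * (1 - s\<^sup>2) \<le> psi T' y" .
    have "s\<^sup>2 \<le> 1" using s_bounds by (simp add: power_le_one)
    then have "l * (psi T y * (1 - s\<^sup>2)) \<le> l' * psi T' y" using a psi0 l'_ge l2 by (intro mult_mono) auto
    then show ?thesis by (simp add: algebra_simps)
  qed
  have E1: "1 \<le> E" unfolding E_def using s_bounds Z0 by simp
  have tiny: "l * psi T y * ((3 * s * (1 + Z))\<^sup>2 * E + Z * (e\<^sup>2 / \<epsilon>\<^sup>2) + s\<^sup>2 + s\<^sup>2 / 32 * (1 + Z\<^sup>2)) \<le> e\<^sup>2"
  proof -
    define k where "k = e\<^sup>2 / \<epsilon>\<^sup>2"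
    have k0: "0 \<le> k" by (simp add: k_def)
    have z1: "(1 + Z)\<^sup>2 \<le> 2 * (1 + Z\<^sup>2)" using zero_le_power2[of "Z - 1"] by (simp add: power2_eq_square algebra_simps)
    have z2: "Z \<le> 1 + Z\<^sup>2" using zero_le_power2[of "Z - 1"] zero_le_power2[of Z] unfolding power2_diff power_one mult_1_right by linarith
    have "(3 * s * (1 + Z))\<^sup>2 * E = 9 * (s\<^sup>2 * (1 + Z)\<^sup>2) * E" by (simp add: power_mult_distrib)
    also have "\<dots> \<le> 9 * (k * (2 * (1 + Z\<^sup>2))) * E"
      using s2 z1 E1 k0 unfolding k_def by (intro mult_right_mono mult_left_mono mult_mono) auto
    also have "\<dots> = 18 * (k * (1 + Z\<^sup>2) * E)" by (simp add: algebra_simps)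
    finally have a: "(3 * s * (1 + Z))\<^sup>2 * E \<le> 18 * (k * (1 + Z\<^sup>2) * E)" .
    have P: "k * (1 + Z\<^sup>2) * 1 \<le> k * (1 + Z\<^sup>2) * E" using E1 k0 by (intro mult_left_mono) auto
    have b: "Z * k \<le> k * (1 + Z\<^sup>2)" using mult_right_mono[OF z2 k0] by (simp add: mult.commute)
    have c: "s\<^sup>2 * (1 + Z\<^sup>2) \<le> k * (1 + Z\<^sup>2)" using s2 unfolding k_def by (intro mult_right_mono) auto
    have d: "s\<^sup>2 \<le> s\<^sup>2 * (1 + Z\<^sup>2)" by (simp add: algebra_simps)
    have "(3 * s * (1 + Z))\<^sup>2 * E + Z * k + s\<^sup>2 + s\<^sup>2 / 32 * (1 + Z\<^sup>2) \<le> 22 * (k * (1 + Z\<^sup>2) * E)"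
    proof -
      have "s\<^sup>2 / 32 * (1 + Z\<^sup>2) = (s\<^sup>2 * (1 + Z\<^sup>2)) / 32" by simp
      moreover have "0 \<le> s\<^sup>2 * (1 + Z\<^sup>2)" by simp
      ultimately show ?thesis using a b c d P by linarith
    qed
    note X = this
    have lpsi: "0 \<le> l * psi T y" "l * psi T y \<le> exp (- Z\<^sup>2 / 2) / \<epsilon>"
    proof -
      show "0 \<le> l * psi T y" using l2 psi0 by simp
      have "l * \<epsilon> / R \<le> 1" using lR sqrtL_inv by linarith
      then have "l / R \<le> 1 / \<epsilon>" using R0 eps0 by (simp add: field_simps)
      then have "l / R * exp (- Z\<^sup>2 / 2) \<le> 1 / \<epsilon> * exp (- Z\<^sup>2 / 2)" by (intro mult_right_mono) auto
      then show "l * psi T y \<le> exp (- Z\<^sup>2 / 2) / \<epsilon>" unfolding psi_eq by simp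
    qed
    have nn: "0 \<le> 22 * (k * (1 + Z\<^sup>2) * E)" using k0 E1 by simp
    have "l * psi T y * ((3 * s * (1 + Z))\<^sup>2 * E + Z * k + s\<^sup>2 + s\<^sup>2 / 32 * (1 + Z\<^sup>2))
       \<le> (exp (- Z\<^sup>2 / 2) / \<epsilon>) * (22 * (k * (1 + Z\<^sup>2) * E))"
      by (rule order_trans[OF mult_left_mono[OF X lpsi(1)] mult_right_mono[OF lpsi(2) nn]])
    also have "\<dots> = 22 * k / \<epsilon> * ((1 + Z\<^sup>2) * (exp (- Z\<^sup>2 / 2) * E))" by simp
    also have "\<dots> \<le> 22 * k / \<epsilon> * ((1 + Z\<^sup>2) * exp (- (3/8 * Z\<^sup>2)))"
    proof (intro mult_left_mono)
      have "3 * s * (1 + Z) \<le> 3 * (1/160000) * (1 + Z)" using s_bounds Z0 by (intro mult_right_mono) auto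
      also have "\<dots> \<le> Z" using Z8 by simp
      also have "Z \<le> Z * Z / 8" using mult_left_mono[OF Z8 Z0] by simp
      finally show "exp (- Z\<^sup>2 / 2) * E \<le> exp (- (3/8 * Z\<^sup>2))"
        by (simp add: E_def exp_add[symmetric] power2_eq_square)
    qed (use k0 eps0 in auto)
    also have "\<dots> \<le> 22 * k / \<epsilon> * (8 * \<epsilon> ^ 16)"
      using bad_gauss(1)[OF bad'] k0 eps0 by (intro mult_left_mono) auto
    also have "\<dots> = 176 * \<epsilon> ^ 13 * e\<^sup>2" using eps0 by (simp add: k_def field_simps power_add[symmetric] power2_eq_square eval_nat_numeral)
    also have "\<dots> \<le> 1 * e\<^sup>2"
    proof (intro mult_right_mono)
      have "\<epsilon> ^ 13 \<le> \<epsilon> / 100 ^ 12" using eps_pow[of 12] by simp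
      then show "176 * \<epsilon> ^ 13 \<le> 1" using eps by simp
    qed simp
    finally show ?thesis unfolding k_def by simp
  qed
  have "l * psi T y * ((3 * s * (1 + Z))\<^sup>2 * E + Z * (e\<^sup>2 / \<epsilon>\<^sup>2) + s\<^sup>2 + s\<^sup>2 / 32 * (1 + Z\<^sup>2)) =
    l * psi T y * ((3 * s * (1 + Z))\<^sup>2 * E + Z * (e\<^sup>2 / \<epsilon>\<^sup>2)) + l * psi T y * s\<^sup>2 + l * (s\<^sup>2 / 32 * ((1 + Z\<^sup>2) * psi T y))"
    by (rule ring_swaps(3))
  moreover have "1 * (s\<^sup>2 / 32 * ((1 + Z\<^sup>2) * psi T y)) \<le> l * (s\<^sup>2 / 32 * ((1 + Z\<^sup>2) * psi T y))"
    using l2 psi0 by (intro mult_right_mono) auto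
  ultimately show ?thesis using up low tiny by linarith
qed

lemma step_bump:
  "l * tw (\<lambda>d. psi T (y + d)) \<le> l' * psi T' y - e\<^sup>2 / 32 * ((1 + Z\<^sup>2) * psi T y / T) + e\<^sup>2 + e\<^sup>2 * rt / \<epsilon>"
proof -
  have "s\<^sup>2 / 32 * ((1 + Z\<^sup>2) * psi T y) = e\<^sup>2 / 32 * ((1 + Z\<^sup>2) * psi T y / T)" unfolding ss by simp
  moreover have "0 \<le> e\<^sup>2" "0 \<le> e\<^sup>2 * rt / \<epsilon>" using rt0 eps0 by auto
  ultimately show ?thesis using bump_good bump_bad by (cases "Z * (l * s) \<le> 1/10000") linarith+
qed

end

subsection \<open>The tilted walk\<close>

lemma expectation_mono_finite:
  fixes F G :: "'a \<Rightarrow> real"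
  assumes "finite (set_pmf Q)" "\<And>X. X \<in> set_pmf Q \<Longrightarrow> F X \<le> G X"
  shows "measure_pmf.expectation Q F \<le> measure_pmf.expectation Q G"
  using assms by (intro integral_mono_AE integrable_measure_pmf_finite) (auto simp: AE_measure_pmf_iff)

lemma expectation_cong_finite:
  fixes F G :: "'a \<Rightarrow> real"
  assumes "\<And>X. X \<in> set_pmf Q \<Longrightarrow> F X = G X"
  shows "measure_pmf.expectation Q F = measure_pmf.expectation Q G"
  using assms by (intro integral_cong_AE) (auto simp: AE_measure_pmf_iff)

lemma expectation_linear_finite:
  fixes F G :: "'a \<Rightarrow> real"
  assumes [simp]: "finite (set_pmf Q)"
  shows "measure_pmf.expectation Q (\<lambda>X. F X + G X) = measure_pmf.expectation Q F + measure_pmf.expectation Q G"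
    "measure_pmf.expectation Q (\<lambda>X. F X - G X) = measure_pmf.expectation Q F - measure_pmf.expectation Q G"
    "measure_pmf.expectation Q (\<lambda>X. c * F X) = c * measure_pmf.expectation Q F"
    "measure_pmf.expectation Q (\<lambda>X. F X * c) = measure_pmf.expectation Q F * c"
    "measure_pmf.expectation Q (\<lambda>X. c) = c"
  by (simp_all add: integrable_measure_pmf_finite)

lemma expectation_bind_finite:
  fixes F :: "'b \<Rightarrow> real"
  assumes "finite (set_pmf Q)" "\<And>X. X \<in> set_pmf Q \<Longrightarrow> finite (set_pmf (N X))"
  shows "measure_pmf.expectation (bind_pmf Q N) F = measure_pmf.expectation Q (\<lambda>X. measure_pmf.expectation (N X) F)"
  by (subst pmf_expectation_bind[OF assms(1,2)]) (auto simp: integral_measure_pmf[OF assms(1)])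

lemma prob_eq_expectation: "measure_pmf.prob Q A = measure_pmf.expectation Q (indicator A)"
  by simp

lemma markov_finite:
  fixes F :: "'a \<Rightarrow> real"
  assumes "finite (set_pmf Q)" "\<And>X. X \<in> set_pmf Q \<Longrightarrow> 0 \<le> F X" "0 < c"
  shows "measure_pmf.prob Q {X. c \<le> F X} \<le> measure_pmf.expectation Q F / c"
proof -
  have "measure_pmf.expectation Q (indicator {X. c \<le> F X}) \<le> measure_pmf.expectation Q (\<lambda>X. F X * (1 / c))"
    using assms by (intro expectation_mono_finite) (auto simp: indicator_def field_simps)
  then show ?thesis using expectation_linear_finite(4)[OF assms(1), of F "1 / c"]
    by (simp add: prob_eq_expectation[symmetric])
qed

lemma sign_pmf_support: "set_pmf (sign_pmf r) \<subseteq> {-1, 1}"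
  by (auto simp: sign_pmf_def)

lemma finite_sign_pmf [simp]: "finite (set_pmf (sign_pmf r))"
  using sign_pmf_support finite_subset by blast

lemma expectation_sign_pmf:
  fixes f :: "int \<Rightarrow> real"
  assumes "0 \<le> r" "r \<le> 1"
  shows "measure_pmf.expectation (sign_pmf r) f = r * f 1 + (1 - r) * f (- 1)"
  using assms by (simp add: sign_pmf_def mult.commute)

text \<open>Conditional mean of step \<open>k + 1\<close> of the untilted walk given its first
  \<open>k\<close> steps.\<close>

definition memdrift :: "real \<Rightarrow> nat \<Rightarrow> (nat \<Rightarrow> int) \<Rightarrow> real" where
  "memdrift p k X = (2 * p - 1) * real_of_int (erw_pos X k) / real k"

definition sign_path :: "nat \<Rightarrow> (nat \<Rightarrow> int) \<Rightarrow> bool" where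
  "sign_path k X \<longleftrightarrow> (\<forall>i\<in>{1..k}. X i = 1 \<or> X i = - 1)"

lemma sign_path_update:
  "sign_path k X \<Longrightarrow> s = 1 \<or> s = - 1 \<Longrightarrow> sign_path (Suc k) (X(Suc k := s))"
  by (auto simp: sign_path_def)

lemma erw_pos_update: "j \<le> k \<Longrightarrow> erw_pos (X(Suc k := s)) j = erw_pos X j"
  "erw_pos (X(Suc k := s)) (Suc k) = erw_pos X k + s"
  by (auto simp: erw_pos_def intro!: sum.cong)

lemma memdrift_update: "j \<le> k \<Longrightarrow> memdrift p j (X(Suc k := s)) = memdrift p j X"
  by (simp add: memdrift_def erw_pos_update)

lemma erw_pos_abs:
  assumes "sign_path k X"
  shows "\<bar>erw_pos X k\<bar> \<le> int k"
proof -
  have "\<bar>erw_pos X k\<bar> \<le> (\<Sum>i=1..k. \<bar>X i\<bar>)" unfolding erw_pos_def by (rule sum_abs)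
  also have "\<dots> = (\<Sum>i=1..k. 1)"
  proof (intro sum.cong refl)
    fix i assume "i \<in> {1..k}"
    then have "X i = 1 \<or> X i = - 1" using assms unfolding sign_path_def by blast
    then show "\<bar>X i\<bar> = 1" by auto
  qed
  finally show ?thesis by simp
qed

lemma memdrift_abs:
  assumes "sign_path k X" "1 \<le> k" "0 \<le> p" "p \<le> 1"
  shows "\<bar>memdrift p k X\<bar> \<le> 1"
proof -
  have "\<bar>real_of_int (erw_pos X k)\<bar> \<le> real k" using erw_pos_abs[OF assms(1)] by linarith
  moreover have "\<bar>2 * p - 1\<bar> \<le> 1" using assms by linarith
  ultimately have "\<bar>2 * p - 1\<bar> * \<bar>real_of_int (erw_pos X k)\<bar> \<le> 1 * real k" by (intro mult_mono) auto
  then show ?thesis using assms by (simp add: memdrift_def abs_mult)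
qed

text \<open>
  The tilt starts at time 2 only: the ratio of the first two weights, \<open>e 2 / e 1 = 1 / (2 * p)\<close>, is
  unbounded as \<open>p\<close> tends to \<open>0\<close>, while all later ratios are at most \<open>2\<close>.
\<close>

primrec twalk :: "real \<Rightarrow> real \<Rightarrow> (nat \<Rightarrow> real) \<Rightarrow> nat \<Rightarrow> (nat \<Rightarrow> int) pmf" where
  "twalk p q c 0 = erw_pmf p q 0"
| "twalk p q c (Suc k) = (if k < 2 then erw_pmf p q (Suc k) else
     bind_pmf (twalk p q c k) (\<lambda>X. map_pmf (\<lambda>s. X(Suc k := s))
       (sign_pmf ((1 + tilt (memdrift p k X) (c (Suc k))) / 2))))"

lemma erw_pmf_Suc:
  "1 \<le> k \<Longrightarrow> erw_pmf p q (Suc k) = bind_pmf (erw_pmf p q k) (\<lambda>X.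
     bind_pmf (pmf_of_set {1..k}) (\<lambda>\<beta>. bind_pmf (sign_pmf p) (\<lambda>\<alpha>. return_pmf (X(Suc k := \<alpha> * X \<beta>)))))"
  by (cases k) simp_all

lemma erw_support: "X \<in> set_pmf (erw_pmf p q k) \<Longrightarrow> sign_path k X"
proof (induction k arbitrary: X)
  case 0
  then show ?case by (simp add: sign_path_def)
next
  case (Suc k)
  show ?case
  proof (cases "k = 0")
    case True
    with Suc.prems sign_pmf_support[of q] show ?thesis by (auto simp: sign_path_def)
  next
    case False
    with Suc.prems obtain X0 \<beta> \<alpha> where X0: "X0 \<in> set_pmf (erw_pmf p q k)" "\<beta> \<in> {1..k}" "\<alpha> \<in> set_pmf (sign_pmf p)"
      "X = X0(Suc k := \<alpha> * X0 \<beta>)"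
      by (auto simp: erw_pmf_Suc)
    have "\<alpha> = 1 \<or> \<alpha> = -1" using X0(3) sign_pmf_support by blast
    moreover have "X0 \<beta> = 1 \<or> X0 \<beta> = - 1" using Suc.IH[OF X0(1)] X0(2) by (auto simp: sign_path_def)
    ultimately show ?thesis unfolding X0(4) by (intro sign_path_update Suc.IH[OF X0(1)]) auto
  qed
qed

lemma finite_erw: "finite (set_pmf (erw_pmf p q k))"
proof (induction k)
  case (Suc k)
  then show ?case by (cases "k = 0") (auto simp: erw_pmf_Suc)
qed simp

text \<open>Averaging over the remembered index and the random sign leaves only the sum of the past
  steps, so the next step depends on the past through the position alone.\<close>

lemma expectation_erw_Suc:
  fixes F :: "(nat \<Rightarrow> int) \<Rightarrow> real"
  assumes k: "1 \<le> k" and p: "0 \<le> p" "p \<le> 1"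
  shows "measure_pmf.expectation (erw_pmf p q (Suc k)) F = measure_pmf.expectation (erw_pmf p q k)
    (\<lambda>X. (1 + memdrift p k X) / 2 * F (X(Suc k := 1)) + (1 - memdrift p k X) / 2 * F (X(Suc k := - 1)))"
proof -
  have "measure_pmf.expectation (erw_pmf p q (Suc k)) F = measure_pmf.expectation (erw_pmf p q k)
    (\<lambda>X. measure_pmf.expectation (bind_pmf (pmf_of_set {1..k}) (\<lambda>\<beta>. bind_pmf (sign_pmf p) (\<lambda>\<alpha>. return_pmf (X(Suc k := \<alpha> * X \<beta>))))) F)"
    unfolding erw_pmf_Suc[OF k] using k by (intro expectation_bind_finite finite_erw) auto
  also have "\<dots> = measure_pmf.expectation (erw_pmf p q k)
    (\<lambda>X. (1 + memdrift p k X) / 2 * F (X(Suc k := 1)) + (1 - memdrift p k X) / 2 * F (X(Suc k := - 1)))"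
  proof (rule expectation_cong_finite)
    fix X assume "X \<in> set_pmf (erw_pmf p q k)"
    then have X: "sign_path k X" by (rule erw_support)
    define A B where "A = F (X(Suc k := 1))" and "B = F (X(Suc k := - 1))"
    have "measure_pmf.expectation (bind_pmf (pmf_of_set {1..k}) (\<lambda>\<beta>. bind_pmf (sign_pmf p) (\<lambda>\<alpha>. return_pmf (X(Suc k := \<alpha> * X \<beta>))))) F
      = measure_pmf.expectation (pmf_of_set {1..k}) (\<lambda>\<beta>. measure_pmf.expectation (bind_pmf (sign_pmf p) (\<lambda>\<alpha>. return_pmf (X(Suc k := \<alpha> * X \<beta>)))) F)"
      using k by (intro expectation_bind_finite) auto
    also have "\<dots> = (\<Sum>\<beta>\<in>{1..k}. measure_pmf.expectation (bind_pmf (sign_pmf p) (\<lambda>\<alpha>. return_pmf (X(Suc k := \<alpha> * X \<beta>)))) F) / real k"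
      using k by (subst integral_pmf_of_set) auto
    also have "(\<Sum>\<beta>\<in>{1..k}. measure_pmf.expectation (bind_pmf (sign_pmf p) (\<lambda>\<alpha>. return_pmf (X(Suc k := \<alpha> * X \<beta>)))) F)
      = (\<Sum>\<beta>\<in>{1..k}. (A + B) / 2 + real_of_int (X \<beta>) * ((2 * p - 1) * (A - B) / 2))"
    proof (rule sum.cong[OF refl])
      fix \<beta> assume \<beta>: "\<beta> \<in> {1..k}"
      have "measure_pmf.expectation (bind_pmf (sign_pmf p) (\<lambda>\<alpha>. return_pmf (X(Suc k := \<alpha> * X \<beta>)))) F
        = p * F (X(Suc k := X \<beta>)) + (1 - p) * F (X(Suc k := - X \<beta>))"
        by (subst expectation_bind_finite) (auto simp: expectation_sign_pmf[OF p])
      moreover have "X \<beta> = 1 \<or> X \<beta> = - 1" using X \<beta> by (auto simp: sign_path_def)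
      ultimately show "measure_pmf.expectation (bind_pmf (sign_pmf p) (\<lambda>\<alpha>. return_pmf (X(Suc k := \<alpha> * X \<beta>)))) F
        = (A + B) / 2 + real_of_int (X \<beta>) * ((2 * p - 1) * (A - B) / 2)"
        by (elim disjE) (simp_all add: A_def B_def field_simps)
    qed
    also have "\<dots> = real k * ((A + B) / 2) + real_of_int (erw_pos X k) * ((2 * p - 1) * (A - B) / 2)"
      by (simp only: sum.distrib sum_distrib_right[symmetric] erw_pos_def of_int_sum sum_constant card_atLeastAtMost) simp
    also have "\<dots> / real k = (1 + memdrift p k X) / 2 * A + (1 - memdrift p k X) / 2 * B"
      using k by (simp add: memdrift_def field_simps)
    finally show "measure_pmf.expectation (bind_pmf (pmf_of_set {1..k}) (\<lambda>\<beta>. bind_pmf (sign_pmf p) (\<lambda>\<alpha>. return_pmf (X(Suc k := \<alpha> * X \<beta>))))) F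
      = (1 + memdrift p k X) / 2 * F (X(Suc k := 1)) + (1 - memdrift p k X) / 2 * F (X(Suc k := - 1))"
      unfolding A_def B_def .
  qed
  finally show ?thesis .
qed

context
  fixes p q :: real and c :: "nat \<Rightarrow> real"
  assumes p: "0 \<le> p" "p \<le> 1" and c: "\<And>k. 0 \<le> c k" "\<And>k. c k \<le> 1/8"
begin

lemma finite_twalk: "finite (set_pmf (twalk p q c k))"
  by (induction k) (auto simp: finite_erw)

lemma twalk_support: "X \<in> set_pmf (twalk p q c k) \<Longrightarrow> sign_path k X"
proof (induction k arbitrary: X)
  case 0
  then show ?case by (simp add: sign_path_def)
next
  case (Suc k)
  show ?case
  proof (cases "k < 2")
    case True
    with Suc.prems show ?thesis using erw_support by simp
  next
    case False
    with Suc.prems obtain X0 s where "X0 \<in> set_pmf (twalk p q c k)" "X = X0(Suc k := s)"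
      "s \<in> set_pmf (sign_pmf ((1 + tilt (memdrift p k X0) (c (Suc k))) / 2))"
      by auto
    then show ?thesis using Suc.IH sign_path_update sign_pmf_support by blast
  qed
qed

lemma expectation_twalk_Suc:
  fixes F :: "(nat \<Rightarrow> int) \<Rightarrow> real"
  assumes k: "2 \<le> k"
  shows "measure_pmf.expectation (twalk p q c (Suc k)) F = measure_pmf.expectation (twalk p q c k)
    (\<lambda>X. (1 + tilt (memdrift p k X) (c (Suc k))) / 2 * F (X(Suc k := 1))
       + (1 - tilt (memdrift p k X) (c (Suc k))) / 2 * F (X(Suc k := - 1)))"
proof -
  have "measure_pmf.expectation (twalk p q c (Suc k)) F = measure_pmf.expectation (twalk p q c k)
    (\<lambda>X. measure_pmf.expectation (map_pmf (\<lambda>s. X(Suc k := s)) (sign_pmf ((1 + tilt (memdrift p k X) (c (Suc k))) / 2))) F)"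
    using k by (simp add: expectation_bind_finite finite_twalk)
  also have "\<dots> = measure_pmf.expectation (twalk p q c k)
    (\<lambda>X. (1 + tilt (memdrift p k X) (c (Suc k))) / 2 * F (X(Suc k := 1))
       + (1 - tilt (memdrift p k X) (c (Suc k))) / 2 * F (X(Suc k := - 1)))"
  proof (rule expectation_cong_finite)
    fix X assume "X \<in> set_pmf (twalk p q c k)"
    then have "\<bar>memdrift p k X\<bar> \<le> 1" using k by (intro memdrift_abs twalk_support p) auto
    then have "\<bar>tilt (memdrift p k X) (c (Suc k))\<bar> \<le> 1" by (intro tilt_bounds(1) c)
    then have "0 \<le> (1 + tilt (memdrift p k X) (c (Suc k))) / 2" "(1 + tilt (memdrift p k X) (c (Suc k))) / 2 \<le> 1"
      by (auto simp: abs_le_iff)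
    from expectation_sign_pmf[OF this, of "\<lambda>s. F (X(Suc k := s))"]
    show "measure_pmf.expectation (map_pmf (\<lambda>s. X(Suc k := s)) (sign_pmf ((1 + tilt (memdrift p k X) (c (Suc k))) / 2))) F
      = (1 + tilt (memdrift p k X) (c (Suc k))) / 2 * F (X(Suc k := 1))
       + (1 - tilt (memdrift p k X) (c (Suc k))) / 2 * F (X(Suc k := - 1))"
      by (simp add: field_simps)
  qed
  finally show ?thesis .
qed

text \<open>The tilt is sequential: later tilts reweight only later signs, so the law of the first
  \<open>k\<close> steps is unchanged.\<close>

lemma expectation_twalk_past:
  fixes F :: "(nat \<Rightarrow> int) \<Rightarrow> real"
  assumes "2 \<le> k" "k \<le> n" and loc: "\<And>X i s. k < i \<Longrightarrow> F (X(i := s)) = F X"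
  shows "measure_pmf.expectation (twalk p q c n) F = measure_pmf.expectation (twalk p q c k) F"
  using assms(2)
proof (induction n rule: dec_induct)
  case (step m)
  have "measure_pmf.expectation (twalk p q c (Suc m)) F = measure_pmf.expectation (twalk p q c m)
    (\<lambda>X. (1 + tilt (memdrift p m X) (c (Suc m))) / 2 * F X
       + (1 - tilt (memdrift p m X) (c (Suc m))) / 2 * F X)"
    using step assms(1) by (subst expectation_twalk_Suc) (auto simp: loc)
  also have "\<dots> = measure_pmf.expectation (twalk p q c m) F"
    by (intro expectation_cong_finite) (simp add: field_simps)
  finally show ?case using step by simp
qed simp

text \<open>Conditional moment generating function of the next untilted step at
  \<open>c (Suc k)\<close>.\<close>

definition normf :: "nat \<Rightarrow> (nat \<Rightarrow> int) \<Rightarrow> real" where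
  "normf k X = cosh (c (Suc k)) + memdrift p k X * sinh (c (Suc k))"

text \<open>Density of the original law with respect to the tilted law.\<close>

definition lik :: "nat \<Rightarrow> (nat \<Rightarrow> int) \<Rightarrow> real" where
  "lik n X = (\<Prod>k=2..<n. exp (- c (Suc k) * real_of_int (X (Suc k))) * normf k X)"

lemma normf_pos:
  assumes "\<bar>memdrift p k X\<bar> \<le> 1"
  shows "0 < normf k X"
proof -
  have "\<bar>memdrift p k X * sinh (c (Suc k))\<bar> \<le> 1 * sinh (c (Suc k))"
    unfolding abs_mult using assms c by (intro mult_mono) auto
  also have "\<dots> < cosh (c (Suc k))" using sinh_less_cosh_real by simp
  finally show ?thesis by (simp add: normf_def abs_less_iff)
qed

text \<open>Clearing \<open>cosh\<close> turns \<open>tilt r h\<close> into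
  \<open>(r * cosh h + sinh h) / (cosh h + r * sinh h)\<close>, the mean of the Esscher transform:
  the weights \<open>(1 + r) / 2\<close> and \<open>(1 - r) / 2\<close> are multiplied by
  \<open>exp h\<close> and \<open>exp (- h)\<close> and renormalised by
  \<open>normf\<close>.\<close>

lemma tilt_weights:
  assumes "\<bar>memdrift p k X\<bar> \<le> 1"
  shows "(1 + tilt (memdrift p k X) (c (Suc k))) * (exp (- c (Suc k)) * normf k X) = 1 + memdrift p k X"
    "(1 - tilt (memdrift p k X) (c (Suc k))) * (exp (c (Suc k)) * normf k X) = 1 - memdrift p k X"
proof -
  define r h where "r = memdrift p k X" and "h = c (Suc k)"
  have n: "0 < cosh h + r * sinh h" using normf_pos[OF assms] by (simp add: normf_def r_def h_def)
  have ch: "cosh h \<noteq> 0" by simp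
  have t: "tilt r h = (r * cosh h + sinh h) / (cosh h + r * sinh h)"
  proof -
    have "tilt r h = (r + sinh h / cosh h) * cosh h / ((1 + r * (sinh h / cosh h)) * cosh h)"
      by (simp add: tilt_def tanh_def)
    then show ?thesis using ch by (simp add: algebra_simps)
  qed
  have "(1 + tilt r h) * (cosh h + r * sinh h) = (1 + r) * (cosh h + sinh h)"
    using n by (simp add: t field_simps)
  also have "cosh h + sinh h = exp h" by (rule cosh_plus_sinh)
  finally have 1: "(1 + tilt r h) * (cosh h + r * sinh h) = (1 + r) * exp h" .
  have "(1 - tilt r h) * (cosh h + r * sinh h) = (1 - r) * (cosh h - sinh h)"
    using n by (simp add: t field_simps)
  also have "cosh h - sinh h = exp (- h)" by (rule cosh_minus_sinh)
  finally have 2: "(1 - tilt r h) * (cosh h + r * sinh h) = (1 - r) * exp (- h)" .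
  have a: "(1 + tilt r h) * (exp (- h) * (cosh h + r * sinh h)) = exp (- h) * ((1 + r) * exp h)"
    unfolding 1[symmetric] by simp
  have b: "exp (- h) * ((1 + r) * exp h) = 1 + r" by (simp add: exp_minus)
  show "(1 + tilt (memdrift p k X) (c (Suc k))) * (exp (- c (Suc k)) * normf k X) = 1 + memdrift p k X"
    using trans[OF a b] unfolding normf_def r_def h_def .
  have a: "(1 - tilt r h) * (exp h * (cosh h + r * sinh h)) = exp h * ((1 - r) * exp (- h))"
    unfolding 2[symmetric] by simp
  have b: "exp h * ((1 - r) * exp (- h)) = 1 - r" by (simp add: exp_minus)
  show "(1 - tilt (memdrift p k X) (c (Suc k))) * (exp (c (Suc k)) * normf k X) = 1 - memdrift p k X"
    using trans[OF a b] unfolding normf_def r_def h_def .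
qed

lemma lik_update:
  assumes "2 \<le> k"
  shows "lik (Suc k) (X(Suc k := s)) = lik k X * (exp (- c (Suc k) * real_of_int s) * normf k X)"
proof -
  have "lik (Suc k) (X(Suc k := s)) = lik k (X(Suc k := s)) * (exp (- c (Suc k) * real_of_int s) * normf k X)"
    using assms by (simp add: lik_def normf_def memdrift_update)
  also have "lik k (X(Suc k := s)) = lik k X"
    unfolding lik_def normf_def by (intro prod.cong) (auto simp: memdrift_update)
  finally show ?thesis .
qed

lemma change_of_measure:
  fixes F :: "(nat \<Rightarrow> int) \<Rightarrow> real"
  assumes "2 \<le> n"
  shows "measure_pmf.expectation (erw_pmf p q n) F = measure_pmf.expectation (twalk p q c n) (\<lambda>X. F X * lik n X)"
  using assms
proof (induction n arbitrary: F rule: dec_induct)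
  case base
  have "twalk p q c 2 = erw_pmf p q 2" by (simp add: eval_nat_numeral)
  then show ?case by (simp add: lik_def)
next
  case (step k)
  have "measure_pmf.expectation (erw_pmf p q (Suc k)) F = measure_pmf.expectation (twalk p q c k)
    (\<lambda>X. ((1 + memdrift p k X) / 2 * F (X(Suc k := 1)) + (1 - memdrift p k X) / 2 * F (X(Suc k := - 1))) * lik k X)"
    using step p by (subst expectation_erw_Suc) auto
  also have "\<dots> = measure_pmf.expectation (twalk p q c k)
    (\<lambda>X. (1 + tilt (memdrift p k X) (c (Suc k))) / 2 * (F (X(Suc k := 1)) * lik (Suc k) (X(Suc k := 1)))
       + (1 - tilt (memdrift p k X) (c (Suc k))) / 2 * (F (X(Suc k := - 1)) * lik (Suc k) (X(Suc k := - 1))))"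
  proof (rule expectation_cong_finite)
    fix X assume "X \<in> set_pmf (twalk p q c k)"
    then have m: "\<bar>memdrift p k X\<bar> \<le> 1" using step by (intro memdrift_abs twalk_support p) auto
    have l: "lik (Suc k) (X(Suc k := 1)) = lik k X * (exp (- c (Suc k)) * normf k X)"
      "lik (Suc k) (X(Suc k := - 1)) = lik k X * (exp (c (Suc k)) * normf k X)"
      using lik_update[of k X 1] lik_update[of k X "- 1"] step by simp_all
    have ring: "(1 + t) / 2 * (f * (u * v)) = ((1 + t) * v) / 2 * f * u" "(1 - t) / 2 * (f * (u * v)) = ((1 - t) * v) / 2 * f * u"
      for t f u v :: real by simp_all
    show "((1 + memdrift p k X) / 2 * F (X(Suc k := 1)) + (1 - memdrift p k X) / 2 * F (X(Suc k := - 1))) * lik k X =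
      (1 + tilt (memdrift p k X) (c (Suc k))) / 2 * (F (X(Suc k := 1)) * lik (Suc k) (X(Suc k := 1)))
       + (1 - tilt (memdrift p k X) (c (Suc k))) / 2 * (F (X(Suc k := - 1)) * lik (Suc k) (X(Suc k := - 1)))"
      unfolding l ring tilt_weights[OF m] by (simp add: distrib_right)
  qed
  also have "\<dots> = measure_pmf.expectation (twalk p q c (Suc k)) (\<lambda>X. F X * lik (Suc k) X)"
    using step by (subst expectation_twalk_Suc) auto
  finally show ?case .
qed

end

text \<open>The telescoping step is Elliott's proof of Hardy's inequality.\<close>

lemma hardy_finite:
  fixes x :: "nat \<Rightarrow> real"
  shows "(\<Sum>k=1..n. ((\<Sum>j=1..k. x j) / real k)\<^sup>2) \<le> 4 * (\<Sum>k=1..n. (x k)\<^sup>2)"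
proof -
  define A where "A k = (\<Sum>j=1..k. x j) / real k" for k
  have tel: "(\<Sum>k=1..m. (A k)\<^sup>2 - 2 * A k * x k) \<le> - (real m * (A m)\<^sup>2)" for m
  proof (induction m)
    case (Suc m)
    have x: "x (Suc m) = real (Suc m) * A (Suc m) - real m * A m"
      by (cases "m = 0") (simp_all add: A_def)
    have "(A (Suc m))\<^sup>2 - 2 * A (Suc m) * x (Suc m)
      = - (real (Suc m) * (A (Suc m))\<^sup>2) + real m * (A m)\<^sup>2 - real m * (A (Suc m) - A m)\<^sup>2"
      unfolding x by (simp add: power2_eq_square algebra_simps)
    moreover have "0 \<le> real m * (A (Suc m) - A m)\<^sup>2" by simp
    moreover have "(\<Sum>k=1..Suc m. (A k)\<^sup>2 - 2 * A k * x k)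
      = (\<Sum>k=1..m. (A k)\<^sup>2 - 2 * A k * x k) + ((A (Suc m))\<^sup>2 - 2 * A (Suc m) * x (Suc m))" by simp
    ultimately show ?case using Suc by linarith
  qed simp
  have "(\<Sum>k=1..n. (A k)\<^sup>2) = (\<Sum>k=1..n. (A k)\<^sup>2 - 2 * A k * x k) + (\<Sum>k=1..n. 2 * A k * x k)"
    by (simp add: sum_subtractf)
  also have "(\<Sum>k=1..n. (A k)\<^sup>2 - 2 * A k * x k) \<le> 0"
    by (rule order_trans[OF tel]) simp
  also have "(\<Sum>k=1..n. 2 * A k * x k) \<le> (\<Sum>k=1..n. (A k)\<^sup>2 / 2 + 2 * (x k)\<^sup>2)"
  proof (rule sum_mono)
    fix k
    have "0 \<le> (A k - 2 * x k)\<^sup>2" by simp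
    then show "2 * A k * x k \<le> (A k)\<^sup>2 / 2 + 2 * (x k)\<^sup>2" by (simp add: power2_eq_square algebra_simps)
  qed
  also have "(\<Sum>k=1..n. (A k)\<^sup>2 / 2 + 2 * (x k)\<^sup>2) = (\<Sum>k=1..n. (A k)\<^sup>2) / 2 + 2 * (\<Sum>k=1..n. (x k)\<^sup>2)"
    by (simp add: sum.distrib sum_divide_distrib sum_distrib_left)
  finally show ?thesis unfolding A_def by simp
qed

subsection \<open>Normal approximation under the tilted law\<close>

text \<open>\<open>e_rec\<close> is the condition that \<open>e k * erw_pos X k\<close> be a
  martingale of the untilted walk from time 2 on; \<open>lam * \<epsilon> \<le> 1/8\<close> keeps
  every tilt within the range of \<open>tilt_bounds\<close>.\<close>

locale tilted_chain =
  fixes p q :: real and n :: nat and e :: "nat \<Rightarrow> real" and lam \<epsilon> :: real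
  assumes p: "0 \<le> p" "p \<le> 1" and n: "3 \<le> n"
    and e_pos: "\<And>k. 1 \<le> k \<Longrightarrow> k \<le> n \<Longrightarrow> 0 < e k"
    and e_rec: "\<And>k. 2 \<le> k \<Longrightarrow> k < n \<Longrightarrow> e (Suc k) * (1 + (2 * p - 1) / real k) = e k"
    and e_sum: "(\<Sum>k=1..n. (e k)\<^sup>2) = 1"
    and e_le: "\<And>k. 1 \<le> k \<Longrightarrow> k \<le> n \<Longrightarrow> e k \<le> \<epsilon>"
    and lam: "0 \<le> lam" "lam * \<epsilon> \<le> 1/8"
    and eps: "\<epsilon> \<le> 1/100" "smin \<epsilon> \<le> 1"
begin

text \<open>The value 0 outside \<open>1..n\<close> makes the bounds on the tilt hold for every
  index, as the lemmas on \<open>twalk\<close> require.\<close>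

definition "c k = (if 1 \<le> k \<and> k \<le> n then lam * e k else 0)"
definition "M k X = e k * real_of_int (erw_pos X k)"
definition "tau k = (\<Sum>j=1..k. (e j)\<^sup>2)"
definition "Y k X = M k X - lam * tau k"
abbreviation "Q \<equiv> twalk p q c"
abbreviation Exq :: "nat \<Rightarrow> ((nat \<Rightarrow> int) \<Rightarrow> real) \<Rightarrow> real"
  where "Exq k F \<equiv> measure_pmf.expectation (Q k) F"
abbreviation "rr \<equiv> memdrift p"

lemma c_bounds: "0 \<le> c k" "c k \<le> 1/8"
proof -
  show "0 \<le> c k" using lam e_pos[of k] by (auto simp: c_def)
  have "lam * e k \<le> 1/8" if "1 \<le> k" "k \<le> n"
    using mult_left_mono[OF e_le[OF that] lam(1)] lam by linarith
  then show "c k \<le> 1/8" by (auto simp: c_def)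
qed

lemmas fin = finite_twalk[OF p c_bounds]
lemmas supp = twalk_support[OF p c_bounds]
lemmas Ex_Suc = expectation_twalk_Suc[OF p c_bounds]
lemmas Ex_past = expectation_twalk_past[OF p c_bounds]
lemmas Ex_lin = expectation_linear_finite[OF fin]
lemmas Ex_mono = expectation_mono_finite[OF fin]

lemma rr_abs: "X \<in> set_pmf (Q k) \<Longrightarrow> 1 \<le> k \<Longrightarrow> \<bar>rr k X\<bar> \<le> 1"
  by (intro memdrift_abs supp p)

lemma c_Suc: "k < n \<Longrightarrow> c (Suc k) = lam * e (Suc k)"
  by (simp add: c_def)

lemma eps_pos: "0 < \<epsilon>" using e_pos[of 1] e_le[of 1] n by linarith

lemma tau_Suc: "tau (Suc k) = tau k + (e (Suc k))\<^sup>2" by (simp add: tau_def)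

lemma tau_n: "tau n = 1" using e_sum by (simp add: tau_def)

lemma tau_nonneg: "0 \<le> tau k" by (simp add: tau_def sum_nonneg)

lemma tau_mono: "j \<le> k \<Longrightarrow> tau j \<le> tau k" unfolding tau_def by (intro sum_mono2) auto

lemma tau_le_1: "k \<le> n \<Longrightarrow> tau k \<le> 1" using tau_mono tau_n by metis

lemma e_sq_le: "1 \<le> k \<Longrightarrow> k \<le> n \<Longrightarrow> (e k)\<^sup>2 \<le> \<epsilon>\<^sup>2"
  using e_pos[of k] e_le[of k] by (intro power_mono) auto

lemma tau_2: "tau 2 \<le> 2 * \<epsilon>\<^sup>2"
  using e_sq_le[of 1] e_sq_le[of 2] n by (simp add: tau_def eval_nat_numeral)

lemma M_step:
  assumes "2 \<le> k" "k < n"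
  shows "M (Suc k) (X(Suc k := s)) = M k X + e (Suc k) * (real_of_int s - rr k X)"
proof -
  have "M k X = e (Suc k) * (1 + (2 * p - 1) / real k) * real_of_int (erw_pos X k)"
    unfolding M_def using e_rec[OF assms] by simp
  also have "\<dots> = e (Suc k) * real_of_int (erw_pos X k) + e (Suc k) * rr k X"
    by (simp add: memdrift_def algebra_simps)
  finally show ?thesis by (simp add: M_def erw_pos_update algebra_simps)
qed

lemma Ex_step:
  fixes G :: "real \<Rightarrow> real"
  assumes "2 \<le> k" "k < n"
  shows "Exq (Suc k) (\<lambda>X. G (Y (Suc k) X)) = Exq k (\<lambda>X. twopt (e (Suc k)) (rr k X) (lam * e (Suc k)) (\<lambda>d. G (Y k X + d)))"
proof -
  have y: "Y (Suc k) (X(Suc k := s)) = Y k X + e (Suc k) * (real_of_int s - rr k X - lam * e (Suc k))" for X s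
    using M_step[OF assms] by (simp add: Y_def tau_Suc power2_eq_square algebra_simps)
  show ?thesis
    using assms by (simp only: Ex_Suc y twopt_def c_Suc) simp
qed

text \<open>From time 2 on \<open>(2 * p - 1) / k\<close> is at least \<open>- 1/2\<close>, so
  consecutive weights differ by a factor of at most 2. This trades the drift for
  \<open>M k / k\<close>, uniformly in \<open>p\<close>.\<close>

lemma step_drift_sq:
  assumes "2 \<le> k" "k < n"
  shows "(e (Suc k))\<^sup>2 * (rr k X)\<^sup>2 \<le> 4 * (M k X)\<^sup>2 / (real k)\<^sup>2"
proof -
  define g where "g = 2 * p - 1"
  have g: "\<bar>g\<bar> \<le> 1" using p by (simp add: g_def abs_le_iff)
  have "- (1 / 2) \<le> g / real k"
  proof -
    have "\<bar>g / real k\<bar> \<le> 1 / 2" unfolding abs_divide using g assms by (intro frac_le) auto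
    then show ?thesis by linarith
  qed
  then have "1/2 \<le> 1 + g / real k" by linarith
  then have "e (Suc k) * (1/2) \<le> e (Suc k) * (1 + g / real k)"
    using e_pos[of "Suc k"] assms by (intro mult_left_mono) auto
  then have 1: "e (Suc k) \<le> 2 * e k" using e_rec[OF assms] by (simp add: g_def)
  have "e (Suc k) * \<bar>g\<bar> \<le> 2 * e k * 1" using 1 g e_pos[of "Suc k"] assms e_pos[of k] by (intro mult_mono) auto
  then have "(e (Suc k) * \<bar>g\<bar>)\<^sup>2 \<le> (2 * e k)\<^sup>2" using e_pos[of "Suc k"] assms by (intro power_mono) auto
  then have "(e (Suc k) * \<bar>g\<bar>)\<^sup>2 * ((real_of_int (erw_pos X k))\<^sup>2 / (real k)\<^sup>2) \<le> (2 * e k)\<^sup>2 * ((real_of_int (erw_pos X k))\<^sup>2 / (real k)\<^sup>2)"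
    by (intro mult_right_mono) auto
  then show ?thesis
    by (simp add: memdrift_def g_def M_def power_mult_distrib power_divide mult_ac)
qed

section \<open>Second moments under the tilted law and the accumulated squared drift\<close>

lemma second_moment_poly:
  assumes "0 \<le> u"
  shows "16 * sqrt (u + u\<^sup>2) + 4 \<le> 16 + 32 * (u::real)"
proof -
  have "sqrt (u + u\<^sup>2) \<le> u + 1/2"
    using assms by (intro real_le_lsqrt) (auto simp: power2_eq_square algebra_simps)
  then show ?thesis using assms by linarith
qed

text \<open>The form of the bound is variance plus squared mean, since \<open>M k\<close> has mean
  of order \<open>lam * tau k\<close>. The excess drift of a step is at most
  \<open>2 * lam * e\<close> whatever \<open>r\<close> is, so no prior control of the memory drift
  is needed.\<close>

lemma second_moment:
  assumes "2 \<le> k" "k \<le> n"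
  shows "Exq k (\<lambda>X. (M k X)\<^sup>2) \<le> 16 * (tau k + lam\<^sup>2 * (tau k)\<^sup>2)"
  using assms
proof (induction k rule: dec_induct)
  case base
  have "Exq 2 (\<lambda>X. (M 2 X)\<^sup>2) \<le> Exq 2 (\<lambda>X. 4 * (e 2)\<^sup>2)"
  proof (rule Ex_mono)
    fix X assume "X \<in> set_pmf (Q 2)"
    then have "\<bar>real_of_int (erw_pos X 2)\<bar> \<le> 2" using erw_pos_abs[OF supp] by fastforce
    then have "(real_of_int (erw_pos X 2))\<^sup>2 \<le> 2\<^sup>2" using abs_le_square_iff by fastforce
    then show "(M 2 X)\<^sup>2 \<le> 4 * (e 2)\<^sup>2"
      using mult_left_mono[of "(real_of_int (erw_pos X 2))\<^sup>2" 4 "(e 2)\<^sup>2"] by (simp add: M_def power_mult_distrib)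
  qed
  also have "\<dots> \<le> 16 * (tau 2 + lam\<^sup>2 * (tau 2)\<^sup>2)"
  proof -
    have "(e 2)\<^sup>2 \<le> tau 2" by (simp add: tau_def eval_nat_numeral)
    moreover have "0 \<le> lam\<^sup>2 * (tau 2)\<^sup>2" by simp
    moreover have "0 \<le> (e 2)\<^sup>2" by simp
    ultimately show ?thesis unfolding Ex_lin distrib_left by linarith
  qed
  finally show ?case .
next
  case (step k)
  define f where "f = e (Suc k)"
  have f0: "0 < f" using e_pos[of "Suc k"] step by (simp add: f_def)
  define B where "B = 16 * (tau k + lam\<^sup>2 * (tau k)\<^sup>2)"
  have tk: "0 < tau k"
  proof -
    have "(e 1)\<^sup>2 \<le> tau k" unfolding tau_def using step by (intro member_le_sum) auto
    moreover have "0 < (e 1)\<^sup>2" using e_pos[of 1] n by simp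
    ultimately show ?thesis by linarith
  qed
  have B0: "0 < B" unfolding B_def using tk by (intro mult_pos_pos add_pos_nonneg) auto
  \<comment> \<open>The inductive bound on the root mean square of \<open>M k\<close>. It is the
    best parameter in \<open>2 * \<bar>m\<bar> \<le> m^2 / K + K\<close> after taking
    expectations.\<close>
  define K where "K = sqrt B"
  have K0: "0 < K" and KK: "K * K = B" using B0 by (auto simp: K_def)
  have IH: "Exq k (\<lambda>X. (M k X)\<^sup>2) \<le> B" using step by (simp add: B_def)
  have "Exq (Suc k) (\<lambda>X. (M (Suc k) X)\<^sup>2) = Exq k (\<lambda>X. (1 + tilt (rr k X) (c (Suc k))) / 2 * (M (Suc k) (X(Suc k := 1)))\<^sup>2
       + (1 - tilt (rr k X) (c (Suc k))) / 2 * (M (Suc k) (X(Suc k := - 1)))\<^sup>2)"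
    using step by (intro Ex_Suc) auto
  also have "\<dots> \<le> Exq k (\<lambda>X. (M k X)\<^sup>2 + (2 * lam * f\<^sup>2 / K * (M k X)\<^sup>2 + (2 * lam * f\<^sup>2 * K + 4 * f\<^sup>2)))"
  proof (rule Ex_mono)
    fix X assume X: "X \<in> set_pmf (Q k)"
    define r \<rho> m where "r = rr k X" and "\<rho> = tilt (rr k X) (c (Suc k))" and "m = M k X"
    have r: "\<bar>r\<bar> \<le> 1" unfolding r_def using rr_abs[OF X] step by auto
    have h: "0 \<le> lam * f" "lam * f \<le> 1/8" using c_bounds[of "Suc k"] c_Suc[of k] step by (simp_all add: f_def)
    have \<rho>: "\<bar>\<rho>\<bar> \<le> 1" "0 \<le> \<rho> - r" "\<rho> - r \<le> 2 * (lam * f)"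
      using tilt_bounds(1,4,5)[OF r h] c_Suc[of k] step by (simp_all add: \<rho>_def r_def f_def)
    have M1: "M (Suc k) (X(Suc k := 1)) = m + f * (1 - r)" "M (Suc k) (X(Suc k := - 1)) = m + f * (- 1 - r)"
      using M_step[of k X 1] M_step[of k X "- 1"] step by (simp_all add: m_def f_def r_def)
    have eq: "(1 + \<rho>) / 2 * (m + f * (1 - r))\<^sup>2 + (1 - \<rho>) / 2 * (m + f * (- 1 - r))\<^sup>2
      = m\<^sup>2 + 2 * (m * f * (\<rho> - r)) + f\<^sup>2 * (1 - 2 * (\<rho> * r) + r\<^sup>2)"
      by (simp add: power2_eq_square field_simps)
    have "m * f * (\<rho> - r) \<le> \<bar>m\<bar> * (f * (\<rho> - r))"
      using f0 \<rho> by (simp add: mult.assoc mult_right_mono)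
    also have "\<dots> \<le> \<bar>m\<bar> * (f * (2 * (lam * f)))" using \<rho> f0 by (intro mult_left_mono) auto
    finally have a: "m * f * (\<rho> - r) \<le> 2 * lam * f\<^sup>2 * \<bar>m\<bar>" by (simp add: power2_eq_square mult_ac)
    have "2 * \<bar>m\<bar> \<le> m\<^sup>2 / K + K"
    proof -
      have "0 \<le> (\<bar>m\<bar> - K)\<^sup>2" by simp
      then have "2 * \<bar>m\<bar> * K \<le> m\<^sup>2 + K * K" unfolding power2_diff power2_abs by (simp add: power2_eq_square)
      then show ?thesis using K0 by (simp add: field_simps)
    qed
    then have "(2 * lam * f\<^sup>2) * (2 * \<bar>m\<bar>) \<le> (2 * lam * f\<^sup>2) * (m\<^sup>2 / K + K)" using lam by (intro mult_left_mono) auto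
    then have b: "2 * (2 * lam * f\<^sup>2 * \<bar>m\<bar>) \<le> 2 * lam * f\<^sup>2 / K * m\<^sup>2 + 2 * lam * f\<^sup>2 * K"
      by (simp add: algebra_simps)
    have "\<bar>\<rho> * r\<bar> \<le> 1 * 1" unfolding abs_mult using \<rho> r by (intro mult_mono) auto
    moreover have "r\<^sup>2 \<le> 1" using r by (simp add: abs_square_le_1)
    ultimately have "1 - 2 * (\<rho> * r) + r\<^sup>2 \<le> 4" by (simp add: abs_le_iff)
    then have "f\<^sup>2 * (1 - 2 * (\<rho> * r) + r\<^sup>2) \<le> f\<^sup>2 * 4" by (intro mult_left_mono) auto
    then show "(1 + tilt (rr k X) (c (Suc k))) / 2 * (M (Suc k) (X(Suc k := 1)))\<^sup>2
       + (1 - tilt (rr k X) (c (Suc k))) / 2 * (M (Suc k) (X(Suc k := - 1)))\<^sup>2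
       \<le> (M k X)\<^sup>2 + (2 * lam * f\<^sup>2 / K * (M k X)\<^sup>2 + (2 * lam * f\<^sup>2 * K + 4 * f\<^sup>2))"
      unfolding M1 \<rho>_def[symmetric] eq unfolding m_def[symmetric] using a b by linarith
  qed
  also have "\<dots> = Exq k (\<lambda>X. (M k X)\<^sup>2) + (2 * lam * f\<^sup>2 / K * Exq k (\<lambda>X. (M k X)\<^sup>2) + (2 * lam * f\<^sup>2 * K + 4 * f\<^sup>2))"
    by (simp only: Ex_lin)
  also have "\<dots> \<le> B + (2 * lam * f\<^sup>2 / K * B + (2 * lam * f\<^sup>2 * K + 4 * f\<^sup>2))"
    using IH lam K0 by (intro add_mono mult_left_mono) auto
  also have "2 * lam * f\<^sup>2 / K * B = 2 * lam * f\<^sup>2 * K" using K0 KK by (simp add: field_simps)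
  finally have F: "Exq (Suc k) (\<lambda>X. (M (Suc k) X)\<^sup>2) \<le> B + f\<^sup>2 * (4 * (lam * K) + 4)"
    by (simp add: algebra_simps)
  define u where "u = lam\<^sup>2 * tau k"
  have u0: "0 \<le> u" using tk by (simp add: u_def)
  have "lam * K = 4 * sqrt (u + u\<^sup>2)"
  proof -
    have "lam * K = sqrt (lam\<^sup>2 * B)" using lam by (simp add: K_def real_sqrt_mult)
    also have "lam\<^sup>2 * B = 16 * (u + u\<^sup>2)" by (simp add: B_def u_def power2_eq_square algebra_simps)
    also have "sqrt (16 * (u + u\<^sup>2)) = 4 * sqrt (u + u\<^sup>2)" unfolding real_sqrt_mult by simp
    finally show ?thesis .
  qed
  \<comment> \<open>\<open>16 + 32 * u\<close> is the derivative of
    \<open>16 * (tau + lam^2 * tau^2)\<close> in \<open>tau\<close>, so the induction closes; the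
    factor 16 leaves room for the estimate.\<close>
  then have "4 * (lam * K) + 4 \<le> 16 + 32 * u" using second_moment_poly[OF u0] by linarith
  then have "f\<^sup>2 * (4 * (lam * K) + 4) \<le> f\<^sup>2 * (16 + 32 * u)" by (intro mult_left_mono) auto
  also have "B + f\<^sup>2 * (16 + 32 * u) \<le> 16 * (tau (Suc k) + lam\<^sup>2 * (tau (Suc k))\<^sup>2)"
  proof -
    have "16 * (tau (Suc k) + lam\<^sup>2 * (tau (Suc k))\<^sup>2) = B + f\<^sup>2 * (16 + 32 * u) + 16 * (lam\<^sup>2 * (f\<^sup>2)\<^sup>2)"
      by (simp add: tau_Suc B_def u_def f_def[symmetric] power2_eq_square algebra_simps)
    moreover have "0 \<le> lam\<^sup>2 * (f\<^sup>2)\<^sup>2" by simp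
    ultimately show ?thesis by linarith
  qed
  finally show ?case using F by linarith
qed

definition "rho k = 64 * (tau k + lam\<^sup>2 * (tau k)\<^sup>2) / (real k)\<^sup>2"

lemma Ex_drift_sq:
  assumes "2 \<le> k" "k < n"
  shows "Exq k (\<lambda>X. (e (Suc k))\<^sup>2 * (rr k X)\<^sup>2) \<le> rho k"
proof -
  have "Exq k (\<lambda>X. (e (Suc k))\<^sup>2 * (rr k X)\<^sup>2) \<le> Exq k (\<lambda>X. 4 / (real k)\<^sup>2 * (M k X)\<^sup>2)"
    using step_drift_sq[OF assms] by (intro Ex_mono) simp
  also have "\<dots> = 4 / (real k)\<^sup>2 * Exq k (\<lambda>X. (M k X)\<^sup>2)" by (simp only: Ex_lin)
  also have "\<dots> \<le> 4 / (real k)\<^sup>2 * (16 * (tau k + lam\<^sup>2 * (tau k)\<^sup>2))"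
    using second_moment[of k] assms by (intro mult_left_mono) auto
  finally show ?thesis by (simp add: rho_def)
qed

text \<open>Hardy's inequality for the sequence \<open>(e k)^2\<close>, whose averages are
  \<open>tau k / k\<close>. The order \<open>\<epsilon>^2\<close>, rather than
  \<open>\<epsilon>\<close>, is essential because this sum is later multiplied by
  \<open>lam^4\<close>.\<close>

lemma tau_hardy: "(\<Sum>k=2..<n. (tau k)\<^sup>2 / (real k)\<^sup>2) \<le> 4 * \<epsilon>\<^sup>2"
proof -
  have "(\<Sum>k=2..<n. (tau k)\<^sup>2 / (real k)\<^sup>2) \<le> (\<Sum>k=1..n. (tau k / real k)\<^sup>2)"
    unfolding power_divide by (intro sum_mono2) auto
  also have "\<dots> \<le> 4 * (\<Sum>k=1..n. ((e k)\<^sup>2)\<^sup>2)" unfolding tau_def by (rule hardy_finite)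
  also have "(\<Sum>k=1..n. ((e k)\<^sup>2)\<^sup>2) \<le> (\<Sum>k=1..n. \<epsilon>\<^sup>2 * (e k)\<^sup>2)"
  proof (rule sum_mono)
    fix k assume "k \<in> {1..n}"
    then have "(e k)\<^sup>2 * (e k)\<^sup>2 \<le> \<epsilon>\<^sup>2 * (e k)\<^sup>2" by (intro mult_right_mono e_sq_le) auto
    then show "((e k)\<^sup>2)\<^sup>2 \<le> \<epsilon>\<^sup>2 * (e k)\<^sup>2" by (simp only: power2_eq_square[of "(e k)\<^sup>2"])
  qed
  also have "\<dots> = \<epsilon>\<^sup>2" unfolding sum_distrib_left[symmetric] e_sum by simp
  finally show ?thesis by simp
qed

text \<open>Remaining time plus a floor: at time \<open>n\<close> the test function is an indicator
  smoothed at scale \<open>sqrt (smin \<epsilon>)\<close>, and the flow never reaches its singular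
  time.\<close>

definition "tt k = 1 - tau k + smin \<epsilon>"

lemma smin_ge: "\<epsilon>\<^sup>2 \<le> smin \<epsilon>"
proof -
  have "\<epsilon>\<^sup>2 * 1 \<le> (160000 * \<epsilon>)\<^sup>2 * (- ln \<epsilon>)"
    using ln_small[OF eps_pos eps(1)] by (intro mult_mono) (auto simp: power_mult_distrib)
  then show ?thesis by (simp add: smin_def)
qed

lemma tt_Suc: "tt k = tt (Suc k) + (e (Suc k))\<^sup>2" by (simp add: tt_def tau_Suc)

lemma tt_ge: "k \<le> n \<Longrightarrow> smin \<epsilon> \<le> tt k" using tau_le_1 by (simp add: tt_def)

lemma heat_step_instance:
  assumes "2 \<le> k" "k < n" "X \<in> set_pmf (Q k)"
  shows "heat_step (e (Suc k)) (rr k X) lam \<epsilon> (tt (Suc k))"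
  using rr_abs[OF assms(3)] assms e_pos[of "Suc k"] e_le[of "Suc k"] lam eps tt_ge[of "Suc k"]
  by unfold_locales auto

text \<open>\<open>2 * lam / sqrt t \<le> lam^2 + 1 / t\<close> separates the tilt from the
  remaining time, and \<open>\<epsilon> \<le> sqrt t\<close> merges the two terms that do not
  contain \<open>r\<close>.\<close>

lemma rterm_bound:
  assumes t: "smin \<epsilon> \<le> t"
  shows "rterm \<epsilon> lam r t \<le> 7 * lam\<^sup>2 * \<epsilon> / sqrt t + r\<^sup>2 * (lam\<^sup>2 + 5 / t)"
proof -
  have "\<epsilon>\<^sup>2 \<le> t" using smin_ge t by linarith
  then have et: "\<epsilon> \<le> sqrt t" by (rule real_le_rsqrt)
  then have s0: "0 < sqrt t" using eps_pos by linarith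
  have tt: "sqrt t * sqrt t = t" using s0 by simp
  have 1: "2 * lam * r\<^sup>2 / sqrt t \<le> r\<^sup>2 * (lam\<^sup>2 + 1 / t)"
  proof -
    have "0 \<le> (lam - 1 / sqrt t)\<^sup>2" by simp
    then have "2 * lam / sqrt t \<le> lam\<^sup>2 + 1 / t" using tt by (simp add: power2_diff power_divide)
    then have "r\<^sup>2 * (2 * lam / sqrt t) \<le> r\<^sup>2 * (lam\<^sup>2 + 1 / t)" by (intro mult_left_mono) auto
    then show ?thesis by (simp add: mult_ac)
  qed
  have 2: "4 * (lam\<^sup>2 * \<epsilon>\<^sup>2) / t \<le> 4 * (lam\<^sup>2 * \<epsilon> / sqrt t)"
  proof -
    have "\<epsilon> / sqrt t \<le> 1" using et s0 by simp
    then have "4 * (lam\<^sup>2 * \<epsilon> / sqrt t) * (\<epsilon> / sqrt t) \<le> 4 * (lam\<^sup>2 * \<epsilon> / sqrt t) * 1"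
      using eps_pos s0 by (intro mult_left_mono) auto
    moreover have "4 * (lam\<^sup>2 * \<epsilon> / sqrt t) * (\<epsilon> / sqrt t) = 4 * (lam\<^sup>2 * \<epsilon>\<^sup>2) / (sqrt t * sqrt t)"
      by (simp add: power2_eq_square)
    ultimately show ?thesis unfolding tt by simp
  qed
  define A B C D F where "A = r\<^sup>2 * lam\<^sup>2" and "B = r\<^sup>2 / t" and "C = lam\<^sup>2 * \<epsilon> / sqrt t"
    and "D = 2 * lam * r\<^sup>2 / sqrt t" and "F = 4 * (lam\<^sup>2 * \<epsilon>\<^sup>2) / t"
  have 1: "D \<le> A + B" using 1 by (simp add: A_def B_def D_def distrib_left)
  have 2: "F \<le> 4 * C" using 2 by (simp add: F_def C_def)
  have "rterm \<epsilon> lam r t = D + 3 * C + 4 * B + F"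
    by (simp add: rterm_def A_def B_def C_def D_def F_def add_divide_distrib distrib_left)
  also have "\<dots> \<le> 7 * C + (A + 5 * B)" using 1 2 by linarith
  also have "\<dots> = 7 * lam\<^sup>2 * \<epsilon> / sqrt t + r\<^sup>2 * (lam\<^sup>2 + 5 / t)"
    by (simp add: A_def B_def C_def distrib_left mult_ac)
  finally show ?thesis .
qed

end

text \<open>Uniform in \<open>x\<close> because
  \<open>\<bar>x\<bar> * std_normal_density (\<xi> * x)\<close> is bounded for
  \<open>\<xi> \<ge> 1/2\<close>. It is needed since the flow does not start at time exactly
  1.\<close>

lemma Phi_scale:
  assumes c: "1/2 \<le> c"
  shows "\<bar>Phi (c * x) - Phi x\<bar> \<le> 2 * \<bar>c - 1\<bar>"
proof -
  have D: "((\<lambda>c. Phi (c * x)) has_real_derivative std_normal_density (c * x) * x) (at c)" for c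
    by (rule DERIV_chain2[OF Phi_deriv]) (auto intro!: derivative_eq_intros)
  have B: "\<bar>std_normal_density (\<xi> * x) * x\<bar> \<le> 2" if \<xi>: "1/2 \<le> \<xi>" for \<xi>
  proof -
    have "\<bar>\<xi> * x\<bar> * std_normal_density (\<xi> * x) \<le> \<bar>\<xi> * x\<bar> * exp (- \<bar>\<xi> * x\<bar>\<^sup>2 / 2)"
      using std_normal_density_le[of "\<xi> * x"] exp_ge_zero[of "- (\<xi> * x)\<^sup>2 / 2"]
      unfolding power2_abs by (intro mult_left_mono) (linarith, simp)
    also have "\<dots> \<le> 1" by (rule gauss_poly3)
    finally have "\<xi> * (\<bar>x\<bar> * std_normal_density (\<xi> * x)) \<le> 1" using \<xi> by (simp add: abs_mult mult.assoc)
    moreover have "1/2 * (\<bar>x\<bar> * std_normal_density (\<xi> * x)) \<le> \<xi> * (\<bar>x\<bar> * std_normal_density (\<xi> * x))"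
      using \<xi> by (intro mult_right_mono) auto
    ultimately show ?thesis by (simp add: abs_mult mult.commute)
  qed
  have *: "\<bar>Phi (b * x) - Phi (a * x)\<bar> \<le> 2 * (b - a)" if ab: "1/2 \<le> a" "a < b" for a b
  proof -
    obtain z where z: "a < z" "z < b" "Phi (b * x) - Phi (a * x) = (b - a) * (std_normal_density (z * x) * x)"
      using MVT2[OF ab(2), of "\<lambda>c. Phi (c * x)" "\<lambda>c. std_normal_density (c * x) * x"] D by blast
    have "\<bar>Phi (b * x) - Phi (a * x)\<bar> = (b - a) * \<bar>std_normal_density (z * x) * x\<bar>"
      unfolding z(3) abs_mult[of "b - a"] using ab by simp
    also have "\<dots> \<le> (b - a) * 2" using B[of z] z ab by (intro mult_left_mono) auto
    finally show ?thesis by simp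
  qed
  show ?thesis
  proof (cases c "1::real" rule: linorder_cases)
    case less
    then show ?thesis using *[of c 1] c by (simp add: abs_minus_commute)
  next
    case greater
    then show ?thesis using *[of 1 c] by simp
  qed simp
qed

section \<open>The replacement argument along the whole chain\<close>

context tilted_chain
begin

definition "u b k X = Phi ((Y k X - b) / sqrt (tt k))"
definition "g b k X = ell \<epsilon> (tt k) * psi (wid \<epsilon> (tt k)) (Y k X - b)"
definition "inc k = 641 * (\<epsilon> * (e (Suc k))\<^sup>2 + 7 * lam\<^sup>2 * \<epsilon> * ((e (Suc k))\<^sup>2 / sqrt (tt (Suc k))) + (lam\<^sup>2 + 5 / tt (Suc k)) * rho k)"

text \<open>\<open>640 = 20 * 32\<close>: times \<open>640 * \<epsilon>\<close>, the surplus
  \<open>1/32\<close> of the barrier cancels the local error \<open>20 * \<epsilon>\<close> of the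
  distribution function exactly. The remaining errors occur once in \<open>u\<close> and 640 times
  in the barrier, hence 641 in \<open>inc\<close>.\<close>

lemma one_step:
  assumes k: "2 \<le> k" "k < n"
  shows "Exq (Suc k) (u b (Suc k)) + 640 * \<epsilon> * Exq (Suc k) (g b (Suc k)) \<le> Exq k (u b k) + 640 * \<epsilon> * Exq k (g b k) + inc k"
    "Exq k (u b k) - 640 * \<epsilon> * Exq k (g b k) - inc k \<le> Exq (Suc k) (u b (Suc k)) - 640 * \<epsilon> * Exq (Suc k) (g b (Suc k))"
proof -
  define f t where "f = e (Suc k)" and "t = tt (Suc k)"
  define U V where "U X = twopt f (rr k X) (lam * f) (\<lambda>d. Phi ((Y k X - b + d) / sqrt t))"
    and "V X = ell \<epsilon> t * twopt f (rr k X) (lam * f) (\<lambda>d. psi (wid \<epsilon> t) (Y k X - b + d))" for X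
  define W where "W X = f\<^sup>2 * (641 * (\<epsilon> + 7 * lam\<^sup>2 * \<epsilon> / sqrt t)) + 641 * (lam\<^sup>2 + 5 / t) * (f\<^sup>2 * (rr k X)\<^sup>2)" for X
  have tk: "tt k = t + f\<^sup>2" unfolding t_def f_def by (rule tt_Suc)
  have E1: "Exq (Suc k) (u b (Suc k)) = Exq k U"
    unfolding u_def[abs_def] U_def[abs_def] f_def t_def
    using Ex_step[OF k, of "\<lambda>y. Phi ((y - b) / sqrt (tt (Suc k)))"] by (simp add: algebra_simps)
  have E2: "Exq (Suc k) (g b (Suc k)) = Exq k V"
    unfolding g_def[abs_def] V_def[abs_def] f_def t_def
    using Ex_step[OF k, of "\<lambda>y. psi (wid \<epsilon> (tt (Suc k))) (y - b)"] by (simp add: Ex_lin algebra_simps)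
  have t0: "0 < t" "smin \<epsilon> \<le> t" using tt_ge[of "Suc k"] k smin_pos[OF eps_pos] eps by (auto simp: t_def)
  have pt: "U X + 640 * \<epsilon> * V X \<le> u b k X + 640 * \<epsilon> * g b k X + W X"
    "u b k X - 640 * \<epsilon> * g b k X - W X \<le> U X - 640 * \<epsilon> * V X" if X: "X \<in> set_pmf (Q k)" for X
  proof -
    have inst: "heat_step f (rr k X) lam \<epsilon> t" using heat_step_instance[OF k X] by (simp only: f_def t_def)
    interpret hs: heat_step f "rr k X" lam \<epsilon> t "Y k X - b" by (rule inst)
    define P where "P = (1 + hs.Z\<^sup>2) * psi hs.T (Y k X - b) / hs.T"
    define R where "R = rterm \<epsilon> lam (rr k X) t"
    have s1: "\<bar>U X - u b k X\<bar> \<le> f\<^sup>2 * (20 * (\<epsilon> * P) + \<epsilon> + R)"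
    proof -
      have "20 * \<epsilon> * (1 + hs.Z\<^sup>2) * psi hs.T (Y k X - b) / hs.T = 20 * (\<epsilon> * P)" by (simp add: P_def)
      then show ?thesis using hs.step_cdf unfolding U_def u_def tk hs.h_def R_def by simp
    qed
    have s2: "V X \<le> g b k X - f\<^sup>2 / 32 * P + f\<^sup>2 + f\<^sup>2 * R / \<epsilon>"
    proof -
      have "(1 + hs.Z\<^sup>2) * psi hs.T (Y k X - b) / hs.T = P" by (simp add: P_def)
      then show ?thesis
        using hs.step_bump unfolding V_def g_def tk hs.h_def R_def hs.l_def hs.l'_def hs.T'_def hs.T_def by simp
    qed
    have "640 * \<epsilon> * V X \<le> 640 * \<epsilon> * (g b k X - f\<^sup>2 / 32 * P + f\<^sup>2 + f\<^sup>2 * R / \<epsilon>)"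
      using s2 eps_pos by (intro mult_left_mono) auto
    also have "\<dots> = 640 * \<epsilon> * g b k X - 20 * (f\<^sup>2 * (\<epsilon> * P)) + 640 * (f\<^sup>2 * \<epsilon>) + 640 * (f\<^sup>2 * R)"
      using eps_pos by (simp add: algebra_simps)
    finally have s3: "640 * \<epsilon> * V X \<le> 640 * \<epsilon> * g b k X - 20 * (f\<^sup>2 * (\<epsilon> * P)) + 640 * (f\<^sup>2 * \<epsilon>) + 640 * (f\<^sup>2 * R)" .
    have s1': "\<bar>U X - u b k X\<bar> \<le> 20 * (f\<^sup>2 * (\<epsilon> * P)) + f\<^sup>2 * \<epsilon> + f\<^sup>2 * R"
      using s1 by (simp add: distrib_left mult.left_commute)
    have "R \<le> 7 * lam\<^sup>2 * \<epsilon> / sqrt t + (rr k X)\<^sup>2 * (lam\<^sup>2 + 5 / t)"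
      unfolding R_def using t0 by (intro rterm_bound) auto
    then have "f\<^sup>2 * R \<le> f\<^sup>2 * (7 * lam\<^sup>2 * \<epsilon> / sqrt t + (rr k X)\<^sup>2 * (lam\<^sup>2 + 5 / t))" by (intro mult_left_mono) auto
    also have "\<dots> = f\<^sup>2 * (7 * lam\<^sup>2 * \<epsilon> / sqrt t) + (lam\<^sup>2 + 5 / t) * (f\<^sup>2 * (rr k X)\<^sup>2)"
      by (simp add: algebra_simps)
    finally have s4: "f\<^sup>2 * R \<le> f\<^sup>2 * (7 * lam\<^sup>2 * \<epsilon> / sqrt t) + (lam\<^sup>2 + 5 / t) * (f\<^sup>2 * (rr k X)\<^sup>2)" .
    have W: "W X = 641 * (f\<^sup>2 * \<epsilon>) + 641 * (f\<^sup>2 * (7 * lam\<^sup>2 * \<epsilon> / sqrt t)) + 641 * ((lam\<^sup>2 + 5 / t) * (f\<^sup>2 * (rr k X)\<^sup>2))"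
      by (simp add: W_def algebra_simps)
    show "U X + 640 * \<epsilon> * V X \<le> u b k X + 640 * \<epsilon> * g b k X + W X"
      "u b k X - 640 * \<epsilon> * g b k X - W X \<le> U X - 640 * \<epsilon> * V X"
      using s1' s3 s4 unfolding W by linarith+
  qed
  have EW: "Exq k W \<le> inc k"
  proof -
    have "Exq k W = f\<^sup>2 * (641 * (\<epsilon> + 7 * lam\<^sup>2 * \<epsilon> / sqrt t)) + 641 * (lam\<^sup>2 + 5 / t) * Exq k (\<lambda>X. f\<^sup>2 * (rr k X)\<^sup>2)"
      unfolding W_def[abs_def] by (simp only: Ex_lin)
    also have "\<dots> \<le> f\<^sup>2 * (641 * (\<epsilon> + 7 * lam\<^sup>2 * \<epsilon> / sqrt t)) + 641 * (lam\<^sup>2 + 5 / t) * rho k"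
      using Ex_drift_sq[OF k] t0 unfolding f_def[symmetric] by (intro add_left_mono mult_left_mono) auto
    also have "\<dots> = inc k" by (simp add: inc_def f_def t_def algebra_simps)
    finally show ?thesis .
  qed
  have "Exq k (\<lambda>X. U X + 640 * \<epsilon> * V X) \<le> Exq k (\<lambda>X. u b k X + 640 * \<epsilon> * g b k X + W X)"
    by (rule Ex_mono) (rule pt(1))
  then show "Exq (Suc k) (u b (Suc k)) + 640 * \<epsilon> * Exq (Suc k) (g b (Suc k)) \<le> Exq k (u b k) + 640 * \<epsilon> * Exq k (g b k) + inc k"
    unfolding E1 E2 using EW by (simp only: Ex_lin)
  have "Exq k (\<lambda>X. u b k X - 640 * \<epsilon> * g b k X - W X) \<le> Exq k (\<lambda>X. U X - 640 * \<epsilon> * V X)"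
    by (rule Ex_mono) (rule pt(2))
  then show "Exq k (u b k) - 640 * \<epsilon> * Exq k (g b k) - inc k \<le> Exq (Suc k) (u b (Suc k)) - 640 * \<epsilon> * Exq (Suc k) (g b (Suc k))"
    unfolding E1 E2 using EW by (simp only: Ex_lin)
qed

lemma all_steps:
  assumes "2 \<le> k" "k \<le> n"
  shows "Exq k (u b k) + 640 * \<epsilon> * Exq k (g b k) \<le> Exq 2 (u b 2) + 640 * \<epsilon> * Exq 2 (g b 2) + (\<Sum>j=2..<k. inc j)"
    "Exq 2 (u b 2) - 640 * \<epsilon> * Exq 2 (g b 2) - (\<Sum>j=2..<k. inc j) \<le> Exq k (u b k) - 640 * \<epsilon> * Exq k (g b k)"
proof -
  have "Exq k (u b k) + 640 * \<epsilon> * Exq k (g b k) \<le> Exq 2 (u b 2) + 640 * \<epsilon> * Exq 2 (g b 2) + (\<Sum>j=2..<k. inc j) \<and>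
    Exq 2 (u b 2) - 640 * \<epsilon> * Exq 2 (g b 2) - (\<Sum>j=2..<k. inc j) \<le> Exq k (u b k) - 640 * \<epsilon> * Exq k (g b k)"
    using assms
  proof (induction k rule: dec_induct)
    case (step k)
    have "(\<Sum>j=2..<Suc k. inc j) = (\<Sum>j=2..<k. inc j) + inc k" using step by simp
    then show ?case using step one_step[of k b] by linarith
  qed simp
  then show "Exq k (u b k) + 640 * \<epsilon> * Exq k (g b k) \<le> Exq 2 (u b 2) + 640 * \<epsilon> * Exq 2 (g b 2) + (\<Sum>j=2..<k. inc j)"
    "Exq 2 (u b 2) - 640 * \<epsilon> * Exq 2 (g b 2) - (\<Sum>j=2..<k. inc j) \<le> Exq k (u b k) - 640 * \<epsilon> * Exq k (g b k)"
    by auto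
qed

lemma g_nonneg: "k \<le> n \<Longrightarrow> 0 \<le> g b k X"
proof -
  assume "k \<le> n"
  then have t: "smin \<epsilon> \<le> tt k" by (rule tt_ge)
  have s: "0 < smin \<epsilon>" using smin_pos[OF eps_pos] eps by simp
  have "0 \<le> ln (tt k / smin \<epsilon>)" using t s by simp
  then have l: "0 \<le> ell \<epsilon> (tt k)" by (simp add: ell_def)
  then have "0 \<le> wid \<epsilon> (tt k)" using t s by (simp add: wid_def)
  then show ?thesis using l by (simp add: g_def psi_def)
qed

definition "L = - ln \<epsilon>"

definition "EL = \<epsilon> * L"

lemma L1: "1 \<le> L" using ln_small[OF eps_pos eps(1)] by (simp add: L_def)

lemma EL: "\<epsilon> \<le> EL" "0 < EL"
proof -
  have "\<epsilon> * 1 \<le> \<epsilon> * L" using eps_pos L1 by (intro mult_left_mono) auto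
  then show "\<epsilon> \<le> EL" "0 < EL" using eps_pos by (simp_all add: EL_def)
qed

lemma tt2: "1/2 \<le> tt 2" "tt 2 \<le> 2" "\<bar>1 - tt 2\<bar> \<le> 2 * \<epsilon>\<^sup>2 + smin \<epsilon>"
proof -
  have "\<epsilon>\<^sup>2 \<le> (1/100)\<^sup>2" using eps eps_pos by (intro power_mono) auto
  then have e2: "\<epsilon>\<^sup>2 \<le> 1/10000" by (simp add: power2_eq_square)
  have s: "0 < smin \<epsilon>" using smin_pos[OF eps_pos] eps by simp
  have "0 \<le> \<epsilon>\<^sup>2" by simp
  then show "1/2 \<le> tt 2" "tt 2 \<le> 2" "\<bar>1 - tt 2\<bar> \<le> 2 * \<epsilon>\<^sup>2 + smin \<epsilon>"
    using tau_2 tau_nonneg[of 2] e2 s eps(2) unfolding tt_def by (auto simp: abs_le_iff)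
qed

lemma smin_le: "smin \<epsilon> \<le> 25600000000 * EL"
proof -
  have "smin \<epsilon> = 25600000000 * (\<epsilon> * EL)" by (simp add: smin_def L_def EL_def power2_eq_square)
  moreover have "\<epsilon> * EL \<le> 1 * EL" using eps EL by (intro mult_right_mono) auto
  ultimately show ?thesis by linarith
qed

text \<open>After two steps the chain is still within \<open>3 * \<epsilon>\<close> of 0, and the
  remaining time differs from 1 by \<open>O(\<epsilon>^2)\<close> and the floor
  \<open>smin \<epsilon>\<close>. The large constant is essentially \<open>4 * 160000^2\<close>,
  from the floor.\<close>

lemma start_u: "\<bar>Exq 2 (u b 2) - Phi (- b)\<bar> \<le> 110000000000 * EL"
proof -
  note eL = EL(1)
  have ee: "\<epsilon>\<^sup>2 \<le> \<epsilon>" using eps eps_pos by (simp add: power2_eq_square mult_left_le)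
  have s0: "1/2 \<le> sqrt (tt 2)" using tt2(1) by (intro real_le_rsqrt) (auto simp: power2_eq_square)
  have s1: "sqrt (tt 2) \<le> 2" using tt2(2) by (intro real_le_lsqrt) auto
  define cc where "cc = 1 / sqrt (tt 2)"
  have "1/2 \<le> 1 / z \<and> 1 / z \<le> 2" if "1/2 \<le> z" "z \<le> 2" for z :: real
    using that by (auto simp: field_simps)
  from this[OF s0 s1] have cc: "1/2 \<le> cc" "cc \<le> 2" unfolding cc_def by auto
  have "\<bar>cc - 1\<bar> \<le> 2 * \<bar>1 - tt 2\<bar>"
  proof -
    define z where "z = sqrt (tt 2)"
    have z: "1/2 \<le> z" "z * z = tt 2" using s0 tt2 by (auto simp: z_def)
    have "(1 - tt 2) / (z * (1 + z)) = (1 - z) * (1 + z) / (z * (1 + z))"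
      unfolding z(2)[symmetric] by (simp add: algebra_simps)
    also have "\<dots> = (1 - z) / z" using z by simp
    also have "\<dots> = cc - 1" using z by (simp add: cc_def z_def[symmetric] diff_divide_distrib)
    finally have "cc - 1 = (1 - tt 2) / (z * (1 + z))" by simp
    then have "\<bar>cc - 1\<bar> = \<bar>1 - tt 2\<bar> / (z * (1 + z))" using z by (simp add: abs_mult)
    also have "\<dots> \<le> \<bar>1 - tt 2\<bar> / (1/2)"
    proof (intro divide_left_mono)
      have "1/2 * 1 \<le> z * (1 + z)" using z by (intro mult_mono) auto
      then show "1/2 \<le> z * (1 + z)" by simp
    qed (use z in auto)
    finally show ?thesis by simp
  qed
  moreover have "a \<le> 51200000004 * EL" if "a \<le> 2 * d" "d \<le> 2 * \<epsilon>\<^sup>2 + smin \<epsilon>" for a d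
    using that smin_le eL ee by linarith
  ultimately have c1: "\<bar>cc - 1\<bar> \<le> 51200000004 * EL" using tt2(3) by blast
  have pt: "\<bar>u b 2 X - Phi (- b)\<bar> \<le> 110000000000 * EL" if X: "X \<in> set_pmf (Q 2)" for X
  proof -
    have "\<bar>real_of_int (erw_pos X 2)\<bar> \<le> 2" using erw_pos_abs[OF supp[OF X]] by linarith
    then have "e 2 * \<bar>real_of_int (erw_pos X 2)\<bar> \<le> \<epsilon> * 2" using e_le[of 2] e_pos[of 2] n eps_pos by (intro mult_mono) auto
    then have m: "\<bar>M 2 X\<bar> \<le> 2 * \<epsilon>" using e_pos[of 2] n by (simp add: M_def abs_mult)
    have "lam * tau 2 \<le> lam * (2 * \<epsilon>\<^sup>2)" using tau_2 lam by (intro mult_left_mono) auto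
    also have "\<dots> = 2 * \<epsilon> * (lam * \<epsilon>)" by (simp add: power2_eq_square)
    also have "\<dots> \<le> 2 * \<epsilon> * (1/8)" using lam eps_pos by (intro mult_left_mono) auto
    finally have l: "lam * tau 2 \<le> \<epsilon> / 4" by simp
    have "0 \<le> lam * tau 2" using lam tau_nonneg by simp
    then have y: "\<bar>Y 2 X\<bar> \<le> 3 * \<epsilon>" unfolding Y_def using m l by (simp add: abs_le_iff)
    have eq: "(Y 2 X - b) / sqrt (tt 2) = cc * Y 2 X + cc * (- b)" by (simp add: cc_def diff_divide_distrib)
    have "\<bar>Phi (cc * Y 2 X + cc * (- b)) - Phi (cc * (- b))\<bar> \<le> \<bar>cc * Y 2 X\<bar>"
      using Phi_lipschitz[of "cc * Y 2 X + cc * (- b)" "cc * (- b)"] by simp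
    also have "\<dots> \<le> 2 * (3 * \<epsilon>)" unfolding abs_mult using y cc by (intro mult_mono) auto
    finally have 1: "\<bar>Phi (cc * Y 2 X + cc * (- b)) - Phi (cc * (- b))\<bar> \<le> 6 * \<epsilon>" by simp
    have 2: "\<bar>Phi (cc * (- b)) - Phi (- b)\<bar> \<le> 2 * \<bar>cc - 1\<bar>" by (rule Phi_scale[OF cc(1)])
    have "\<bar>u b 2 X - Phi (- b)\<bar> \<le> \<bar>Phi (cc * Y 2 X + cc * (- b)) - Phi (cc * (- b))\<bar> + \<bar>Phi (cc * (- b)) - Phi (- b)\<bar>"
      unfolding u_def eq by (rule order_trans[OF _ abs_triangle_ineq]) simp
    moreover have "a1 \<le> 110000000000 * EL" if "a1 \<le> a2 + a3" "a2 \<le> 6 * \<epsilon>" "a3 \<le> 2 * a4" "a4 \<le> 51200000004 * EL" for a1 a2 a3 a4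
      using that eL EL(2) by linarith
    ultimately show ?thesis using 1 2 c1 by blast
  qed
  have "Exq 2 (u b 2) \<le> Exq 2 (\<lambda>X. Phi (- b) + 110000000000 * EL)"
    by (rule Ex_mono) (use pt in \<open>force simp: abs_le_iff\<close>)
  moreover have "Exq 2 (\<lambda>X. Phi (- b) - 110000000000 * EL) \<le> Exq 2 (u b 2)"
    by (rule Ex_mono) (use pt in \<open>force simp: abs_le_iff\<close>)
  ultimately show ?thesis unfolding Ex_lin by (simp add: abs_le_iff)
qed

text \<open>The initial barrier is of the order of its logarithm, as the kernel is bounded at times
  near 1. Multiplied by \<open>\<epsilon>\<close> it contributes the logarithmic factor of the final
  rate.\<close>

lemma start_g: "Exq 2 (g b 2) \<le> 10 * L"
proof -
  have s0: "1/2 \<le> sqrt (tt 2)" using tt2(1) by (intro real_le_rsqrt) (auto simp: power2_eq_square)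
  have s: "0 < smin \<epsilon>" using smin_pos[OF eps_pos] eps by simp
  have "tt 2 / smin \<epsilon> \<le> 2 / \<epsilon>\<^sup>2" using tt2 smin_ge eps_pos by (intro frac_le) auto
  then have "ln (tt 2 / smin \<epsilon>) \<le> ln (2 / \<epsilon>\<^sup>2)" using s tt2 eps_pos by (subst ln_le_cancel_iff) auto
  also have "\<dots> = ln 2 + 2 * L" using eps_pos by (simp add: ln_div L_def ln_realpow)
  also have "\<dots> \<le> 1 + 2 * L" using ln_2_less_1 by simp
  finally have l: "ell \<epsilon> (tt 2) \<le> 5 * L" using L1 by (simp add: ell_def)
  have l0: "2 \<le> ell \<epsilon> (tt 2)" using tt_ge[of 2] n s by (simp add: ell_def)
  have "tt 2 \<le> wid \<epsilon> (tt 2)" using l0 tt2 by (simp add: wid_def)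
  then have "sqrt (tt 2) \<le> sqrt (wid \<epsilon> (tt 2))" by (rule real_sqrt_le_mono)
  with s0 have w: "1/2 \<le> sqrt (wid \<epsilon> (tt 2))" by linarith
  have pt: "g b 2 X \<le> 10 * L" for X
  proof -
    have "psi (wid \<epsilon> (tt 2)) (Y 2 X - b) \<le> 1 / (1/2)"
      unfolding psi_def using w \<open>tt 2 \<le> wid \<epsilon> (tt 2)\<close> tt2 by (intro frac_le) auto
    then have "g b 2 X \<le> (5 * L) * 2"
      unfolding g_def using l l0 L1 \<open>tt 2 \<le> wid \<epsilon> (tt 2)\<close> tt2 by (intro mult_mono) (auto simp: psi_def)
    then show ?thesis by simp
  qed
  have "Exq 2 (g b 2) \<le> Exq 2 (\<lambda>X. 10 * L)" by (rule Ex_mono) (rule pt)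
  then show ?thesis unfolding Ex_lin .
qed

text \<open>Comparison with the integral of \<open>1 / sqrt t\<close>, by telescoping. Since
  \<open>e^2 \<le> smin \<epsilon>\<close>, remaining times at most double over one step backwards,
  so \<open>a + b \<le> 3 * a\<close>.\<close>

lemma sqrt_sum: "(\<Sum>k=2..<n. (e (Suc k))\<^sup>2 / sqrt (tt (Suc k))) \<le> 6"
proof -
  have *: "(e (Suc k))\<^sup>2 / sqrt (tt (Suc k)) \<le> 3 * (sqrt (tt k) - sqrt (tt (Suc k)))" if k: "2 \<le> k" "k < n" for k
  proof -
    define a b where "a = sqrt (tt (Suc k))" and "b = sqrt (tt k)"
    have s: "0 < smin \<epsilon>" using smin_pos[OF eps_pos] eps by simp
    have t: "smin \<epsilon> \<le> tt (Suc k)" "smin \<epsilon> \<le> tt k" using k by (auto intro: tt_ge)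
    have a: "0 < a" "a * a = tt (Suc k)" and b: "0 < b" "b * b = tt k" using t s by (auto simp: a_def b_def)
    have "(e (Suc k))\<^sup>2 \<le> tt (Suc k)" using e_sq_le[of "Suc k"] k smin_ge t by linarith
    then have "b * b \<le> 2 * (a * a)" using a b tt_Suc[of k] by linarith
    then have "b\<^sup>2 \<le> (2 * a)\<^sup>2" using mult_pos_pos[OF a(1) a(1)] by (simp add: power2_eq_square)
    then have ba: "b \<le> 2 * a" by (rule power2_le_imp_le) (use a(1) in simp)
    have ab: "a \<le> b" unfolding a_def b_def using tt_Suc[of k] by simp
    have "(e (Suc k))\<^sup>2 = (b - a) * (b + a)" using a b tt_Suc[of k] by (simp add: algebra_simps)
    also have "\<dots> \<le> (b - a) * (3 * a)" using ab ba by (intro mult_left_mono) auto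
    finally show ?thesis using a unfolding a_def[symmetric] b_def[symmetric] by (simp add: field_simps)
  qed
  have "(\<Sum>k=2..<n. (e (Suc k))\<^sup>2 / sqrt (tt (Suc k))) \<le> (\<Sum>k=2..<n. 3 * (sqrt (tt k) - sqrt (tt (Suc k))))"
    using * by (intro sum_mono) auto
  also have "\<dots> = 3 * (sqrt (tt 2) - sqrt (tt n))"
    unfolding sum_distrib_left[symmetric] using n by (subst sum_Suc_diff'[where f="\<lambda>k. - sqrt (tt k)", simplified, symmetric]) auto
  also have "\<dots> \<le> 6"
  proof -
    have "sqrt (tt 2) \<le> 2" using tt2(2) by (intro real_le_lsqrt) auto
    moreover have "0 \<le> sqrt (tt n)" using tt_ge[of n] smin_pos[OF eps_pos] eps by simp
    ultimately show ?thesis unfolding right_diff_distrib by linarith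
  qed
  finally show ?thesis .
qed

end

text \<open>\<open>m\<close> is the moment generating function of the centred sign, so its logarithm
  is \<open>(1 - r^2) * h^2 / 2\<close> up to \<open>O(h^3)\<close>. For the upper bound the
  variance loss \<open>r^2\<close> may be dropped; the lower bound has to keep it.\<close>

lemma norm_factor_bounds:
  fixes r h :: real
  assumes r: "\<bar>r\<bar> \<le> 1" and h: "0 \<le> h" "h \<le> 1/8"
  defines "m \<equiv> exp (- (h * r)) * (cosh h + r * sinh h)"
  shows "m \<le> exp (h\<^sup>2 / 2 + 8 * h ^ 3)" "exp (h\<^sup>2 / 2 - r\<^sup>2 * h\<^sup>2 / 2 - 9 * h ^ 3) \<le> m"
proof -
  have w: "0 \<le> (1 + r) / 2" "0 \<le> (1 - r) / 2" using r by (auto simp: abs_le_iff)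
  have m: "m = (1 + r) / 2 * exp (h * (1 - r)) + (1 - r) / 2 * exp (- (h * (1 + r)))"
  proof -
    have "cosh h + r * sinh h = (1 + r) / 2 * exp h + (1 - r) / 2 * exp (- h)"
      by (simp add: cosh_def sinh_def algebra_simps add_divide_distrib diff_divide_distrib)
    moreover have "exp (- (h * r)) * exp h = exp (h * (1 - r))" "exp (- (h * r)) * exp (- h) = exp (- (h * (1 + r)))"
      by (simp_all add: exp_add[symmetric] algebra_simps)
    ultimately show ?thesis unfolding m_def by (simp only: distrib_left mult.left_commute[of "exp (- (h * r))"])
  qed
  have h3: "h ^ 3 \<ge> 0" "h\<^sup>2 \<ge> 0" using h by auto
  have b: "\<bar>exp x - (1 + x + x\<^sup>2 / 2)\<bar> \<le> 8 * h ^ 3" if "\<bar>x\<bar> \<le> 2 * h" for x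
  proof -
    have "\<bar>x\<bar> \<le> 1" using that h by linarith
    from exp_cubic_bound[OF this] have "\<bar>exp x - (1 + x + x\<^sup>2 / 2)\<bar> \<le> \<bar>x\<bar> ^ 3" .
    also have "\<dots> \<le> (2 * h) ^ 3" using that by (intro power_mono) auto
    finally show ?thesis by (simp add: power_mult_distrib)
  qed
  have x1: "\<bar>h * (1 - r)\<bar> \<le> 2 * h" and x2: "\<bar>- (h * (1 + r))\<bar> \<le> 2 * h"
  proof -
    have "h * \<bar>1 - r\<bar> \<le> h * 2" "h * \<bar>1 + r\<bar> \<le> h * 2" using r h by (intro mult_left_mono; simp add: abs_le_iff)+
    then show "\<bar>h * (1 - r)\<bar> \<le> 2 * h" "\<bar>- (h * (1 + r))\<bar> \<le> 2 * h" using h by (simp_all add: abs_mult)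
  qed
  define E1 E2 where "E1 = exp (h * (1 - r)) - (1 + h * (1 - r) + (h * (1 - r))\<^sup>2 / 2)"
    and "E2 = exp (- (h * (1 + r))) - (1 + - (h * (1 + r)) + (- (h * (1 + r)))\<^sup>2 / 2)"
  have E: "\<bar>E1\<bar> \<le> 8 * h ^ 3" "\<bar>E2\<bar> \<le> 8 * h ^ 3" using b[OF x1] b[OF x2] by (simp_all add: E1_def E2_def)
  define v where "v = (1 + r) / 2 * E1 + (1 - r) / 2 * E2"
  have mv: "m = 1 + (1 - r\<^sup>2) * h\<^sup>2 / 2 + v"
    unfolding m v_def E1_def E2_def by (simp add: power2_eq_square field_simps)
  have v: "\<bar>v\<bar> \<le> 8 * h ^ 3"
  proof -
    have "\<bar>v\<bar> \<le> \<bar>(1 + r) / 2 * E1\<bar> + \<bar>(1 - r) / 2 * E2\<bar>" unfolding v_def by (rule abs_triangle_ineq)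
    also have "\<dots> \<le> (1 + r) / 2 * (8 * h ^ 3) + (1 - r) / 2 * (8 * h ^ 3)"
      unfolding abs_mult abs_of_nonneg[OF w(1)] abs_of_nonneg[OF w(2)] using E w by (intro add_mono mult_left_mono) auto
    also have "\<dots> = 8 * h ^ 3" by (simp add: field_simps)
    finally show ?thesis .
  qed
  have r2: "0 \<le> r\<^sup>2" "r\<^sup>2 \<le> 1" using r by (auto simp: abs_square_le_1)
  have q: "0 \<le> (1 - r\<^sup>2) * h\<^sup>2 / 2" "(1 - r\<^sup>2) * h\<^sup>2 / 2 \<le> h\<^sup>2 / 2" using r2 h3 by (auto intro: mult_right_le_one_le mult_left_le_one_le)
  have "m \<le> 1 + (h\<^sup>2 / 2 + 8 * h ^ 3)" unfolding mv using v q by linarith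
  also have "\<dots> \<le> exp (h\<^sup>2 / 2 + 8 * h ^ 3)" by (rule exp_ge_add_one_self)
  finally show "m \<le> exp (h\<^sup>2 / 2 + 8 * h ^ 3)" .
  define w where "w = (1 - r\<^sup>2) * h\<^sup>2 / 2 + v"
  have hh: "h ^ 3 \<le> h\<^sup>2 / 8"
  proof -
    have "h * h\<^sup>2 \<le> 1/8 * h\<^sup>2" using h by (intro mult_right_mono) auto
    then show ?thesis by (simp add: power3_eq_cube power2_eq_square)
  qed
  have wb: "\<bar>w\<bar> \<le> 3/2 * h\<^sup>2" unfolding w_def abs_le_iff using v q hh by linarith
  have h2: "h\<^sup>2 \<le> 1/64" using power_mono[OF h(2) h(1), of 2] by (simp add: power2_eq_square)
  have "\<bar>ln (1 + w) - w\<bar> \<le> 2 * w\<^sup>2" using wb h2 by (intro abs_ln_one_plus_x_minus_x_bound) linarith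
  moreover have "w\<^sup>2 \<le> (3/2 * h\<^sup>2)\<^sup>2" using power_mono[OF wb, of 2] by simp
  moreover have "(3/2 * h\<^sup>2)\<^sup>2 \<le> 9/32 * h ^ 3"
  proof -
    have "h * h ^ 3 \<le> 1/8 * h ^ 3" using h by (intro mult_right_mono) auto
    then show ?thesis by (simp add: power2_eq_square power3_eq_cube)
  qed
  ultimately have "h\<^sup>2 / 2 - r\<^sup>2 * h\<^sup>2 / 2 - 9 * h ^ 3 \<le> ln (1 + w)"
  proof -
    have "(1 - r\<^sup>2) * h\<^sup>2 / 2 = h\<^sup>2 / 2 - r\<^sup>2 * h\<^sup>2 / 2" by (simp add: left_diff_distrib diff_divide_distrib)
    then have "h\<^sup>2 / 2 - r\<^sup>2 * h\<^sup>2 / 2 - 8 * h ^ 3 \<le> w" unfolding w_def using v by linarith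
    moreover assume "\<bar>ln (1 + w) - w\<bar> \<le> 2 * w\<^sup>2" "w\<^sup>2 \<le> (3/2 * h\<^sup>2)\<^sup>2" "(3/2 * h\<^sup>2)\<^sup>2 \<le> 9/32 * h ^ 3"
    ultimately show ?thesis using h3 by linarith
  qed
  then have "exp (h\<^sup>2 / 2 - r\<^sup>2 * h\<^sup>2 / 2 - 9 * h ^ 3) \<le> exp (ln (1 + w))" by simp
  also have "exp (ln (1 + w)) = 1 + w" using wb h2 by (intro exp_ln) linarith
  also have "\<dots> = m" by (simp add: mv w_def)
  finally show "exp (h\<^sup>2 / 2 - r\<^sup>2 * h\<^sup>2 / 2 - 9 * h ^ 3) \<le> m" .
qed

section \<open>From smooth test functions to the Kolmogorov distance\<close>

context tilted_chain
begin

text \<open>Up to constants, the part of the expected squared drift that is linear in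
  \<open>tau\<close>, relative to the remaining time. It is free of \<open>lam\<close> and has the
  floor \<open>\<epsilon>^2\<close>, so one bound on its sum serves every tilt.\<close>

definition "hx k = tau k / ((real k)\<^sup>2 * (1 - tau (Suc k) + \<epsilon>\<^sup>2))"

text \<open>Terms with one factor \<open>tau\<close>, or with the remaining time in the denominator,
  are compared with \<open>hx\<close>. The term \<open>lam^4 * tau^2\<close> goes to
  \<open>tau_hardy\<close> and becomes \<open>(lam^2 * \<epsilon>)^2\<close>, where
  \<open>small\<close> removes one factor.\<close>

lemma rho_sum_bounds:
  assumes HA: "(\<Sum>k=2..<n. hx k) \<le> A * \<epsilon>" and small: "lam\<^sup>2 * \<epsilon> \<le> 1"
  shows "(\<Sum>k=2..<n. (lam\<^sup>2 + 5 / tt (Suc k)) * rho k) \<le> 64 * (7 * (A * (lam\<^sup>2 * \<epsilon>)) + 5 * (A * \<epsilon>) + 4 * (lam\<^sup>2 * \<epsilon>))"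
proof -
  define z where "z k = (tau k)\<^sup>2 / (real k)\<^sup>2" for k
  have pt: "(lam\<^sup>2 + 5 / tt (Suc k)) * rho k \<le> 64 * ((7 * lam\<^sup>2 + 5) * hx k + lam\<^sup>2 * lam\<^sup>2 * z k)" if k: "k \<in> {2..<n}" for k
  proof -
    define w a where "w = 1 - tau (Suc k) + \<epsilon>\<^sup>2" and "a = tau k / (real k)\<^sup>2"
    have e2: "0 < \<epsilon>\<^sup>2" "\<epsilon>\<^sup>2 \<le> 1" using eps_pos eps by (auto simp: power_le_one)
    have "tau (Suc k) \<le> 1" using tau_le_1[of "Suc k"] k by simp
    then have w: "0 < w" "w \<le> 2" using tau_nonneg[of "Suc k"] e2 unfolding w_def by linarith+
    have wt: "w \<le> tt (Suc k)" using smin_ge by (simp add: w_def tt_def)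
    have a0: "0 \<le> a" using tau_nonneg by (simp add: a_def)
    have za: "0 \<le> z k" "z k \<le> a"
      using tau_nonneg[of k] tau_le_1[of k] k by (auto simp: z_def a_def power2_eq_square intro!: divide_right_mono mult_left_le)
    have hx: "hx k = a / w" by (simp add: hx_def a_def w_def)
    have hx0: "0 \<le> hx k" unfolding hx using a0 w by simp
    have 1: "a \<le> 2 * hx k"
    proof -
      have "a * w \<le> a * 2" using w a0 by (intro mult_left_mono) auto
      then show ?thesis unfolding hx using w by (simp add: field_simps)
    qed
    have 2: "a / tt (Suc k) \<le> hx k" unfolding hx using w wt a0 by (intro divide_left_mono) auto
    have 3: "z k / tt (Suc k) \<le> hx k" using za wt w 2 by (meson divide_right_mono less_le_trans less_imp_le order_trans)
    have l2: "0 \<le> lam\<^sup>2" by simp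
    have "rho k = 64 * (a + lam\<^sup>2 * z k)" by (simp add: rho_def a_def z_def add_divide_distrib)
    then have "(lam\<^sup>2 + 5 / tt (Suc k)) * rho k =
      64 * (lam\<^sup>2 * a + lam\<^sup>2 * lam\<^sup>2 * z k + 5 * (a / tt (Suc k)) + 5 * (lam\<^sup>2 * (z k / tt (Suc k))))"
      by (simp add: algebra_simps)
    also have "\<dots> \<le> 64 * (lam\<^sup>2 * (2 * hx k) + lam\<^sup>2 * lam\<^sup>2 * z k + 5 * hx k + 5 * (lam\<^sup>2 * hx k))"
      by (intro mult_left_mono add_mono 1 2 3 l2 order_refl) auto
    also have "\<dots> = 64 * ((7 * lam\<^sup>2 + 5) * hx k + lam\<^sup>2 * lam\<^sup>2 * z k)" by (simp add: algebra_simps)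
    finally show ?thesis .
  qed
  have "(\<Sum>k=2..<n. (lam\<^sup>2 + 5 / tt (Suc k)) * rho k) \<le> (\<Sum>k=2..<n. 64 * ((7 * lam\<^sup>2 + 5) * hx k + lam\<^sup>2 * lam\<^sup>2 * z k))"
    by (intro sum_mono pt)
  also have "\<dots> = 64 * ((7 * lam\<^sup>2 + 5) * (\<Sum>k=2..<n. hx k) + lam\<^sup>2 * lam\<^sup>2 * (\<Sum>k=2..<n. z k))"
    by (simp only: sum_distrib_left[symmetric] sum.distrib)
  also have "\<dots> \<le> 64 * ((7 * lam\<^sup>2 + 5) * (A * \<epsilon>) + lam\<^sup>2 * lam\<^sup>2 * (4 * \<epsilon>\<^sup>2))"
    using HA tau_hardy unfolding z_def by (intro mult_left_mono add_mono) auto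
  also have "lam\<^sup>2 * lam\<^sup>2 * (4 * \<epsilon>\<^sup>2) = 4 * ((lam\<^sup>2 * \<epsilon>) * (lam\<^sup>2 * \<epsilon>))" by (simp add: power2_eq_square)
  also have "(lam\<^sup>2 * \<epsilon>) * (lam\<^sup>2 * \<epsilon>) \<le> 1 * (lam\<^sup>2 * \<epsilon>)" using small eps_pos by (intro mult_right_mono) auto
  finally show ?thesis by (simp add: algebra_simps)
qed

definition "rate = lam\<^sup>2 * \<epsilon> + EL"
definition "arate A = (1 + A) * rate"
definition "eta A = 200000000000 * arate A"

lemma rate_pos: "\<epsilon> \<le> rate" "lam\<^sup>2 * \<epsilon> \<le> rate" "EL \<le> rate" "0 < rate"
proof -
  have "0 \<le> lam\<^sup>2 * \<epsilon>" using eps_pos by simp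
  then show "\<epsilon> \<le> rate" "lam\<^sup>2 * \<epsilon> \<le> rate" "EL \<le> rate" "0 < rate"
    using eps_pos EL unfolding rate_def by linarith+
qed

lemma arate_ge: "0 \<le> A \<Longrightarrow> rate \<le> arate A" "0 \<le> A \<Longrightarrow> arate A = rate + A * rate"
  using rate_pos by (simp_all add: arate_def algebra_simps)

lemma inc_sum:
  assumes HA: "(\<Sum>k=2..<n. hx k) \<le> A * \<epsilon>" and A: "0 \<le> A" and small: "lam\<^sup>2 * \<epsilon> \<le> 1"
  shows "(\<Sum>k=2..<n. inc k) \<le> 1000000 * arate A"
proof -
  have "(\<Sum>k=2..<n. inc k) = 641 * (\<epsilon> * (\<Sum>k=2..<n. (e (Suc k))\<^sup>2) + 7 * lam\<^sup>2 * \<epsilon> * (\<Sum>k=2..<n. (e (Suc k))\<^sup>2 / sqrt (tt (Suc k)))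
     + (\<Sum>k=2..<n. (lam\<^sup>2 + 5 / tt (Suc k)) * rho k))"
    unfolding inc_def by (simp only: sum_distrib_left[symmetric] sum.distrib)
  also have "\<dots> \<le> 641 * (\<epsilon> * 1 + 7 * lam\<^sup>2 * \<epsilon> * 6 + 64 * (7 * (A * (lam\<^sup>2 * \<epsilon>)) + 5 * (A * \<epsilon>) + 4 * (lam\<^sup>2 * \<epsilon>)))"
  proof (intro mult_left_mono add_mono rho_sum_bounds[OF HA small] sqrt_sum)
    have "(\<Sum>k=2..<n. (e (Suc k))\<^sup>2) = (\<Sum>k=3..n. (e k)\<^sup>2)"
      by (rule sum.reindex_bij_witness[of _ "\<lambda>k. k - 1" Suc]) auto
    also have "\<dots> \<le> (\<Sum>k=1..n. (e k)\<^sup>2)" by (intro sum_mono2) auto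
    finally show "(\<Sum>k=2..<n. (e (Suc k))\<^sup>2) \<le> 1" using e_sum by simp
  qed (use eps_pos in auto)
  also have "\<dots> \<le> 1000000 * arate A"
  proof -
    have "A * (lam\<^sup>2 * \<epsilon>) \<le> A * rate" "A * \<epsilon> \<le> A * rate" using rate_pos A by (auto intro: mult_left_mono)
    moreover have "0 \<le> A * rate" using A rate_pos by simp
    moreover have "641 * \<epsilon> + 191018 * x + 287168 * y + 205120 * z \<le> 1000000 * arate A"
      if "x \<le> rate" "y \<le> A * rate" "z \<le> A * rate" "0 \<le> A * rate" for x y z
      using that rate_pos unfolding arate_ge(2)[OF A] distrib_left by linarith
    ultimately have "641 * \<epsilon> + 191018 * (lam\<^sup>2 * \<epsilon>) + 287168 * (A * (lam\<^sup>2 * \<epsilon>)) + 205120 * (A * \<epsilon>) \<le> 1000000 * arate A"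
      using rate_pos(2) by blast
    moreover have "641 * (\<epsilon> * 1 + 7 * lam\<^sup>2 * \<epsilon> * 6 + 64 * (7 * (A * (lam\<^sup>2 * \<epsilon>)) + 5 * (A * \<epsilon>) + 4 * (lam\<^sup>2 * \<epsilon>)))
      = 641 * \<epsilon> + 191018 * (lam\<^sup>2 * \<epsilon>) + 287168 * (A * (lam\<^sup>2 * \<epsilon>)) + 205120 * (A * \<epsilon>)"
      by (simp add: algebra_simps)
    ultimately show ?thesis by linarith
  qed
  finally show ?thesis .
qed

lemma smooth_clt:
  assumes HA: "(\<Sum>k=2..<n. hx k) \<le> A * \<epsilon>" and A: "0 \<le> A" and small: "lam\<^sup>2 * \<epsilon> \<le> 1"
  shows "\<bar>Exq n (u b n) - Phi (- b)\<bar> \<le> 120000000000 * arate A"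
proof -
  have g0: "0 \<le> 640 * \<epsilon> * Exq n (g b n)"
    using eps_pos g_nonneg[of n b] by (intro mult_nonneg_nonneg Bochner_Integration.integral_nonneg) auto
  have "640 * \<epsilon> * Exq 2 (g b 2) \<le> 640 * \<epsilon> * (10 * L)" using start_g eps_pos by (intro mult_left_mono) auto
  then have g2: "640 * \<epsilon> * Exq 2 (g b 2) \<le> 6400 * EL" by (simp add: EL_def)
  note A1 = arate_ge(1)[OF A]
  have "110000000000 * EL + 6400 * EL + 1000000 * arate A \<le> 120000000000 * arate A"
    using A1 rate_pos by linarith
  then show ?thesis
    using all_steps[of n b] n g0 g2 inc_sum[OF HA A small] start_u[of b] by (simp add: abs_le_iff)
qed

text \<open>Smoothing is undone by shifting the threshold by \<open>\<kappa> * \<sigma>\<close>,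
  after which the smoothed and the sharp indicator compare up to \<open>\<epsilon>\<close>. The
  shift costs no more than the error already made.\<close>

lemma kolmogorov:
  assumes HA: "(\<Sum>k=2..<n. hx k) \<le> A * \<epsilon>" and A: "0 \<le> A"
  shows "\<bar>measure_pmf.prob (Q n) {X. b \<le> Y n X} - Phi (- b)\<bar> \<le> eta A"
proof (cases "lam\<^sup>2 * \<epsilon> \<le> 1")
  \<comment> \<open>For \<open>lam^2 * \<epsilon> > 1\<close> the claimed bound exceeds 1.\<close>
  case False
  have "1 \<le> eta A" using A False rate_pos arate_ge(1)[OF A] unfolding eta_def by linarith
  moreover have "\<bar>measure_pmf.prob (Q n) {X. b \<le> Y n X} - Phi (- b)\<bar> \<le> 1"
    using Phi_nonneg[of "- b"] Phi_le_1[of "- b"] measure_pmf.prob_le_1[of "Q n" "{X. b \<le> Y n X}"] measure_nonneg[of "Q n" "{X. b \<le> Y n X}"]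
    unfolding abs_le_iff by linarith
  ultimately show ?thesis by linarith
next
  case True
  \<comment> \<open>\<open>\<kappa> = sqrt (2 * L)\<close> is the least value with
    \<open>exp (- \<kappa>^2 / 2) \<le> \<epsilon>\<close>. The product
    \<open>\<kappa> * \<sigma>\<close> is of order \<open>\<epsilon> * L\<close> since each factor
    contains one \<open>sqrt L\<close>.\<close>
  define \<sigma> \<kappa> where "\<sigma> = sqrt (smin \<epsilon>)" and "\<kappa> = sqrt (2 * L)"
  have s: "0 < \<sigma>" using smin_pos[OF eps_pos] eps by (simp add: \<sigma>_def)
  have tn: "sqrt (tt n) = \<sigma>" by (simp add: tt_def tau_n \<sigma>_def)
  have \<kappa>: "0 \<le> \<kappa>" "\<kappa>\<^sup>2 = 2 * L" using L1 by (auto simp: \<kappa>_def)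
  have tail: "1 - Phi \<kappa> \<le> \<epsilon>"
  proof -
    have "1 - Phi \<kappa> \<le> exp (- \<kappa>\<^sup>2 / 2) / (1 + \<kappa>)" by (rule normal_tail_bounds(1)[OF \<kappa>(1)])
    also have "\<dots> \<le> exp (- \<kappa>\<^sup>2 / 2) / 1" using \<kappa>(1) by (intro divide_left_mono) auto
    also have "\<dots> = \<epsilon>" using eps_pos by (simp add: \<kappa>(2) L_def)
    finally show ?thesis .
  qed
  have \<kappa>\<sigma>: "\<kappa> * \<sigma> \<le> 320000 * EL"
  proof -
    have "\<sigma> = 160000 * \<epsilon> * sqrt L"
      unfolding \<sigma>_def smin_def L_def real_sqrt_mult real_sqrt_abs using eps_pos by simp
    moreover have "\<kappa> = sqrt 2 * sqrt L" by (simp add: \<kappa>_def real_sqrt_mult)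
    moreover have "sqrt L * sqrt L = L" using L1 by simp
    ultimately have "\<kappa> * \<sigma> = sqrt 2 * 160000 * (\<epsilon> * L)" by (metis (no_types, opaque_lifting) mult.assoc mult.commute)
    also have "\<dots> \<le> 2 * 160000 * (\<epsilon> * L)"
      using eps_pos L1 by (intro mult_right_mono) (auto intro!: real_le_lsqrt)
    finally show ?thesis by (simp add: EL_def)
  qed
  have up: "measure_pmf.prob (Q n) {X. b \<le> Y n X} \<le> Exq n (u (b - \<kappa> * \<sigma>) n) + \<epsilon>"
  proof -
    have "Exq n (indicator {X. b \<le> Y n X}) \<le> Exq n (\<lambda>X. u (b - \<kappa> * \<sigma>) n X + \<epsilon>)"
    proof (rule Ex_mono)
      fix X
      show "indicator {X. b \<le> Y n X} X \<le> u (b - \<kappa> * \<sigma>) n X + \<epsilon>"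
      proof (cases "b \<le> Y n X")
        case True
        then have "\<kappa> * \<sigma> \<le> Y n X - (b - \<kappa> * \<sigma>)" by simp
        then have "\<kappa> \<le> (Y n X - (b - \<kappa> * \<sigma>)) / \<sigma>" using s by (simp add: pos_le_divide_eq)
        then have "Phi \<kappa> \<le> u (b - \<kappa> * \<sigma>) n X" unfolding u_def tn by (rule Phi_mono)
        with tail show ?thesis using True by simp
      next
        case False
        then show ?thesis using Phi_nonneg eps_pos by (simp add: u_def)
      qed
    qed
    then show ?thesis by (simp only: prob_eq_expectation Ex_lin)
  qed
  have lo: "Exq n (u (b + \<kappa> * \<sigma>) n) - \<epsilon> \<le> measure_pmf.prob (Q n) {X. b \<le> Y n X}"
  proof -
    have "Exq n (\<lambda>X. u (b + \<kappa> * \<sigma>) n X - \<epsilon>) \<le> Exq n (indicator {X. b \<le> Y n X})"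
    proof (rule Ex_mono)
      fix X
      show "u (b + \<kappa> * \<sigma>) n X - \<epsilon> \<le> indicator {X. b \<le> Y n X} X"
      proof (cases "b \<le> Y n X")
        case True
        then show ?thesis using Phi_le_1[of "(Y n X - (b + \<kappa> * \<sigma>)) / sqrt (tt n)"] eps_pos unfolding u_def by simp
      next
        case False
        then have "Y n X - (b + \<kappa> * \<sigma>) \<le> - \<kappa> * \<sigma>" by simp
        then have "(Y n X - (b + \<kappa> * \<sigma>)) / \<sigma> \<le> - \<kappa>" using s by (simp add: pos_divide_le_eq)
        then have "u (b + \<kappa> * \<sigma>) n X \<le> Phi (- \<kappa>)" unfolding u_def tn by (rule Phi_mono)
        with tail show ?thesis using False by (simp add: Phi_minus)
      qed
    qed
    then show ?thesis by (simp only: prob_eq_expectation Ex_lin)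
  qed
  have ks0: "0 \<le> \<kappa> * \<sigma>" using \<kappa> s by simp
  have l1: "\<bar>Phi (- (b - \<kappa> * \<sigma>)) - Phi (- b)\<bar> \<le> \<kappa> * \<sigma>" "\<bar>Phi (- (b + \<kappa> * \<sigma>)) - Phi (- b)\<bar> \<le> \<kappa> * \<sigma>"
    using Phi_lipschitz[of "- (b - \<kappa> * \<sigma>)" "- b"] Phi_lipschitz[of "- (b + \<kappa> * \<sigma>)" "- b"] ks0 by simp_all
  note A1 = arate_ge(1)[OF A]
  note et = eta_def[of A]
  show ?thesis
    using up lo l1 smooth_clt[OF HA A True, of "b - \<kappa> * \<sigma>"] smooth_clt[OF HA A True, of "b + \<kappa> * \<sigma>"] \<kappa>\<sigma> A1 rate_pos
    unfolding et abs_le_iff by linarith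
qed

lemma window_clt:
  assumes HA: "(\<Sum>k=2..<n. hx k) \<le> A * \<epsilon>" and A: "0 \<le> A" and s: "0 \<le> s"
  shows "\<bar>measure_pmf.prob (Q n) {X. 0 \<le> Y n X \<and> Y n X \<le> s} - (Phi s - Phi 0)\<bar> \<le> 2 * eta A"
proof -
  let ?P = "\<lambda>S. measure_pmf.prob (Q n) S"
  have split: "?P {X. 0 \<le> Y n X} = ?P {X. 0 \<le> Y n X \<and> Y n X \<le> s} + ?P {X. s < Y n X}"
  proof -
    have "{X. 0 \<le> Y n X} = {X. 0 \<le> Y n X \<and> Y n X \<le> s} \<union> {X. s < Y n X}" using s by auto
    then show ?thesis by (simp add: measure_pmf.finite_measure_Union[symmetric] disjoint_iff)
  qed
  have u: "?P {X. s < Y n X} \<le> Phi (- s) + eta A"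
  proof -
    have "?P {X. s < Y n X} \<le> ?P {X. s \<le> Y n X}" by (intro measure_pmf.finite_measure_mono) auto
    then show ?thesis using kolmogorov[OF HA A, of s] by (simp add: abs_le_iff)
  qed
  have l: "Phi (- s) - eta A \<le> ?P {X. s < Y n X}"
  \<comment> \<open>The strict event is approached from inside by the closed events
    \<open>s + d \<le> Y n X\<close>.\<close>
  proof (rule field_le_epsilon)
    fix d :: real assume d: "0 < d"
    have "?P {X. s + d \<le> Y n X} \<le> ?P {X. s < Y n X}" using d by (intro measure_pmf.finite_measure_mono) auto
    then show "Phi (- s) - eta A \<le> ?P {X. s < Y n X} + d"
      using kolmogorov[OF HA A, of "s + d"] Phi_lipschitz[of "- s" "- (s + d)"] d unfolding abs_le_iff by linarith
  qed
  have "Phi (- s) = 1 - Phi s" "Phi 0 = 1 - Phi 0" using Phi_minus[of s] Phi_minus[of 0] by auto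
  then show ?thesis using split u l kolmogorov[OF HA A, of 0] unfolding abs_le_iff by simp
qed

end

subsection \<open>Tail bounds by change of measure\<close>

lemma exp_minus_double_le:
  fixes y :: real
  assumes "0 \<le> y" "y \<le> 1/2"
  shows "exp (- (2 * y)) \<le> 1 - y"
proof -
  have "y * y \<le> 1/2 * y" using assms by (intro mult_right_mono) auto
  then have "1 \<le> (1 - y) * (1 + 2 * y)" by (simp add: algebra_simps)
  also have "\<dots> \<le> (1 - y) * exp (2 * y)" using assms by (intro mult_left_mono exp_ge_add_one_self) auto
  finally show ?thesis by (simp add: exp_minus field_simps)
qed

context tilted_chain
begin

text \<open>The variance lost to memory: under the original law the conditional variances of the
  steps of \<open>M\<close> from time 3 to \<open>n\<close> add up to
  \<open>1 - tau 2 - V X\<close>.\<close>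

definition "V X = (\<Sum>k=2..<n. (e (Suc k))\<^sup>2 * (rr k X)\<^sup>2)"
definition "vbar A = 64 * (2 * (A * \<epsilon>) + 4 * (lam\<^sup>2 * \<epsilon>\<^sup>2))"
text \<open>The cubic terms of the logarithmic moment generating functions, and the price of the two
  untilted steps: \<open>2 * (lam * \<epsilon>)\<close> from \<open>lam * M 2 X\<close> and
  \<open>lam * \<epsilon>\<close> from \<open>lam^2 * tau 2\<close>.\<close>

definition "err = 9 * (lam ^ 3 * \<epsilon>) + 3 * (lam * \<epsilon>)"
definition "PP x = measure_pmf.prob (erw_pmf p q n) {X. x \<le> e n * real_of_int (erw_pos X n)}"

lemma V_nonneg: "0 \<le> V X" unfolding V_def by (intro sum_nonneg) simp

lemma Ex_V:
  assumes HA: "(\<Sum>k=2..<n. hx k) \<le> A * \<epsilon>"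
  shows "Exq n V \<le> vbar A"
proof -
  have "Exq n V = (\<Sum>k=2..<n. Exq n (\<lambda>X. (e (Suc k))\<^sup>2 * (rr k X)\<^sup>2))"
    unfolding V_def by (intro Bochner_Integration.integral_sum integrable_measure_pmf_finite fin)
  also have "\<dots> = (\<Sum>k=2..<n. Exq k (\<lambda>X. (e (Suc k))\<^sup>2 * (rr k X)\<^sup>2))"
  proof (intro sum.cong refl Ex_past)
    fix k i :: nat and X s assume "k < i"
    then have "erw_pos (X(i := s)) k = erw_pos X k" unfolding erw_pos_def by (intro sum.cong) auto
    then show "(e (Suc k))\<^sup>2 * (rr k (X(i := s)))\<^sup>2 = (e (Suc k))\<^sup>2 * (rr k X)\<^sup>2" by (simp add: memdrift_def)
  qed auto
  also have "\<dots> \<le> (\<Sum>k=2..<n. 64 * (2 * hx k + lam\<^sup>2 * ((tau k)\<^sup>2 / (real k)\<^sup>2)))"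
  proof (rule sum_mono)
    fix k assume k: "k \<in> {2..<n}"
    define w a where "w = 1 - tau (Suc k) + \<epsilon>\<^sup>2" and "a = tau k / (real k)\<^sup>2"
    have e2: "0 < \<epsilon>\<^sup>2" "\<epsilon>\<^sup>2 \<le> 1" using eps_pos eps by (auto simp: power_le_one)
    have "tau (Suc k) \<le> 1" using tau_le_1[of "Suc k"] k by simp
    then have w: "0 < w" "w \<le> 2" using tau_nonneg[of "Suc k"] e2 unfolding w_def by linarith+
    have a0: "0 \<le> a" using tau_nonneg by (simp add: a_def)
    have "a * w \<le> a * 2" using w a0 by (intro mult_left_mono) auto
    then have "a \<le> 2 * (a / w)" using w by (simp add: field_simps)
    moreover have "hx k = a / w" by (simp add: hx_def a_def w_def)
    moreover have "rho k = 64 * (a + lam\<^sup>2 * ((tau k)\<^sup>2 / (real k)\<^sup>2))" by (simp add: rho_def a_def add_divide_distrib)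
    ultimately have "rho k \<le> 64 * (2 * hx k + lam\<^sup>2 * ((tau k)\<^sup>2 / (real k)\<^sup>2))"
      unfolding distrib_left by linarith
    then show "Exq k (\<lambda>X. (e (Suc k))\<^sup>2 * (rr k X)\<^sup>2) \<le> 64 * (2 * hx k + lam\<^sup>2 * ((tau k)\<^sup>2 / (real k)\<^sup>2))"
      using Ex_drift_sq[of k] k by (meson atLeastLessThan_iff order_trans)
  qed
  also have "\<dots> = 64 * (2 * (\<Sum>k=2..<n. hx k) + lam\<^sup>2 * (\<Sum>k=2..<n. (tau k)\<^sup>2 / (real k)\<^sup>2))"
    by (simp only: sum_distrib_left[symmetric] sum.distrib)
  also have "\<dots> \<le> 64 * (2 * (A * \<epsilon>) + lam\<^sup>2 * (4 * \<epsilon>\<^sup>2))"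
    using HA tau_hardy by (intro mult_left_mono add_mono) auto
  finally show ?thesis by (simp add: vbar_def)
qed

definition "mm k X = exp (- (c (Suc k) * rr k X)) * normf p c k X"

text \<open>The tilt parameters are proportional to the weights, so the centred exponents telescope
  to a function of \<open>M m\<close> and \<open>M 2\<close> only. What remains is the product of
  centred moment generating functions.\<close>

lemma lik_eq:
  assumes "2 \<le> m" "m \<le> n"
  shows "lik p c m X = exp (- (lam * (M m X - M 2 X))) * (\<Prod>k=2..<m. mm k X)"
  using assms
proof (induction m rule: dec_induct)
  case base
  show ?case by (simp add: lik_def[OF p c_bounds])
next
  case (step k)
  have "M (Suc k) X = M k X + e (Suc k) * (real_of_int (X (Suc k)) - rr k X)"
    using M_step[of k X "X (Suc k)"] step by simp
  moreover have "c (Suc k) = lam * e (Suc k)" using step by (simp add: c_Suc)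
  ultimately have "- (lam * (M (Suc k) X - M 2 X)) =
    - (lam * (M k X - M 2 X)) + - c (Suc k) * real_of_int (X (Suc k)) + c (Suc k) * rr k X"
    by (simp only: ring_distribs minus_mult_left minus_add_distrib mult.assoc)
  then have E: "exp (- (lam * (M (Suc k) X - M 2 X))) =
    exp (- (lam * (M k X - M 2 X))) * exp (- c (Suc k) * real_of_int (X (Suc k))) * exp (c (Suc k) * rr k X)"
    by (simp only: exp_add)
  have "exp (c (Suc k) * rr k X) * mm k X = normf p c k X" by (simp add: mm_def exp_minus)
  moreover have "lik p c (Suc k) X = lik p c k X * (exp (- c (Suc k) * real_of_int (X (Suc k))) * normf p c k X)"
    using step by (simp add: lik_def[OF p c_bounds])
  moreover have "lik p c k X = exp (- (lam * (M k X - M 2 X))) * (\<Prod>k=2..<k. mm k X)" using step by simp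
  ultimately show ?case using step E by (simp add: mult_ac)
qed

lemma M2_bound: "X \<in> set_pmf (Q k) \<Longrightarrow> 2 \<le> k \<Longrightarrow> \<bar>M 2 X\<bar> \<le> 2 * \<epsilon>"
proof -
  assume X: "X \<in> set_pmf (Q k)" and "2 \<le> k"
  then have "sign_path 2 X" using supp[OF X] by (auto simp: sign_path_def)
  then have "\<bar>real_of_int (erw_pos X 2)\<bar> \<le> 2" using erw_pos_abs by fastforce
  then have "e 2 * \<bar>real_of_int (erw_pos X 2)\<bar> \<le> \<epsilon> * 2" using e_le[of 2] e_pos[of 2] n eps_pos by (intro mult_mono) auto
  then show ?thesis using e_pos[of 2] n by (simp add: M_def abs_mult)
qed

lemma sum_e2: "(\<Sum>k=2..<n. (e (Suc k))\<^sup>2) = 1 - tau 2" "(\<Sum>k=2..<n. (e (Suc k)) ^ 3) \<le> \<epsilon>"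
proof -
  have "(\<Sum>k=2..<m. (e (Suc k))\<^sup>2) = tau m - tau 2" if "2 \<le> m" for m
    using that by (induction m rule: dec_induct) (auto simp: tau_Suc)
  then show 1: "(\<Sum>k=2..<n. (e (Suc k))\<^sup>2) = 1 - tau 2" using n tau_n by simp
  have "(\<Sum>k=2..<n. (e (Suc k)) ^ 3) \<le> (\<Sum>k=2..<n. \<epsilon> * (e (Suc k))\<^sup>2)"
  proof (rule sum_mono)
    fix k assume "k \<in> {2..<n}"
    then have "e (Suc k) * (e (Suc k))\<^sup>2 \<le> \<epsilon> * (e (Suc k))\<^sup>2" using e_le[of "Suc k"] by (intro mult_right_mono) auto
    then show "(e (Suc k)) ^ 3 \<le> \<epsilon> * (e (Suc k))\<^sup>2" by (simp add: power3_eq_cube power2_eq_square)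
  qed
  also have "\<dots> = \<epsilon> * (1 - tau 2)" unfolding sum_distrib_left[symmetric] 1 ..
  also have "\<dots> \<le> \<epsilon> * 1" using tau_nonneg[of 2] eps_pos by (intro mult_left_mono) auto
  finally show "(\<Sum>k=2..<n. (e (Suc k)) ^ 3) \<le> \<epsilon>" by simp
qed

text \<open>Memory only lowers conditional variances, so \<open>V\<close> occurs in the lower bound
  alone. \<open>V\<close> is not uniformly small, but it enters the exponent linearly and its
  expectation is small.\<close>

lemma lik_bounds:
  assumes X: "X \<in> set_pmf (Q n)"
  shows "lik p c n X \<le> exp (lam\<^sup>2 / 2 - lam * M n X + err)"
    "exp (lam\<^sup>2 / 2 - lam * M n X - err - lam\<^sup>2 / 2 * V X) \<le> lik p c n X"
proof -
  have r1: "\<bar>rr k X\<bar> \<le> 1" if "k \<in> {2..<n}" for k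
  proof -
    have "sign_path k X" using supp[OF X] that by (auto simp: sign_path_def)
    then show ?thesis using that by (intro memdrift_abs p) auto
  qed
  have mm: "mm k X \<le> exp ((c (Suc k))\<^sup>2 / 2 + 8 * (c (Suc k)) ^ 3)"
    "exp ((c (Suc k))\<^sup>2 / 2 - (rr k X)\<^sup>2 * (c (Suc k))\<^sup>2 / 2 - 9 * (c (Suc k)) ^ 3) \<le> mm k X" if "k \<in> {2..<n}" for k
    using norm_factor_bounds[OF r1[OF that] c_bounds[of "Suc k"]] by (simp_all add: mm_def normf_def[OF p c_bounds])
  have mm0: "0 \<le> mm k X" if "k \<in> {2..<n}" for k using mm(2)[OF that] exp_ge_zero order_trans by blast
  have s2: "(\<Sum>k=2..<n. (c (Suc k))\<^sup>2) = lam\<^sup>2 * (1 - tau 2)"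
  proof -
    have "(\<Sum>k=2..<n. (c (Suc k))\<^sup>2) = (\<Sum>k=2..<n. lam\<^sup>2 * (e (Suc k))\<^sup>2)"
      by (intro sum.cong) (auto simp: c_Suc power_mult_distrib)
    then show ?thesis unfolding sum_distrib_left[symmetric] sum_e2(1) .
  qed
  have s3: "(\<Sum>k=2..<n. (c (Suc k)) ^ 3) \<le> lam ^ 3 * \<epsilon>"
  proof -
    have "(\<Sum>k=2..<n. (c (Suc k)) ^ 3) = (\<Sum>k=2..<n. lam ^ 3 * (e (Suc k)) ^ 3)"
      by (intro sum.cong) (auto simp: c_Suc power_mult_distrib)
    then show ?thesis unfolding sum_distrib_left[symmetric] using sum_e2(2) lam by (simp add: mult_left_mono)
  qed
  have sV: "(\<Sum>k=2..<n. (rr k X)\<^sup>2 * (c (Suc k))\<^sup>2 / 2) = lam\<^sup>2 / 2 * V X"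
    unfolding V_def sum_distrib_left by (intro sum.cong) (auto simp: c_Suc power_mult_distrib)
  have m2: "\<bar>lam * M 2 X\<bar> \<le> 2 * (lam * \<epsilon>)"
    using mult_left_mono[OF M2_bound[OF X] lam(1)] n lam by (simp add: abs_mult)
  have t2: "lam\<^sup>2 * tau 2 \<le> lam * \<epsilon>"
  proof -
    have "lam\<^sup>2 * tau 2 \<le> lam\<^sup>2 * (2 * \<epsilon>\<^sup>2)" using tau_2 by (intro mult_left_mono) auto
    also have "\<dots> = 2 * (lam * \<epsilon>) * (lam * \<epsilon>)" by (simp add: power2_eq_square)
    also have "\<dots> \<le> 1 * (lam * \<epsilon>)" using lam eps_pos by (intro mult_right_mono) auto
    finally show ?thesis by simp
  qed
  have t20: "0 \<le> lam\<^sup>2 * tau 2" using tau_nonneg by simp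
  have l3: "0 \<le> lam ^ 3 * \<epsilon>" "0 \<le> lam * \<epsilon>" using lam eps_pos by auto
  have "(\<Prod>k=2..<n. mm k X) \<le> (\<Prod>k=2..<n. exp ((c (Suc k))\<^sup>2 / 2 + 8 * (c (Suc k)) ^ 3))"
    using mm mm0 by (intro prod_mono) auto
  also have "\<dots> = exp (\<Sum>k=2..<n. (c (Suc k))\<^sup>2 / 2 + 8 * (c (Suc k)) ^ 3)" by (simp add: exp_sum)
  also have "(\<Sum>k=2..<n. (c (Suc k))\<^sup>2 / 2 + 8 * (c (Suc k)) ^ 3) = lam\<^sup>2 * (1 - tau 2) / 2 + 8 * (\<Sum>k=2..<n. (c (Suc k)) ^ 3)"
    unfolding sum.distrib sum_divide_distrib[symmetric] sum_distrib_left[symmetric] s2 ..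
  finally have P1: "(\<Prod>k=2..<n. mm k X) \<le> exp (lam\<^sup>2 * (1 - tau 2) / 2 + 8 * (\<Sum>k=2..<n. (c (Suc k)) ^ 3))" .
  have d: "lam\<^sup>2 * (1 - tau 2) / 2 = lam\<^sup>2 / 2 - (lam\<^sup>2 * tau 2) / 2" by (simp add: right_diff_distrib diff_divide_distrib)
  have lM: "- (lam * (M n X - M 2 X)) = - (lam * M n X) + lam * M 2 X" by (simp add: algebra_simps)
  have "lik p c n X \<le> exp (- (lam * (M n X - M 2 X))) * exp (lam\<^sup>2 * (1 - tau 2) / 2 + 8 * (\<Sum>k=2..<n. (c (Suc k)) ^ 3))"
    using lik_eq[of n X] n P1 by (simp add: mult_left_mono)
  also have "\<dots> \<le> exp (lam\<^sup>2 / 2 - lam * M n X + err)"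
    unfolding exp_add[symmetric] exp_le_cancel_iff d lM err_def using s3 m2 t20 l3 unfolding abs_le_iff by linarith
  finally show "lik p c n X \<le> exp (lam\<^sup>2 / 2 - lam * M n X + err)" .
  have "(\<Prod>k=2..<n. exp ((c (Suc k))\<^sup>2 / 2 - (rr k X)\<^sup>2 * (c (Suc k))\<^sup>2 / 2 - 9 * (c (Suc k)) ^ 3)) \<le> (\<Prod>k=2..<n. mm k X)"
    using mm by (intro prod_mono) auto
  also have "(\<Prod>k=2..<n. exp ((c (Suc k))\<^sup>2 / 2 - (rr k X)\<^sup>2 * (c (Suc k))\<^sup>2 / 2 - 9 * (c (Suc k)) ^ 3))
    = exp (\<Sum>k=2..<n. (c (Suc k))\<^sup>2 / 2 - (rr k X)\<^sup>2 * (c (Suc k))\<^sup>2 / 2 - 9 * (c (Suc k)) ^ 3)" by (simp add: exp_sum)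
  also have "(\<Sum>k=2..<n. (c (Suc k))\<^sup>2 / 2 - (rr k X)\<^sup>2 * (c (Suc k))\<^sup>2 / 2 - 9 * (c (Suc k)) ^ 3)
    = lam\<^sup>2 * (1 - tau 2) / 2 - lam\<^sup>2 / 2 * V X - 9 * (\<Sum>k=2..<n. (c (Suc k)) ^ 3)"
    unfolding sum_subtractf sV sum_distrib_left[symmetric] unfolding sum_divide_distrib[symmetric] s2 ..
  finally have P2: "exp (lam\<^sup>2 * (1 - tau 2) / 2 - lam\<^sup>2 / 2 * V X - 9 * (\<Sum>k=2..<n. (c (Suc k)) ^ 3)) \<le> (\<Prod>k=2..<n. mm k X)" .
  have "exp (lam\<^sup>2 / 2 - lam * M n X - err - lam\<^sup>2 / 2 * V X)
    \<le> exp (- (lam * (M n X - M 2 X))) * exp (lam\<^sup>2 * (1 - tau 2) / 2 - lam\<^sup>2 / 2 * V X - 9 * (\<Sum>k=2..<n. (c (Suc k)) ^ 3))"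
    unfolding exp_add[symmetric] exp_le_cancel_iff d lM err_def using s3 m2 t2 l3 unfolding abs_le_iff by linarith
  also have "\<dots> \<le> lik p c n X" using lik_eq[of n X] n P2 by (simp add: mult_left_mono)
  finally show "exp (lam\<^sup>2 / 2 - lam * M n X - err - lam\<^sup>2 / 2 * V X) \<le> lik p c n X" .
qed

lemma PP_eq: "PP x = Exq n (\<lambda>X. indicator {X. x \<le> M n X} X * lik p c n X)"
proof -
  have "PP x = measure_pmf.expectation (erw_pmf p q n) (indicator {X. x \<le> M n X})"
    unfolding PP_def M_def by simp
  also have "\<dots> = Exq n (\<lambda>X. indicator {X. x \<le> M n X} X * lik p c n X)"
    using n by (intro change_of_measure[OF p c_bounds]) auto
  finally show ?thesis .
qed

definition "f X = (if 0 \<le> Y n X then exp (- (lam * Y n X)) else 0)"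

lemma Y_n: "Y n X = M n X - lam" by (simp add: Y_def tau_n)

lemma f_bounds: "0 \<le> f X" "f X \<le> 1" using lam by (auto simp: f_def)

lemma expectation_tilted_tail:
  assumes HA: "(\<Sum>k=2..<n. hx k) \<le> A * \<epsilon>" and A: "0 \<le> A"
  shows "\<bar>Exq n f - exp (lam\<^sup>2 / 2) * (1 - Phi lam)\<bar> \<le> 2 * eta A"
proof -
  have e0: "0 \<le> eta A" using arate_ge(1)[OF A] rate_pos unfolding eta_def by linarith
  show ?thesis
  proof (cases "lam = 0")
    \<comment> \<open>For \<open>lam = 0\<close> the exponential density degenerates and
      \<open>f\<close> is the indicator itself.\<close>
    case True
    have l: "lam * Y n X = 0" for X using True by (metis mult_zero_left)
    have "f = indicator {X. 0 \<le> Y n X}" by (rule ext) (simp add: f_def l indicator_def del: mult_eq_0_iff)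
    then have "Exq n f = measure_pmf.prob (Q n) {X. 0 \<le> Y n X}" by simp
    then show ?thesis using kolmogorov[OF HA A, of 0] e0 True by (simp add: Phi_0)
  next
    case False
    then show ?thesis
      unfolding f_def[abs_def] using lam e0 window_clt[OF HA A] by (intro exp_moment_via_cdf fin) auto
  qed
qed

lemma upper_bound_expectation: "PP lam \<le> exp (- (lam\<^sup>2 / 2) + err) * Exq n f"
proof -
  have "PP lam \<le> Exq n (\<lambda>X. exp (- (lam\<^sup>2 / 2) + err) * f X)"
    unfolding PP_eq
  proof (rule Ex_mono)
    fix X assume X: "X \<in> set_pmf (Q n)"
    show "indicator {X. lam \<le> M n X} X * lik p c n X \<le> exp (- (lam\<^sup>2 / 2) + err) * f X"
    proof (cases "lam \<le> M n X")
      case True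
      have "lam\<^sup>2 / 2 - lam * M n X + err = (- (lam\<^sup>2 / 2) + err) + - (lam * Y n X)"
        by (simp add: Y_n power2_eq_square algebra_simps)
      then have "exp (lam\<^sup>2 / 2 - lam * M n X + err) = exp (- (lam\<^sup>2 / 2) + err) * exp (- (lam * Y n X))"
        by (simp only: exp_add)
      then show ?thesis using lik_bounds(1)[OF X] True by (simp add: f_def Y_n)
    next
      case False
      then show ?thesis using f_bounds by simp
    qed
  qed
  then show ?thesis by (simp only: Ex_lin)
qed

text \<open>Turns an absolute error, carrying the factor \<open>exp (- (lam^2 / 2))\<close>, into
  one relative to the normal tail. This conversion is the origin of the factor \<open>1 + x\<close>
  in the final exponent.\<close>

lemma gauss_le_tail: "exp (- (lam\<^sup>2 / 2)) \<le> 3 * (1 + lam) * (1 - Phi lam)"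
proof -
  have "exp (- lam\<^sup>2 / 2) / (3 * (1 + lam)) \<le> 1 - Phi lam" by (rule normal_tail_bounds(2)[OF lam(1)])
  then show ?thesis using lam by (simp add: field_simps)
qed

lemma tail_pos: "0 < 1 - Phi lam"
proof -
  have "0 < exp (- lam\<^sup>2 / 2) / (3 * (1 + lam))" using lam by simp
  then show ?thesis using normal_tail_bounds(2)[OF lam(1)] by linarith
qed

lemma exp_shift: "exp (- (lam\<^sup>2 / 2) + err) = exp err * exp (- (lam\<^sup>2 / 2))"
  unfolding exp_add by (rule mult.commute)

lemma upper_bound:
  assumes HA: "(\<Sum>k=2..<n. hx k) \<le> A * \<epsilon>" and A: "0 \<le> A"
  shows "PP lam \<le> (1 - Phi lam) * exp (err + 6 * ((1 + lam) * eta A))"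
proof -
  define G where "G = 1 - Phi lam"
  have e0: "0 \<le> eta A" using arate_ge(1)[OF A] rate_pos unfolding eta_def by linarith
  have "exp (- (lam\<^sup>2 / 2)) * Exq n f \<le> exp (- (lam\<^sup>2 / 2)) * (exp (lam\<^sup>2 / 2) * G + 2 * eta A)"
    using expectation_tilted_tail[OF HA A] unfolding G_def by (intro mult_left_mono) (auto simp: abs_le_iff)
  also have "\<dots> = G + exp (- (lam\<^sup>2 / 2)) * (2 * eta A)"
    by (simp add: distrib_left exp_minus)
  also have "\<dots> \<le> G + (3 * (1 + lam) * G) * (2 * eta A)"
    using gauss_le_tail e0 unfolding G_def by (intro add_left_mono mult_right_mono) auto
  also have "\<dots> = G * (1 + 6 * ((1 + lam) * eta A))" by (simp add: algebra_simps)
  also have "\<dots> \<le> G * exp (6 * ((1 + lam) * eta A))"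
    using tail_pos unfolding G_def by (intro mult_left_mono exp_ge_add_one_self) auto
  finally have 1: "exp (- (lam\<^sup>2 / 2)) * Exq n f \<le> G * exp (6 * ((1 + lam) * eta A))" .
  have "PP lam \<le> exp err * (exp (- (lam\<^sup>2 / 2)) * Exq n f)"
    using upper_bound_expectation unfolding exp_shift mult.assoc .
  also have "\<dots> \<le> exp err * (G * exp (6 * ((1 + lam) * eta A)))" using 1 by (intro mult_left_mono) auto
  finally show ?thesis by (simp add: G_def exp_add mult_ac)
qed

text \<open>Uses only \<open>f \<le> 1\<close>. The loss \<open>3 * (1 + lam)\<close> is affordable
  once \<open>lam\<close> itself is bounded by a multiple of
  \<open>lam^3 * \<epsilon>\<close>.\<close>

lemma upper_bound_crude: "PP lam \<le> (1 - Phi lam) * (3 * (1 + lam) * exp err)"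
proof -
  have "Exq n f \<le> Exq n (\<lambda>X. 1)" by (rule Ex_mono) (rule f_bounds)
  then have "Exq n f \<le> 1" unfolding Ex_lin .
  then have "exp (- (lam\<^sup>2 / 2) + err) * Exq n f \<le> exp (- (lam\<^sup>2 / 2) + err) * 1" by (intro mult_left_mono) auto
  then have "PP lam \<le> exp (- (lam\<^sup>2 / 2)) * exp err" using upper_bound_expectation unfolding exp_add by linarith
  also have "\<dots> \<le> (3 * (1 + lam) * (1 - Phi lam)) * exp err" using gauss_le_tail by (intro mult_right_mono) auto
  finally show ?thesis by (simp add: mult_ac)
qed

text \<open>Everything outside the window is discarded. By \<open>1 - z \<le> exp (- z)\<close> the
  random cost becomes linear in \<open>V\<close>, so only its expectation enters and no joint
  control of \<open>V\<close> and \<open>M\<close> is required.\<close>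

lemma lower_window:
  assumes HA: "(\<Sum>k=2..<n. hx k) \<le> A * \<epsilon>" and S: "\<And>X. S X \<Longrightarrow> x \<le> M n X \<and> M n X \<le> z" and z: "0 \<le> v"
    and prob: "v \<le> measure_pmf.prob (Q n) {X. S X} - lam\<^sup>2 / 2 * vbar A"
  shows "exp (lam\<^sup>2 / 2 - lam * z - err) * v \<le> PP x"
proof -
  have "Exq n (\<lambda>X. exp (lam\<^sup>2 / 2 - lam * z - err) * (indicator {X. S X} X - lam\<^sup>2 / 2 * V X)) \<le> PP x"
    unfolding PP_eq
  proof (rule Ex_mono)
    fix X assume X: "X \<in> set_pmf (Q n)"
    have lp: "0 \<le> lik p c n X" using lik_bounds(2)[OF X] exp_ge_zero order_trans by blast
    have vv: "0 \<le> lam\<^sup>2 / 2 * V X" using V_nonneg by simp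
    show "exp (lam\<^sup>2 / 2 - lam * z - err) * (indicator {X. S X} X - lam\<^sup>2 / 2 * V X) \<le> indicator {X. x \<le> M n X} X * lik p c n X"
    proof (cases "S X")
      case True
      have "lam * M n X \<le> lam * z" using S[OF True] lam by (intro mult_left_mono) auto
      then have "exp (lam\<^sup>2 / 2 - lam * z - err + - (lam\<^sup>2 / 2 * V X)) \<le> exp (lam\<^sup>2 / 2 - lam * M n X - err - lam\<^sup>2 / 2 * V X)"
        by simp
      then have "exp (lam\<^sup>2 / 2 - lam * z - err) * exp (- (lam\<^sup>2 / 2 * V X)) \<le> lik p c n X"
        unfolding exp_add using lik_bounds(2)[OF X] by linarith
      moreover have "1 - lam\<^sup>2 / 2 * V X \<le> exp (- (lam\<^sup>2 / 2 * V X))"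
        using exp_ge_add_one_self[of "- (lam\<^sup>2 / 2 * V X)"] by linarith
      then have "exp (lam\<^sup>2 / 2 - lam * z - err) * (1 - lam\<^sup>2 / 2 * V X) \<le> exp (lam\<^sup>2 / 2 - lam * z - err) * exp (- (lam\<^sup>2 / 2 * V X))"
        by (intro mult_left_mono) auto
      moreover have "indicator {X. S X} X = (1::real)" "indicator {X. x \<le> M n X} X = (1::real)" using True S[OF True] by auto
      ultimately show ?thesis by (simp only: mult_1_left)
    next
      case False
      have "exp (lam\<^sup>2 / 2 - lam * z - err) * (0 - lam\<^sup>2 / 2 * V X) \<le> 0"
        using vv by (intro mult_nonneg_nonpos) auto
      moreover have "0 \<le> indicator {X. x \<le> M n X} X * lik p c n X" using lp by simp
      ultimately show ?thesis using False by simp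
    qed
  qed
  then have "exp (lam\<^sup>2 / 2 - lam * z - err) * (measure_pmf.prob (Q n) {X. S X} - lam\<^sup>2 / 2 * Exq n V) \<le> PP x"
    unfolding Ex_lin prob_eq_expectation .
  moreover have "v \<le> measure_pmf.prob (Q n) {X. S X} - lam\<^sup>2 / 2 * Exq n V"
    using prob mult_left_mono[OF Ex_V[OF HA], of "lam\<^sup>2 / 2"] by simp
  then have "exp (lam\<^sup>2 / 2 - lam * z - err) * v \<le> exp (lam\<^sup>2 / 2 - lam * z - err) * (measure_pmf.prob (Q n) {X. S X} - lam\<^sup>2 / 2 * Exq n V)"
    by (intro mult_left_mono) auto
  ultimately show ?thesis by linarith
qed

lemma drift_cost_le_eta:
  assumes A: "0 \<le> A" and small: "lam\<^sup>2 * \<epsilon> \<le> 1"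
  shows "lam\<^sup>2 / 2 * vbar A \<le> eta A"
proof -
  have "lam\<^sup>2 / 2 * vbar A = 64 * (A * (lam\<^sup>2 * \<epsilon>)) + 128 * ((lam\<^sup>2 * \<epsilon>) * (lam\<^sup>2 * \<epsilon>))"
    by (simp add: vbar_def power2_eq_square algebra_simps)
  moreover have "(lam\<^sup>2 * \<epsilon>) * (lam\<^sup>2 * \<epsilon>) \<le> 1 * (lam\<^sup>2 * \<epsilon>)" using small eps_pos by (intro mult_right_mono) auto
  moreover have "A * (lam\<^sup>2 * \<epsilon>) \<le> A * rate" using rate_pos A by (intro mult_left_mono) auto
  moreover have "0 \<le> A * rate" using A rate_pos by simp
  ultimately show ?thesis unfolding eta_def arate_ge(2)[OF A] distrib_left using rate_pos by linarith
qed

text \<open>For small \<open>y = (1 + lam) * eta A\<close> the argument of the upper bound works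
  with reversed signs. Otherwise the error could swallow the main term; a short window just above
  \<open>lam\<close> still has guaranteed mass and gives the tail up to a factor of order
  \<open>y\<close>, which \<open>exp (- (100 * y))\<close> absorbs because \<open>y\<close> is
  bounded below.\<close>

lemma lower_bound:
  assumes HA: "(\<Sum>k=2..<n. hx k) \<le> A * \<epsilon>" and A: "0 \<le> A" and small: "lam\<^sup>2 * \<epsilon> \<le> 1" and eta: "eta A \<le> 1/100"
  shows "(1 - Phi lam) * exp (- (err + 100 * ((1 + lam) * eta A))) \<le> PP lam"
proof -
  define G where "G = 1 - Phi lam"
  define E where "E = lam\<^sup>2 / 2 * vbar A"
  define y where "y = (1 + lam) * eta A"
  have G0: "0 < G" using tail_pos by (simp add: G_def)
  have e0: "0 < eta A" using arate_ge(1)[OF A] rate_pos unfolding eta_def by linarith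
  have y0: "0 \<le> y" using e0 lam by (simp add: y_def)
  have EE: "E \<le> eta A" unfolding E_def by (rule drift_cost_le_eta[OF A small])
  show ?thesis
  proof (cases "9 * y \<le> 1/2")
    case True
    have "Exq n (\<lambda>X. exp (- (lam\<^sup>2 / 2) - err) * (f X - lam\<^sup>2 / 2 * V X)) \<le> PP lam"
      unfolding PP_eq
    proof (rule Ex_mono)
      fix X assume X: "X \<in> set_pmf (Q n)"
      have lp: "0 \<le> lik p c n X" using lik_bounds(2)[OF X] exp_ge_zero order_trans by blast
      have vv: "0 \<le> lam\<^sup>2 / 2 * V X" using V_nonneg by simp
      show "exp (- (lam\<^sup>2 / 2) - err) * (f X - lam\<^sup>2 / 2 * V X) \<le> indicator {X. lam \<le> M n X} X * lik p c n X"
      proof (cases "lam \<le> M n X")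
        case True
        have "lam\<^sup>2 / 2 - lam * M n X - err - lam\<^sup>2 / 2 * V X = (- (lam\<^sup>2 / 2) - err) + - (lam * Y n X) + - (lam\<^sup>2 / 2 * V X)"
          by (simp add: Y_n power2_eq_square algebra_simps)
        then have E1: "exp (lam\<^sup>2 / 2 - lam * M n X - err - lam\<^sup>2 / 2 * V X) = exp (- (lam\<^sup>2 / 2) - err) * (f X * exp (- (lam\<^sup>2 / 2 * V X)))"
          using True by (simp only: exp_add f_def Y_n mult.assoc diff_ge_0_iff_ge if_True)
        have "f X * (1 - lam\<^sup>2 / 2 * V X) \<le> f X * exp (- (lam\<^sup>2 / 2 * V X))"
          using f_bounds exp_ge_add_one_self[of "- (lam\<^sup>2 / 2 * V X)"] by (intro mult_left_mono) auto
        moreover have "f X * (lam\<^sup>2 / 2 * V X) \<le> 1 * (lam\<^sup>2 / 2 * V X)" using f_bounds vv by (intro mult_right_mono) auto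
        ultimately have "f X - lam\<^sup>2 / 2 * V X \<le> f X * exp (- (lam\<^sup>2 / 2 * V X))" unfolding right_diff_distrib by linarith
        then have "exp (- (lam\<^sup>2 / 2) - err) * (f X - lam\<^sup>2 / 2 * V X) \<le> exp (- (lam\<^sup>2 / 2) - err) * (f X * exp (- (lam\<^sup>2 / 2 * V X)))"
          by (intro mult_left_mono) auto
        moreover have "indicator {X. lam \<le> M n X} X = (1::real)" using True by simp
        ultimately show ?thesis using lik_bounds(2)[OF X] unfolding E1 by (simp only: mult_1_left)
      next
        case False
        have "exp (- (lam\<^sup>2 / 2) - err) * (0 - lam\<^sup>2 / 2 * V X) \<le> 0"
          using vv by (intro mult_nonneg_nonpos) auto
        moreover have "f X = 0" using False by (simp add: f_def Y_n)
        ultimately show ?thesis using False by simp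
      qed
    qed
    then have 1: "exp (- (lam\<^sup>2 / 2) - err) * (Exq n f - lam\<^sup>2 / 2 * Exq n V) \<le> PP lam" unfolding Ex_lin .
    have "lam\<^sup>2 / 2 * Exq n V \<le> E" unfolding E_def using Ex_V[OF HA] by (intro mult_left_mono) auto
    then have "exp (lam\<^sup>2 / 2) * G - 3 * eta A \<le> Exq n f - lam\<^sup>2 / 2 * Exq n V"
      using expectation_tilted_tail[OF HA A] EE unfolding G_def abs_le_iff by linarith
    then have "exp (- (lam\<^sup>2 / 2) - err) * (exp (lam\<^sup>2 / 2) * G - 3 * eta A) \<le> PP lam"
      by (rule order_trans[OF mult_left_mono 1]) simp
    moreover have "exp (- (lam\<^sup>2 / 2) - err) * (exp (lam\<^sup>2 / 2) * G - 3 * eta A) = exp (- err) * (G - exp (- (lam\<^sup>2 / 2)) * (3 * eta A))"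
    proof -
      have "exp (- (lam\<^sup>2 / 2) - err) = exp (- err) * exp (- (lam\<^sup>2 / 2))" by (simp add: exp_add[symmetric])
      moreover have "exp (- (lam\<^sup>2 / 2)) * exp (lam\<^sup>2 / 2) = 1" by (simp add: exp_minus)
      ultimately show ?thesis by (simp add: right_diff_distrib mult.assoc[symmetric])
    qed
    moreover have "G * (1 - 9 * y) \<le> G - exp (- (lam\<^sup>2 / 2)) * (3 * eta A)"
    proof -
      have "exp (- (lam\<^sup>2 / 2)) * (3 * eta A) \<le> (3 * (1 + lam) * G) * (3 * eta A)"
        using gauss_le_tail e0 unfolding G_def by (intro mult_right_mono) auto
      also have "\<dots> = G * (9 * y)" by (simp add: y_def)
      finally show ?thesis unfolding right_diff_distrib by simp
    qed
    then have "exp (- err) * (G * (1 - 9 * y)) \<le> exp (- err) * (G - exp (- (lam\<^sup>2 / 2)) * (3 * eta A))" by (intro mult_left_mono) auto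
    ultimately have 2: "exp (- err) * (G * (1 - 9 * y)) \<le> PP lam" by linarith
    have "exp (- (2 * (9 * y))) \<le> 1 - 9 * y" using True y0 by (intro exp_minus_double_le) auto
    then have "exp (- err) * (G * exp (- (2 * (9 * y)))) \<le> exp (- err) * (G * (1 - 9 * y))" using G0 by (intro mult_left_mono) auto
    moreover have "exp (- (err + 100 * y)) \<le> exp (- err) * exp (- (2 * (9 * y)))" unfolding exp_add[symmetric] using y0 by simp
    then have "G * exp (- (err + 100 * y)) \<le> G * (exp (- err) * exp (- (2 * (9 * y))))" using G0 by (intro mult_left_mono) auto
    ultimately show ?thesis using 2 unfolding G_def[symmetric] y_def[symmetric] by (simp add: mult_ac)
  next
    case False
    \<comment> \<open>\<open>24 / 6 - 2 - 1 = 1\<close>: the normal mass of the window, less the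
      error of \<open>window_clt\<close> and the drift cost, leaves \<open>eta A\<close>.\<close>
    define \<delta> where "\<delta> = 24 * eta A"
    have \<delta>: "0 \<le> \<delta>" "\<delta> \<le> 1" using eta e0 by (auto simp: \<delta>_def)
    have "exp (lam\<^sup>2 / 2 - lam * (lam + \<delta>) - err) * eta A \<le> PP lam"
    proof (rule lower_window[OF HA, where S = "\<lambda>X. 0 \<le> Y n X \<and> Y n X \<le> \<delta>"])
      show "eta A \<le> measure_pmf.prob (Q n) {X. 0 \<le> Y n X \<and> Y n X \<le> \<delta>} - lam\<^sup>2 / 2 * vbar A"
        using window_clt[OF HA A \<delta>(1)] Phi_window[OF \<delta>] EE unfolding E_def \<delta>_def abs_le_iff by linarith
    qed (use e0 in \<open>auto simp: Y_n\<close>)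
    moreover have "lam\<^sup>2 / 2 - lam * (lam + \<delta>) - err = - (lam\<^sup>2 / 2) + - (err + lam * \<delta>)"
      by (simp add: power2_eq_square algebra_simps)
    ultimately have 1: "exp (- (lam\<^sup>2 / 2)) * exp (- (err + lam * \<delta>)) * eta A \<le> PP lam" by (simp only: exp_add)
    have g: "G * (1 + lam) \<le> exp (- (lam\<^sup>2 / 2))"
      using normal_tail_bounds(1)[OF lam(1)] lam unfolding G_def by (simp add: field_simps)
    have "G * (exp (- (err + lam * \<delta>)) * y) = (G * (1 + lam)) * (exp (- (err + lam * \<delta>)) * eta A)" by (simp add: y_def)
    also have "\<dots> \<le> exp (- (lam\<^sup>2 / 2)) * (exp (- (err + lam * \<delta>)) * eta A)" using g e0 by (intro mult_right_mono) auto
    finally have 2: "G * (exp (- (err + lam * \<delta>)) * y) \<le> PP lam" using 1 unfolding mult.assoc by linarith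
    \<comment> \<open>76 is what remains of 100 after \<open>lam * \<delta> \<le> 24 * y\<close>;
      the claim rests on \<open>y > 1/18\<close>.\<close>
    have "exp (- (76 * y)) \<le> y"
    proof -
      have "1 + 76 * y \<le> exp (76 * y)" by (rule exp_ge_add_one_self)
      moreover have "20 \<le> 76 * y * 5" using False by simp
      moreover have "1 / y \<le> 18" using False by (simp add: field_simps)
      moreover have "18 \<le> exp (76 * y)"
      proof -
        have "13/5 \<le> exp (19/18 :: real)" using exp_lower_Taylor_quadratic[of "19/18 :: real"] by (simp add: power2_eq_square)
        then have "13/5 * (13/5) \<le> exp (19/18) * exp (19/18 :: real)" by (intro mult_mono) auto
        then have a: "17/4 \<le> exp (38/18 :: real)" unfolding exp_add[symmetric] by simp
        have "17/4 * (17/4) \<le> exp (38/18) * exp (38/18 :: real)" using a by (intro mult_mono) auto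
        then have b: "18 \<le> exp (76/18 :: real)" unfolding exp_add[symmetric] by simp
        have "exp (76/18) \<le> exp (76 * y)" using False by simp
        with b show ?thesis by linarith
      qed
      moreover have "0 < y" using False by simp
      ultimately have "1 / y \<le> exp (76 * y)" by linarith
      then show ?thesis using \<open>0 < y\<close> by (simp add: exp_minus field_simps)
    qed
    moreover have ld: "lam * \<delta> \<le> 24 * y" using e0 lam by (simp add: \<delta>_def y_def algebra_simps)
    have "exp (- (err + 100 * y)) \<le> exp (- (err + lam * \<delta>)) * exp (- (76 * y))"
      unfolding exp_add[symmetric] using ld by simp
    ultimately have "exp (- (err + 100 * y)) \<le> exp (- (err + lam * \<delta>)) * y"
      by (meson exp_ge_zero mult_left_mono order_trans)
    then have "G * exp (- (err + 100 * y)) \<le> G * (exp (- (err + lam * \<delta>)) * y)" using G0 by (intro mult_left_mono) auto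
    with 2 show ?thesis unfolding G_def[symmetric] y_def[symmetric] by linarith
  qed
qed

end

section \<open>Lower bound by tilting beyond the level\<close>

context tilted_chain
begin

text \<open>The martingale part of \<open>M\<close> under the tilted law, started at time 2; its
  increments are orthogonal and their variances add up to at most \<open>tau\<close>.\<close>

definition "Mart k X = M k X - (\<Sum>j=2..<k. e (Suc j) * (tilt (rr j X) (c (Suc j)) - rr j X))"

lemma Mart_step:
  assumes "2 \<le> k" "k < n"
  shows "Mart (Suc k) (X(Suc k := s)) = Mart k X + e (Suc k) * (real_of_int s - tilt (rr k X) (c (Suc k)))"
proof -
  have "(\<Sum>j=2..<Suc k. e (Suc j) * (tilt (rr j (X(Suc k := s))) (c (Suc j)) - rr j (X(Suc k := s))))
    = (\<Sum>j=2..<Suc k. e (Suc j) * (tilt (rr j X) (c (Suc j)) - rr j X))"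
    by (intro sum.cong refl) (auto simp: memdrift_update)
  then show ?thesis using assms M_step[OF assms, of X s] by (simp add: Mart_def algebra_simps)
qed

lemma Mart_moment:
  assumes "2 \<le> k" "k \<le> n"
  shows "Exq k (\<lambda>X. (Mart k X)\<^sup>2) \<le> 4 * \<epsilon>\<^sup>2 + tau k"
  using assms
proof (induction k rule: dec_induct)
  case base
  have "Exq 2 (\<lambda>X. (Mart 2 X)\<^sup>2) \<le> Exq 2 (\<lambda>X. 4 * \<epsilon>\<^sup>2)"
  proof (rule Ex_mono)
    fix X assume "X \<in> set_pmf (Q 2)"
    then have "\<bar>M 2 X\<bar> \<le> 2 * \<epsilon>" by (rule M2_bound) simp
    then have "(M 2 X)\<^sup>2 \<le> (2 * \<epsilon>)\<^sup>2" using power_mono[of "\<bar>M 2 X\<bar>" "2 * \<epsilon>" 2] by simp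
    then show "(Mart 2 X)\<^sup>2 \<le> 4 * \<epsilon>\<^sup>2" by (simp add: Mart_def power_mult_distrib)
  qed
  then show ?case unfolding Ex_lin using tau_nonneg[of 2] by linarith
next
  case (step k)
  have "Exq (Suc k) (\<lambda>X. (Mart (Suc k) X)\<^sup>2) = Exq k (\<lambda>X. (1 + tilt (rr k X) (c (Suc k))) / 2 * (Mart (Suc k) (X(Suc k := 1)))\<^sup>2
       + (1 - tilt (rr k X) (c (Suc k))) / 2 * (Mart (Suc k) (X(Suc k := - 1)))\<^sup>2)"
    using step by (intro Ex_Suc) auto
  also have "\<dots> \<le> Exq k (\<lambda>X. (Mart k X)\<^sup>2 + (e (Suc k))\<^sup>2)"
  proof (rule Ex_mono)
    fix X assume X: "X \<in> set_pmf (Q k)"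
    define \<rho> m f where "\<rho> = tilt (rr k X) (c (Suc k))" and "m = Mart k X" and "f = e (Suc k)"
    have M1: "Mart (Suc k) (X(Suc k := 1)) = m + f * (1 - \<rho>)" "Mart (Suc k) (X(Suc k := - 1)) = m + f * (- 1 - \<rho>)"
      using Mart_step[of k X 1] Mart_step[of k X "- 1"] step by (simp_all add: m_def f_def \<rho>_def)
    have "(1 + \<rho>) / 2 * (m + f * (1 - \<rho>))\<^sup>2 + (1 - \<rho>) / 2 * (m + f * (- 1 - \<rho>))\<^sup>2 = m\<^sup>2 + f\<^sup>2 * (1 - \<rho>\<^sup>2)"
      by (simp add: power2_eq_square field_simps)
    also have "\<dots> \<le> m\<^sup>2 + f\<^sup>2 * 1" by (intro add_left_mono mult_left_mono) auto
    finally show "(1 + tilt (rr k X) (c (Suc k))) / 2 * (Mart (Suc k) (X(Suc k := 1)))\<^sup>2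
       + (1 - tilt (rr k X) (c (Suc k))) / 2 * (Mart (Suc k) (X(Suc k := - 1)))\<^sup>2 \<le> (Mart k X)\<^sup>2 + (e (Suc k))\<^sup>2"
      unfolding M1 \<rho>_def[symmetric] unfolding m_def f_def by simp
  qed
  also have "\<dots> = Exq k (\<lambda>X. (Mart k X)\<^sup>2) + (e (Suc k))\<^sup>2" by (simp only: Ex_lin)
  finally show ?case using step tau_Suc[of k] by linarith
qed

lemma drift_close:
  assumes X: "X \<in> set_pmf (Q n)"
  shows "\<bar>M n X - Mart n X - lam\<bar> \<le> 2 * (lam * V X) + 3 * (lam\<^sup>2 * \<epsilon>) + 1"
proof -
  have r1: "\<bar>rr k X\<bar> \<le> 1" if "k \<in> {2..<n}" for k
  proof -
    have "sign_path k X" using supp[OF X] that by (auto simp: sign_path_def)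
    then show ?thesis using that by (intro memdrift_abs p) auto
  qed
  have "(\<Sum>k=2..<n. e (Suc k) * c (Suc k)) = (\<Sum>k=2..<n. lam * (e (Suc k))\<^sup>2)"
    by (intro sum.cong) (auto simp: c_Suc power2_eq_square)
  then have s1: "(\<Sum>k=2..<n. e (Suc k) * c (Suc k)) = lam - lam * tau 2"
    unfolding sum_distrib_left[symmetric] sum_e2(1) by (simp add: algebra_simps)
  have eq: "M n X - Mart n X - (lam - lam * tau 2) = (\<Sum>k=2..<n. e (Suc k) * (tilt (rr k X) (c (Suc k)) - rr k X - c (Suc k)))"
    unfolding s1[symmetric] Mart_def by (simp add: sum_subtractf[symmetric] right_diff_distrib)
  have "\<bar>M n X - Mart n X - (lam - lam * tau 2)\<bar> \<le> (\<Sum>k=2..<n. 2 * lam * ((e (Suc k))\<^sup>2 * (rr k X)\<^sup>2) + 3 * lam\<^sup>2 * (e (Suc k)) ^ 3)"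
    unfolding eq
  proof (rule order_trans[OF sum_abs sum_mono])
    fix k assume k: "k \<in> {2..<n}"
    have e0: "0 < e (Suc k)" using e_pos[of "Suc k"] k by auto
    have "\<bar>tilt (rr k X) (c (Suc k)) - rr k X - c (Suc k)\<bar> \<le> 2 * c (Suc k) * (rr k X)\<^sup>2 + 3 * (c (Suc k))\<^sup>2"
      by (rule tilt_bounds(2)[OF r1[OF k] c_bounds])
    then have "e (Suc k) * \<bar>tilt (rr k X) (c (Suc k)) - rr k X - c (Suc k)\<bar> \<le> e (Suc k) * (2 * c (Suc k) * (rr k X)\<^sup>2 + 3 * (c (Suc k))\<^sup>2)"
      using e0 by (intro mult_left_mono) auto
    also have "\<dots> = 2 * lam * ((e (Suc k))\<^sup>2 * (rr k X)\<^sup>2) + 3 * lam\<^sup>2 * (e (Suc k)) ^ 3"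
      using k by (simp add: c_Suc power2_eq_square power3_eq_cube algebra_simps)
    finally show "\<bar>e (Suc k) * (tilt (rr k X) (c (Suc k)) - rr k X - c (Suc k))\<bar> \<le> 2 * lam * ((e (Suc k))\<^sup>2 * (rr k X)\<^sup>2) + 3 * lam\<^sup>2 * (e (Suc k)) ^ 3"
      using e0 by (simp add: abs_mult)
  qed
  also have "\<dots> = 2 * lam * V X + 3 * lam\<^sup>2 * (\<Sum>k=2..<n. (e (Suc k)) ^ 3)"
    unfolding V_def by (simp only: sum.distrib sum_distrib_left)
  also have "\<dots> \<le> 2 * lam * V X + 3 * lam\<^sup>2 * \<epsilon>" using sum_e2(2) by (intro add_left_mono mult_left_mono) auto
  finally have 1: "\<bar>M n X - Mart n X - (lam - lam * tau 2)\<bar> \<le> 2 * (lam * V X) + 3 * (lam\<^sup>2 * \<epsilon>)" by simp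
  have "lam * tau 2 \<le> lam * (2 * \<epsilon>\<^sup>2)" using tau_2 lam by (intro mult_left_mono) auto
  also have "\<dots> = 2 * \<epsilon> * (lam * \<epsilon>)" by (simp add: power2_eq_square)
  also have "\<dots> \<le> 2 * (1/100) * (1/8)" using lam eps_pos eps by (intro mult_mono) auto
  finally have 2: "lam * tau 2 \<le> 1" by simp
  have 3: "0 \<le> lam * tau 2" using lam tau_nonneg by simp
  show ?thesis using 1 2 3 unfolding abs_le_iff by linarith
qed

text \<open>With \<open>lam\<close> exceeding \<open>x\<close> by the uncertainty \<open>w\<close>
  of \<open>M n\<close>, a typical path of the tilted walk lies above \<open>x\<close>. An event of
  probability 1/2 then suffices, and no normal approximation is involved.\<close>

lemma lower_bound_far:
  assumes HA: "(\<Sum>k=2..<n. hx k) \<le> A * \<epsilon>" and A: "1 \<le> A"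
    and w: "4 + 8 * (lam * vbar A) + 3 * (lam\<^sup>2 * \<epsilon>) \<le> w" and x: "x \<le> lam - w"
  shows "exp (- (lam\<^sup>2 / 2) - lam * w - err - 2 * (lam * (lam * vbar A))) / 2 \<le> PP x"
proof -
  have v0: "0 < vbar A"
  proof -
    have "0 < A * \<epsilon>" using A eps_pos by simp
    moreover have "0 \<le> lam\<^sup>2 * \<epsilon>\<^sup>2" by simp
    ultimately show ?thesis unfolding vbar_def distrib_left by linarith
  qed
  \<comment> \<open>The two Chebyshev-Markov failures, \<open>2/9\<close> and \<open>1/4\<close>,
    sum to less than \<open>1/2\<close>. The thresholds explain \<open>w\<close>:
    \<open>4 = 3 + 1\<close> and \<open>8 = 2 * 4\<close>, with 1 and 2 taken from
    \<open>drift_close\<close>.\<close>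
  define S where "S = {X. \<bar>Mart n X\<bar> < 3 \<and> V X < 4 * vbar A}"
  define K where "K = exp (- (lam\<^sup>2 / 2) - lam * w - err - 2 * (lam * (lam * vbar A)))"
  have m2: "Exq n (\<lambda>X. (Mart n X)\<^sup>2) \<le> 2"
  proof -
    have "\<epsilon>\<^sup>2 \<le> (1/100)\<^sup>2" using eps eps_pos by (intro power_mono) auto
    then show ?thesis using Mart_moment[of n] n tau_n by (simp add: power2_eq_square)
  qed
  have p1: "measure_pmf.prob (Q n) {X. 9 \<le> (Mart n X)\<^sup>2} \<le> 2 / 9"
    by (rule order_trans[OF markov_finite[OF fin]]) (use m2 in auto)
  have p2: "measure_pmf.prob (Q n) {X. 4 * vbar A \<le> V X} \<le> 1 / 4"
  proof -
    have "measure_pmf.prob (Q n) {X. 4 * vbar A \<le> V X} \<le> Exq n V / (4 * vbar A)"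
      using v0 V_nonneg by (intro markov_finite fin) auto
    also have "\<dots> \<le> vbar A / (4 * vbar A)" using Ex_V[OF HA] v0 by (intro divide_right_mono) auto
    finally show ?thesis using v0 by simp
  qed
  have pS: "1 / 2 \<le> measure_pmf.prob (Q n) S"
  proof -
    have "UNIV = S \<union> ({X. 9 \<le> (Mart n X)\<^sup>2} \<union> {X. 4 * vbar A \<le> V X})"
    proof (rule UNIV_eq_I)
      fix X
      have "9 \<le> (Mart n X)\<^sup>2" if "3 \<le> \<bar>Mart n X\<bar>" using power_mono[OF that, of 2] by simp
      then show "X \<in> S \<union> ({X. 9 \<le> (Mart n X)\<^sup>2} \<union> {X. 4 * vbar A \<le> V X})" by (auto simp: S_def not_le[symmetric])
    qed
    then have "1 = measure_pmf.prob (Q n) (S \<union> ({X. 9 \<le> (Mart n X)\<^sup>2} \<union> {X. 4 * vbar A \<le> V X}))"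
      using measure_pmf.prob_space[of "Q n"] by simp
    also have "\<dots> \<le> measure_pmf.prob (Q n) S + (measure_pmf.prob (Q n) {X. 9 \<le> (Mart n X)\<^sup>2} + measure_pmf.prob (Q n) {X. 4 * vbar A \<le> V X})"
      by (rule order_trans[OF measure_Un_le add_left_mono[OF measure_Un_le]]) auto
    finally show ?thesis using p1 p2 by linarith
  qed
  have "Exq n (\<lambda>X. K * indicator S X) \<le> PP x"
    unfolding PP_eq
  proof (rule Ex_mono)
    fix X assume X: "X \<in> set_pmf (Q n)"
    have lp: "0 \<le> lik p c n X" using lik_bounds(2)[OF X] exp_ge_zero order_trans by blast
    show "K * indicator S X \<le> indicator {X. x \<le> M n X} X * lik p c n X"
    proof (cases "X \<in> S")
      case True
      then have S: "\<bar>Mart n X\<bar> < 3" "V X \<le> 4 * vbar A" by (auto simp: S_def)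
      have lV: "lam * V X \<le> 4 * (lam * vbar A)" using mult_left_mono[OF S(2) lam(1)] by simp
      have Mw: "\<bar>M n X - lam\<bar> \<le> w" using drift_close[OF X] S(1) lV w unfolding abs_le_iff abs_less_iff by linarith
      have "x \<le> M n X" using Mw x unfolding abs_le_iff by linarith
      moreover have "K \<le> lik p c n X"
      proof -
        have a: "lam * M n X \<le> lam * lam + lam * w"
          using mult_left_mono[of "M n X" "lam + w" lam] Mw lam unfolding abs_le_iff by (simp add: distrib_left)
        have b: "lam\<^sup>2 / 2 * V X \<le> 2 * (lam * (lam * vbar A))"
          using mult_left_mono[OF lV lam(1)] by (simp add: power2_eq_square)
        have "- (lam\<^sup>2 / 2) - lam * w - err - 2 * (lam * (lam * vbar A)) \<le> lam\<^sup>2 / 2 - lam * M n X - err - lam\<^sup>2 / 2 * V X"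
          using a b unfolding power2_eq_square by linarith
        then have "K \<le> exp (lam\<^sup>2 / 2 - lam * M n X - err - lam\<^sup>2 / 2 * V X)" unfolding K_def by simp
        also have "\<dots> \<le> lik p c n X" by (rule lik_bounds(2)[OF X])
        finally show ?thesis .
      qed
      ultimately show ?thesis using True by simp
    next
      case False
      then show ?thesis using lp by simp
    qed
  qed
  then have "K * measure_pmf.prob (Q n) S \<le> PP x" by (simp only: Ex_lin prob_eq_expectation)
  moreover have "K * (1 / 2) \<le> K * measure_pmf.prob (Q n) S" using pS by (intro mult_left_mono) (auto simp: K_def)
  ultimately show ?thesis unfolding K_def[symmetric] by linarith
qed

end

lemma eps_log_le: "0 < \<epsilon> \<Longrightarrow> \<epsilon> * (- ln \<epsilon>) \<le> 2 * sqrt (\<epsilon>::real)"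
proof -
  assume e: "0 < \<epsilon>"
  define s where "s = sqrt \<epsilon>"
  have s: "0 < s" "\<epsilon> = s * s" using e by (auto simp: s_def)
  have "ln (1 / s) \<le> 1 / s - 1" using s by (intro ln_le_minus_one) auto
  then have "- ln s \<le> 1 / s" using s by (simp add: ln_div)
  then have "s * (- ln s) \<le> s * (1 / s)" using s by (intro mult_left_mono) auto
  then have "s * (- ln s) \<le> 1" using s by simp
  then have "2 * s * (s * (- ln s)) \<le> 2 * s * 1" using s by (intro mult_left_mono) auto
  then show ?thesis using s by (simp add: ln_mult_pos s_def[symmetric] algebra_simps)
qed

text \<open>
  The constant \<open>K\<close> is the factor in the Kolmogorov bound. The memory parameter and the regime enter
  only through \<open>A\<close>, the bound on the accumulated memory drift.
\<close>

locale scaled_walk =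
  fixes p q :: real and n :: nat and e :: "nat \<Rightarrow> real" and \<epsilon> A K :: real
  assumes p: "0 \<le> p" "p \<le> 1" and n: "3 \<le> n"
    and e_pos: "\<And>k. 1 \<le> k \<Longrightarrow> k \<le> n \<Longrightarrow> 0 < e k"
    and e_rec: "\<And>k. 2 \<le> k \<Longrightarrow> k < n \<Longrightarrow> e (Suc k) * (1 + (2 * p - 1) / real k) = e k"
    and e_sum: "(\<Sum>k=1..n. (e k)\<^sup>2) = 1"
    and e_le: "\<And>k. 1 \<le> k \<Longrightarrow> k \<le> n \<Longrightarrow> e k \<le> \<epsilon>"
    and A: "1 \<le> A" and K: "K = 200000000000 * (1 + A)" and eps0: "\<epsilon> \<le> 1 / (400 * K) ^ 4"
    and HA: "(\<Sum>k=2..<n. (\<Sum>j=1..k. (e j)\<^sup>2) / ((real k)\<^sup>2 * (1 - (\<Sum>j=1..Suc k. (e j)\<^sup>2) + \<epsilon>\<^sup>2))) \<le> A * \<epsilon>"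
begin

definition "W = \<epsilon> * (- ln \<epsilon>)"
definition "D x = x ^ 3 * \<epsilon> + (1 + x) * W"
definition "TP x = measure_pmf.prob (erw_pmf p q n) {X. x \<le> e n * real_of_int (erw_pos X n)}"

lemma K_ge: "400000000000 \<le> K" unfolding K distrib_left using A by linarith

lemma eps_pos: "0 < \<epsilon>" using e_pos[of 1] e_le[of 1] n by linarith

lemma eps_bounds: "\<epsilon> \<le> 1/100" "W \<le> 1 / (200 * K)" "smin \<epsilon> \<le> 1" "\<epsilon> \<le> W"
proof -
  define k where "k = 400 * K"
  have k: "1 \<le> k" "160000000000000 \<le> k" using K_ge by (auto simp: k_def)
  have "k ^ 1 \<le> k ^ 4" using k by (intro power_increasing) auto
  then have k4: "k \<le> k ^ 4" by simp
  have e4: "\<epsilon> \<le> 1 / k ^ 4" using eps0 by (simp add: k_def)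
  also have "\<dots> \<le> 1 / 100" using k k4 by (intro divide_left_mono) auto
  finally show e1: "\<epsilon> \<le> 1/100" .
  have "sqrt \<epsilon> \<le> sqrt (1 / k ^ 4)" using e4 by simp
  also have "\<dots> = 1 / k\<^sup>2"
  proof -
    have "1 / k ^ 4 = (1 / k\<^sup>2)\<^sup>2" by (simp add: power_divide power_mult[symmetric])
    then show ?thesis using k by simp
  qed
  also have "\<dots> \<le> 1 / k"
    using k by (intro divide_left_mono) (auto simp: power2_eq_square)
  finally have s: "sqrt \<epsilon> \<le> 1 / k" .
  have W2: "W \<le> 2 * sqrt \<epsilon>" unfolding W_def by (rule eps_log_le[OF eps_pos])
  then have "W \<le> 2 * (1 / k)" using s by linarith
  also have "2 * (1 / k) = 1 / (200 * K)" by (simp add: k_def)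
  finally show Wk: "W \<le> 1 / (200 * K)" .
  show "\<epsilon> \<le> W"
    using mult_left_mono[OF ln_small[OF eps_pos e1], of \<epsilon>] eps_pos by (simp add: W_def)
  have "smin \<epsilon> = 25600000000 * (\<epsilon> * W)" by (simp add: smin_def W_def power2_eq_square)
  also have "\<dots> \<le> 25600000000 * (1 * W)"
    using e1 eps_pos \<open>\<epsilon> \<le> W\<close> by (intro mult_left_mono mult_right_mono) auto
  also have "\<dots> \<le> 25600000000 * (1 / (200 * K))" using Wk by simp
  also have "\<dots> \<le> 25600000000 * (1 / (200 * 400000000000))" using K_ge by (intro mult_left_mono divide_left_mono) auto
  finally show "smin \<epsilon> \<le> 1" by simp
qed

lemma chain: "0 \<le> lam \<Longrightarrow> lam * \<epsilon> \<le> 1/8 \<Longrightarrow> tilted_chain p n e lam \<epsilon>"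
  using p n e_pos e_rec e_sum e_le eps_bounds by unfold_locales auto

lemma drift_sum_le: "tilted_chain p n e lam \<epsilon> \<Longrightarrow> (\<Sum>k=2..<n. tilted_chain.hx e \<epsilon> k) \<le> A * \<epsilon>"
  using HA by (simp add: tilted_chain.hx_def tilted_chain.tau_def)

lemma D_parts:
  assumes "0 \<le> x"
  shows "x ^ 3 * \<epsilon> \<le> D x" "(1 + x) * W \<le> D x" "x * \<epsilon> \<le> D x" "(1 + x) * (x\<^sup>2 * \<epsilon>) \<le> 2 * D x"
proof -
  have W0: "0 \<le> W" using eps_bounds eps_pos by linarith
  have a: "0 \<le> x ^ 3 * \<epsilon>" "0 \<le> (1 + x) * W" using assms eps_pos W0 by auto
  show 1: "x ^ 3 * \<epsilon> \<le> D x" and 2: "(1 + x) * W \<le> D x" unfolding D_def using a by linarith+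
  have "x * \<epsilon> \<le> (1 + x) * W" using assms eps_bounds(4) eps_pos by (intro mult_mono) auto
  then show "x * \<epsilon> \<le> D x" using 2 by linarith
  have "x\<^sup>2 \<le> x ^ 3 + 1"
  proof (cases "x \<le> 1")
    case True
    then have "x\<^sup>2 \<le> 1" using assms by (simp add: power_le_one)
    moreover have "0 \<le> x ^ 3" using assms by simp
    ultimately show ?thesis by linarith
  next
    case False
    then have "x\<^sup>2 \<le> x ^ 3" by (intro power_increasing) auto
    then show ?thesis by simp
  qed
  then have "x\<^sup>2 * \<epsilon> \<le> (x ^ 3 + 1) * \<epsilon>" using eps_pos by (intro mult_right_mono) auto
  then have "x\<^sup>2 * \<epsilon> \<le> x ^ 3 * \<epsilon> + \<epsilon>" by (simp add: distrib_right)
  moreover have "\<epsilon> \<le> (1 + x) * W"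
  proof -
    have "1 * W \<le> (1 + x) * W" using assms W0 by (intro mult_right_mono) auto
    then show ?thesis using eps_bounds(4) by linarith
  qed
  moreover have "(1 + x) * (x\<^sup>2 * \<epsilon>) = x\<^sup>2 * \<epsilon> + x ^ 3 * \<epsilon>" by (simp add: power2_eq_square power3_eq_cube algebra_simps)
  ultimately show "(1 + x) * (x\<^sup>2 * \<epsilon>) \<le> 2 * D x" unfolding D_def distrib_left[of 2] using a by linarith
qed

text \<open>The threshold makes \<open>eta A = K * (x^2 * \<epsilon> + W)\<close> at most
  \<open>1/200 + 1/200\<close>, as \<open>lower_bound\<close> requires. In the constant, 12 bounds
  \<open>err\<close> and \<open>300 = 100 * 3\<close> comes from
  \<open>(1 + x) * eta A\<close>.\<close>

lemma moderate_deviation_near: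
  assumes x: "0 \<le> x" "x * \<epsilon> \<le> 1/8" and c: "x\<^sup>2 * \<epsilon> \<le> 1 / (200 * K)"
  shows "TP x \<le> (1 - Phi x) * exp ((12 + 300 * K) * D x)" "(1 - Phi x) * exp (- ((12 + 300 * K) * D x)) \<le> TP x"
proof -
  interpret tc: tilted_chain p q n e x \<epsilon> by (rule chain[OF x])
  note ha = drift_sum_le[OF tc.tilted_chain_axioms]
  have A0: "0 \<le> A" using A by simp
  have rate: "tc.rate = x\<^sup>2 * \<epsilon> + W" by (simp add: tc.rate_def tc.EL_def tc.L_def W_def)
  have eta: "tc.eta A = K * (x\<^sup>2 * \<epsilon> + W)" by (simp add: tc.eta_def tc.arate_def rate K)
  have K0: "0 < K" using K_ge by linarith
  have small: "x\<^sup>2 * \<epsilon> \<le> 1"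
  proof -
    have "1 / (200 * K) \<le> 1 / 1" using K_ge by (intro divide_left_mono) auto
    then show ?thesis using c by linarith
  qed
  have eta1: "tc.eta A \<le> 1/100"
  proof -
    have "K * (x\<^sup>2 * \<epsilon> + W) \<le> K * (1 / (200 * K) + 1 / (200 * K))" using K0 c eps_bounds(2) by (intro mult_left_mono) auto
    also have "\<dots> = 1/100" using K0 by simp
    finally show ?thesis by (simp add: eta)
  qed
  note d = D_parts[OF x(1)]
  have ke: "(1 + x) * tc.eta A \<le> K * (3 * D x)"
  proof -
    have "(1 + x) * tc.eta A = K * ((1 + x) * (x\<^sup>2 * \<epsilon>) + (1 + x) * W)" by (simp add: eta algebra_simps)
    also have "\<dots> \<le> K * (3 * D x)" using d K0 by (intro mult_left_mono) auto
    finally show ?thesis .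
  qed
  have er: "tc.err \<le> 12 * D x" unfolding tc.err_def using d by linarith
  have D0: "0 \<le> D x" using d(3) x eps_pos by (meson less_imp_le mult_nonneg_nonneg order_trans)
  have KD: "0 \<le> K * D x" using K0 D0 by simp
  have G0: "0 \<le> 1 - Phi x" using Phi_le_1[of x] by simp
  have TP: "TP x = tc.PP x" by (simp add: TP_def tc.PP_def)
  have "tc.err + 6 * ((1 + x) * tc.eta A) \<le> (12 + 300 * K) * D x"
    using ke er KD unfolding distrib_right[of 12] mult.assoc distrib_left[of 6] by linarith
  then have "(1 - Phi x) * exp (tc.err + 6 * ((1 + x) * tc.eta A)) \<le> (1 - Phi x) * exp ((12 + 300 * K) * D x)"
    using G0 by (intro mult_left_mono) auto
  then show "TP x \<le> (1 - Phi x) * exp ((12 + 300 * K) * D x)"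
    using tc.upper_bound[OF ha A0] unfolding TP by linarith
  have "tc.err + 100 * ((1 + x) * tc.eta A) \<le> (12 + 300 * K) * D x"
    using ke er KD unfolding distrib_right[of 12] mult.assoc distrib_left[of 6] by linarith
  then have "(1 - Phi x) * exp (- ((12 + 300 * K) * D x)) \<le> (1 - Phi x) * exp (- (tc.err + 100 * ((1 + x) * tc.eta A)))"
    using G0 by (intro mult_left_mono) auto
  then show "(1 - Phi x) * exp (- ((12 + 300 * K) * D x)) \<le> TP x"
    using tc.lower_bound[OF ha A0 small eta1] unfolding TP by linarith
qed

definition "Ka = 4 + 128 * A"
definition "C = 20000 + 6000 * (K * Ka)"

text \<open>As \<open>x^2 * \<epsilon>\<close> is bounded below,
  \<open>x \<le> 200 * K * x^3 * \<epsilon>\<close>. Any factor \<open>exp (O(x))\<close> is thus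
  within the allowed error, which admits both the crude upper bound and a tilt overshooting by
  \<open>d\<close>.\<close>

lemma moderate_deviation_far:
  assumes x: "0 \<le> x" "x * \<epsilon> \<le> 1/4000" and c: "1 / (200 * K) < x\<^sup>2 * \<epsilon>"
  shows "TP x \<le> (1 - Phi x) * exp (C * D x)" "(1 - Phi x) * exp (- (C * D x)) \<le> TP x"
proof -
  have K0: "0 < K" using K_ge by linarith
  have Ka4: "4 \<le> Ka" using A by (simp add: Ka_def)
  define z where "z = x ^ 3 * \<epsilon>"
  have zD: "z \<le> D x" unfolding z_def by (rule D_parts(1)[OF x(1)])
  have xz: "x \<le> 200 * K * z"
  proof -
    have "1 \<le> 200 * K * (x\<^sup>2 * \<epsilon>)" using c K0 by (simp add: field_simps)
    then have "x * 1 \<le> x * (200 * K * (x\<^sup>2 * \<epsilon>))" using x by (intro mult_left_mono) auto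
    then show ?thesis by (simp add: z_def power2_eq_square power3_eq_cube mult_ac)
  qed
  \<comment> \<open>The fourth power in the bound on \<open>\<epsilon>\<close> is spent here: for
    \<open>x < K\<close> it would make \<open>x^2 * \<epsilon>\<close> smaller than the
    threshold.\<close>
  have xK: "K \<le> x"
  proof (rule ccontr)
    assume "\<not> K \<le> x"
    then have "x\<^sup>2 * \<epsilon> \<le> K\<^sup>2 * (1 / (400 * K) ^ 4)" using x eps0 eps_pos by (intro mult_mono power_mono) auto
    also have "\<dots> = 1 / (25600000000 * K * K)" using K0 by (simp add: power_mult_distrib field_simps eval_nat_numeral)
    also have "\<dots> \<le> 1 / (200 * K)"
    proof (intro divide_left_mono)
      have "200 * K * 1 \<le> 25600000000 * K * K" using K_ge by (intro mult_mono) auto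
      then show "200 * K \<le> 25600000000 * K * K" by simp
    qed (use K0 in auto)
    finally show False using c by simp
  qed
  have x1: "1 \<le> x" "2 * Ka \<le> x" using xK K_ge K A by (auto simp: Ka_def)
  have KK: "4 * K \<le> K * Ka" using Ka4 K0 by simp
  have z0: "0 \<le> z" using x eps_pos by (simp add: z_def)
  have Kz: "4 * (K * z) \<le> K * Ka * z" using mult_right_mono[OF KK z0] by simp
  have Kz0: "0 \<le> K * z" using K0 z0 by simp
  have Cz: "C * z = 20000 * z + 6000 * (K * Ka * z)" by (simp add: C_def algebra_simps)
  have C0: "0 \<le> C" using K0 Ka4 by (simp add: C_def)
  have CD: "C * z \<le> C * D x" using zD C0 by (intro mult_left_mono) auto
  have G0: "0 \<le> 1 - Phi x" using Phi_le_1[of x] by simp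
  have xe: "x * \<epsilon> \<le> x" using x1 eps_bounds(1) eps_pos by (simp add: mult_left_le)
  {
    interpret tc: tilted_chain p q n e x \<epsilon> using x by (intro chain) auto
    have TP: "TP x = tc.PP x" by (simp add: TP_def tc.PP_def)
    have "3 * (1 + x) \<le> exp (6 * x)"
      unfolding distrib_left using exp_ge_add_one_self[of "6 * x"] x1 by linarith
    then have "3 * (1 + x) * exp tc.err \<le> exp (6 * x) * exp tc.err" by (intro mult_right_mono) auto
    also have "\<dots> \<le> exp (C * D x)"
      unfolding exp_add[symmetric] exp_le_cancel_iff tc.err_def z_def[symmetric]
      using xz xe z0 Kz Kz0 Cz CD by linarith
    finally have "(1 - Phi x) * (3 * (1 + x) * exp tc.err) \<le> (1 - Phi x) * exp (C * D x)"
      using G0 by (intro mult_left_mono) auto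
    then show "TP x \<le> (1 - Phi x) * exp (C * D x)" using tc.upper_bound_crude unfolding TP by linarith
  }
  \<comment> \<open>The overshoot must dominate
    \<open>4 + 8 * (y * vbar) + 3 * (y^2 * \<epsilon>)\<close>, which itself depends on
    \<open>y = x + d\<close>. With \<open>y \<le> 2 * x\<close> this becomes
    \<open>Ka + (256 + 3) * 4 * (x^2 * \<epsilon>)\<close>, hence 1036;
    \<open>x * \<epsilon> \<le> 1/4000\<close> in turn ensures \<open>d \<le> x\<close>.\<close>
  define d where "d = Ka + 1036 * (x\<^sup>2 * \<epsilon>)"
  define y where "y = x + d"
  have x2: "1036 * (x\<^sup>2 * \<epsilon>) \<le> x / 2"
  proof -
    have "x * (x * \<epsilon>) \<le> x * (1/4000)" using x by (intro mult_left_mono) auto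
    then show ?thesis using x by (simp add: power2_eq_square)
  qed
  have d0: "0 \<le> d" using Ka4 eps_pos by (simp add: d_def)
  have dx: "d \<le> x" using x2 x1 unfolding d_def by linarith
  have y: "0 \<le> y" "y \<le> 2 * x" using x d0 dx by (auto simp: y_def)
  have ye: "y * \<epsilon> \<le> 1/8"
  proof -
    have "y * \<epsilon> \<le> 2 * x * \<epsilon>" using y eps_pos by (intro mult_right_mono) auto
    then show ?thesis using x by simp
  qed
  interpret tc: tilted_chain p q n e y \<epsilon> by (rule chain[OF y(1) ye])
  have TP: "TP x = tc.PP x" by (simp add: TP_def tc.PP_def)
  define t where "t = y * tc.vbar A"
  have y2: "y\<^sup>2 * \<epsilon> \<le> 4 * (x\<^sup>2 * \<epsilon>)"
  proof -
    have "y\<^sup>2 \<le> (2 * x)\<^sup>2" using y by (intro power_mono) auto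
    then have "y\<^sup>2 * \<epsilon> \<le> (2 * x)\<^sup>2 * \<epsilon>" using eps_pos by (intro mult_right_mono) auto
    then show ?thesis by (simp add: power_mult_distrib)
  qed
  have "t = 128 * (A * (y * \<epsilon>)) + 256 * ((y * \<epsilon>) * (y\<^sup>2 * \<epsilon>))"
    by (simp add: t_def tc.vbar_def power2_eq_square algebra_simps)
  moreover have "A * (y * \<epsilon>) \<le> A * (1/8)" using ye A by (intro mult_left_mono) auto
  moreover have "(y * \<epsilon>) * (y\<^sup>2 * \<epsilon>) \<le> 1/8 * (y\<^sup>2 * \<epsilon>)" using ye eps_pos by (intro mult_right_mono) auto
  ultimately have t: "8 * t \<le> 128 * A + 256 * (y\<^sup>2 * \<epsilon>)" by linarith
  have wd: "4 + 8 * (y * tc.vbar A) + 3 * (y\<^sup>2 * \<epsilon>) \<le> d"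
    unfolding t_def[symmetric] d_def Ka_def using t y2 by linarith
  have low: "exp (- (y\<^sup>2 / 2) - y * d - tc.err - 2 * (y * (y * tc.vbar A))) / 2 \<le> TP x"
    unfolding TP by (rule tc.lower_bound_far[OF drift_sum_le[OF tc.tilted_chain_axioms] A wd]) (simp add: y_def)
  have t8: "8 * t \<le> d" using wd eps_pos unfolding t_def[symmetric] by (smt (verit) mult_nonneg_nonneg zero_le_power2)
  have xd: "x * d \<le> 200 * (K * Ka * z) + 1036 * z"
  proof -
    have "x * d = Ka * x + 1036 * z" by (simp add: d_def z_def power2_eq_square power3_eq_cube algebra_simps)
    moreover have "Ka * x \<le> Ka * (200 * K * z)" using xz Ka4 by (intro mult_left_mono) auto
    ultimately show ?thesis by (simp add: mult_ac)
  qed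
  have e1: "y\<^sup>2 / 2 \<le> x\<^sup>2 / 2 + 3/2 * (x * d)"
  proof -
    have "y\<^sup>2 = x\<^sup>2 + 2 * (x * d) + d * d" by (simp add: y_def power2_eq_square algebra_simps)
    moreover have "d * d \<le> x * d" using dx d0 by (intro mult_right_mono) auto
    ultimately show ?thesis by linarith
  qed
  have e2: "y * d \<le> 2 * (x * d)" using mult_right_mono[OF y(2) d0] by simp
  have e3: "tc.err \<le> 72 * z + 6 * x"
  proof -
    have "y ^ 3 \<le> (2 * x) ^ 3" using y by (intro power_mono) auto
    then have "y ^ 3 * \<epsilon> \<le> (2 * x) ^ 3 * \<epsilon>" using eps_pos by (intro mult_right_mono) auto
    then have "y ^ 3 * \<epsilon> \<le> 8 * z" by (simp add: z_def power_mult_distrib)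
    moreover have "y * \<epsilon> \<le> 2 * x" using ye x1 by linarith
    ultimately show ?thesis unfolding tc.err_def by linarith
  qed
  have e4: "2 * (y * t) \<le> x * d"
  proof -
    have "y * t \<le> 2 * x * (d / 8)"
    proof (intro mult_mono)
      show "0 \<le> t" unfolding t_def tc.vbar_def using y A eps_pos by (intro mult_nonneg_nonneg add_nonneg_nonneg) auto
    qed (use y x t8 in auto)
    moreover have "0 \<le> x * d" using x d0 by simp
    moreover have "2 * x * (d / 8) = (x * d) / 4" by simp
    ultimately show ?thesis by linarith
  qed
  have "x\<^sup>2 / 2 - C * D x + (y\<^sup>2 / 2 + y * d + tc.err + 2 * (y * t)) - x\<^sup>2 / 2 \<le> x\<^sup>2 / 2 - 1"
    using e1 e2 e3 e4 xd xz x1 Kz Kz0 z0 Cz CD by linarith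
  then have "- (x\<^sup>2 / 2) - C * D x \<le> (- (y\<^sup>2 / 2) - y * d - tc.err - 2 * (y * t)) - 1" by linarith
  then have "exp (- (x\<^sup>2 / 2) - C * D x) \<le> exp ((- (y\<^sup>2 / 2) - y * d - tc.err - 2 * (y * t)) - 1)" by simp
  also have "\<dots> \<le> exp (- (y\<^sup>2 / 2) - y * d - tc.err - 2 * (y * t)) / 2"
  proof -
    have "2 \<le> exp (1::real)" using exp_ge_add_one_self[of 1] by simp
    then show ?thesis unfolding exp_diff[of _ 1] by (intro divide_left_mono) auto
  qed
  finally have 1: "exp (- (x\<^sup>2 / 2)) * exp (- (C * D x)) \<le> TP x"
    using low unfolding t_def by (simp add: exp_add[symmetric])
  have "1 - Phi x \<le> exp (- x\<^sup>2 / 2) / (1 + x)" by (rule normal_tail_bounds(1)[OF x(1)])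
  also have "\<dots> \<le> exp (- x\<^sup>2 / 2) / 1" using x by (intro divide_left_mono) auto
  finally have "(1 - Phi x) * exp (- (C * D x)) \<le> exp (- (x\<^sup>2 / 2)) * exp (- (C * D x))" by (intro mult_right_mono) auto
  then show "(1 - Phi x) * exp (- (C * D x)) \<le> TP x" using 1 by linarith
qed

lemma moderate_deviation:
  assumes x: "0 \<le> x" "x * \<epsilon> \<le> 1/4000"
  shows "TP x \<le> (1 - Phi x) * exp (C * D x)" "(1 - Phi x) * exp (- (C * D x)) \<le> TP x"
proof -
  have "TP x \<le> (1 - Phi x) * exp (C * D x) \<and> (1 - Phi x) * exp (- (C * D x)) \<le> TP x"
  proof (cases "x\<^sup>2 * \<epsilon> \<le> 1 / (200 * K)")
    case True
    have x8: "x * \<epsilon> \<le> 1/8" using x by simp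
    have D0: "0 \<le> D x" using D_parts(3)[OF x(1)] x eps_pos by (meson less_imp_le mult_nonneg_nonneg order_trans)
    have "K * 4 \<le> K * Ka" using A K_ge by (intro mult_left_mono) (auto simp: Ka_def)
    then have "12 + 300 * K \<le> C" unfolding C_def using K_ge by linarith
    then have CD: "(12 + 300 * K) * D x \<le> C * D x" using D0 by (intro mult_right_mono) auto
    have G0: "0 \<le> 1 - Phi x" using Phi_le_1[of x] by simp
    have "(1 - Phi x) * exp ((12 + 300 * K) * D x) \<le> (1 - Phi x) * exp (C * D x)"
      "(1 - Phi x) * exp (- (C * D x)) \<le> (1 - Phi x) * exp (- ((12 + 300 * K) * D x))"
      using G0 CD by (intro mult_left_mono; simp)+
    then show ?thesis using moderate_deviation_near[OF x(1) x8 True] by linarith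
  next
    case False
    then show ?thesis using moderate_deviation_far[OF x] by simp
  qed
  then show "TP x \<le> (1 - Phi x) * exp (C * D x)" "(1 - Phi x) * exp (- (C * D x)) \<le> TP x" by auto
qed

end

subsection \<open>The normalising sequences\<close>

text \<open>Concavity of \<open>ln\<close>, applied to \<open>1 + g * x\<close> as a convex
  combination of \<open>1\<close> and \<open>1 + x\<close>.\<close>

lemma Bernoulli_powr:
  fixes x g :: real
  assumes g: "0 \<le> g" "g \<le> 1" and x: "- 1 < x"
  shows "(1 + x) powr g \<le> 1 + g * x"
proof -
  have e: "1 + g * x = (1 - g) *\<^sub>R 1 + g *\<^sub>R (1 + x)" by (simp add: algebra_simps)
  have pos: "0 < 1 + g * x"
  proof (cases "g = 0")
    case False
    then have "0 < g * (1 + x)" using g x by simp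
    then show ?thesis using g unfolding distrib_left by simp
  qed simp
  have "(1 - g) * ln 1 + g * ln (1 + x) \<le> ln (1 + g * x)"
    unfolding e using g x by (intro concave_onD[OF ln_concave]) auto
  then have "exp (g * ln (1 + x)) \<le> 1 + g * x" using pos by (simp add: ln_ge_iff)
  then show ?thesis using x by (simp add: powr_def)
qed

lemma ln_le_sqrt: "0 < x \<Longrightarrow> ln x \<le> 2 * (sqrt x - 1)"
  using ln_le_minus_one[of "sqrt x"] by (simp add: ln_sqrt)

lemma ln_gt_1: "3 \<le> n \<Longrightarrow> 1 < ln (real n)"
proof -
  assume n: "3 \<le> n"
  have "exp 1 < real n" using e_less_272 n by linarith
  then have "ln (exp 1) < ln (real n)" using n by (subst ln_less_cancel_iff) auto
  then show ?thesis by simp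
qed

lemma erw_a_1:
  assumes "0 < p" shows "erw_a p 1 = 1"
proof -
  have "0 < Gamma (2 * p)" using assms by simp
  then show ?thesis by (simp add: erw_a_def)
qed

lemma erw_a_pos: "0 < p \<Longrightarrow> 1 \<le> k \<Longrightarrow> 0 < erw_a p k"
  unfolding erw_a_def by (intro divide_pos_pos mult_pos_pos Gamma_real_pos) auto

lemma erw_a_Suc:
  assumes p: "0 < p" and k: "1 \<le> k"
  shows "erw_a p (Suc k) = erw_a p k * (real k / (real k + (2 * p - 1)))"
proof -
  define y where "y = real k + (2 * p - 1)"
  have 1: "0 < real k" "0 < y" using p k by (auto simp: y_def)
  have G: "Gamma (real k + 1) = real k * Gamma (real k)" "Gamma (y + 1) = y * Gamma y"
    using 1 by (intro Gamma_plus1; force dest: nonpos_Ints_nonpos)+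
  have a: "real (Suc k) + 2 * p - 1 = y + 1" "real (Suc k) = real k + 1" "real k + 2 * p - 1 = y" by (auto simp: y_def)
  show ?thesis unfolding erw_a_def a(1) unfolding a(2,3) G y_def[symmetric] by (simp add: mult_ac)
qed

lemma erw_v_Suc: "erw_v p (Suc k) = erw_v p k + (erw_a p (Suc k))\<^sup>2"
  by (simp add: erw_v_def)

lemma erw_v_pos:
  assumes "0 < p" "1 \<le> k" shows "0 < erw_v p k"
  unfolding erw_v_def using assms erw_a_pos[of p] by (intro sum_pos) (auto simp: less_imp_neq[symmetric])

lemma erw_v_mono: "j \<le> k \<Longrightarrow> erw_v p j \<le> erw_v p k"
  unfolding erw_v_def by (intro sum_mono2) auto

definition "erw_e p n k = erw_a p k / sqrt (erw_v p n)"
definition "erw_t p n k = erw_v p k / erw_v p n"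

lemma erw_scaled:
  assumes p: "0 < p" and n: "1 \<le> n"
  shows "1 \<le> k \<Longrightarrow> 0 < erw_e p n k"
    "1 \<le> k \<Longrightarrow> erw_e p n (Suc k) * (1 + (2 * p - 1) / real k) = erw_e p n k"
    "(\<Sum>j=1..k. (erw_e p n j)\<^sup>2) = erw_t p n k" "erw_t p n n = 1" "0 \<le> erw_t p n k" "k \<le> n \<Longrightarrow> erw_t p n k \<le> 1"
    "x \<le> erw_norm p n X \<longleftrightarrow> x \<le> erw_e p n n * real_of_int (erw_pos X n)"
proof -
  have v: "0 < erw_v p n" using erw_v_pos p n by simp
  show "0 < erw_e p n k" if "1 \<le> k" using erw_a_pos[OF p that] v by (simp add: erw_e_def)
  show "erw_e p n (Suc k) * (1 + (2 * p - 1) / real k) = erw_e p n k" if "1 \<le> k"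
  proof -
    have 1: "0 < real k" "0 < real k + (2 * p - 1)" using p that by auto
    have "1 + (2 * p - 1) / real k = (real k + (2 * p - 1)) / real k" using 1 by (simp add: field_simps)
    then show ?thesis using 1 unfolding erw_e_def erw_a_Suc[OF p that] by simp
  qed
  show "(\<Sum>j=1..k. (erw_e p n j)\<^sup>2) = erw_t p n k"
    unfolding erw_t_def erw_v_def[of p k] sum_divide_distrib using v
    by (intro sum.cong) (auto simp: erw_e_def power_divide)
  show "erw_t p n n = 1" using v by (simp add: erw_t_def)
  have "0 \<le> erw_v p k" unfolding erw_v_def by (intro sum_nonneg) simp
  then show "0 \<le> erw_t p n k" using v by (simp add: erw_t_def)
  show "erw_t p n k \<le> 1" if "k \<le> n" using erw_v_mono[OF that, of p] v by (simp add: erw_t_def)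
  show "x \<le> erw_norm p n X \<longleftrightarrow> x \<le> erw_e p n n * real_of_int (erw_pos X n)"
    by (simp add: erw_norm_def erw_e_def)
qed

lemma erw_a_incseq:
  assumes p: "0 < p" "p \<le> 1/2" and "1 \<le> j" "j \<le> k"
  shows "erw_a p j \<le> erw_a p k"
  using assms(4)
proof (induction k rule: dec_induct)
  case (step m)
  have "1 \<le> real m / (real m + (2 * p - 1))" using p step assms(3) by (subst le_divide_eq) auto
  then have "erw_a p m * 1 \<le> erw_a p m * (real m / (real m + (2 * p - 1)))"
    using erw_a_pos[OF p(1), of m] step assms(3) by (intro mult_left_mono) auto
  then show ?case using step assms(3) erw_a_Suc[OF p(1), of m] by simp
qed simp

text \<open>For \<open>p < 1/2\<close> the one-step ratios of the weights are at most \<open>j / (j - 1)\<close>, uniformly in \<open>p\<close>.\<close>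

lemma erw_a_growth:
  assumes p: "0 < p" and "2 \<le> j" "j \<le> k"
  shows "erw_a p k * (real j - 1) \<le> erw_a p j * (real k - 1)"
  using assms(3)
proof (induction k rule: dec_induct)
  case (step m)
  have m: "2 \<le> m" using step assms by simp
  have "real m / (real m + (2 * p - 1)) \<le> real m / (real m - 1)" using p m by (intro divide_left_mono) auto
  then have "erw_a p m * (real m / (real m + (2 * p - 1))) \<le> erw_a p m * (real m / (real m - 1))"
    by (rule mult_left_mono) (use erw_a_pos[OF p, of m] m in auto)
  then have "erw_a p (Suc m) \<le> erw_a p m * (real m / (real m - 1))"
    using erw_a_Suc[OF p, of m] m by simp
  then have "erw_a p (Suc m) * (real j - 1) \<le> erw_a p m * (real m / (real m - 1)) * (real j - 1)"
    using assms by (intro mult_right_mono) auto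
  also have "\<dots> = (erw_a p m * (real j - 1)) * (real m / (real m - 1))" by simp
  also have "\<dots> \<le> (erw_a p j * (real m - 1)) * (real m / (real m - 1))"
    using step m by (intro mult_right_mono) auto
  also have "\<dots> = erw_a p j * real m" using m by simp
  finally show ?case by simp
qed simp

lemma sum_squares_pred: "(\<Sum>j=1..n. (real j - 1)\<^sup>2) = (real n - 1) * real n * (2 * real n - 1) / 6"
  by (induction n) (auto simp: field_simps power2_eq_square)

text \<open>The weights increase, so the last is the largest and
  \<open>erw_t p n k \<le> k / n\<close>. By \<open>erw_a_growth\<close> they grow no faster than
  \<open>j - 1\<close>, so \<open>v\<close> is at least of order \<open>n * (erw_a p n)^2\<close>.
  Neither comparison degenerates as \<open>p\<close> tends to 0 or to 1/2.\<close>

lemma erw_antipersistent: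
  assumes p: "0 < p" "p \<le> 1/2" and n: "3 \<le> n"
  shows "1 \<le> k \<Longrightarrow> k \<le> n \<Longrightarrow> erw_e p n k \<le> 2 / sqrt (real n)" "1 / sqrt (real n) \<le> erw_e p n n"
    "k \<le> n \<Longrightarrow> erw_t p n k \<le> real k / real n"
proof -
  have v: "0 < erw_v p n" and an: "0 < erw_a p n" using erw_v_pos erw_a_pos p n by auto
  have "(erw_a p n)\<^sup>2 * (\<Sum>j=1..n. (real j - 1)\<^sup>2) \<le> erw_v p n * (real n - 1)\<^sup>2"
    unfolding erw_v_def sum_distrib_left sum_distrib_right
  proof (rule sum_mono)
    fix j assume j: "j \<in> {1..n}"
    have "erw_a p n * (real j - 1) \<le> erw_a p j * (real n - 1)"
    proof (cases "j = 1")
      case True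
      then show ?thesis using erw_a_pos[of p 1] p n by simp
    next
      case False
      then show ?thesis using j by (intro erw_a_growth p) auto
    qed
    then have "(erw_a p n * (real j - 1))\<^sup>2 \<le> (erw_a p j * (real n - 1))\<^sup>2"
      using an j by (intro power_mono) auto
    then show "(erw_a p n)\<^sup>2 * (real j - 1)\<^sup>2 \<le> (erw_a p j)\<^sup>2 * (real n - 1)\<^sup>2" by (simp add: power_mult_distrib)
  qed
  moreover have "(real n - 1)\<^sup>2 * (real n / 4) \<le> (\<Sum>j=1..n. (real j - 1)\<^sup>2)"
  proof -
    have "(real n - 1) * real n * ((real n - 1) / 4) \<le> (real n - 1) * real n * ((2 * real n - 1) / 6)"
      using n by (intro mult_left_mono) auto
    then show ?thesis unfolding sum_squares_pred by (simp add: power2_eq_square mult_ac)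
  qed
  then have "(erw_a p n)\<^sup>2 * ((real n - 1)\<^sup>2 * (real n / 4)) \<le> (erw_a p n)\<^sup>2 * (\<Sum>j=1..n. (real j - 1)\<^sup>2)"
    by (intro mult_left_mono) auto
  ultimately have "(real n - 1)\<^sup>2 * ((erw_a p n)\<^sup>2 * (real n / 4)) \<le> (real n - 1)\<^sup>2 * erw_v p n"
    by (simp add: mult_ac)
  then have "(erw_a p n)\<^sup>2 * (real n / 4) \<le> erw_v p n" using n by (subst (asm) mult_le_cancel_left_pos) auto
  then have "(erw_a p n)\<^sup>2 / erw_v p n \<le> 4 / real n" using v n by (simp add: field_simps)
  then have "sqrt ((erw_a p n)\<^sup>2 / erw_v p n) \<le> sqrt (4 / real n)" by simp
  then have en: "erw_e p n n \<le> 2 / sqrt (real n)" using an by (simp add: erw_e_def real_sqrt_divide)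
  show "erw_e p n k \<le> 2 / sqrt (real n)" if k: "1 \<le> k" "k \<le> n"
  proof -
    have "erw_e p n k \<le> erw_e p n n" unfolding erw_e_def using erw_a_incseq[OF p k] v by (intro divide_right_mono) auto
    then show ?thesis using en by linarith
  qed
  have sq: "(erw_a p j)\<^sup>2 \<le> (erw_a p k)\<^sup>2" if "1 \<le> j" "j \<le> k" for j k
    using erw_a_incseq[OF p that] erw_a_pos[OF p(1) that(1)] by (intro power_mono) auto
  have "erw_v p n \<le> (\<Sum>j=1..n. (erw_a p n)\<^sup>2)" unfolding erw_v_def by (intro sum_mono sq) auto
  then have "erw_v p n \<le> real n * (erw_a p n)\<^sup>2" by simp
  then have "1 / real n \<le> (erw_a p n)\<^sup>2 / erw_v p n" using v n by (simp add: field_simps)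
  then have "sqrt (1 / real n) \<le> sqrt ((erw_a p n)\<^sup>2 / erw_v p n)" by simp
  then show "1 / sqrt (real n) \<le> erw_e p n n" using an by (simp add: erw_e_def real_sqrt_divide)
  show "erw_t p n k \<le> real k / real n" if k: "k \<le> n"
  proof -
    have "erw_v p k * real m \<le> real k * erw_v p m" if "k \<le> m" for m
      using that
    proof (induction m rule: dec_induct)
      case (step m)
      have "erw_v p k \<le> (\<Sum>j=1..k. (erw_a p (Suc m))\<^sup>2)" unfolding erw_v_def using step by (intro sum_mono sq) auto
      then have "erw_v p k \<le> real k * (erw_a p (Suc m))\<^sup>2" by simp
      then show ?case using step by (simp add: erw_v_Suc algebra_simps)
    qed simp
    from this[OF k] show ?thesis using v n by (simp add: erw_t_def field_simps)
  qed
qed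

text \<open>With \<open>g = 2 * p - 1\<close>, Bernoulli's inequality shows that
  \<open>erw_a p k * k powr g\<close> never rises above its initial value 1, while
  \<open>erw_a p k * (k - 1) powr g\<close> never falls below its value
  \<open>1 / (1 + g) \<ge> 2/3\<close> at \<open>k = 2\<close>. The Gamma function is used only
  through the recursion.\<close>

lemma erw_a_persistent:
  assumes p: "1/2 \<le> p" "p \<le> 3/4" and k: "1 \<le> k"
  shows "erw_a p k \<le> real k powr (- (2 * p - 1))" "real k powr (- (2 * p - 1)) / 2 \<le> erw_a p k"
proof -
  define g where "g = 2 * p - 1"
  have g: "0 \<le> g" "g \<le> 1/2" using p by (auto simp: g_def)
  have p0: "0 < p" using p by simp
  have S: "erw_a p (Suc k) = erw_a p k * (real k / (real k + g))" if "1 \<le> k" for k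
    using erw_a_Suc[OF p0 that] by (simp add: g_def)
  have a0: "0 < erw_a p k" if "1 \<le> k" for k using erw_a_pos[OF p0 that] .
  have "erw_a p k * real k powr g \<le> 1" using k
  proof (induction k rule: dec_induct)
    case base
    then show ?case using erw_a_1[OF p0] by simp
  next
    case (step m)
    have m: "0 < real m" using step by simp
    have "real m * (1 + 1 / real m) = real (Suc m)" using m by (simp add: field_simps)
    then have "real (Suc m) powr g = real m powr g * (1 + 1 / real m) powr g" using powr_mult by metis
    also have "\<dots> \<le> real m powr g * (1 + g * (1 / real m))" using g m by (intro mult_left_mono Bernoulli_powr) (auto intro: less_le_trans[of _ 0])
    finally have "real (Suc m) powr g \<le> real m powr g * (1 + g * (1 / real m))" .
    then have "erw_a p (Suc m) * real (Suc m) powr g \<le> erw_a p (Suc m) * (real m powr g * (1 + g * (1 / real m)))"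
      using a0[of "Suc m"] by (intro mult_left_mono) auto
    also have "\<dots> = (erw_a p m * real m powr g) * ((real m / (real m + g)) * (1 + g * (1 / real m)))"
      using step S[of m] by (simp add: mult_ac)
    also have "(real m / (real m + g)) * (1 + g * (1 / real m)) = 1" 
    proof -
      have "1 + g * (1 / real m) = (real m + g) / real m" using m by (simp add: field_simps)
      then show ?thesis using m g by simp
    qed
    finally show ?case using step by simp
  qed
  then show "erw_a p k \<le> real k powr (- (2 * p - 1))"
    using k unfolding g_def[symmetric] by (simp add: powr_minus field_simps)
  have low: "2/3 \<le> erw_a p k * (real k - 1) powr g" if "2 \<le> k" for k using that
  proof (induction k rule: dec_induct)
    case base
    have "erw_a p 2 = 1 / (1 + g)" using S[of 1] erw_a_1[OF p0] by (simp add: numeral_2_eq_2)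
    moreover have "2/3 \<le> 1 / (1 + g)" using g by (simp add: field_simps)
    ultimately show ?case by simp
  next
    case (step m)
    have m: "2 \<le> real m" using step by simp
    have "real m * (1 + (- 1 / real m)) = real m - 1" using m by (simp add: field_simps)
    then have "(real m - 1) powr g = real m powr g * (1 + (- 1 / real m)) powr g" using powr_mult by metis
    also have "\<dots> \<le> real m powr g * (1 + g * (- 1 / real m))"
      using g m by (intro mult_left_mono Bernoulli_powr) auto
    also have "\<dots> \<le> real m powr g * (real m / (real m + g))"
    proof (intro mult_left_mono)
      have "(real m - g) * (real m + g) \<le> real m * real m" by (simp add: algebra_simps)
      then show "1 + g * (- 1 / real m) \<le> real m / (real m + g)" using m g by (simp add: field_simps)
    qed simp
    finally have "(real m - 1) powr g \<le> real m powr g * (real m / (real m + g))" .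
    then have "erw_a p m * (real m - 1) powr g \<le> erw_a p m * (real m powr g * (real m / (real m + g)))"
      using a0[of m] m by (intro mult_left_mono) auto
    also have "\<dots> = erw_a p (Suc m) * real m powr g" using S[of m] m by simp
    finally show ?case using step by simp
  qed
  have "1/2 \<le> erw_a p k * real k powr g"
  proof (cases "k = 1")
    case True
    then show ?thesis using erw_a_1[OF p0] by simp
  next
    case False
    then have k2: "2 \<le> k" using k by simp
    have "erw_a p k * (real k - 1) powr g \<le> erw_a p k * real k powr g"
      using k2 g a0[OF k] by (intro mult_left_mono powr_mono2) auto
    then show ?thesis using low[OF k2] by linarith
  qed
  then show "real k powr (- (2 * p - 1)) / 2 \<le> erw_a p k"
    using k unfolding g_def[symmetric] by (simp add: powr_minus field_simps)
qed

text \<open>The bound by \<open>1 / (3 - 4 * p)\<close> telescopes through Bernoulli's inequality.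
  Its blow-up at \<open>p = 3/4\<close> is the source of the dependence on \<open>p\<close> in the
  second regime. The fourth inequality bounds from below the time remaining after
  \<open>k\<close>.\<close>

lemma erw_v_persistent:
  assumes p: "1/2 \<le> p" "p \<le> 3/4" and n: "1 \<le> n"
  shows "real n powr (3 - 4 * p) / 4 \<le> erw_v p n" "erw_v p n \<le> real n"
    "p < 3/4 \<Longrightarrow> erw_v p n \<le> real n powr (3 - 4 * p) / (3 - 4 * p)"
    "k \<le> n \<Longrightarrow> erw_v p k + real (n - k) * (real n powr (- (2 * (2 * p - 1))) / 4) \<le> erw_v p n"
    "1 \<le> j \<Longrightarrow> (erw_a p j)\<^sup>2 \<le> real j powr (- (2 * (2 * p - 1)))"
    "1 \<le> j \<Longrightarrow> real j powr (- (2 * (2 * p - 1))) / 4 \<le> (erw_a p j)\<^sup>2"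
proof -
  define g where "g = 2 * p - 1"
  have g: "0 \<le> g" "g \<le> 1/2" using p by (auto simp: g_def)
  have p0: "0 < p" using p by simp
  have up: "(erw_a p j)\<^sup>2 \<le> real j powr (- (2 * g))" if "1 \<le> j" for j
  proof -
    have "(erw_a p j)\<^sup>2 \<le> (real j powr (- g))\<^sup>2"
      using erw_a_persistent(1)[OF p that] erw_a_pos[OF p0 that] unfolding g_def by (intro power_mono) auto
    also have "\<dots> = real j powr (- (2 * g))" by (simp add: power2_eq_square powr_add[symmetric])
    finally show ?thesis .
  qed
  have lo: "real j powr (- (2 * g)) / 4 \<le> (erw_a p j)\<^sup>2" if "1 \<le> j" for j
  proof -
    have "(real j powr (- g) / 2)\<^sup>2 \<le> (erw_a p j)\<^sup>2"
      using erw_a_persistent(2)[OF p that] unfolding g_def by (intro power_mono) auto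
    also have "(real j powr (- g) / 2)\<^sup>2 = real j powr (- (2 * g)) / 4"
      by (simp add: power2_eq_square powr_add[symmetric])
    finally show ?thesis .
  qed
  show "1 \<le> j \<Longrightarrow> (erw_a p j)\<^sup>2 \<le> real j powr (- (2 * (2 * p - 1)))"
    "1 \<le> j \<Longrightarrow> real j powr (- (2 * (2 * p - 1))) / 4 \<le> (erw_a p j)\<^sup>2" using up[of j] lo[of j] by (simp_all add: g_def)
  have lon: "real n powr (- (2 * g)) / 4 \<le> (erw_a p j)\<^sup>2" if "1 \<le> j" "j \<le> n" for j
  proof -
    have "real n powr (- (2 * g)) \<le> real j powr (- (2 * g))" using that g by (intro powr_mono2') auto
    then show ?thesis using lo[OF that(1)] by linarith
  qed
  show inc: "erw_v p k + real (n - k) * (real n powr (- (2 * (2 * p - 1))) / 4) \<le> erw_v p n" if "k \<le> n" for k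
  proof -
    have "{1..n} = {1..k} \<union> {k+1..n}" "{1..k} \<inter> {k+1..n} = {}" using that by auto
    then have "erw_v p n = erw_v p k + (\<Sum>j=k+1..n. (erw_a p j)\<^sup>2)"
      unfolding erw_v_def by (metis finite_atLeastAtMost sum.union_disjoint)
    moreover have "(\<Sum>j=k+1..n. real n powr (- (2 * g)) / 4) \<le> (\<Sum>j=k+1..n. (erw_a p j)\<^sup>2)"
      by (intro sum_mono lon) auto
    ultimately show ?thesis by (simp add: g_def)
  qed
  have np: "real n * real n powr (- (2 * g)) = real n powr (1 - 2 * g)"
    using n powr_add[of "real n" 1 "- (2 * g)"] by simp
  have e: "3 - 4 * p = 1 - 2 * g" by (simp add: g_def)
  show "real n powr (3 - 4 * p) / 4 \<le> erw_v p n"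
    using inc[of 0] np unfolding e by (simp add: g_def[symmetric] erw_v_def)
  have "erw_v p n \<le> (\<Sum>j=1..n. 1)" unfolding erw_v_def
  proof (rule sum_mono)
    fix j assume "j \<in> {1..n}"
    then have "(erw_a p j)\<^sup>2 \<le> real j powr (- (2 * g))" "real j powr (- (2 * g)) \<le> 1"
      using up[of j] g by (auto simp: powr_minus ge_one_powr_ge_zero inverse_le_1_iff)
    then show "(erw_a p j)\<^sup>2 \<le> 1" by linarith
  qed
  then show "erw_v p n \<le> real n" by simp
  show "erw_v p n \<le> real n powr (3 - 4 * p) / (3 - 4 * p)" if "p < 3/4"
  proof -
    define d where "d = 3 - 4 * p"
    have d: "0 < d" "d \<le> 1" "- (2 * g) = d - 1" using that p by (auto simp: d_def g_def)
    have "erw_v p m \<le> real m powr d / d" for m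
    proof (induction m)
      case 0
      then show ?case by (simp add: erw_v_def)
    next
      case (Suc m)
      have "real m powr d \<le> real (Suc m) powr d * (1 + d * (- 1 / real (Suc m)))"
      proof (cases "m = 0")
        case False
        have "real (Suc m) * (1 + (- 1 / real (Suc m))) = real m"
          unfolding distrib_left by (simp del: of_nat_Suc)
        then have "real m powr d = real (Suc m) powr d * (1 + (- 1 / real (Suc m))) powr d" using powr_mult by metis
        also have "\<dots> \<le> real (Suc m) powr d * (1 + d * (- 1 / real (Suc m)))"
          using d False by (intro mult_left_mono Bernoulli_powr) auto
        finally show ?thesis .
      qed (use d in auto)
      also have "\<dots> = real (Suc m) powr d - d * real (Suc m) powr (d - 1)"
        by (simp add: powr_diff right_diff_distrib)
      finally have "d * real (Suc m) powr (d - 1) \<le> real (Suc m) powr d - real m powr d" by linarith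
      then have "real (Suc m) powr (d - 1) \<le> real (Suc m) powr d / d - real m powr d / d"
        using d by (simp add: field_simps)
      then show ?case using up[of "Suc m"] Suc unfolding d(3) by (simp add: erw_v_Suc)
    qed
    then show ?thesis by (simp add: d_def)
  qed
qed

subsection \<open>The accumulated memory drift\<close>

lemma sum_inverse_k_sqrt: "2 \<le> n \<Longrightarrow> (\<Sum>k=2..<n. 1 / (real k * sqrt (real k))) \<le> 2 - 2 / sqrt (real n - 1)"
proof (induction n rule: dec_induct)
  case (step n)
  define u w where "u = sqrt (real n - 1)" and "w = sqrt (real n)"
  have n: "2 \<le> real n" using step by simp
  have uw: "0 < u" "u \<le> w" "u * u = real n - 1" "w * w = real n" using n by (auto simp: u_def w_def)
  have w0: "0 < w" using uw by linarith
  have "1 = (w - u) * (w + u)" using uw by (simp add: algebra_simps)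
  also have "\<dots> \<le> (w - u) * (2 * w)" using uw by (intro mult_left_mono) auto
  finally have 1: "1 \<le> (w - u) * (2 * w)" .
  have "1 / (w * w * w) \<le> 1 / (w * w * u)" using uw(1,2) w0 by (intro divide_left_mono mult_left_mono mult_pos_pos) auto
  also have "\<dots> \<le> ((w - u) * (2 * w)) / (w * w * u)" using 1 uw by (intro divide_right_mono) auto
  also have "\<dots> = 2 / u - 2 / w" using uw(1) w0 by (simp add: field_simps)
  finally have "1 / (real n * sqrt (real n)) \<le> 2 / u - 2 / w" using uw(4) by (simp add: w_def)
  then show ?case using step by (simp add: u_def w_def)
qed simp

lemma sum_inverse_sqrt: "(\<Sum>k=1..n. 1 / sqrt (real k)) \<le> 2 * sqrt (real n)"
proof (induction n)
  case (Suc n)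
  define u w where "u = sqrt (real n)" and "w = sqrt (real n + 1)"
  have uw: "0 \<le> u" "u \<le> w" "0 < w" "u * u = real n" "w * w = real n + 1" by (auto simp: u_def w_def)
  have "1 = (w - u) * (w + u)" using uw by (simp add: algebra_simps)
  also have "\<dots> \<le> (w - u) * (2 * w)" using uw by (intro mult_left_mono) auto
  finally have "1 / w \<le> 2 * (w - u)" using uw by (simp add: field_simps)
  then show ?case using Suc by (simp add: u_def w_def add.commute)
qed simp

text \<open>Partial fractions with \<open>m = n - k\<close>:
  \<open>n / (k^2 * m) = 1 / k^2 + 1 / (k * m)\<close>. The first part is summable thanks to the
  smallness of \<open>t k\<close> for early \<open>k\<close>; the second is
  \<open>(1 / k + 1 / m) / n\<close>, and weakening to square roots gives
  \<open>O(1 / sqrt n)\<close> without a logarithm.\<close>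

lemma drift_sum_bound:
  fixes t :: "nat \<Rightarrow> real"
  assumes n: "2 \<le> n" and c: "0 < c" "c \<le> 1" and B: "0 \<le> B" and e: "0 < \<epsilon>" "1 / sqrt (real n) \<le> \<epsilon>"
    and t: "\<And>k. k \<le> n \<Longrightarrow> 0 \<le> t k" "\<And>k. k \<le> n \<Longrightarrow> t k \<le> 1" "\<And>k. k \<le> n \<Longrightarrow> t k \<le> B * (sqrt (real k) * \<epsilon>)"
    and gap: "\<And>k. k \<le> n \<Longrightarrow> c * (real n - real k) / real n \<le> 1 - t k"
  shows "(\<Sum>k=2..<n. t k / ((real k)\<^sup>2 * (1 - t (Suc k) + \<epsilon>\<^sup>2))) \<le> (2 * B + 4) / c * \<epsilon>"
proof -
  have e2: "1 / real n \<le> \<epsilon>\<^sup>2"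
    using power_mono[OF e(2), of 2] by (simp add: power_divide)
  have "t k / ((real k)\<^sup>2 * (1 - t (Suc k) + \<epsilon>\<^sup>2)) \<le>
    1 / c * (B * \<epsilon> * (1 / (real k * sqrt (real k))) + 1 / real n * (1 / sqrt (real k) + 1 / sqrt (real (n - k))))"
    if k: "k \<in> {2..<n}" for k
  proof -
    define m where "m = real n - real k"
    have m: "1 \<le> m" "m = real (n - k)" using k by (auto simp: m_def of_nat_diff)
    have kk: "2 \<le> real k" "0 < real n" using k by auto
    have T: "0 \<le> t k" "t k \<le> 1" "t k \<le> B * (sqrt (real k) * \<epsilon>)" using t k by auto
    \<comment> \<open>The denominator belongs to \<open>Suc k\<close> and has only
      \<open>m - 1\<close> steps left, none for the last \<open>k\<close>. The floor
      \<open>\<epsilon>^2 \<ge> 1 / n\<close> restores the missing unit because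
      \<open>c \<le> 1\<close>.\<close>
    have "c * (m - 1) / real n + 1 / real n \<le> 1 - t (Suc k) + \<epsilon>\<^sup>2"
      using gap[of "Suc k"] k e2 by (simp add: m_def algebra_simps)
    moreover have "c * m / real n \<le> c * (m - 1) / real n + 1 / real n"
      using c kk unfolding add_divide_distrib[symmetric] by (intro divide_right_mono) (auto simp: algebra_simps)
    ultimately have D: "c * m / real n \<le> 1 - t (Suc k) + \<epsilon>\<^sup>2" by linarith
    have D0: "0 < c * m / real n" using c m kk by simp
    have D1: "0 < 1 - t (Suc k) + \<epsilon>\<^sup>2" using D D0 by linarith
    have "t k / ((real k)\<^sup>2 * (1 - t (Suc k) + \<epsilon>\<^sup>2)) \<le> t k / ((real k)\<^sup>2 * (c * m / real n))"
      using D D0 D1 T kk by (intro divide_left_mono mult_left_mono mult_pos_pos) auto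
    also have "\<dots> = 1 / c * (t k * (1 / (real k * real k)) + t k * (1 / (real k * m)))"
    proof -
      have "real n = m + real k" by (simp add: m_def)
      then have "real n / (real k * real k * m) = 1 / (real k * real k) + 1 / (real k * m)"
        using kk m by (simp add: field_simps)
      then have "t k * (real n / (real k * real k * m)) = t k * (1 / (real k * real k)) + t k * (1 / (real k * m))"
        by (simp add: distrib_left)
      moreover have "t k / ((real k)\<^sup>2 * (c * m / real n)) = 1 / c * (t k * (real n / (real k * real k * m)))"
        using c kk m(1) by (simp add: power2_eq_square)
      ultimately show ?thesis by (simp only:)
    qed
    also have "\<dots> \<le> 1 / c * (B * \<epsilon> * (1 / (real k * sqrt (real k))) + 1 / real n * (1 / sqrt (real k) + 1 / sqrt m))"
    proof (intro mult_left_mono add_mono)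
      have "t k * (1 / (real k * real k)) \<le> (B * (sqrt (real k) * \<epsilon>)) * (1 / (real k * real k))"
        using T kk by (intro mult_right_mono) auto
      also have "\<dots> = B * \<epsilon> * (sqrt (real k) / (real k * real k))" by simp
      also have "sqrt (real k) / (real k * real k) = 1 / (real k * sqrt (real k))"
        using kk real_sqrt_mult_self[of "real k"] by (simp add: field_simps)
      finally show "t k * (1 / (real k * real k)) \<le> B * \<epsilon> * (1 / (real k * sqrt (real k)))" .
      have "t k * (1 / (real k * m)) \<le> 1 * (1 / (real k * m))" using T kk m by (intro mult_right_mono) auto
      also have "\<dots> = 1 / real n * (1 / real k + 1 / m)"
      proof -
        have "real n = m + real k" by (simp add: m_def)
        then show ?thesis using kk m by (simp add: field_simps)
      qed
      also have "\<dots> \<le> 1 / real n * (1 / sqrt (real k) + 1 / sqrt m)"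
      proof -
        have "sqrt y \<le> y" if "1 \<le> y" for y :: real using that by (intro real_le_lsqrt) (auto simp: power2_eq_square)
        then have "1 / real k \<le> 1 / sqrt (real k)" "1 / m \<le> 1 / sqrt m" using kk m by (auto intro!: divide_left_mono)
        then show ?thesis using kk by (intro mult_left_mono) auto
      qed
      finally show "t k * (1 / (real k * m)) \<le> 1 / real n * (1 / sqrt (real k) + 1 / sqrt m)" .
    qed (use c in auto)
    finally show ?thesis unfolding m(2) .
  qed
  then have "(\<Sum>k=2..<n. t k / ((real k)\<^sup>2 * (1 - t (Suc k) + \<epsilon>\<^sup>2))) \<le>
    (\<Sum>k=2..<n. 1 / c * (B * \<epsilon> * (1 / (real k * sqrt (real k))) + 1 / real n * (1 / sqrt (real k) + 1 / sqrt (real (n - k)))))"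
    by (rule sum_mono)
  also have "\<dots> = 1 / c * (B * \<epsilon> * (\<Sum>k=2..<n. 1 / (real k * sqrt (real k))) +
    1 / real n * ((\<Sum>k=2..<n. 1 / sqrt (real k)) + (\<Sum>k=2..<n. 1 / sqrt (real (n - k)))))"
    unfolding sum_distrib_left[symmetric] sum.distrib ..
  also have "\<dots> \<le> 1 / c * (B * \<epsilon> * 2 + 4 * \<epsilon>)"
  proof (intro mult_left_mono add_mono)
    have "0 \<le> 2 / sqrt (real n - 1)" using n by simp
    then show "(\<Sum>k=2..<n. 1 / (real k * sqrt (real k))) \<le> 2" using sum_inverse_k_sqrt[OF n] by linarith
    have "(\<Sum>k=2..<n. 1 / sqrt (real k)) \<le> (\<Sum>k=1..n. 1 / sqrt (real k))" by (intro sum_mono2) auto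
    moreover have "(\<Sum>k=2..<n. 1 / sqrt (real (n - k))) = (\<Sum>k\<in>(\<lambda>k. n - k) ` {2..<n}. 1 / sqrt (real k))"
      by (subst sum.reindex) (auto simp: inj_on_def)
    moreover have "\<dots> \<le> (\<Sum>k=1..n. 1 / sqrt (real k))" by (intro sum_mono2) auto
    ultimately have "(\<Sum>k=2..<n. 1 / sqrt (real k)) + (\<Sum>k=2..<n. 1 / sqrt (real (n - k))) \<le> 4 * sqrt (real n)"
      using sum_inverse_sqrt[of n] by linarith
    then have "1 / real n * ((\<Sum>k=2..<n. 1 / sqrt (real k)) + (\<Sum>k=2..<n. 1 / sqrt (real (n - k)))) \<le> 1 / real n * (4 * sqrt (real n))"
      by (intro mult_left_mono) auto
    also have "\<dots> = 4 * (1 / sqrt (real n))" using n real_sqrt_mult_self[of "real n"] by (simp add: field_simps)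
    also have "\<dots> \<le> 4 * \<epsilon>" using e by simp
    finally show "1 / real n * ((\<Sum>k=2..<n. 1 / sqrt (real k)) + (\<Sum>k=2..<n. 1 / sqrt (real (n - k)))) \<le> 4 * \<epsilon>" .
  qed (use c B e in auto)
  also have "\<dots> = (2 * B + 4) / c * \<epsilon>" using c by (simp add: field_simps)
  finally show ?thesis .
qed

section \<open>The critical case: logarithmic variance\<close>

lemma harmonic_upper: "1 \<le> k \<Longrightarrow> (\<Sum>j=1..k. 1 / real j) \<le> 1 + ln (real k)"
proof (induction k rule: dec_induct)
  case (step k)
  have k: "0 < real k" using step by simp
  have "ln (real k / real (Suc k)) \<le> real k / real (Suc k) - 1" using k by (intro ln_le_minus_one) auto
  also have "\<dots> = - (1 / real (Suc k))" by (simp add: field_simps)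
  finally have "1 / real (Suc k) \<le> ln (real (Suc k)) - ln (real k)" using k by (simp add: ln_div)
  then show ?case using step by simp
qed simp

lemma critical_v:
  assumes "1 \<le> n"
  shows "ln (real n) / 4 \<le> erw_v (3/4) n" "erw_v (3/4) n \<le> 1 + ln (real n)"
proof -
  note P = erw_v_persistent(5,6)[of "3/4", OF _ _ assms]
  have s: "(erw_a (3/4) j)\<^sup>2 \<le> 1 / real j" "1 / real j / 4 \<le> (erw_a (3/4) j)\<^sup>2" if "1 \<le> j" for j
    using P[OF _ _ that] that by (simp_all add: powr_minus_divide)
  have "erw_v (3/4) n \<le> (\<Sum>j=1..n. 1 / real j)" unfolding erw_v_def using s by (intro sum_mono) auto
  then show "erw_v (3/4) n \<le> 1 + ln (real n)" using harmonic_upper[OF assms] by linarith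
  have "(\<Sum>j=1..n. 1 / real j / 4) \<le> erw_v (3/4) n" unfolding erw_v_def using s by (intro sum_mono) auto
  moreover have "ln (real n + 1) \<le> (\<Sum>j=1..n. 1 / real j)"
    using ln_le_harm[of n] by (simp add: harm_def inverse_eq_divide)
  moreover have "ln (real n) \<le> ln (real n + 1)" using assms by simp
  ultimately show "ln (real n) / 4 \<le> erw_v (3/4) n" unfolding sum_divide_distrib[symmetric] by linarith
qed

text \<open>Here \<open>t k\<close> is of order \<open>ln k / ln n\<close>. While
  \<open>t (Suc k) \<le> 1/2\<close> the remaining time is harmless and \<open>ln k\<close> is
  absorbed by \<open>sqrt k\<close>. Afterwards \<open>ln n\<close> is at most of order
  \<open>ln k\<close>, so even the bare floor \<open>\<epsilon>^2 = 4 / ln n\<close> is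
  enough.\<close>

lemma critical_drift_sum:
  assumes n: "3 \<le> n"
  defines "\<epsilon> \<equiv> 2 / sqrt (ln (real n))" and "t \<equiv> erw_t (3/4) n"
  shows "(\<Sum>k=2..<n. t k / ((real k)\<^sup>2 * (1 - t (Suc k) + \<epsilon>\<^sup>2))) \<le> 512 * \<epsilon>"
proof -
  define Ln where "Ln = ln (real n)"
  have L: "1 < Ln" using ln_gt_1[OF n] by (simp add: Ln_def)
  have e2: "\<epsilon>\<^sup>2 = 4 / Ln" using L by (simp add: \<epsilon>_def Ln_def[symmetric] power_divide)
  define v where "v = erw_v (3/4) n"
  have v: "Ln / 4 \<le> v" "0 < v" using critical_v(1)[of n] n L by (auto simp: v_def Ln_def)
  have t01: "0 \<le> t k" "k \<le> n \<Longrightarrow> t k \<le> 1" for k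
    using erw_scaled(5,6)[of "3/4" n k] n by (simp_all add: t_def)
  have tu: "t k \<le> 4 * (1 + ln (real k)) / Ln" if "1 \<le> k" for k
  proof -
    have "t k \<le> (1 + ln (real k)) / v"
      unfolding t_def erw_t_def v_def[symmetric] using critical_v(2)[OF that] v by (intro divide_right_mono) auto
    also have "\<dots> \<le> (1 + ln (real k)) / (Ln / 4)" using that v L by (intro divide_left_mono) auto
    also have "\<dots> = 4 * (1 + ln (real k)) / Ln" by simp
    finally show ?thesis .
  qed
  have "t k / ((real k)\<^sup>2 * (1 - t (Suc k) + \<epsilon>\<^sup>2)) \<le> 512 / Ln * (1 / (real k * sqrt (real k)))" if k: "k \<in> {2..<n}" for k
  proof -
    have kk: "2 \<le> real k" "0 < (real k)\<^sup>2" using k by auto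
    have sk: "sqrt (real k) / (real k)\<^sup>2 = 1 / (real k * sqrt (real k))"
      using kk real_sqrt_mult_self[of "real k"] by (simp add: field_simps power2_eq_square)
    have e20: "0 < \<epsilon>\<^sup>2" using L by (simp add: e2)
    show ?thesis
    proof (cases "t (Suc k) \<le> 1/2")
      case True
      have D: "1/2 \<le> 1 - t (Suc k) + \<epsilon>\<^sup>2" "0 < 1 - t (Suc k) + \<epsilon>\<^sup>2" using True e20 by linarith+
      have "t k / ((real k)\<^sup>2 * (1 - t (Suc k) + \<epsilon>\<^sup>2)) \<le> t k / ((real k)\<^sup>2 * (1/2))"
        using D kk t01 by (intro divide_left_mono mult_left_mono mult_pos_pos) auto
      also have "\<dots> \<le> (4 * (2 * sqrt (real k)) / Ln) / ((real k)\<^sup>2 * (1/2))"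
      proof (intro divide_right_mono)
        have "4 * (1 + ln (real k)) / Ln \<le> 4 * (2 * sqrt (real k)) / Ln"
          using ln_le_sqrt[of "real k"] kk L by (intro divide_right_mono) auto
        then show "t k \<le> 4 * (2 * sqrt (real k)) / Ln" using tu[of k] kk by simp
      qed simp
      also have "\<dots> = 16 / Ln * (sqrt (real k) / (real k)\<^sup>2)" by simp
      also have "\<dots> \<le> 512 / Ln * (sqrt (real k) / (real k)\<^sup>2)" using L by (intro mult_right_mono divide_right_mono) auto
      finally show ?thesis unfolding sk .
    next
      case False
      define x where "x = real (Suc k)"
      have x: "3 \<le> x" using kk by (simp add: x_def)
      have "t (Suc k) \<le> 4 * (1 + ln x) / Ln" using tu[of "Suc k"] by (simp add: x_def del: of_nat_Suc)
      then have "1/2 \<le> 4 * (1 + ln x) / Ln" using False by linarith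
      then have l1: "Ln \<le> 8 * (1 + ln x)" using L by (simp add: field_simps)
      \<comment> \<open>A fourth root, because \<open>Ln\<close> is squared below and its square has
        to be of order \<open>sqrt k\<close>.\<close>
      have "ln x = 2 * ln (sqrt x)" using x by (simp add: ln_sqrt)
      also have "\<dots> \<le> 2 * (2 * (sqrt (sqrt x) - 1))" using ln_le_sqrt[of "sqrt x"] x by simp
      finally have "1 + ln x \<le> 4 * sqrt (sqrt x)" by simp
      then have "Ln \<le> 32 * sqrt (sqrt x)" using l1[unfolded distrib_left] by linarith
      then have "Ln * Ln \<le> (32 * sqrt (sqrt x)) * (32 * sqrt (sqrt x))" using L x by (intro mult_mono) auto
      also have "\<dots> = 1024 * sqrt x" using x by simp
      also have "\<dots> \<le> 1024 * (2 * sqrt (real k))"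
      proof -
        have "sqrt x \<le> sqrt (4 * real k)" using kk by (simp add: x_def)
        then show ?thesis by (simp add: real_sqrt_mult)
      qed
      finally have LL: "Ln * Ln \<le> 2048 * sqrt (real k)" by simp
      have tS: "t (Suc k) \<le> 1" using t01 k by auto
      have "t k / ((real k)\<^sup>2 * (1 - t (Suc k) + \<epsilon>\<^sup>2)) \<le> t k / ((real k)\<^sup>2 * (4 / Ln))"
        unfolding e2 using tS L kk t01 by (intro divide_left_mono mult_left_mono mult_pos_pos) (auto intro!: add_nonneg_pos)
      also have "\<dots> \<le> 1 / ((real k)\<^sup>2 * (4 / Ln))" using t01[of k] k L by (intro divide_right_mono) auto
      also have "\<dots> = (Ln * Ln) / (4 * Ln * (real k)\<^sup>2)" using L kk by (simp add: field_simps)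
      also have "\<dots> \<le> (2048 * sqrt (real k)) / (4 * Ln * (real k)\<^sup>2)" using LL L by (intro divide_right_mono) auto
      also have "\<dots> = 512 / Ln * (sqrt (real k) / (real k)\<^sup>2)" by simp
      finally show ?thesis unfolding sk .
    qed
  qed
  then have "(\<Sum>k=2..<n. t k / ((real k)\<^sup>2 * (1 - t (Suc k) + \<epsilon>\<^sup>2))) \<le> (\<Sum>k=2..<n. 512 / Ln * (1 / (real k * sqrt (real k))))"
    by (rule sum_mono)
  also have "\<dots> = 512 / Ln * (\<Sum>k=2..<n. 1 / (real k * sqrt (real k)))" unfolding sum_distrib_left ..
  also have "\<dots> \<le> 512 / Ln * 2"
  proof (intro mult_left_mono)
    have "0 \<le> 2 / sqrt (real n - 1)" using n by simp
    then show "(\<Sum>k=2..<n. 1 / (real k * sqrt (real k))) \<le> 2" using sum_inverse_k_sqrt[of n] n by linarith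
  qed (use L in auto)
  also have "\<dots> = 512 * (2 / Ln)" by simp
  also have "\<dots> \<le> 512 * \<epsilon>"
  proof -
    have "sqrt Ln \<le> Ln" using L by (intro real_le_lsqrt) (auto simp: power2_eq_square)
    then have "2 / Ln \<le> 2 / sqrt Ln" using L by (intro divide_left_mono) auto
    then show ?thesis by (simp add: \<epsilon>_def Ln_def)
  qed
  finally show ?thesis .
qed

text \<open>The last inequality places the admissible \<open>x\<close> below the value of the
  statistic at position \<open>n - 2\<close>; it serves the case of bounded
  \<open>n\<close>.\<close>

lemma persistent_drift:
  assumes p: "1/2 < p" "p < 3/4" and n: "3 \<le> n"
  defines "\<delta> \<equiv> 3 - 4 * p"
  defines "\<epsilon> \<equiv> 2 / real n powr (\<delta> / 2)"
  shows "1 \<le> k \<Longrightarrow> k \<le> n \<Longrightarrow> erw_e p n k \<le> \<epsilon>"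
    "(\<Sum>k=2..<n. erw_t p n k / ((real k)\<^sup>2 * (1 - erw_t p n (Suc k) + \<epsilon>\<^sup>2))) \<le> (16 / \<delta>\<^sup>2 + 16 / \<delta>) * \<epsilon>"
    "real n powr (\<delta> / 2) / 6 \<le> erw_e p n n * (real n - 2)"
proof -
  have p': "1/2 \<le> p" "p \<le> 3/4" "0 < p" using p by auto
  have d: "0 < \<delta>" "\<delta> \<le> 1" using p by (auto simp: \<delta>_def)
  have n1: "1 \<le> n" "0 < real n" "1 \<le> real n" using n by auto
  define s where "s = real n powr (\<delta> / 2)"
  have s: "0 < s" "s * s = real n powr \<delta>" using n by (auto simp: s_def powr_add[symmetric])
  define v where "v = erw_v p n"
  have v: "0 < v" "s * s / 4 \<le> v" "v \<le> real n" "v \<le> s * s / \<delta>"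
    using erw_v_pos[OF p'(3) n1(1)] erw_v_persistent(1,2,3)[OF p'(1,2) n1(1)] p(2) s(2) by (auto simp: v_def \<delta>_def)
  have sv: "s / 2 \<le> sqrt v" using v(2) by (intro real_le_rsqrt) (simp add: power2_eq_square)
  show "erw_e p n k \<le> \<epsilon>" if k: "1 \<le> k" "k \<le> n"
  proof -
    have "erw_a p k \<le> real k powr (- (2 * p - 1))" by (rule erw_a_persistent(1)[OF p'(1,2) k(1)])
    also have "\<dots> \<le> 1" using powr_mono[of "- (2 * p - 1)" 0 "real k"] k p by auto
    finally have "erw_e p n k \<le> 1 / sqrt v" unfolding erw_e_def v_def[symmetric] using v by (intro divide_right_mono) auto
    also have "\<dots> \<le> 1 / (s / 2)" using sv s v by (intro divide_left_mono) auto
    finally show ?thesis by (simp add: \<epsilon>_def s_def)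
  qed
  have ss: "s \<le> sqrt (real n)"
  proof -
    have "s \<le> real n powr (1/2)" unfolding s_def using d n by (intro powr_mono) auto
    then show ?thesis by (simp add: powr_half_sqrt)
  qed
  show "(\<Sum>k=2..<n. erw_t p n k / ((real k)\<^sup>2 * (1 - erw_t p n (Suc k) + \<epsilon>\<^sup>2))) \<le> (16 / \<delta>\<^sup>2 + 16 / \<delta>) * \<epsilon>"
  proof -
    have "(\<Sum>k=2..<n. erw_t p n k / ((real k)\<^sup>2 * (1 - erw_t p n (Suc k) + \<epsilon>\<^sup>2))) \<le> (2 * (2 / \<delta>) + 4) / (\<delta> / 4) * \<epsilon>"
    proof (rule drift_sum_bound)
      show "1 / sqrt (real n) \<le> \<epsilon>"
      proof -
        have "1 / sqrt (real n) \<le> 1 / s" using ss s n1 by (intro divide_left_mono) auto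
        also have "\<dots> \<le> 2 / s" using s by (intro divide_right_mono) auto
        finally show ?thesis by (simp add: \<epsilon>_def s_def)
      qed
      show "0 \<le> erw_t p n k" "k \<le> n \<Longrightarrow> erw_t p n k \<le> 1" for k using erw_scaled(5,6)[OF p'(3) n1(1)] by auto
      show "erw_t p n k \<le> 2 / \<delta> * (sqrt (real k) * \<epsilon>)" if k: "k \<le> n" for k
      proof (cases "k = 0")
        case True
        then show ?thesis by (simp add: erw_t_def erw_v_def)
      next
        case False
        define u where "u = real k powr (\<delta> / 2)"
        have k1: "1 \<le> k" using False by simp
        have u: "0 < u" "u * u = real k powr \<delta>" using k1 by (auto simp: u_def powr_add[symmetric])
        have us: "u \<le> s" unfolding u_def s_def using k d by (intro powr_mono2) auto
        have "u \<le> real k powr (1/2)" unfolding u_def using d k1 by (intro powr_mono) auto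
        then have uk: "u \<le> sqrt (real k)" by (simp add: powr_half_sqrt)
        have "erw_v p k \<le> u * u / \<delta>" using erw_v_persistent(3)[OF p'(1,2) k1] p(2) u by (simp add: \<delta>_def)
        then have "erw_t p n k \<le> (u * u / \<delta>) / v" unfolding erw_t_def v_def[symmetric] using v by (intro divide_right_mono) auto
        \<comment> \<open>Only one of the two factors \<open>u\<close> is replaced by
          \<open>s\<close>: the other, at most \<open>sqrt k\<close>, gives the early smallness that
          \<open>drift_sum_bound\<close> asks for.\<close>
        also have "\<dots> \<le> (u * s / \<delta>) / (s * s / 4)"
          using v us u s d by (intro frac_le divide_right_mono mult_left_mono) auto
        also have "\<dots> = 2 / \<delta> * (u * (2 / s))" using s(1) d(1) by (simp add: field_simps)
        also have "\<dots> \<le> 2 / \<delta> * (sqrt (real k) * (2 / s))" using uk s d by (intro mult_left_mono mult_right_mono) auto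
        finally show ?thesis by (simp add: \<epsilon>_def s_def)
      qed
      show "\<delta> / 4 * (real n - real k) / real n \<le> 1 - erw_t p n k" if k: "k \<le> n" for k
      proof -
        define w where "w = real n powr (- (2 * (2 * p - 1)))"
        have w: "real n * w = s * s" using n1 powr_add[of "real n" 1 "- (2 * (2 * p - 1))"] by (simp add: s(2) w_def \<delta>_def)
        have "erw_v p k + (real n - real k) * (w / 4) \<le> v"
          using erw_v_persistent(4)[OF p'(1,2) n1(1) k] k by (simp add: v_def w_def of_nat_diff)
        then have "((real n - real k) * (w / 4)) / v \<le> (v - erw_v p k) / v" using v by (intro divide_right_mono) auto
        also have "\<dots> = 1 - erw_t p n k" using v by (simp add: erw_t_def v_def diff_divide_distrib)
        finally have 1: "((real n - real k) * (w / 4)) / v \<le> 1 - erw_t p n k" .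
        have "\<delta> * v \<le> real n * w" using v(4) d w by (simp add: field_simps)
        then have "\<delta> / real n \<le> w / v" using v n1 by (simp add: field_simps)
        then have "(real n - real k) / 4 * (\<delta> / real n) \<le> (real n - real k) / 4 * (w / v)" using k by (intro mult_left_mono) auto
        then show ?thesis using 1 by (simp add: mult_ac)
      qed
    qed (use n d s in \<open>auto simp: \<epsilon>_def s_def\<close>)
    also have "(2 * (2 / \<delta>) + 4) / (\<delta> / 4) = 16 / \<delta>\<^sup>2 + 16 / \<delta>" using d by (simp add: field_simps power2_eq_square)
    finally show ?thesis .
  qed
  have "real n powr (- (2 * p - 1)) / 2 / sqrt (real n) \<le> erw_e p n n"
    unfolding erw_e_def using erw_a_persistent(2)[OF p'(1,2) n1(1)] erw_a_pos[OF p'(3) n1(1)] v n1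
    by (intro frac_le) (auto simp: v_def)
  moreover have "real n / 3 \<le> real n - 2" using n by simp
  ultimately have "(real n powr (- (2 * p - 1)) / 2 / sqrt (real n)) * (real n / 3) \<le> erw_e p n n * (real n - 2)"
    using n erw_scaled(1)[OF p'(3) n1(1) n1(1)] by (intro mult_mono) auto
  moreover have "real n powr (- (2 * p - 1)) / sqrt (real n) * real n = s"
  proof -
    have "real n powr (- (2 * p - 1)) * real n powr (- (1/2)) * real n powr 1 = s"
      unfolding powr_add[symmetric] s_def \<delta>_def by (simp add: field_simps)
    then show ?thesis using n1 by (simp add: powr_minus_divide powr_half_sqrt)
  qed
  then have "(real n powr (- (2 * p - 1)) / 2 / sqrt (real n)) * (real n / 3) = s / 6" by simp
  ultimately show "real n powr (\<delta> / 2) / 6 \<le> erw_e p n n * (real n - 2)" unfolding s_def by linarith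
qed

lemma critical_scale:
  assumes n: "3 \<le> n"
  shows "1 \<le> k \<Longrightarrow> k \<le> n \<Longrightarrow> erw_e (3/4) n k \<le> 2 / sqrt (ln (real n))"
    "sqrt (ln (real n)) / 12 \<le> erw_e (3/4) n n * (real n - 2)"
proof -
  define Ln where "Ln = ln (real n)"
  have L: "1 < Ln" using ln_gt_1[OF n] by (simp add: Ln_def)
  define v where "v = erw_v (3/4) n"
  have v: "Ln / 4 \<le> v" "0 < v" "v \<le> 1 + Ln" using critical_v[of n] n L by (auto simp: v_def Ln_def)
  have "sqrt (Ln / 4) \<le> sqrt v" using v by simp
  then have sv: "sqrt Ln / 2 \<le> sqrt v" by (simp add: real_sqrt_divide)
  show "erw_e (3/4) n k \<le> 2 / sqrt (ln (real n))" if k: "1 \<le> k" "k \<le> n"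
  proof -
    have "erw_a (3/4) k \<le> real k powr (- (2 * (3/4) - 1))" using k by (intro erw_a_persistent(1)) auto
    also have "\<dots> \<le> 1" using k by (simp add: powr_minus ge_one_powr_ge_zero inverse_le_1_iff)
    finally have "erw_e (3/4) n k \<le> 1 / sqrt v" unfolding erw_e_def v_def[symmetric] using v by (intro divide_right_mono) auto
    also have "\<dots> \<le> 1 / (sqrt Ln / 2)" using sv L v by (intro divide_left_mono) auto
    finally show ?thesis by (simp add: Ln_def)
  qed
  define s where "s = sqrt (real n)"
  have s: "0 < s" "s * s = real n" using n by (auto simp: s_def)
  have lns: "1 + Ln \<le> 2 * s" using ln_le_sqrt[of "real n"] n by (simp add: Ln_def s_def)
  have "(sqrt v * sqrt Ln) \<le> sqrt (2 * s) * sqrt (2 * s)" using v lns L by (intro mult_mono) auto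
  then have vl: "sqrt v * sqrt Ln \<le> 2 * s" using s by simp
  have "real n powr (- (1/2)) / 2 \<le> erw_a (3/4) n" using erw_a_persistent(2)[of "3/4" n] n by simp
  then have "1 / s / 2 \<le> erw_a (3/4) n" using n by (simp add: powr_minus_divide powr_half_sqrt s_def)
  then have "1 / s / 2 / sqrt v \<le> erw_e (3/4) n n"
    unfolding erw_e_def v_def[symmetric] using v by (intro divide_right_mono) auto
  moreover have "real n / 3 \<le> real n - 2" using n by simp
  moreover have "0 \<le> 1 / s / 2 / sqrt v" using s v by simp
  ultimately have "(1 / s / 2 / sqrt v) * (real n / 3) \<le> erw_e (3/4) n n * (real n - 2)"
    using n erw_scaled(1)[of "3/4" n n] by (intro mult_mono) auto
  moreover have "(1 / s / 2 / sqrt v) * (real n / 3) = s / (6 * sqrt v)"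
    unfolding s(2)[symmetric] using s(1) v(2) by (simp add: field_simps)
  moreover have "sqrt Ln / 12 \<le> s / (6 * sqrt v)"
    using vl v by (simp add: field_simps)
  ultimately show "sqrt (ln (real n)) / 12 \<le> erw_e (3/4) n n * (real n - 2)" by (simp add: Ln_def)
qed

subsection \<open>The three regimes\<close>

lemma sign_pmf_flip:
  assumes "0 \<le> q" "q \<le> 1"
  shows "map_pmf uminus (sign_pmf q) = sign_pmf (1 - q)"
proof -
  have "pmf (map_pmf Not (bernoulli_pmf q)) b = pmf (bernoulli_pmf (1 - q)) b" for b
    using pmf_map_inj'[of Not "bernoulli_pmf q" "\<not> b"] assms by (cases b) (auto simp: inj_def)
  then have N: "map_pmf Not (bernoulli_pmf q) = bernoulli_pmf (1 - q)" by (rule pmf_eqI)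
  have "map_pmf uminus (sign_pmf q) = map_pmf (\<lambda>b. if b then 1 else - 1) (map_pmf Not (bernoulli_pmf q))"
    unfolding sign_pmf_def map_pmf_comp by (intro map_pmf_cong) auto
  then show ?thesis by (simp add: N sign_pmf_def)
qed

lemma erw_flip:
  assumes q: "0 \<le> q" "q \<le> 1"
  shows "map_pmf (\<lambda>X i. - X i) (erw_pmf p q n) = erw_pmf p (1 - q) n"
proof (induction n rule: induct_nat_012)
  case 0
  show ?case by simp
next
  case 1
  have "map_pmf (\<lambda>X i. - X i) (erw_pmf p q (Suc 0)) = map_pmf (\<lambda>x i. - ((\<lambda>_. 0)(1 := x)) i) (sign_pmf q)"
    by (simp only: erw_pmf.simps map_pmf_comp)
  also have "\<dots> = map_pmf (\<lambda>x. (\<lambda>_. 0)(1 := - x)) (sign_pmf q)"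
    by (intro map_pmf_cong refl ext) auto
  also have "\<dots> = erw_pmf p (1 - q) (Suc 0)"
    by (simp only: erw_pmf.simps sign_pmf_flip[OF q, symmetric] map_pmf_comp)
  finally show ?case .
next
  case (ge2 n)
  have "map_pmf (\<lambda>X i. - X i) (erw_pmf p q (Suc (Suc n))) =
    bind_pmf (erw_pmf p q (Suc n)) (\<lambda>X. bind_pmf (pmf_of_set {1..Suc n}) (\<lambda>\<beta>. bind_pmf (sign_pmf p) (\<lambda>\<alpha>.
      return_pmf (\<lambda>i. - (X(Suc (Suc n) := \<alpha> * X \<beta>)) i))))"
    by (simp only: erw_pmf.simps map_bind_pmf map_return_pmf)
  also have "\<dots> = bind_pmf (erw_pmf p q (Suc n)) (\<lambda>X. bind_pmf (pmf_of_set {1..Suc n}) (\<lambda>\<beta>. bind_pmf (sign_pmf p) (\<lambda>\<alpha>.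
      return_pmf ((\<lambda>i. - X i)(Suc (Suc n) := \<alpha> * - X \<beta>)))))"
    by (intro bind_pmf_cong refl arg_cong[of _ _ return_pmf] ext) auto
  also have "\<dots> = erw_pmf p (1 - q) (Suc (Suc n))"
    by (simp only: erw_pmf.simps ge2(2)[symmetric] bind_map_pmf)
  finally show ?case .
qed

lemma lower_tail_ratio_flip:
  assumes q: "0 \<le> q" "q \<le> 1"
  shows "lower_tail_ratio p q n x = upper_tail_ratio p (1 - q) n x"
proof -
  have "erw_norm p n (\<lambda>i. - X i) = - erw_norm p n X" for X
    by (simp add: erw_norm_def erw_pos_def sum_negf)
  then have "(\<lambda>X i. - X i) -` {X. x \<le> erw_norm p n X} = {X. erw_norm p n X \<le> - x}" by auto
  then have "measure_pmf.prob (erw_pmf p (1 - q) n) {X. x \<le> erw_norm p n X} = measure_pmf.prob (erw_pmf p q n) {X. erw_norm p n X \<le> - x}"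
    unfolding erw_flip[OF q, symmetric] by (simp add: measure_map_pmf)
  then show ?thesis by (simp add: lower_tail_ratio_def upper_tail_ratio_def Phi_minus)
qed

text \<open>All steps but at most one equal \<open>1\<close>: the exceptional step keeps the probability positive
  uniformly in \<open>p\<close> near \<open>0\<close>, where long runs of equal steps become unlikely.\<close>

lemma almost_maximal:
  assumes p: "0 < p" "p \<le> 3/4" and n: "1 \<le> n"
  shows "1 / (4 ^ n * fact n) \<le> measure_pmf.prob (erw_pmf p q n) {X. int n - 2 \<le> erw_pos X n}"
  using n
proof (induction n rule: dec_induct)
  case base
  have "measure_pmf.expectation (erw_pmf p q 1) (indicator {X. int 1 - 2 \<le> erw_pos X 1}) = measure_pmf.expectation (erw_pmf p q 1) (\<lambda>X. 1::real)"
  proof (rule expectation_cong_finite)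
    fix X assume "X \<in> set_pmf (erw_pmf p q 1)"
    from erw_pos_abs[OF erw_support[OF this]] show "indicator {X. int 1 - 2 \<le> erw_pos X 1} X = (1::real)"
      by (auto simp: indicator_def)
  qed
  then have "measure_pmf.prob (erw_pmf p q 1) {X. int 1 - 2 \<le> erw_pos X 1} = 1" by simp
  then show ?case by simp
next
  case (step k)
  have k: "1 \<le> real k" using step by simp
  let ?S = "\<lambda>k. {X. int k - 2 \<le> erw_pos X k}"
  have "1 / (4 ^ Suc k * fact (Suc k)) = 1 / (4 * real (Suc k)) * (1 / (4 ^ k * fact k))" by simp
  also have "\<dots> \<le> 1 / (4 * real (Suc k)) * measure_pmf.prob (erw_pmf p q k) (?S k)"
    using step by (intro mult_left_mono) auto
  also have "\<dots> = measure_pmf.expectation (erw_pmf p q k) (\<lambda>X. 1 / (4 * real (Suc k)) * indicator (?S k) X)"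
    by simp
  also have "\<dots> \<le> measure_pmf.expectation (erw_pmf p q k)
    (\<lambda>X. (1 + memdrift p k X) / 2 * indicator (?S (Suc k)) (X(Suc k := 1)) + (1 - memdrift p k X) / 2 * indicator (?S (Suc k)) (X(Suc k := - 1)))"
  proof (rule expectation_mono_finite[OF finite_erw])
    fix X assume X: "X \<in> set_pmf (erw_pmf p q k)"
    define r m where "r = memdrift p k X" and "m = erw_pos X k"
    have r1: "\<bar>r\<bar> \<le> 1" unfolding r_def using erw_support[OF X] step p by (intro memdrift_abs) auto
    have m1: "\<bar>m\<bar> \<le> int k" unfolding m_def by (rule erw_pos_abs[OF erw_support[OF X]])
    have r: "r = (2 * p - 1) * (real_of_int m / real k)" by (simp add: r_def m_def memdrift_def)
    have I: "indicator (?S k) X = (if int k - 2 \<le> m then 1 else (0::real))"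
      "indicator (?S (Suc k)) (X(Suc k := 1)) = (if int (Suc k) - 2 \<le> m + 1 then 1 else (0::real))"
      "indicator (?S (Suc k)) (X(Suc k := - 1)) = (if int (Suc k) - 2 \<le> m + - 1 then 1 else (0::real))"
      unfolding indicator_def mem_Collect_eq erw_pos_update(2) m_def[symmetric] by simp_all
    show "1 / (4 * real (Suc k)) * indicator (?S k) X \<le> (1 + r) / 2 * indicator (?S (Suc k)) (X(Suc k := 1)) + (1 - r) / 2 * indicator (?S (Suc k)) (X(Suc k := - 1))"
      unfolding I
    proof (cases "int k - 2 \<le> m")
      case True
      have small: "1 / (4 * real (Suc k)) \<le> 1/4" "1 / (4 * real (Suc k)) \<le> 1 / (2 * real k)"
        using k by (auto simp: field_simps)
      have nn: "0 \<le> (1 - r) / 2" using r1 by simp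
      \<comment> \<open>After \<open>k\<close> steps all equal to 1 both continuations stay in the
        event. Otherwise \<open>m \<le> k - 1\<close> bounds the memory drift away from
        \<open>-1\<close>, however small \<open>p\<close> is.\<close>
      have "1 / (4 * real (Suc k)) \<le> (1 + r) / 2 \<or> m = int k"
      proof (cases "m = int k")
        case False
        then have mk: "real_of_int m \<le> real k - 1" using m1 by linarith
        define y where "y = real_of_int m / real k"
        have y: "- 1 \<le> y" "y \<le> 1 - 1 / real k"
          using m1 mk k by (auto simp: y_def field_simps)
        have ry: "r = (2 * p - 1) * y" by (simp add: r y_def)
        have "1/4 \<le> (1 + r) / 2 \<or> 1 / (2 * real k) \<le> (1 + r) / 2"
        proof (cases "1/2 \<le> p")
          case True
          then have "(2 * p - 1) * (- 1) \<le> r" unfolding ry using y by (intro mult_left_mono) auto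
          then show ?thesis using p by simp
        next
          case p12: False
          show ?thesis
          proof (cases "0 \<le> y")
            case True
            have "- 1 * y \<le> r" unfolding ry using True p by (intro mult_right_mono) auto
            then have "1 / real k \<le> 1 + r" using y by simp
            then have "1 / real k / 2 \<le> (1 + r) / 2" by (intro divide_right_mono) auto
            then show ?thesis by simp
          next
            case False
            then have "0 \<le> r" unfolding ry using p12 by (intro mult_nonpos_nonpos) auto
            then show ?thesis by simp
          qed
        qed
        then show ?thesis using small by linarith
      qed simp
      then show "1 / (4 * real (Suc k)) * (if int k - 2 \<le> m then 1 else 0) \<le> (1 + r) / 2 * (if int (Suc k) - 2 \<le> m + 1 then 1 else 0) + (1 - r) / 2 * (if int (Suc k) - 2 \<le> m + - 1 then 1 else 0)"
      proof
        assume "1 / (4 * real (Suc k)) \<le> (1 + r) / 2"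
        moreover have "(if int (Suc k) - 2 \<le> m + 1 then 1 else 0) = (1::real)" using True by simp
        moreover have "0 \<le> (1 - r) / 2 * (if int (Suc k) - 2 \<le> m + - 1 then 1 else 0)" using nn by simp
        ultimately show ?thesis using True by (simp only: if_True mult_1_right)
      next
        assume "m = int k"
        then show ?thesis using small by (simp add: field_simps)
      qed
    next
      case False
      then show "1 / (4 * real (Suc k)) * (if int k - 2 \<le> m then 1 else 0) \<le> (1 + r) / 2 * (if int (Suc k) - 2 \<le> m + 1 then 1 else 0) + (1 - r) / 2 * (if int (Suc k) - 2 \<le> m + - 1 then 1 else 0)"
        by simp
    qed
  qed
  also have "\<dots> = measure_pmf.expectation (erw_pmf p q (Suc k)) (indicator (?S (Suc k)))"
    using step p by (intro expectation_erw_Suc[symmetric]) auto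
  finally show ?case by simp
qed

section \<open>Assembly: large and bounded \<open>n\<close>, and the three regimes\<close>

definition "ratio_bounds p q n x C s T \<longleftrightarrow>
  exp (- (C * (x ^ 3 / s + (1 + x) * (T / s)))) \<le> upper_tail_ratio p q n x \<and>
  upper_tail_ratio p q n x \<le> exp (C * (x ^ 3 / s + (1 + x) * (T / s)))"

lemma upper_tail_ratio_alt:
  assumes "0 < p" "1 \<le> n"
  shows "upper_tail_ratio p q n x =
    measure_pmf.prob (erw_pmf p q n) {X. x \<le> erw_e p n n * real_of_int (erw_pos X n)} / (1 - Phi x)"
  unfolding upper_tail_ratio_def erw_scaled(7)[OF assms] ..

lemma Phi_tail_pos: "0 \<le> x \<Longrightarrow> 0 < 1 - Phi x"
  using normal_tail_bounds(2)[of x] by (smt (verit) divide_pos_pos exp_gt_zero)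

lemma ratio_bounds_mono:
  assumes "ratio_bounds p q n x C s T" "C \<le> C'" "0 \<le> x" "0 < s" "0 \<le> T"
  shows "ratio_bounds p q n x C' s T"
proof -
  have "C * (x ^ 3 / s + (1 + x) * (T / s)) \<le> C' * (x ^ 3 / s + (1 + x) * (T / s))"
    using assms by (intro mult_right_mono) auto
  then show ?thesis using assms(1) unfolding ratio_bounds_def by (smt (verit) exp_le_cancel_iff)
qed

definition "Kdev A = 200000000000 * (1 + (A::real))"
text \<open>Twice the constant \<open>C\<close> of \<open>scaled_walk\<close>, for
  \<open>K = Kdev A\<close>; the 2 comes from taking \<open>2 / s\<close> as the bound on the
  weights.\<close>

definition "Cdev A = 2 * (20000 + 6000 * (Kdev A * (4 + 128 * A)))"

lemma Cdev_pos: "1 \<le> A \<Longrightarrow> 0 < Cdev A"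
  by (simp add: Cdev_def Kdev_def add_pos_nonneg)

lemma ratio_bounds_large_n:
  assumes p: "0 < p" "p \<le> 1" and n: "3 \<le> n" and s: "0 < s" and T: "ln s \<le> T" "0 \<le> T"
    and e_le: "\<And>k. 1 \<le> k \<Longrightarrow> k \<le> n \<Longrightarrow> erw_e p n k \<le> 2 / s"
    and A: "1 \<le> A" and big: "2 * (400 * Kdev A) ^ 4 \<le> s"
    and HA: "(\<Sum>k=2..<n. erw_t p n k / ((real k)\<^sup>2 * (1 - erw_t p n (Suc k) + (2 / s)\<^sup>2))) \<le> A * (2 / s)"
    and x: "0 \<le> x" "x \<le> s / 8000"
  shows "ratio_bounds p q n x (Cdev A) s T"
proof -
  have n1: "1 \<le> n" using n by simp
  have K: "0 < (400 * Kdev A) ^ 4" using A by (simp add: Kdev_def)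
  interpret sw: scaled_walk p q n "erw_e p n" "2 / s" A "Kdev A"
  proof
    show "erw_e p n (Suc k) * (1 + (2 * p - 1) / real k) = erw_e p n k" if "2 \<le> k" "k < n" for k
      using that by (intro erw_scaled(2) p n1) auto
    show "(\<Sum>k=1..n. (erw_e p n k)\<^sup>2) = 1" using erw_scaled(3)[OF p(1) n1, of n] erw_scaled(4)[OF p(1) n1] by simp
    show "2 / s \<le> 1 / (400 * Kdev A) ^ 4" using big K s by (simp add: field_simps)
    show "(\<Sum>k=2..<n. (\<Sum>j=1..k. (erw_e p n j)\<^sup>2) / ((real k)\<^sup>2 * (1 - (\<Sum>j=1..Suc k. (erw_e p n j)\<^sup>2) + (2 / s)\<^sup>2))) \<le> A * (2 / s)"
      unfolding erw_scaled(3)[OF p(1) n1] by (rule HA)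
  qed (use p n A e_le erw_scaled(1)[OF p(1) n1] in \<open>auto simp: Kdev_def\<close>)
  have "x * (2 / s) \<le> s / 8000 * (2 / s)" using x s by (intro mult_right_mono) auto
  then have xs: "x * (2 / s) \<le> 1/4000" using s by simp
  note md = sw.moderate_deviation[OF x(1) xs]
  have "0 < ln (2::real)" by simp
  then have "- ln (2 / s) \<le> T" using T s by (simp add: ln_div del: ln_gt_zero_iff)
  then have "2 / s * (- ln (2 / s)) \<le> 2 / s * T" using s by (intro mult_left_mono) auto
  then have "(1 + x) * sw.W \<le> (1 + x) * (2 / s * T)" unfolding sw.W_def by (rule mult_left_mono) (use x in auto)
  then have D: "sw.D x \<le> 2 * (x ^ 3 / s + (1 + x) * (T / s))" unfolding sw.D_def by (simp add: distrib_left mult_ac)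
  have C0: "0 \<le> sw.C" using Cdev_pos[OF A] by (simp add: sw.C_def sw.Ka_def Cdev_def)
  have "sw.C * sw.D x \<le> sw.C * (2 * (x ^ 3 / s + (1 + x) * (T / s)))" using D C0 by (rule mult_left_mono)
  also have "\<dots> = Cdev A * (x ^ 3 / s + (1 + x) * (T / s))"
    unfolding sw.C_def sw.Ka_def Cdev_def by (simp only: mult_ac)
  finally have CD: "sw.C * sw.D x \<le> Cdev A * (x ^ 3 / s + (1 + x) * (T / s))" .
  have G: "0 < 1 - Phi x" by (rule Phi_tail_pos[OF x(1)])
  have R: "upper_tail_ratio p q n x = sw.TP x / (1 - Phi x)"
    by (simp add: upper_tail_ratio_alt[OF p(1) n1] sw.TP_def)
  have "exp (- (sw.C * sw.D x)) \<le> sw.TP x / (1 - Phi x)" "sw.TP x / (1 - Phi x) \<le> exp (sw.C * sw.D x)"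
    using md G by (simp_all add: field_simps)
  then show ?thesis using CD unfolding ratio_bounds_def R by (smt (verit) exp_le_cancel_iff)
qed

text \<open>For \<open>x \<le> N\<close> the first three terms bound the logarithm of
  \<open>3 * (1 + x) * exp (x^2 / 2)\<close>, hence of the ratio; the last exceeds the logarithm of
  the inverse probability in \<open>almost_maximal\<close>.\<close>

definition "Hdev N = 3 + real N + (real N)\<^sup>2 + 4 ^ N * fact N"

text \<open>For \<open>n \<le> N\<close> the ratio lies between fixed positive bounds. Since
  \<open>T / s \<ge> d > 0\<close>, a constant of at least \<open>Hdev N / d\<close> makes the
  exponent cover them even at \<open>x = 0\<close>.\<close>

lemma ratio_bounds_small_n:
  assumes p: "0 < p" "p \<le> 3/4" and n: "3 \<le> n" "n \<le> N" and s: "0 < s" and x: "0 \<le> x" "x \<le> real n"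
    and top: "x \<le> erw_e p n n * (real n - 2)" and d: "0 < d" "d \<le> T / s" and C: "Hdev N / d \<le> C"
  shows "ratio_bounds p q n x C s T"
proof -
  have n1: "1 \<le> n" using n by simp
  have H0: "0 \<le> Hdev N" by (simp add: Hdev_def)
  have "Hdev N \<le> C * d" using C d by (simp add: field_simps)
  also have "\<dots> \<le> C * (x ^ 3 / s + (1 + x) * (T / s))"
  proof (intro mult_left_mono)
    have "0 \<le> Hdev N / d" using H0 d by simp
    then show "0 \<le> C" using C by linarith
    have "1 * (T / s) \<le> (1 + x) * (T / s)" using x d by (intro mult_right_mono) auto
    moreover have "0 \<le> x ^ 3 / s" using x s by simp
    ultimately show "d \<le> x ^ 3 / s + (1 + x) * (T / s)" using d by linarith
  qed
  finally have H: "Hdev N \<le> C * (x ^ 3 / s + (1 + x) * (T / s))" .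
  define P where "P = measure_pmf.prob (erw_pmf p q n) {X. x \<le> erw_e p n n * real_of_int (erw_pos X n)}"
  have G: "0 < 1 - Phi x" "1 - Phi x \<le> 1" by (rule Phi_tail_pos[OF x(1)]) (simp add: Phi_nonneg)
  have R: "upper_tail_ratio p q n x = P / (1 - Phi x)" by (simp add: upper_tail_ratio_alt[OF p(1) n1] P_def)
  have xN: "x \<le> real N" using x n by linarith
  have "1 / (3 * (1 + x) * exp (x\<^sup>2 / 2)) \<le> 1 - Phi x"
    using normal_tail_bounds(2)[OF x(1)] by (simp add: exp_minus field_simps)
  then have "P / (1 - Phi x) \<le> 1 / (1 / (3 * (1 + x) * exp (x\<^sup>2 / 2)))"
    using x G by (intro frac_le) (auto simp: P_def)
  also have "\<dots> = 3 * (1 + x) * exp (x\<^sup>2 / 2)" by simp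
  also have "\<dots> \<le> exp 3 * exp x * exp (x\<^sup>2 / 2)"
    using x exp_ge_add_one_self[of 3] by (intro mult_right_mono mult_mono exp_ge_add_one_self) auto
  also have "\<dots> \<le> exp (Hdev N)"
  proof -
    have "x\<^sup>2 \<le> (real N)\<^sup>2" using x xN by (intro power_mono) auto
    moreover have "0 \<le> x\<^sup>2" "(0::real) \<le> 4 ^ N * fact N" by auto
    ultimately show ?thesis unfolding exp_add[symmetric] exp_le_cancel_iff Hdev_def using xN by linarith
  qed
  finally have up: "P / (1 - Phi x) \<le> exp (Hdev N)" .
  have "exp (- Hdev N) \<le> 1 / (4 ^ N * fact N)"
  proof -
    have "4 ^ N * fact N \<le> Hdev N" by (simp add: Hdev_def)
    also have "\<dots> \<le> exp (Hdev N)" using exp_ge_add_one_self[of "Hdev N"] by linarith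
    finally show ?thesis by (simp add: exp_minus inverse_eq_divide frac_le)
  qed
  also have "\<dots> \<le> 1 / (4 ^ n * fact n)" using n by (intro frac_le mult_mono power_increasing fact_mono) auto
  also have "\<dots> \<le> measure_pmf.prob (erw_pmf p q n) {X. int n - 2 \<le> erw_pos X n}" by (rule almost_maximal[OF p n1])
  also have "\<dots> \<le> P" unfolding P_def
  proof (intro measure_pmf.finite_measure_mono subsetI CollectI)
    fix X assume "X \<in> {X. int n - 2 \<le> erw_pos X n}"
    then have "real n - 2 \<le> real_of_int (erw_pos X n)" by simp
    then have "erw_e p n n * (real n - 2) \<le> erw_e p n n * real_of_int (erw_pos X n)"
      using erw_scaled(1)[OF p(1) n1 n1] by (intro mult_left_mono) auto
    then show "x \<le> erw_e p n n * real_of_int (erw_pos X n)" using top by linarith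
  qed simp
  also have "\<dots> \<le> P / (1 - Phi x)" using G by (simp add: P_def le_divide_eq mult_left_le)
  finally have "exp (- Hdev N) \<le> P / (1 - Phi x)" .
  then show ?thesis using up H unfolding ratio_bounds_def R by (smt (verit) exp_le_cancel_iff)
qed

lemma theta_form:
  fixes C D R :: real
  assumes "0 < C" "0 < D" "exp (- (C * D)) \<le> R" "R \<le> exp (C * D)"
  shows "\<exists>\<theta>. \<bar>\<theta>\<bar> \<le> 1 \<and> R = exp (\<theta> * C * D)"
proof (intro exI conjI)
  have R: "0 < R" using assms(3) exp_gt_zero less_le_trans by blast
  have CD: "0 < C * D" using assms by simp
  have "ln R \<le> ln (exp (C * D))" using assms R by (subst ln_le_cancel_iff) auto
  moreover have "- (C * D) \<le> ln R" using assms R by (simp add: ln_ge_iff)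
  ultimately have "\<bar>ln R\<bar> \<le> C * D" by simp
  then show "\<bar>ln R / (C * D)\<bar> \<le> 1" using CD by (simp add: abs_divide)
  show "R = exp (ln R / (C * D) * C * D)" using R assms by simp
qed

lemma ratio_bounds_conclude:
  assumes up: "\<And>q. 0 \<le> q \<Longrightarrow> q \<le> 1 \<Longrightarrow> ratio_bounds p q n x C s T" and q: "0 \<le> q" "q \<le> 1"
    and C: "0 < C" and s: "0 < s" and T: "0 < T" and x: "0 \<le> x"
  shows "\<forall>R \<in> {upper_tail_ratio p q n x, lower_tail_ratio p q n x}.
    \<exists>\<theta> :: real. \<bar>\<theta>\<bar> \<le> 1 \<and> R = exp (\<theta> * C * (x ^ 3 / s + (1 + x) * (T / s)))"
proof -
  have D: "0 < x ^ 3 / s + (1 + x) * (T / s)" using s T x by (intro add_nonneg_pos) auto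
  show ?thesis
    using up[of q] up[of "1 - q"] q theta_form[OF C D]
    unfolding lower_tail_ratio_flip[OF q] ratio_bounds_def by auto
qed

lemma antipersistent_case:
  "\<exists>C>0. \<forall>p q n x. 0 < p \<and> p < 1/2 \<and> 3 \<le> n \<and> 0 \<le> x \<and> x \<le> 1/8000 * sqrt (real n) \<longrightarrow>
    ratio_bounds p q n x C (sqrt (real n)) (ln (real n))"
proof -
  \<comment> \<open>The value of the scale \<open>s = sqrt n\<close> from which
    \<open>\<epsilon> = 2 / s\<close> is small enough for \<open>scaled_walk\<close>;
    \<open>N\<close> is the corresponding index. Neither depends on \<open>p\<close>.\<close>
  define M where "M = 2 * (400 * Kdev 6) ^ 4"
  define N where "N = nat \<lceil>M\<^sup>2\<rceil> + 1"
  have N: "0 < N" by (simp add: N_def)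
  define d where "d = 1 / sqrt (real N)"
  define C where "C = max (Cdev 6) (Hdev N / d)"
  have d: "0 < d" by (simp add: d_def N)
  have "0 < C" using Cdev_pos[of 6] by (simp add: C_def less_max_iff_disj)
  moreover have "ratio_bounds p q n x C (sqrt (real n)) (ln (real n))"
    if p: "0 < p" "p < 1/2" and n: "3 \<le> n" and x: "0 \<le> x" "x \<le> 1/8000 * sqrt (real n)" for p q x :: real and n :: nat
  proof -
    have p2: "p \<le> 1/2" using p by simp
    have n1: "1 \<le> n" using n by simp
    have s: "0 < sqrt (real n)" using n by simp
    have L: "1 < ln (real n)" by (rule ln_gt_1[OF n])
    note ap = erw_antipersistent[OF p(1) p2 n]
    show ?thesis
    proof (cases "n \<le> N")
      case True
      have "ratio_bounds p q n x (Hdev N / d) (sqrt (real n)) (ln (real n))"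
      proof (rule ratio_bounds_small_n[OF p(1) _ n True s x(1) _ _ d])
        have "sqrt (real n) \<le> real n" using n by (intro real_le_lsqrt) (auto simp: power2_eq_square)
        then show "x \<le> real n" using x s by linarith
        have "1 / sqrt (real n) * (real n / 3) \<le> erw_e p n n * (real n - 2)"
          using ap(2) s n order_trans[OF _ ap(2), of 0] by (intro mult_mono) auto
        moreover have "1 / sqrt (real n) * (real n / 3) = sqrt (real n) / 3"
          using n real_sqrt_mult_self[of "real n"] by (simp add: field_simps)
        ultimately show "x \<le> erw_e p n n * (real n - 2)" using x s by linarith
        have "d \<le> 1 / sqrt (real n)" unfolding d_def using True n by (intro divide_left_mono) auto
        also have "\<dots> \<le> ln (real n) / sqrt (real n)" using L s by (intro divide_right_mono) auto
        finally show "d \<le> ln (real n) / sqrt (real n)" .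
      qed (use p in auto)
      then show ?thesis by (rule ratio_bounds_mono) (use x s L in \<open>auto simp: C_def\<close>)
    next
      case False
      have "ratio_bounds p q n x (Cdev 6) (sqrt (real n)) (ln (real n))"
      proof (rule ratio_bounds_large_n[OF p(1) _ n s])
        show "ln (sqrt (real n)) \<le> ln (real n)" using L n by (simp add: ln_sqrt)
        have "M\<^sup>2 \<le> real n" using False unfolding N_def by linarith
        then have "M \<le> sqrt (real n)" by (rule real_le_rsqrt)
        then show "2 * (400 * Kdev 6) ^ 4 \<le> sqrt (real n)" by (simp add: M_def)
        \<comment> \<open>\<open>erw_t p n k \<le> k / n\<close> allows \<open>B = 1\<close> and
          \<open>c = 1\<close> for every \<open>p\<close> in the range, so \<open>A = 6\<close> and
          with it the constant \<open>C\<close> are absolute.\<close>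
        have "(\<Sum>k=2..<n. erw_t p n k / ((real k)\<^sup>2 * (1 - erw_t p n (Suc k) + (2 / sqrt (real n))\<^sup>2))) \<le> (2 * 1 + 4) / 1 * (2 / sqrt (real n))"
        proof (rule drift_sum_bound)
          show "0 \<le> erw_t p n k" "k \<le> n \<Longrightarrow> erw_t p n k \<le> 1" for k using erw_scaled(5,6)[OF p(1) n1] by auto
          show "erw_t p n k \<le> 1 * (sqrt (real k) * (2 / sqrt (real n)))" if k: "k \<le> n" for k
          proof -
            have "real k / real n = (sqrt (real k) * sqrt (real k)) / (sqrt (real n) * sqrt (real n))" by simp
            also have "\<dots> \<le> (sqrt (real k) * sqrt (real n)) / (sqrt (real n) * sqrt (real n))"
              using k by (intro divide_right_mono mult_left_mono) auto
            also have "\<dots> = sqrt (real k) / sqrt (real n)"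
              by (rule mult_divide_mult_cancel_right) (use n in auto)
            also have "\<dots> \<le> sqrt (real k) * 2 / sqrt (real n)" by (intro divide_right_mono) auto
            finally show ?thesis using ap(3)[OF k] by simp
          qed
          show "1 * (real n - real k) / real n \<le> 1 - erw_t p n k" if k: "k \<le> n" for k
            using ap(3)[OF k] n by (simp add: diff_divide_distrib)
          show "1 / sqrt (real n) \<le> 2 / sqrt (real n)" by (intro divide_right_mono) auto
        qed (use n in auto)
        then show "(\<Sum>k=2..<n. erw_t p n k / ((real k)\<^sup>2 * (1 - erw_t p n (Suc k) + (2 / sqrt (real n))\<^sup>2))) \<le> 6 * (2 / sqrt (real n))"
          by simp
      qed (use p x L ap(1) in auto)
      then show ?thesis by (rule ratio_bounds_mono) (use x s L in \<open>auto simp: C_def\<close>)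
    qed
  qed
  ultimately show ?thesis by blast
qed

lemma persistent_case:
  assumes p: "1/2 < p" "p < 3/4"
  shows "\<exists>C>0. \<forall>q n x. 3 \<le> n \<and> 0 \<le> x \<and> x \<le> 1/8000 * real n powr ((3 - 4 * p) / 2) \<longrightarrow>
    ratio_bounds p q n x C (real n powr ((3 - 4 * p) / 2)) (ln (real n))"
proof -
  define \<delta> where "\<delta> = 3 - 4 * p"
  have dl: "0 < \<delta>" "\<delta> \<le> 1" using p by (auto simp: \<delta>_def)
  define A where "A = 16 / \<delta>\<^sup>2 + 16 / \<delta>"
  have A: "1 \<le> A"
  proof -
    have "16 / 1 \<le> 16 / \<delta>" using dl by (intro divide_left_mono) auto
    moreover have "0 \<le> 16 / \<delta>\<^sup>2" by simp
    ultimately show ?thesis unfolding A_def by linarith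
  qed
  define M where "M = 2 * (400 * Kdev A) ^ 4"
  have M: "0 < M" using A by (simp add: M_def Kdev_def)
  define N where "N = nat \<lceil>M powr (2 / \<delta>)\<rceil> + 1"
  have N: "0 < N" by (simp add: N_def)
  define d where "d = 1 / real N"
  define C where "C = max (Cdev A) (Hdev N / d)"
  have d: "0 < d" by (simp add: d_def N)
  have "0 < C" using Cdev_pos[OF A] by (simp add: C_def less_max_iff_disj)
  moreover have "ratio_bounds p q n x C (real n powr (\<delta> / 2)) (ln (real n))"
    if n: "3 \<le> n" and x: "0 \<le> x" "x \<le> 1/8000 * real n powr (\<delta> / 2)" for q x :: real and n :: nat
  proof -
    have p0: "0 < p" using p by simp
    define s where "s = real n powr (\<delta> / 2)"
    have s: "0 < s" using n by (simp add: s_def)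
    have sn: "s \<le> real n" using powr_mono[of "\<delta> / 2" 1 "real n"] dl n by (simp add: s_def)
    have L: "1 < ln (real n)" by (rule ln_gt_1[OF n])
    note pd = persistent_drift[OF p n, folded \<delta>_def, folded s_def, folded A_def]
    have "ratio_bounds p q n x C s (ln (real n))"
    proof (cases "n \<le> N")
      case True
      have "ratio_bounds p q n x (Hdev N / d) s (ln (real n))"
      proof (rule ratio_bounds_small_n[OF p0 _ n True s x(1) _ _ d])
        show "x \<le> real n" "x \<le> erw_e p n n * (real n - 2)" using x s sn pd(3) unfolding s_def[symmetric] by linarith+
        have "d \<le> 1 / real n" unfolding d_def using True n by (intro divide_left_mono) auto
        also have "\<dots> \<le> 1 / s" using s sn n by (intro divide_left_mono) auto
        also have "\<dots> \<le> ln (real n) / s" using L s by (intro divide_right_mono) auto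
        finally show "d \<le> ln (real n) / s" .
      qed (use p in auto)
      then show ?thesis by (rule ratio_bounds_mono) (use x s L in \<open>auto simp: C_def\<close>)
    next
      case False
      have "ratio_bounds p q n x (Cdev A) s (ln (real n))"
      proof (rule ratio_bounds_large_n[OF p0 _ n s _ _ _ A])
        show "ln s \<le> ln (real n)" using s sn n by simp
        have "M powr (2 / \<delta>) \<le> real n" using False unfolding N_def by linarith
        then have "(M powr (2 / \<delta>)) powr (\<delta> / 2) \<le> s" unfolding s_def using dl by (intro powr_mono2) auto
        then show "2 * (400 * Kdev A) ^ 4 \<le> s" using M dl by (simp add: powr_powr M_def)
      qed (use p x L pd(1,2) s_def in auto)
      then show ?thesis by (rule ratio_bounds_mono) (use x s L in \<open>auto simp: C_def\<close>)
    qed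
    then show ?thesis by (simp add: s_def)
  qed
  ultimately show ?thesis unfolding \<delta>_def by blast
qed

lemma critical_case:
  "\<exists>C>0. \<forall>q n x. 3 \<le> n \<and> 0 \<le> x \<and> x \<le> 1/8000 * sqrt (ln (real n)) \<longrightarrow>
    ratio_bounds (3/4) q n x C (sqrt (ln (real n))) (ln (ln (real n)))"
proof -
  define M where "M = 2 * (400 * Kdev 512) ^ 4"
  define N where "N = nat \<lceil>exp (M\<^sup>2)\<rceil> + 1"
  have N: "0 < N" by (simp add: N_def)
  \<comment> \<open>\<open>ln (ln n)\<close> is smallest at \<open>n = 3\<close>, and positive there
    because \<open>3 > exp 1\<close>.\<close>
  define d where "d = ln (ln 3) / sqrt (real N)"
  define C where "C = max (Cdev 512) (Hdev N / d)"
  have l3: "0 < ln (ln (3::real))" using ln_gt_1[of 3] by simp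
  have d: "0 < d" using l3 by (simp add: d_def N)
  have "0 < C" using Cdev_pos[of 512] by (simp add: C_def less_max_iff_disj)
  moreover have "ratio_bounds (3/4) q n x C (sqrt (ln (real n))) (ln (ln (real n)))"
    if n: "3 \<le> n" and x: "0 \<le> x" "x \<le> 1/8000 * sqrt (ln (real n))" for q x :: real and n :: nat
  proof -
    have L: "1 < ln (real n)" by (rule ln_gt_1[OF n])
    define s where "s = sqrt (ln (real n))"
    have s: "1 \<le> s" "0 < s" using L by (auto simp: s_def)
    have Ln: "ln (real n) \<le> real n" using ln_le_minus_one[of "real n"] n by linarith
    have sn: "s \<le> sqrt (real n)" using Ln by (simp add: s_def)
    have LL: "ln (ln 3) \<le> ln (ln (real n))" using n L ln_gt_1[of 3] by (subst ln_le_cancel_iff) auto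
    have LL0: "0 \<le> ln (ln (real n))" using LL l3 by linarith
    note cs = critical_scale[OF n, folded s_def]
    have "ratio_bounds (3/4) q n x C s (ln (ln (real n)))"
    proof (cases "n \<le> N")
      case True
      have "ratio_bounds (3/4) q n x (Hdev N / d) s (ln (ln (real n)))"
      proof (rule ratio_bounds_small_n[OF _ _ n True s(2) x(1) _ _ d])
        have "sqrt (real n) \<le> real n" using n by (intro real_le_lsqrt) (auto simp: power2_eq_square)
        then show "x \<le> real n" "x \<le> erw_e (3/4) n n * (real n - 2)"
          using x s sn cs(2) unfolding s_def[symmetric] by linarith+
        have "d \<le> ln (ln 3) / s" unfolding d_def using True sn s l3 n
          by (intro divide_left_mono) (auto intro: order_trans[OF sn])
        also have "\<dots> \<le> ln (ln (real n)) / s" using LL s by (intro divide_right_mono) auto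
        finally show "d \<le> ln (ln (real n)) / s" .
      qed auto
      then show ?thesis by (rule ratio_bounds_mono) (use x s LL0 in \<open>auto simp: C_def\<close>)
    next
      case False
      have "ratio_bounds (3/4) q n x (Cdev 512) s (ln (ln (real n)))"
      proof (rule ratio_bounds_large_n[OF _ _ n s(2)])
        show "ln s \<le> ln (ln (real n))" using LL l3 L by (simp add: s_def ln_sqrt)
        have "exp (M\<^sup>2) \<le> real n" using False unfolding N_def by linarith
        then have "M\<^sup>2 \<le> ln (real n)" using n by (subst ln_ge_iff) auto
        then have "M \<le> s" unfolding s_def by (rule real_le_rsqrt)
        then show "2 * (400 * Kdev 512) ^ 4 \<le> s" by (simp add: M_def)
        show "(\<Sum>k=2..<n. erw_t (3/4) n k / ((real k)\<^sup>2 * (1 - erw_t (3/4) n (Suc k) + (2 / s)\<^sup>2))) \<le> 512 * (2 / s)"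
          unfolding s_def by (rule critical_drift_sum[OF n])
      qed (use x LL0 cs(1) in \<open>auto simp: s_def\<close>)
      then show ?thesis by (rule ratio_bounds_mono) (use x s LL0 in \<open>auto simp: C_def\<close>)
    qed
    then show ?thesis by (simp add: s_def)
  qed
  ultimately show ?thesis by blast
qed

theorem theorem2:
  shows
    "(\<exists>\<alpha>\<^sub>0>0. \<exists>C>0. \<forall>p q :: real. \<forall>n :: nat. \<forall>x :: real.
        0 < p \<and> p < 1/2 \<and> 0 \<le> q \<and> q \<le> 1 \<and> 3 \<le> n \<and> 0 \<le> x \<and> x \<le> \<alpha>\<^sub>0 * sqrt (real n) \<longrightarrow>
        (\<forall>R \<in> {upper_tail_ratio p q n x, lower_tail_ratio p q n x}.
          \<exists>\<theta> :: real. \<bar>\<theta>\<bar> \<le> 1 \<and>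
            R = exp (\<theta> * C * (x ^ 3 / sqrt (real n) + (1 + x) * (ln (real n) / sqrt (real n))))))
     \<and>
     (\<exists>\<alpha>\<^sub>0>0. \<forall>p :: real. 1/2 < p \<and> p < 3/4 \<longrightarrow> (\<exists>C>0. \<forall>q :: real. \<forall>n :: nat. \<forall>x :: real.
        0 \<le> q \<and> q \<le> 1 \<and> 3 \<le> n \<and> 0 \<le> x \<and> x \<le> \<alpha>\<^sub>0 * real n powr ((3 - 4 * p) / 2) \<longrightarrow>
        (\<forall>R \<in> {upper_tail_ratio p q n x, lower_tail_ratio p q n x}.
          \<exists>\<theta> :: real. \<bar>\<theta>\<bar> \<le> 1 \<and>
            R = exp (\<theta> * C * (x ^ 3 / real n powr ((3 - 4 * p) / 2)
                  + (1 + x) * (ln (real n) / real n powr ((3 - 4 * p) / 2)))))))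
     \<and>
     (\<exists>\<alpha>\<^sub>0>0. \<exists>C>0. \<forall>q :: real. \<forall>n :: nat. \<forall>x :: real.
        0 \<le> q \<and> q \<le> 1 \<and> 3 \<le> n \<and> 0 \<le> x \<and> x \<le> \<alpha>\<^sub>0 * sqrt (ln (real n)) \<longrightarrow>
        (\<forall>R \<in> {upper_tail_ratio (3/4) q n x, lower_tail_ratio (3/4) q n x}.
          \<exists>\<theta> :: real. \<bar>\<theta>\<bar> \<le> 1 \<and>
            R = exp (\<theta> * C * (x ^ 3 / sqrt (ln (real n))
                  + (1 + x) * (ln (ln (real n)) / sqrt (ln (real n)))))))"
proof (intro conjI)
  obtain C where C: "0 < C" "\<And>p q n x. 0 < p \<Longrightarrow> p < 1/2 \<Longrightarrow> 3 \<le> n \<Longrightarrow> 0 \<le> x \<Longrightarrow> x \<le> 1/8000 * sqrt (real n) \<Longrightarrow>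
    ratio_bounds p q n x C (sqrt (real n)) (ln (real n))"
    using antipersistent_case by blast
  show "\<exists>\<alpha>\<^sub>0>0. \<exists>C>0. \<forall>p q :: real. \<forall>n :: nat. \<forall>x :: real.
        0 < p \<and> p < 1/2 \<and> 0 \<le> q \<and> q \<le> 1 \<and> 3 \<le> n \<and> 0 \<le> x \<and> x \<le> \<alpha>\<^sub>0 * sqrt (real n) \<longrightarrow>
        (\<forall>R \<in> {upper_tail_ratio p q n x, lower_tail_ratio p q n x}.
          \<exists>\<theta> :: real. \<bar>\<theta>\<bar> \<le> 1 \<and>
            R = exp (\<theta> * C * (x ^ 3 / sqrt (real n) + (1 + x) * (ln (real n) / sqrt (real n)))))"
  \<comment> \<open>\<open>moderate_deviation\<close> needs
    \<open>x * \<epsilon> \<le> 1/4000\<close>, and \<open>\<epsilon>\<close> is twice the inverse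
    of the scale.\<close>
  proof (rule exI[of _ "1/8000 :: real"], intro exI[of _ C] conjI allI impI)
    fix p q x :: real and n :: nat
    assume a: "0 < p \<and> p < 1/2 \<and> 0 \<le> q \<and> q \<le> 1 \<and> 3 \<le> n \<and> 0 \<le> x \<and> x \<le> 1/8000 * sqrt (real n)"
    then have "1 < ln (real n)" using ln_gt_1 by blast
    then show "\<forall>R \<in> {upper_tail_ratio p q n x, lower_tail_ratio p q n x}.
          \<exists>\<theta> :: real. \<bar>\<theta>\<bar> \<le> 1 \<and>
            R = exp (\<theta> * C * (x ^ 3 / sqrt (real n) + (1 + x) * (ln (real n) / sqrt (real n))))"
      using a by (intro ratio_bounds_conclude C) auto
  qed (use C in auto)
next
  show "\<exists>\<alpha>\<^sub>0>0. \<forall>p :: real. 1/2 < p \<and> p < 3/4 \<longrightarrow> (\<exists>C>0. \<forall>q :: real. \<forall>n :: nat. \<forall>x :: real.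
        0 \<le> q \<and> q \<le> 1 \<and> 3 \<le> n \<and> 0 \<le> x \<and> x \<le> \<alpha>\<^sub>0 * real n powr ((3 - 4 * p) / 2) \<longrightarrow>
        (\<forall>R \<in> {upper_tail_ratio p q n x, lower_tail_ratio p q n x}.
          \<exists>\<theta> :: real. \<bar>\<theta>\<bar> \<le> 1 \<and>
            R = exp (\<theta> * C * (x ^ 3 / real n powr ((3 - 4 * p) / 2)
                  + (1 + x) * (ln (real n) / real n powr ((3 - 4 * p) / 2))))))"
  proof (rule exI[of _ "1/8000 :: real"], intro conjI allI impI)
    fix p :: real assume p: "1/2 < p \<and> p < 3/4"
    then obtain C where C: "0 < C" "\<And>q n x. 3 \<le> n \<Longrightarrow> 0 \<le> x \<Longrightarrow> x \<le> 1/8000 * real n powr ((3 - 4 * p) / 2) \<Longrightarrow>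
      ratio_bounds p q n x C (real n powr ((3 - 4 * p) / 2)) (ln (real n))"
      using persistent_case by blast
    show "\<exists>C>0. \<forall>q :: real. \<forall>n :: nat. \<forall>x :: real.
        0 \<le> q \<and> q \<le> 1 \<and> 3 \<le> n \<and> 0 \<le> x \<and> x \<le> 1/8000 * real n powr ((3 - 4 * p) / 2) \<longrightarrow>
        (\<forall>R \<in> {upper_tail_ratio p q n x, lower_tail_ratio p q n x}.
          \<exists>\<theta> :: real. \<bar>\<theta>\<bar> \<le> 1 \<and>
            R = exp (\<theta> * C * (x ^ 3 / real n powr ((3 - 4 * p) / 2)
                  + (1 + x) * (ln (real n) / real n powr ((3 - 4 * p) / 2)))))"
    proof (intro exI[of _ C] conjI allI impI)
      fix q x :: real and n :: nat
      assume a: "0 \<le> q \<and> q \<le> 1 \<and> 3 \<le> n \<and> 0 \<le> x \<and> x \<le> 1/8000 * real n powr ((3 - 4 * p) / 2)"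
      then have "1 < ln (real n)" using ln_gt_1 by blast
      then show "\<forall>R \<in> {upper_tail_ratio p q n x, lower_tail_ratio p q n x}.
          \<exists>\<theta> :: real. \<bar>\<theta>\<bar> \<le> 1 \<and>
            R = exp (\<theta> * C * (x ^ 3 / real n powr ((3 - 4 * p) / 2)
                  + (1 + x) * (ln (real n) / real n powr ((3 - 4 * p) / 2))))"
        using a by (intro ratio_bounds_conclude C) auto
    qed (use C in auto)
  qed auto
next
  obtain C where C: "0 < C" "\<And>q n x. 3 \<le> n \<Longrightarrow> 0 \<le> x \<Longrightarrow> x \<le> 1/8000 * sqrt (ln (real n)) \<Longrightarrow>
    ratio_bounds (3/4) q n x C (sqrt (ln (real n))) (ln (ln (real n)))"
    using critical_case by blast
  show "\<exists>\<alpha>\<^sub>0>0. \<exists>C>0. \<forall>q :: real. \<forall>n :: nat. \<forall>x :: real.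
        0 \<le> q \<and> q \<le> 1 \<and> 3 \<le> n \<and> 0 \<le> x \<and> x \<le> \<alpha>\<^sub>0 * sqrt (ln (real n)) \<longrightarrow>
        (\<forall>R \<in> {upper_tail_ratio (3/4) q n x, lower_tail_ratio (3/4) q n x}.
          \<exists>\<theta> :: real. \<bar>\<theta>\<bar> \<le> 1 \<and>
            R = exp (\<theta> * C * (x ^ 3 / sqrt (ln (real n))
                  + (1 + x) * (ln (ln (real n)) / sqrt (ln (real n))))))"
  proof (rule exI[of _ "1/8000 :: real"], intro exI[of _ C] conjI allI impI)
    fix q x :: real and n :: nat
    assume a: "0 \<le> q \<and> q \<le> 1 \<and> 3 \<le> n \<and> 0 \<le> x \<and> x \<le> 1/8000 * sqrt (ln (real n))"
    then have "1 < ln (real n)" using ln_gt_1 by blast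
    then show "\<forall>R \<in> {upper_tail_ratio (3/4) q n x, lower_tail_ratio (3/4) q n x}.
          \<exists>\<theta> :: real. \<bar>\<theta>\<bar> \<le> 1 \<and>
            R = exp (\<theta> * C * (x ^ 3 / sqrt (ln (real n))
                  + (1 + x) * (ln (ln (real n)) / sqrt (ln (real n)))))"
      using a by (intro ratio_bounds_conclude C ln_gt_zero) auto
  qed (use C in auto)
qed

end
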